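(* Let $K$ be a convex body in $\mathbb{R}^d$, let $I$ be a random point uniformly distributed in $K$ and let $B$ be a random point uniformly distributed on the boundary $\partial K$. Assume that at least one of the following holds: (i) $d=2$ and $\mathbb{E} I=\mathbb{E} B$; (ii) $K$ is a circumscribed polytope whose inscribed sphere has center $O$ with $O=\mathbb{E} I=\mathbb{E} B$. Let $k\ge 1$ be an integer and let $\varphi:(\mathbb{R}^d)^k\to\mathbb{R}$ be a function convex in each argument. Let $I_1,\dots,I_k$ be independent random points, each uniformly distributed in $K$, and let $B_1,\dots,B_k$ be independent random points, each uniformly distributed on $\partial K$. Then $$\mathbb{E}\,\varphi(I_1,\dots,I_k)\le \mathbb{E}\,\varphi(B_1,\dots,B_k).$$
   Context: A convex body in $\mathbb{R}^d$ is a compact convex set with nonempty interior. "Uniformly distributed in $K$" means with law equal to Lebesgue measure restricted to $K$, normalized to be a probability measure. "Uniformly distributed on $\partial K$" means with law equal to the surface measure (the $(d-1)$-dimensional Hausdorff measure) restricted to $\partial K$, normalized to be a probability measure. A circumscribed polytope is a convex polytope (with nonempty interior) that has an inscribed sphere, i.e. a sphere contained in the polytope and tangent to all of its facets ($(d-1)$-dimensional faces). A function $\varphi:(\mathbb{R}^d)^k\to\mathbb{R}$ is convex in each argument if for each $j$ and each fixed choice of the other $k-1$ arguments, the map $x_j\mapsto\varphi(x_1,\dots,x_k)$ is convex on $\mathbb{R}^d$. *)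

theory Defs
  imports "HOL-Probability.Probability"
begin

definition convex_body :: "'a::euclidean_space set \<Rightarrow> bool" where
  "convex_body K \<longleftrightarrow> compact K \<and> convex K \<and> interior K \<noteq> {}"

text \<open>The Hausdorff measure of integer dimension \<open>s\<close>, with the normalization that makes it agree
  with Lebesgue measure in dimension \<open>s\<close>. Covering sets are required to be bounded because
  \<^const>\<open>diameter\<close> is only meaningful for bounded sets. Empty covering sets contribute 0 (and
  not \<open>0 ^ 0 = 1\<close>), so that the case \<open>s = 0\<close> gives the counting measure.\<close>

definition hausdorff_pre :: "nat \<Rightarrow> real \<Rightarrow> 'a::metric_space set \<Rightarrow> ennreal" where
  "hausdorff_pre s \<delta> A =
     (INF U \<in> {U :: nat \<Rightarrow> 'a set. A \<subseteq> (\<Union>i. U i) \<and> (\<forall>i. bounded (U i) \<and> diameter (U i) \<le> \<delta>)}.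
        \<Sum>i. if U i = {} then 0 else ennreal (unit_ball_vol (real s) * (diameter (U i) / 2) ^ s))"

definition hausdorff_outer :: "nat \<Rightarrow> 'a::metric_space set \<Rightarrow> ennreal" where
  "hausdorff_outer s A = (SUP \<delta> \<in> {0<..}. hausdorff_pre s \<delta> A)"

text \<open>The outer measure is countably additive on Borel sets (it is a metric outer measure), so
  \<^const>\<open>measure_of\<close> does not fall back to the zero measure here.\<close>

definition hausdorff_measure :: "nat \<Rightarrow> 'a::metric_space measure" where
  "hausdorff_measure s = measure_of UNIV (sets borel) (hausdorff_outer s)"

definition uniform_in :: "'m measure \<Rightarrow> ('m \<Rightarrow> 'a::euclidean_space) \<Rightarrow> 'a set \<Rightarrow> bool" where
  "uniform_in M X K \<longleftrightarrow>
     X \<in> borel_measurable M \<and> distr M borel X = uniform_measure lborel K"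

definition uniform_on_boundary :: "'m measure \<Rightarrow> ('m \<Rightarrow> 'a::euclidean_space) \<Rightarrow> 'a set \<Rightarrow> bool" where
  "uniform_on_boundary M X K \<longleftrightarrow>
     X \<in> borel_measurable M \<and>
     distr M borel X = uniform_measure (hausdorff_measure (DIM('a) - 1)) (frontier K)"

text \<open>Tangency to a facet \<open>F\<close>: the sphere meets the hyperplane spanned by \<open>F\<close> in exactly
  one point, and this point belongs to \<open>F\<close>.\<close>

definition inscribed_sphere :: "'a::euclidean_space set \<Rightarrow> 'a \<Rightarrow> real \<Rightarrow> bool" where
  "inscribed_sphere K c r \<longleftrightarrow>
     r > 0 \<and> sphere c r \<subseteq> K \<and>
     (\<forall>F. F facet_of K \<longrightarrow> (\<exists>p\<in>F. sphere c r \<inter> affine hull F = {p}))"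

definition convex_in_each_arg :: "('a::real_vector ^ 'k \<Rightarrow> real) \<Rightarrow> bool" where
  "convex_in_each_arg \<phi> \<longleftrightarrow>
     (\<forall>j x. convex_on UNIV (\<lambda>y. \<phi> (\<chi> i. if i = j then y else x $ i)))"

end

theory Submission
  imports Defs
begin

text \<open>Replacing the factors one at a time reduces the claim to \<open>k = 1\<close>: for a convex \<open>f\<close>, the mean of \<open>f\<close>
  over \<open>K\<close> is at most its mean over \<open>\<partial>K\<close>. For a circumscribed polytope, the cones from \<open>O\<close> over
  the facets have equal height, so their mass is proportional to the area of the facets, and convexity
  along the segments from \<open>O\<close> gives \<open>E f(I) \<le> (1 - \<theta>) f(O) + \<theta> E f(B)\<close>, while \<open>f(O) \<le> E f(B)\<close> by Jensen.
  In the plane, a convex function on an inscribed polygon is dominated by the convex envelope of its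
  values on the boundary, which is an affine function plus a sum of folds \<open>max 0 (u x + c)\<close>, and it
  remains to treat a fold. The area of a cap of \<open>K\<close> lies in a trapezoid that is controlled by the
  length of its arc; this makes the survival functions of the coordinates of \<open>I\<close> and \<open>B\<close> cross only once,
  so that equality of the means yields the inequality for the folds.\<close>

section \<open>Hausdorff measure\<close>

text \<open>\<open>hausdorff_measure\<close> applies \<open>measure_of\<close> to an outer measure
  and would be the zero measure if countable additivity failed. Additivity is read off from the
  hypothesis: a probability law on \<open>frontier K\<close> forces the boundary to have nonzero and
  finite measure. The two facts travel on as \<open>hausdorff_additive\<close> and as a bound on the
  outer measure of the boundary. In the plane lengths are compared with areas, so segments are
  measured exactly and convex graphs from above. Over facets only invariance is used: on a
  hyperplane, the Hausdorff measure and the projection of a weighted slab are both translation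
  invariant, hence proportional, and rotations make the factor the same for all facets. For a fold
  in the plane the obstacle is that neither the normalized arc nor the normalized area dominates at
  all levels. What holds is a monotonicity: above the widest slice the ratio of arc to area of a cap
  grows with the level, and below it the ratio of the complements falls. So once the boundary has
  the larger share above some level, it has the larger share above every higher one.\<close>

lemma hausdorff_pre_mono:
  assumes "A \<subseteq> B"
  shows "hausdorff_pre s \<delta> A \<le> hausdorff_pre s \<delta> B"
  unfolding hausdorff_pre_def using assms by (intro INF_superset_mono) auto

lemma hausdorff_outer_mono:
  assumes "A \<subseteq> B"
  shows "hausdorff_outer s A \<le> hausdorff_outer s B"
  unfolding hausdorff_outer_def by (intro SUP_mono') (rule hausdorff_pre_mono[OF assms])

text \<open>A cover of \<open>A\<close> by sets of diameter at most \<open>\<delta> / L\<close> is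
  mapped to a cover of the image by sets of diameter at most \<open>\<delta>\<close>, and each
  summand grows at most by the factor \<open>L ^ s\<close>.\<close>

lemma hausdorff_pre_lipschitz_image:
  fixes f :: "'a::metric_space \<Rightarrow> 'b::metric_space"
  assumes L: "0 < L" and lip: "\<And>x y. x \<in> A \<Longrightarrow> y \<in> A \<Longrightarrow> dist (f x) (f y) \<le> L * dist x y"
  shows "hausdorff_pre s \<delta> (f ` A) \<le> ennreal (L ^ s) * hausdorff_pre s (\<delta> / L) A"
proof -
  let ?c = "ennreal (L ^ s)"
  define g where "g V = (if V = {} then 0 else ennreal (unit_ball_vol (real s) * (diameter V / 2) ^ s))"
    for V :: "'a set"
  define h where "h V = (if V = {} then 0 else ennreal (unit_ball_vol (real s) * (diameter V / 2) ^ s))"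
    for V :: "'b set"
  have c0: "?c \<noteq> 0" "?c \<noteq> \<top>" "0 < ?c" using L by auto
  have key: "hausdorff_pre s \<delta> (f ` A) \<le> ?c * (\<Sum>i. g (U i))"
    if U: "A \<subseteq> (\<Union>i. U i)" "\<forall>i. bounded (U i) \<and> diameter (U i) \<le> \<delta> / L" for U :: "nat \<Rightarrow> 'a set"
  proof -
    \<comment> \<open>\<open>f\<close> is Lipschitz on \<open>A\<close> only, so a covering set is
      cut down to \<open>A\<close> before it is mapped.\<close>
    define W where "W i = f ` (A \<inter> U i)" for i
    have dW: "\<And>x y. x \<in> W i \<Longrightarrow> y \<in> W i \<Longrightarrow> dist x y \<le> L * diameter (U i)" for i
    proof -
      fix x y assume "x \<in> W i" "y \<in> W i"
      then obtain a b where ab: "a \<in> A" "b \<in> A" "a \<in> U i" "b \<in> U i" "x = f a" "y = f b"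
        unfolding W_def by auto
      have "dist a b \<le> diameter (U i)" using ab U(2) by (intro diameter_bounded_bound) auto
      then show "dist x y \<le> L * diameter (U i)"
        using lip[OF ab(1,2)] L ab by (smt (verit) mult_left_mono)
    qed
    have bW: "bounded (W i)" for i
    proof (cases "W i = {}")
      case False
      then obtain z where "z \<in> W i" by blast
      then show ?thesis unfolding bounded_def using dW[of z i] by blast
    qed simp
    have diW: "diameter (W i) \<le> L * diameter (U i)" for i
    proof -
      have "0 \<le> L * diameter (U i)" using L U(2) diameter_ge_0[of "U i"] by auto
      moreover have "(SUP (x, y)\<in>W i \<times> W i. dist x y) \<le> L * diameter (U i)" if "W i \<noteq> {}"
        using that dW by (intro cSUP_least) auto
      ultimately show ?thesis unfolding diameter_def by auto
    qed
    have diW': "diameter (W i) \<le> \<delta>" for i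
    proof -
      have "L * diameter (U i) \<le> L * (\<delta> / L)" using U(2) L by (intro mult_left_mono) auto
      then show ?thesis using diW[of i] L by simp
    qed
    have "hausdorff_pre s \<delta> (f ` A) \<le> (\<Sum>i. h (W i))"
      unfolding hausdorff_pre_def h_def
    proof (rule INF_lower, safe)
      fix x assume "x \<in> A"
      moreover then obtain i where "x \<in> U i" using U(1) by blast
      ultimately have "f x \<in> W i" unfolding W_def by blast
      then show "f x \<in> (\<Union>i. W i)" by blast
    next
      fix i show "bounded (W i)" "diameter (W i) \<le> \<delta>" by (rule bW, rule diW')
    qed
    also have "\<dots> \<le> (\<Sum>i. ?c * g (U i))"
    proof (intro suminf_le summableI)
      fix i
      show "h (W i) \<le> ?c * g (U i)"
      proof (cases "W i = {}")
        case False
        then have ne: "U i \<noteq> {}" unfolding W_def by auto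
        have "unit_ball_vol (real s) * (diameter (W i) / 2) ^ s \<le> unit_ball_vol (real s) * (L * diameter (U i) / 2) ^ s"
          using diW[of i] diameter_ge_0[OF bW[of i]] by (intro mult_left_mono power_mono) auto
        also have "\<dots> = L ^ s * (unit_ball_vol (real s) * (diameter (U i) / 2) ^ s)"
          by (simp add: power_mult_distrib power_divide)
        finally show ?thesis using False ne L
          by (simp add: h_def g_def ennreal_leI flip: ennreal_mult')
      qed (simp add: h_def)
    qed
    also have "\<dots> = ?c * (\<Sum>i. g (U i))" by simp
    finally show ?thesis .
  qed
  \<comment> \<open>Dividing by the finite positive \<open>?c\<close> leaves the infimum alone on
    the right, where \<open>INF_greatest\<close> applies.\<close>
  have "hausdorff_pre s \<delta> (f ` A) / ?c \<le> hausdorff_pre s (\<delta> / L) A"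
    unfolding hausdorff_pre_def[of s "\<delta> / L"]
  proof (rule INF_greatest, clarify)
    fix U :: "nat \<Rightarrow> 'a set"
    assume "A \<subseteq> (\<Union>i. U i)" "\<forall>i. bounded (U i) \<and> diameter (U i) \<le> \<delta> / L"
    from key[OF this] c0
    show "hausdorff_pre s \<delta> (f ` A) / ?c \<le> (\<Sum>i. if U i = {} then 0 else ennreal (unit_ball_vol (real s) * (diameter (U i) / 2) ^ s))"
      unfolding g_def by (intro divide_le_posI_ennreal) (auto simp: mult.commute)
  qed
  then have "?c * (hausdorff_pre s \<delta> (f ` A) / ?c) \<le> ?c * hausdorff_pre s (\<delta> / L) A"
    by (rule mult_left_mono) simp
  moreover have "?c * (hausdorff_pre s \<delta> (f ` A) / ?c) = hausdorff_pre s \<delta> (f ` A)"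
    using c0 mult_divide_eq_ennreal[of ?c] by (metis ennreal_times_divide mult.commute)
  ultimately show ?thesis by simp
qed

lemma hausdorff_outer_lipschitz_image:
  fixes f :: "'a::metric_space \<Rightarrow> 'b::metric_space"
  assumes "0 < L" "\<And>x y. x \<in> A \<Longrightarrow> y \<in> A \<Longrightarrow> dist (f x) (f y) \<le> L * dist x y"
  shows "hausdorff_outer s (f ` A) \<le> ennreal (L ^ s) * hausdorff_outer s A"
  unfolding hausdorff_outer_def[of s "f ` A"]
proof (rule SUP_least)
  fix \<delta> :: real assume "\<delta> \<in> {0<..}"
  then have "\<delta> / L \<in> {0<..}" using assms(1) by auto
  then have "hausdorff_pre s (\<delta> / L) A \<le> hausdorff_outer s A"
    unfolding hausdorff_outer_def by (rule SUP_upper)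
  then show "hausdorff_pre s \<delta> (f ` A) \<le> ennreal (L ^ s) * hausdorff_outer s A"
    using hausdorff_pre_lipschitz_image[OF assms, where s=s and \<delta>=\<delta>]
    by (meson mult_left_mono order_trans zero_le)
qed

text \<open>The map and its inverse on the image are both Lipschitz with constant
  \<open>1\<close>.\<close>

lemma hausdorff_outer_isometry_image:
  fixes f :: "'a::metric_space \<Rightarrow> 'b::metric_space"
  assumes "\<And>x y. x \<in> A \<Longrightarrow> y \<in> A \<Longrightarrow> dist (f x) (f y) = dist x y"
  shows "hausdorff_outer s (f ` A) = hausdorff_outer s A"
proof (rule antisym)
  show "hausdorff_outer s (f ` A) \<le> hausdorff_outer s A"
    using hausdorff_outer_lipschitz_image[of 1 A f s] assms by simp
  have inj: "inj_on f A" using assms by (metis dist_eq_0_iff inj_onI)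
  then have "the_inv_into A f ` (f ` A) = A" by (auto simp: the_inv_into_f_f image_image)
  then show "hausdorff_outer s A \<le> hausdorff_outer s (f ` A)"
    using hausdorff_outer_lipschitz_image[of 1 "f ` A" "the_inv_into A f" s, OF zero_less_one] assms inj
    by (force simp: the_inv_into_f_f)
qed

section \<open>The Hausdorff outer measure as a measure\<close>

lemma sets_hausdorff_measure [simp, measurable_cong]: "sets (hausdorff_measure s) = sets borel"
  unfolding hausdorff_measure_def by (simp add: sets.sigma_sets_eq[of borel, simplified])

lemma space_hausdorff_measure [simp]: "space (hausdorff_measure s) = UNIV"
  unfolding hausdorff_measure_def by simp

text \<open>Says that \<open>measure_of\<close> in \<open>hausdorff_measure\<close> really returns
  the outer measure on Borel sets. The \<open>itself\<close> argument carries the type of the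
  points, which \<open>s\<close> does not determine.\<close>

definition hausdorff_additive :: "nat \<Rightarrow> 'a::metric_space itself \<Rightarrow> bool" where
  "hausdorff_additive s T \<longleftrightarrow> measure_space UNIV (sets borel) (hausdorff_outer s :: 'a set \<Rightarrow> ennreal)"

lemma sigma_sets_borel [simp]: "sigma_sets UNIV (sets borel) = sets borel"
  using sets.sigma_sets_eq[of borel] by simp

lemma emeasure_hausdorff_measure:
  assumes "hausdorff_additive s TYPE('a::metric_space)" "A \<in> sets borel"
  shows "emeasure (hausdorff_measure s) A = hausdorff_outer s (A :: 'a set)"
  using assms unfolding hausdorff_measure_def hausdorff_additive_def
  by (simp add: emeasure_measure_of_conv)

text \<open>The fallback of \<open>measure_of\<close> vanishes on every set, so a single set of
  nonzero measure rules it out.\<close>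

lemma hausdorff_additiveI:
  assumes "emeasure (hausdorff_measure s) (A :: 'a::metric_space set) \<noteq> 0"
  shows "hausdorff_additive s TYPE('a)"
  using assms unfolding hausdorff_measure_def hausdorff_additive_def
  by (auto simp: emeasure_measure_of_conv split: if_splits)

text \<open>Additivity is obtained on \<open>real ^ 'd\<close>; this carries it to
  \<open>real \<times> real\<close>, where the planar estimates are done. A set and its preimage
  under the isometry have equal outer measure, so disjoint unions are compared on the source
  side.\<close>

lemma hausdorff_additive_isometry:
  fixes J :: "'a::metric_space \<Rightarrow> 'b::metric_space"
  assumes ha: "hausdorff_additive s TYPE('a)"
    and iso: "\<And>x y. dist (J x) (J y) = dist x y" and sur: "surj J"
  shows "hausdorff_additive s TYPE('b)"
proof -
  have inj: "inj J" using iso by (metis dist_eq_0_iff injI)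
  have cont: "continuous_on UNIV J"
    unfolding continuous_on_iff using iso by metis
  have meas[measurable]: "J \<in> borel_measurable borel" by (rule borel_measurable_continuous_onI[OF cont])
  have eq: "hausdorff_outer s (J -` B) = hausdorff_outer s B" for B
    using hausdorff_outer_isometry_image[of "J -` B" J s] iso sur by (simp add: surj_image_vimage_eq)
  have vb: "J -` B \<in> sets borel" if "B \<in> sets borel" for B
    using measurable_sets[OF meas that] by simp
  have ms: "measure_space UNIV (sets borel) (hausdorff_outer s :: 'a set \<Rightarrow> ennreal)"
    using ha unfolding hausdorff_additive_def .
  then have ca: "countably_additive (sets borel) (hausdorff_outer s :: 'a set \<Rightarrow> ennreal)"
    and po: "positive (sets borel) (hausdorff_outer s :: 'a set \<Rightarrow> ennreal)"
    unfolding measure_space_def by auto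
  have "countably_additive (sets borel) (hausdorff_outer s :: 'b set \<Rightarrow> ennreal)"
    unfolding countably_additive_def
  proof (intro allI impI)
    fix A :: "nat \<Rightarrow> 'b set"
    assume A: "range A \<subseteq> sets borel" "disjoint_family A" "\<Union> (range A) \<in> sets borel"
    have "(\<Sum>i. hausdorff_outer s (J -` A i)) = hausdorff_outer s (\<Union>i. J -` A i)"
      using A by (intro ca[unfolded countably_additive_def, rule_format])
        (auto simp: disjoint_family_on_def vb intro!: sets.countable_UN)
    then show "(\<Sum>i. hausdorff_outer s (A i)) = hausdorff_outer s (\<Union> (range A))"
      using eq by (simp add: vimage_UN[symmetric])
  qed
  moreover have "positive (sets borel) (hausdorff_outer s :: 'b set \<Rightarrow> ennreal)"
    using po eq[of "{}"] unfolding positive_def by simp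
  moreover have "sigma_algebra UNIV (sets (borel :: 'b measure))"
    using sets.sigma_algebra_axioms[of "borel :: 'b measure"] by simp
  ultimately show ?thesis unfolding hausdorff_additive_def measure_space_def by simp
qed

text \<open>Fubini proof of the uniqueness of Haar measure: translate the second variable by the first one
  and then the first one by the second.\<close>

lemma translation_invariant_unique:
  fixes N1 N2 :: "'a::euclidean_space measure"
  assumes sf: "sigma_finite_measure N1" "sigma_finite_measure N2"
    and sets[measurable_cong, simp]: "sets N1 = sets borel" "sets N2 = sets borel"
    and conc: "AE x in N1. x \<in> V" "AE x in N2. x \<in> V"
    and inv1: "\<And>v. v \<in> V \<Longrightarrow> distr N1 borel (\<lambda>x. x - v) = N1"
    and inv2: "\<And>v. v \<in> V \<Longrightarrow> distr N2 borel (\<lambda>x. x + v) = N2"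
    and A[measurable]: "A \<in> sets borel" and B[measurable]: "B \<in> sets borel"
  shows "emeasure N1 A * emeasure N2 B = emeasure N1 B * emeasure N2 (uminus -` A)"
proof -
  interpret N1: sigma_finite_measure N1 by fact
  interpret N2: sigma_finite_measure N2 by fact
  interpret pair_sigma_finite N1 N2 by unfold_locales
  have [simp]: "space N1 = UNIV" "space N2 = UNIV" using sets_eq_imp_space_eq[OF sets(1)] sets_eq_imp_space_eq[OF sets(2)] by auto
  have t2: "(\<integral>\<^sup>+y. f y \<partial>N2) = (\<integral>\<^sup>+y. f (y + v) \<partial>N2)" if "v \<in> V" and [measurable]: "f \<in> borel_measurable borel" for f :: "'a \<Rightarrow> ennreal" and v
  proof -
    have "(\<integral>\<^sup>+y. f y \<partial>N2) = (\<integral>\<^sup>+y. f y \<partial>distr N2 borel (\<lambda>x. x + v))" by (simp only: inv2[OF that(1)])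
    also have "\<dots> = (\<integral>\<^sup>+y. f (y + v) \<partial>N2)" by (rule nn_integral_distr) measurable
    finally show ?thesis .
  qed
  have t1: "(\<integral>\<^sup>+y. f y \<partial>N1) = (\<integral>\<^sup>+y. f (y - v) \<partial>N1)" if "v \<in> V" and [measurable]: "f \<in> borel_measurable borel" for f :: "'a \<Rightarrow> ennreal" and v
  proof -
    have "(\<integral>\<^sup>+y. f y \<partial>N1) = (\<integral>\<^sup>+y. f y \<partial>distr N1 borel (\<lambda>x. x - v))" by (simp only: inv1[OF that(1)])
    also have "\<dots> = (\<integral>\<^sup>+y. f (y - v) \<partial>N1)" by (rule nn_integral_distr) measurable
    finally show ?thesis .
  qed
  have "emeasure N1 A * emeasure N2 B = (\<integral>\<^sup>+x. indicator A x * emeasure N2 B \<partial>N1)"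
    by (simp add: nn_integral_multc)
  also have "\<dots> = (\<integral>\<^sup>+x. (\<integral>\<^sup>+y. indicator A x * indicator B y \<partial>N2) \<partial>N1)"
    by (simp add: nn_integral_cmult)
  \<comment> \<open>\<open>x\<close> lies in \<open>V\<close> almost everywhere, so for fixed
    \<open>x\<close> the measure \<open>N2\<close> is invariant under the shift by
    \<open>x\<close>.\<close>
  also have "\<dots> = (\<integral>\<^sup>+x. (\<integral>\<^sup>+y. indicator A x * indicator B (y + x) \<partial>N2) \<partial>N1)"
  proof (rule nn_integral_cong_AE, rule AE_mp[OF conc(1)], rule AE_I2, rule impI)
    fix x assume x: "x \<in> V"
    show "(\<integral>\<^sup>+y. indicator A x * indicator B y \<partial>N2) = (\<integral>\<^sup>+y. indicator A x * indicator B (y + x) \<partial>N2)"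
      by (rule t2[OF x, of "\<lambda>y. indicator A x * indicator B y"]) measurable
  qed
  also have "\<dots> = (\<integral>\<^sup>+y. (\<integral>\<^sup>+x. indicator A x * indicator B (y + x) \<partial>N1) \<partial>N2)"
    by (rule Fubini'[symmetric]) measurable
  also have "\<dots> = (\<integral>\<^sup>+y. (\<integral>\<^sup>+x. indicator A (x - y) * indicator B x \<partial>N1) \<partial>N2)"
  proof (rule nn_integral_cong_AE, rule AE_mp[OF conc(2)], rule AE_I2, rule impI)
    fix y assume y: "y \<in> V"
    have "(\<integral>\<^sup>+x. indicator A x * indicator B (y + x) \<partial>N1) = (\<integral>\<^sup>+x. indicator A (x - y) * indicator B (y + (x - y)) \<partial>N1)"
      by (rule t1[OF y, of "\<lambda>x. indicator A x * indicator B (y + x)"]) measurable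
    then show "(\<integral>\<^sup>+x. indicator A x * indicator B (y + x) \<partial>N1) = (\<integral>\<^sup>+x. indicator A (x - y) * indicator B x \<partial>N1)"
      by simp
  qed
  also have "\<dots> = (\<integral>\<^sup>+x. (\<integral>\<^sup>+y. indicator A (x - y) * indicator B x \<partial>N2) \<partial>N1)"
    by (rule Fubini') measurable
  \<comment> \<open>A last shift of \<open>y\<close> by \<open>x\<close> turns \<open>x - y\<close>
    into \<open>- y\<close>: the integrand becomes a function of \<open>y\<close> times a function
    of \<open>x\<close>.\<close>
  also have "\<dots> = (\<integral>\<^sup>+x. (\<integral>\<^sup>+y. indicator (uminus -` A) y * indicator B x \<partial>N2) \<partial>N1)"
  proof (rule nn_integral_cong_AE, rule AE_mp[OF conc(1)], rule AE_I2, rule impI)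
    fix x assume x: "x \<in> V"
    have "(\<integral>\<^sup>+y. indicator A (x - y) * indicator B x \<partial>N2) = (\<integral>\<^sup>+y. indicator A (x - (y + x)) * indicator B x \<partial>N2)"
      by (rule t2[OF x, of "\<lambda>y. indicator A (x - y) * indicator B x"]) measurable
    then show "(\<integral>\<^sup>+y. indicator A (x - y) * indicator B x \<partial>N2) = (\<integral>\<^sup>+y. indicator (uminus -` A) y * indicator B x \<partial>N2)"
      by (simp add: indicator_def)
  qed
  also have "\<dots> = (\<integral>\<^sup>+x. emeasure N2 (uminus -` A) * indicator B x \<partial>N1)"
  proof (rule nn_integral_cong)
    fix x
    have [measurable]: "uminus -` A \<in> sets borel"
      using measurable_sets[of uminus borel borel A] by simp
    show "(\<integral>\<^sup>+y. indicator (uminus -` A) y * indicator B x \<partial>N2) = emeasure N2 (uminus -` A) * indicator B x"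
      by (subst nn_integral_multc) auto
  qed
  also have "\<dots> = emeasure N1 B * emeasure N2 (uminus -` A)"
    by (subst nn_integral_cmult) (auto simp: mult.commute)
  finally show ?thesis .
qed

section \<open>Linear images of Lebesgue measure\<close>

text \<open>The image of \<open>lborel\<close> under \<open>f\<close> is translation invariant and
  finite on bounded sets, hence a multiple of \<open>lborel\<close> by uniqueness. Two types are
  allowed so that isometries between different models of the plane are covered.\<close>

lemma emeasure_lborel_linear_vimage:
  fixes f :: "'a::euclidean_space \<Rightarrow> 'b::euclidean_space"
  assumes lin: "linear f" and bij: "bij f"
  obtains c where "0 \<le> c" "\<And>A. A \<in> sets borel \<Longrightarrow> emeasure lborel (f -` A) = ennreal c * emeasure lborel A"
proof -
  have [measurable]: "f \<in> borel_measurable borel"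
    by (intro borel_measurable_continuous_onI linear_continuous_on linear_linear[THEN iffD2] lin)
  define g where "g = inv f"
  have fg: "f (g y) = y" for y using bij by (simp add: g_def bij_is_surj surj_f_inv_f)
  have gf: "g (f x) = x" for x using bij by (simp add: g_def bij_is_inj inv_f_f)
  have ling: "linear g"
  proof (rule linearI)
    fix x y :: 'b and c :: real
    show "g (x + y) = g x + g y" using gf[of "g x + g y"] by (simp add: linear_add[OF lin] fg)
    show "g (c *\<^sub>R x) = c *\<^sub>R g x" using gf[of "c *\<^sub>R g x"] by (simp add: linear_scale[OF lin] fg)
  qed
  define N where "N = distr lborel borel f"
  have em: "emeasure N A = emeasure lborel (f -` A)" if "A \<in> sets borel" for A
    unfolding N_def using that by (simp add: emeasure_distr)
  have fin: "emeasure N A < \<infinity>" if "bounded A" "A \<in> sets borel" for A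
  proof -
    have "f -` A = g ` A"
    proof (intro set_eqI iffI)
      fix x assume "x \<in> f -` A" then show "x \<in> g ` A" using gf[of x] by (metis image_eqI vimageE)
    qed (auto simp: fg)
    then have "bounded (f -` A)" using bounded_linear_image[OF that(1)] ling linear_conv_bounded_linear by metis
    then show ?thesis using that em emeasure_bounded_finite[of "f -` A"] by simp
  qed
  have sf: "sigma_finite_measure N"
  proof
    show "\<exists>A. countable A \<and> A \<subseteq> sets N \<and> \<Union> A = space N \<and> (\<forall>a\<in>A. emeasure N a \<noteq> \<infinity>)"
    proof (intro exI[of _ "range (\<lambda>n::nat. ball 0 (real n))"] conjI ballI)
      show "\<Union> (range (\<lambda>n::nat. ball (0::'b) (real n))) = space N"
        using reals_Archimedean2 by (auto simp: N_def)
      show "range (\<lambda>n::nat. ball (0::'b) (real n)) \<subseteq> sets N" by (auto simp: N_def)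
      fix a assume "a \<in> range (\<lambda>n::nat. ball (0::'b) (real n))"
      then show "emeasure N a \<noteq> \<infinity>" using fin[of a] by auto
    qed simp
  qed
  have inv: "distr N borel (\<lambda>x. x - v) = N" for v
  proof -
    have "distr N borel (\<lambda>x. x - v) = distr (distr lborel borel (\<lambda>x. x - g v)) borel f"
      unfolding N_def by (simp add: distr_distr o_def linear_diff[OF lin] fg)
    also have "distr lborel borel (\<lambda>x. x - g v) = (lborel :: 'a measure)"
    proof -
      have "(\<lambda>x. x - g v) = (+) (- g v)" by auto
      then show ?thesis by (simp only: lborel_distr_plus)
    qed
    finally show ?thesis unfolding N_def .
  qed
  have uniq: "emeasure N A * emeasure lborel (ball (0::'b) 1) = emeasure N (ball 0 1) * emeasure lborel A"
    if A: "A \<in> sets borel" for A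
  proof -
    have "emeasure N A * emeasure lborel (ball (0::'b) 1) = emeasure N (ball 0 1) * emeasure lborel (uminus -` A)"
    proof (rule translation_invariant_unique[where V=UNIV])
      show "sigma_finite_measure N" "sigma_finite_measure lborel" by (rule sf, rule sigma_finite_lborel)
      show "distr N borel (\<lambda>x. x - v) = N" for v by (rule inv)
      show "distr lborel borel (\<lambda>x. x + v) = lborel" for v :: 'b
      proof -
        have "(\<lambda>x. x + v) = (+) v" by (auto simp: add.commute)
        then show ?thesis by (simp only: lborel_distr_plus)
      qed
      show "sets N = sets borel" unfolding N_def by simp
    qed (use A in auto)
    \<comment> \<open>Uniqueness produces the reflected set; reflection leaves \<open>lborel\<close>
      unchanged.\<close>
    also have "emeasure lborel (uminus -` A) = emeasure (distr lborel borel uminus) A"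
      using A by (simp add: emeasure_distr)
    also have "distr lborel borel uminus = (lborel :: 'b measure)"
    proof -
      have "(\<lambda>x. 0 + (-1) *\<^sub>R x) = (uminus :: 'b \<Rightarrow> 'b)" by auto
      then show ?thesis using lborel_affine[of "-1" "0::'b"] by (simp add: density_1 flip: one_ennreal_def)
    qed
    finally show ?thesis .
  qed
  define b where "b = measure lborel (ball (0::'b) 1)"
  have b: "emeasure lborel (ball (0::'b) 1) = ennreal b" "b > 0"
    unfolding b_def by (simp_all add: emeasure_eq_ennreal_measure emeasure_ball content_ball)
  define c where "c = enn2real (emeasure N (ball 0 1)) / b"
  have eN: "emeasure N (ball 0 1) = ennreal (c * b)" 
    using fin[of "ball 0 1"] b by (simp add: c_def)
  show ?thesis
  proof (rule that[of c])
    show "0 \<le> c" using b by (simp add: c_def)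
    fix A :: "'b set" assume A: "A \<in> sets borel"
    have "emeasure N A * ennreal b = (ennreal c * emeasure lborel A) * ennreal b"
      using uniq[OF A] b eN \<open>0 \<le> c\<close> by (simp add: ennreal_mult' mult_ac)
    then show "emeasure lborel (f -` A) = ennreal c * emeasure lborel A"
      using b(2) em[OF A] mult_divide_eq_ennreal[of "ennreal b"] by (metis ennreal_eq_0_iff ennreal_neq_top not_less)
  qed
qed

text \<open>The factor is \<open>1\<close> since the preimage of the unit ball is the unit ball, and
  equal dimensions give both balls the same volume.\<close>

lemma lborel_distr_isometry:
  fixes f :: "'a::euclidean_space \<Rightarrow> 'b::euclidean_space"
  assumes lin: "linear f" and bij: "bij f" and nrm: "\<And>x. norm (f x) = norm x"
    and dim: "DIM('a) = DIM('b)"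
  shows "distr lborel borel f = lborel"
proof -
  have [measurable]: "f \<in> borel_measurable borel"
    by (intro borel_measurable_continuous_onI linear_continuous_on linear_linear[THEN iffD2] lin)
  obtain c where c: "0 \<le> c" "\<And>A. A \<in> sets borel \<Longrightarrow> emeasure lborel (f -` A) = ennreal c * emeasure lborel A"
    using emeasure_lborel_linear_vimage[OF lin bij] by blast
  have "f -` ball 0 1 = ball 0 1" by (auto simp: nrm)
  then have "emeasure lborel (ball (0::'a) 1) = ennreal c * emeasure lborel (ball (0::'b) 1)"
    using c(2)[of "ball 0 1"] by simp
  moreover have "unit_ball_vol (real DIM('b)) \<noteq> 0" using unit_ball_vol_pos[of "real DIM('b)"] by linarith
  ultimately have "c = 1" using dim c(1)
    by (simp add: emeasure_ball flip: ennreal_mult)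
  then show ?thesis using c by (intro measure_eqI) (auto simp: emeasure_distr)
qed

section \<open>One-dimensional Hausdorff measure of segments and curves\<close>

lemma hausdorff_outer_singleton:
  assumes "0 < s"
  shows "hausdorff_outer s {x} = 0"
proof -
  have "hausdorff_pre s \<delta> {x} \<le> 0" if "\<delta> > 0" for \<delta> :: real
  proof -
    define U where "U i = (if i = 0 then {x} else {})" for i :: nat
    have "hausdorff_pre s \<delta> {x} \<le> (\<Sum>i. if U i = {} then 0 else ennreal (unit_ball_vol (real s) * (diameter (U i) / 2) ^ s))"
      unfolding hausdorff_pre_def
      by (rule INF_lower) (use that in \<open>auto simp: U_def\<close>)
    also have "(\<lambda>i. if U i = {} then 0 else ennreal (unit_ball_vol (real s) * (diameter (U i) / 2) ^ s)) = (\<lambda>i. 0)"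
      using assms by (auto simp: U_def)
    finally show ?thesis by simp
  qed
  then show ?thesis unfolding hausdorff_outer_def by (auto simp: SUP_eq_iff intro!: antisym SUP_least)
qed

text \<open>Cover by \<open>n\<close> equal pieces of length at most \<open>\<delta>\<close>. The
  unit ball of the line has volume \<open>2\<close>, which cancels the halving of the diameters, so
  each piece contributes \<open>l / n\<close>.\<close>

lemma hausdorff_outer_1_Icc_le:
  fixes l :: real
  assumes l: "0 \<le> l"
  shows "hausdorff_outer 1 {0..l} \<le> ennreal l"
  unfolding hausdorff_outer_def
proof (rule SUP_least)
  fix \<delta> :: real assume "\<delta> \<in> {0<..}"
  then have d: "\<delta> > 0" by simp
  obtain n :: nat where n: "l / \<delta> < real n" using reals_Archimedean2 by blast
  then have n0: "0 < n" using l d by (metis divide_nonneg_pos gr0I not_less of_nat_0)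
  have ln: "l / n \<le> \<delta>" using n n0 d by (simp add: field_simps)
  define U where "U i = (if i < n then {real i * (l / n)..real (Suc i) * (l / n)} else {})" for i
  have dU: "diameter (U i) = l / n" if "i < n" for i
  proof -
    have "real i * (l / n) \<le> real (Suc i) * (l / n)" using l by (intro mult_right_mono) auto
    then have "diameter (U i) = real (Suc i) * (l / n) - real i * (l / n)"
      using that by (simp add: U_def del: of_nat_Suc)
    then show ?thesis by (simp add: algebra_simps add_divide_distrib)
  qed
  have cov: "{0..l} \<subseteq> (\<Union>i. U i)"
  proof
    fix x assume x: "x \<in> {0..l}"
    show "x \<in> (\<Union>i. U i)"
    \<comment> \<open>At the right end the floor would give the index \<open>n\<close>, one past the
      last piece; the piece \<open>n - 1\<close> is named directly.\<close>
    proof (cases "x = l")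
      case True
      have "real (Suc (n - 1)) * (l / n) = l" "real (n - 1) * (l / n) \<le> real n * (l / n)"
        using n0 l by (simp, intro mult_right_mono) auto
      then have "x \<in> U (n - 1)" using n0 True by (simp add: U_def del: of_nat_Suc)
      then show ?thesis by blast
    next
      case False
      then have xl: "0 \<le> x" "x < l" using x by auto
      define i where "i = nat \<lfloor>x / (l / n)\<rfloor>"
      have p: "0 < l / n" using xl n0 by auto
      have i1: "real i \<le> x / (l / n)" "x / (l / n) < real i + 1"
        using p xl by (auto simp: i_def) 
      have "x / (l / n) < n" using p xl n0 by (simp add: field_simps)
      then have "i < n" using i1 by linarith
      moreover have "real i * (l / n) \<le> x" "x \<le> (real i + 1) * (l / n)"
        using i1 p by (simp_all only: pos_le_divide_eq pos_divide_less_eq)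
      ultimately have "x \<in> U i" by (simp add: U_def add.commute)
      then show ?thesis by blast
    qed
  qed
  have "hausdorff_pre 1 \<delta> {0..l} \<le> (\<Sum>i. if U i = {} then 0 else ennreal (unit_ball_vol (real 1) * (diameter (U i) / 2) ^ 1))"
    unfolding hausdorff_pre_def
  proof (rule INF_lower, safe)
    fix i
    show "bounded (U i)" by (simp add: U_def)
    show "diameter (U i) \<le> \<delta>" using dU[of i] ln d by (cases "i < n") (auto simp: U_def)
  qed (use cov in auto)
  also have "(\<lambda>i. if U i = {} then 0 else ennreal (unit_ball_vol (real 1) * (diameter (U i) / 2) ^ 1)) =
      (\<lambda>i. if i < n then ennreal (l / n) else 0)"
  proof
    fix i
    have "real i * (l / n) \<le> real (Suc i) * (l / n)" using l by (intro mult_right_mono) auto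
    then have "U i \<noteq> {}" if "i < n" using that unfolding U_def by (simp only: if_True atLeastatMost_empty_iff) simp
    then show "(if U i = {} then 0 else ennreal (unit_ball_vol (real 1) * (diameter (U i) / 2) ^ 1)) = (if i < n then ennreal (l / n) else 0)"
      using dU[of i] by (auto simp: U_def)
  qed
  also have "(\<Sum>i. if i < n then ennreal (l / n) else 0) = (\<Sum>i\<in>{..<n}. if i < n then ennreal (l / n) else 0)"
    by (rule suminf_finite) auto
  also have "\<dots> = ennreal l" using n0 l by (simp add: ennreal_of_nat_eq_real_of_nat flip: ennreal_mult)
  finally show "hausdorff_pre 1 \<delta> {0..l} \<le> ennreal l" .
qed

text \<open>Each covering set lies in the interval from its infimum to its supremum, whose length is
  at most the diameter, and Lebesgue measure is countably subadditive. Any fixed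
  \<open>\<delta>\<close> bounds the supremum over \<open>\<delta>\<close> from below;
  \<open>1\<close> is an arbitrary choice.\<close>

lemma hausdorff_outer_1_Icc_ge:
  fixes l :: real
  assumes l: "0 \<le> l"
  shows "ennreal l \<le> hausdorff_outer 1 {0..l}"
proof -
  have "ennreal l \<le> hausdorff_pre 1 1 {0..l}"
    unfolding hausdorff_pre_def
  proof (rule INF_greatest, clarify)
    fix U :: "nat \<Rightarrow> real set"
    assume U: "{0..l} \<subseteq> (\<Union>i. U i)" "\<forall>i. bounded (U i) \<and> diameter (U i) \<le> 1"
    define W where "W i = (if U i = {} then {} else {Inf (U i)..Sup (U i)})" for i
    have bd: "bdd_above (U i)" "bdd_below (U i)" for i
      using U(2) bounded_imp_bdd_above bounded_imp_bdd_below by auto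
    have UW: "U i \<subseteq> W i" for i
      using bd[of i] cInf_lower[of _ "U i"] cSup_upper[of _ "U i"] by (auto simp: W_def)
    have eW: "emeasure lborel (W i) \<le> (if U i = {} then 0 else ennreal (diameter (U i)))" for i
    proof (cases "U i = {}")
      case False
      have "a - b \<le> diameter (U i)" if "a \<in> U i" "b \<in> U i" for a b
        using diameter_bounded_bound[of "U i" a b] U(2) that by (auto simp: dist_real_def)
      then have "Sup (U i) \<le> b + diameter (U i)" if "b \<in> U i" for b
        using that False by (intro cSup_least) force+
      then have "Sup (U i) - diameter (U i) \<le> Inf (U i)" using False by (intro cInf_greatest) force+
      moreover have "Inf (U i) \<le> Sup (U i)" using False bd by (meson cInf_le_cSup)
      ultimately show ?thesis using False by (simp add: W_def ennreal_leI)
    qed (simp add: W_def)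
    have "ennreal l = emeasure lborel {0..l}" using l by simp
    also have "\<dots> \<le> emeasure lborel (\<Union>i. W i)"
    proof (rule emeasure_mono)
      show "{0..l} \<subseteq> (\<Union>i. W i)" using U(1) UW by (meson SUP_mono' order_trans)
      show "(\<Union>i. W i) \<in> sets lborel" by (auto simp: W_def)
    qed
    also have "\<dots> \<le> (\<Sum>i. emeasure lborel (W i))"
      by (rule emeasure_subadditive_countably) (auto simp: W_def)
    also have "\<dots> \<le> (\<Sum>i. if U i = {} then 0 else ennreal (diameter (U i)))"
      by (intro suminf_le eW summableI)
    also have "\<dots> = (\<Sum>i. if U i = {} then 0 else ennreal (unit_ball_vol (real 1) * (diameter (U i) / 2) ^ 1))"
      by (intro suminf_cong) auto
    finally show "ennreal l \<le> (\<Sum>i. if U i = {} then 0 else ennreal (unit_ball_vol (real 1) * (diameter (U i) / 2) ^ 1))" .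
  qed
  also have "\<dots> \<le> hausdorff_outer 1 {0..l}"
    unfolding hausdorff_outer_def by (rule SUP_upper) auto
  finally show ?thesis .
qed

lemma hausdorff_outer_1_Icc:
  fixes l :: real
  assumes l: "0 \<le> l"
  shows "hausdorff_outer 1 {0..l} = ennreal l"
  using hausdorff_outer_1_Icc_le[OF l] hausdorff_outer_1_Icc_ge[OF l] by (rule antisym)

lemma hausdorff_outer_1_segment:
  fixes p q :: "'a::euclidean_space"
  shows "hausdorff_outer 1 (closed_segment p q) = ennreal (dist p q)"
proof (cases "p = q")
  case True then show ?thesis by (simp add: hausdorff_outer_singleton)
next
  case False
  define l where "l = dist p q"
  have l: "l > 0" using False by (simp add: l_def)
  define e where "e = (1 / l) *\<^sub>R (q - p)"
  have ne: "norm e = 1" using l by (simp add: e_def l_def dist_norm norm_minus_commute)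
  have "closed_segment p q = (\<lambda>t. p + t *\<^sub>R e) ` {0..l}"
  proof (intro set_eqI iffI)
    fix x assume "x \<in> closed_segment p q"
    then obtain u where u: "0 \<le> u" "u \<le> 1" "x = (1 - u) *\<^sub>R p + u *\<^sub>R q" by (auto simp: in_segment)
    have "x = p + (u * l) *\<^sub>R e" using l u by (simp add: e_def algebra_simps)
    then show "x \<in> (\<lambda>t. p + t *\<^sub>R e) ` {0..l}" using u l by (intro image_eqI[of _ _ "u * l"]) (auto simp: mult_left_le_one_le)
  next
    fix x assume "x \<in> (\<lambda>t. p + t *\<^sub>R e) ` {0..l}"
    then obtain t where t: "0 \<le> t" "t \<le> l" "x = p + t *\<^sub>R e" by auto
    then have "x = (1 - t / l) *\<^sub>R p + (t / l) *\<^sub>R q" using l by (simp add: e_def algebra_simps)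
    then show "x \<in> closed_segment p q" using t l unfolding in_segment by (intro exI[of _ "t / l"]) auto
  qed
  moreover have "dist (p + x *\<^sub>R e) (p + y *\<^sub>R e) = dist x y" for x y :: real
  proof -
    have "p + x *\<^sub>R e - (p + y *\<^sub>R e) = (x - y) *\<^sub>R e" by (simp add: algebra_simps)
    then show ?thesis using ne by (simp add: dist_norm)
  qed
  ultimately show ?thesis
    using hausdorff_outer_isometry_image[of "{0..l}" "\<lambda>t. p + t *\<^sub>R e" 1] hausdorff_outer_1_Icc[of l] l
    by (simp add: l_def)
qed

lemma hausdorff_outer_1_lipschitz_curve:
  fixes g :: "real \<Rightarrow> 'a::metric_space"
  assumes "s \<le> t" "0 < L" "\<And>x y. x \<in> {s..t} \<Longrightarrow> y \<in> {s..t} \<Longrightarrow> dist (g x) (g y) \<le> L * dist x y"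
  shows "hausdorff_outer 1 (g ` {s..t}) \<le> ennreal (L * (t - s))"
proof -
  have "hausdorff_outer 1 (g ` {s..t}) \<le> ennreal (L ^ 1) * hausdorff_outer 1 {s..t}"
    using assms(2,3) by (rule hausdorff_outer_lipschitz_image)
  also have "{s..t} = closed_segment s t" using assms(1) by (simp add: closed_segment_eq_real_ivl)
  also have "hausdorff_outer 1 \<dots> = ennreal (t - s)"
    using assms(1) by (simp only: hausdorff_outer_1_segment) (simp add: dist_real_def)
  finally show ?thesis
    using assms by (simp add: closed_segment_eq_real_ivl flip: ennreal_mult)
qed

text \<open>Nearest-point projection onto \<open>C\<close> is a contraction, and the outer normal ray at a boundary
  point of \<open>C\<close> meets the boundary of \<open>K\<close> in a point that projects back to it.\<close>

lemma hausdorff_outer_frontier_mono: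
  fixes C K :: "'a::euclidean_space set"
  assumes C: "convex C" "closed C" and CK: "C \<subseteq> K" and K: "compact K"
  shows "hausdorff_outer s (frontier C) \<le> hausdorff_outer s (frontier K)"
proof (cases "C = {}")
  case True then show ?thesis
    using hausdorff_outer_mono[of "{}" "frontier K" s] by simp
next
  case ne: False
  have "frontier C \<subseteq> closest_point C ` frontier K"
  proof
    fix y assume y: "y \<in> frontier C"
    then have yC: "y \<in> C" using C(2) frontier_subset_closed by blast
    \<comment> \<open>An outer normal at \<open>y\<close>. If \<open>C\<close> has empty interior it
      lies in a hyperplane, whose normal serves at every point.\<close>
    have "\<exists>a. a \<noteq> 0 \<and> (\<forall>x\<in>C. a \<bullet> x \<le> a \<bullet> y)"
    proof (cases "rel_interior C = interior C \<and> interior C \<noteq> {}")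
      case True
      then have "y \<notin> rel_interior C" using y by (auto simp: frontier_def)
      then obtain a where "a \<noteq> 0" "\<And>x. x \<in> closure C \<Longrightarrow> a \<bullet> y \<le> a \<bullet> x"
        using supporting_hyperplane_rel_boundary[OF C(1) yC] C(2) by (metis closure_closed)
      then show ?thesis using C(2) by (intro exI[of _ "- a"]) (auto simp: closure_closed)
    next
      case False
      then have "interior C = {}" using rel_interior_nonempty_interior by blast
      then obtain a b where "a \<noteq> 0" "C \<subseteq> {x. a \<bullet> x = b}"
        using empty_interior_subset_hyperplane[OF C(1)] by blast
      then have "a \<bullet> x = a \<bullet> y" if "x \<in> C" for x using yC that by blast
      then show ?thesis using \<open>a \<noteq> 0\<close> by (intro exI[of _ a]) auto
    qed
    then obtain a where a: "a \<noteq> 0" "\<And>x. x \<in> C \<Longrightarrow> a \<bullet> x \<le> a \<bullet> y" by blast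
    \<comment> \<open>From an interior point of \<open>K\<close> the ray must leave
      \<open>K\<close>; a point \<open>y\<close> that is not interior is already on the boundary,
      and \<open>r = 0\<close> is taken.\<close>
    have "\<exists>r\<ge>0. y + r *\<^sub>R a \<in> frontier K"
    proof (cases "y \<in> interior K")
      case True
      then obtain r where "0 < r" "y + r *\<^sub>R a \<in> frontier K"
        using ray_to_frontier[OF compact_imp_bounded[OF K] True a(1)] by auto
      then show ?thesis by (intro exI[of _ r]) auto
    next
      case False
      then have "y \<in> frontier K" using yC CK K by (simp add: frontier_def compact_imp_closed subset_iff)
      then show ?thesis by (intro exI[of _ 0]) auto
    qed
    then obtain r where r: "r \<ge> 0" "y + r *\<^sub>R a \<in> frontier K" by blast
    \<comment> \<open>For \<open>z\<close> in \<open>C\<close> the vector \<open>y - z\<close> makes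
      no obtuse angle with \<open>r *\<^sub>R a\<close>, so adding it cannot shorten that vector.
      Hence \<open>y\<close> is the nearest point of \<open>C\<close>.\<close>
    have "dist (y + r *\<^sub>R a) y \<le> dist (y + r *\<^sub>R a) z" if "z \<in> C" for z
    proof -
      have "(r *\<^sub>R a) \<bullet> (y - z) \<ge> 0" using a(2)[OF that] r(1) by (simp add: inner_diff_right mult_left_mono)
      then have "norm (r *\<^sub>R a) ^ 2 \<le> norm (r *\<^sub>R a + (y - z)) ^ 2"
        unfolding power2_norm_eq_inner by (simp only: inner_add_left inner_add_right) (simp add: inner_commute)
      then have "norm (r *\<^sub>R a) \<le> norm (r *\<^sub>R a + (y - z))" by (rule power2_le_imp_le) simp
      then show ?thesis by (simp add: dist_norm algebra_simps)
    qed
    then have "y = closest_point C (y + r *\<^sub>R a)"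
      using closest_point_unique[OF C yC] by blast
    then show "y \<in> closest_point C ` frontier K" using r(2) by blast
  qed
  then have "hausdorff_outer s (frontier C) \<le> hausdorff_outer s (closest_point C ` frontier K)"
    by (rule hausdorff_outer_mono)
  also have "\<dots> \<le> ennreal (1 ^ s) * hausdorff_outer s (frontier K)"
    by (rule hausdorff_outer_lipschitz_image) (use closest_point_lipschitz[OF C ne] in auto)
  finally show ?thesis by simp
qed

lemma distr_hausdorff_measure_isometry:
  fixes J :: "'a::metric_space \<Rightarrow> 'b::metric_space"
  assumes ha: "hausdorff_additive s TYPE('a)"
    and iso: "\<And>x y. dist (J x) (J y) = dist x y" and sur: "surj J"
  shows "distr (hausdorff_measure s) borel J = hausdorff_measure s"
proof (rule measure_eqI)
  have "continuous_on UNIV J" unfolding continuous_on_iff using iso by metis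
  then have [measurable]: "J \<in> borel_measurable borel" by (rule borel_measurable_continuous_onI)
  fix B assume "B \<in> sets (distr (hausdorff_measure s) borel J)"
  then have B: "B \<in> sets borel" by simp
  have v: "J -` B \<in> sets borel" using measurable_sets[of J borel borel B] B by simp
  have "hausdorff_outer s (J -` B) = hausdorff_outer s B"
    using hausdorff_outer_isometry_image[of "J -` B" J s] iso sur by (simp add: surj_image_vimage_eq)
  then show "emeasure (distr (hausdorff_measure s) borel J) B = emeasure (hausdorff_measure s) B"
    using B v emeasure_hausdorff_measure[OF ha v] emeasure_hausdorff_measure[OF hausdorff_additive_isometry[OF ha iso sur] B]
    by (simp add: emeasure_distr)
qed simp

section \<open>Caps of planar convex bodies\<close>

lemma supporting_functional:
  fixes K :: "'a::euclidean_space set"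
  assumes "convex K" "interior K \<noteq> {}" "z \<in> K" "z \<notin> interior K"
  obtains w where "w \<noteq> 0" "\<And>y. y \<in> K \<Longrightarrow> w \<bullet> y \<le> w \<bullet> z"
proof -
  have "z \<notin> rel_interior K" using assms by (simp add: rel_interior_nonempty_interior)
  then obtain w where w: "w \<noteq> 0" "\<And>y. y \<in> K \<Longrightarrow> w \<bullet> z \<le> w \<bullet> y"
    using supporting_hyperplane_rel_boundary[OF assms(1,3)] by metis
  show ?thesis
    by (rule that[of "- w"]) (use w in auto)
qed

lemma not_interior_halfspace:
  fixes C :: "'a::euclidean_space set"
  assumes "u \<noteq> 0" "C \<subseteq> {y. u \<bullet> y \<le> \<beta>}" "u \<bullet> z = \<beta>"
  shows "z \<notin> interior C"
  using interior_mono[OF assms(2)] interior_halfspace_le[OF assms(1)] assms(3) by auto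

text \<open>A fold in an arbitrary direction is later rotated so that it depends on the second
  coordinate. Hence levels are second coordinates and slices are horizontal.\<close>

locale planar_body =
  fixes K :: "(real \<times> real) set"
  assumes compact_K: "compact K" and convex_K: "convex K" and interior_K: "interior K \<noteq> {}"
begin

definition a where "a = Inf (snd ` K)"
definition b where "b = Sup (snd ` K)"
definition lo where "lo t = Inf {x. (x, t) \<in> K}"
definition hi where "hi t = Sup {x. (x, t) \<in> K}"
definition w where "w t = hi t - lo t"

lemma K_ne: "K \<noteq> {}" using interior_K interior_subset by auto

lemma snd_image: "snd ` K = {a..b}"
proof -
  have "compact (snd ` K)"
    by (rule compact_continuous_image[OF _ compact_K]) (intro continuous_intros)
  moreover have "connected (snd ` K)"
    by (rule connected_continuous_image[OF _ convex_connected[OF convex_K]]) (intro continuous_intros)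
  ultimately obtain c d where "snd ` K = {c..d}"
    using connected_compact_interval_1[of "snd ` K"] by metis
  moreover have "snd ` K \<noteq> {}" using K_ne by simp
  ultimately have cd: "snd ` K = {c..d}" "c \<le> d" by auto
  then show ?thesis unfolding a_def b_def by simp
qed

lemma snd_bounds: "z \<in> K \<Longrightarrow> a \<le> snd z \<and> snd z \<le> b"
  using imageI[of z K snd] unfolding snd_image by simp

lemma slice_compact: "compact {x. (x, t) \<in> K}"
proof -
  have "{x. (x, t) \<in> K} = fst ` (K \<inter> {z. snd z = t})" by force
  moreover have "compact (K \<inter> {z. snd z = t})"
    using compact_K by (intro compact_Int_closed closed_Collect_eq continuous_intros)
  ultimately show ?thesis
    using compact_continuous_image[OF continuous_on_fst[OF continuous_on_id]] by simp
qed

lemma slice_ne: "a \<le> t \<Longrightarrow> t \<le> b \<Longrightarrow> {x. (x, t) \<in> K} \<noteq> {}"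
proof -
  assume "a \<le> t" "t \<le> b"
  then have "t \<in> snd ` K" unfolding snd_image by simp
  then obtain z where "z \<in> K" "t = snd z" by blast
  then have "(fst z, t) \<in> K" by simp
  then show ?thesis by blast
qed

lemma slice_bdd: "bdd_below {x. (x, t) \<in> K}" "bdd_above {x. (x, t) \<in> K}"
  by (rule bounded_imp_bdd_below[OF compact_imp_bounded[OF slice_compact]])
    (rule bounded_imp_bdd_above[OF compact_imp_bounded[OF slice_compact]])

lemma lo_in: "a \<le> t \<Longrightarrow> t \<le> b \<Longrightarrow> (lo t, t) \<in> K"
  using closed_contains_Inf[OF slice_ne slice_bdd(1) compact_imp_closed[OF slice_compact], of t]
  unfolding lo_def by blast

lemma hi_in: "a \<le> t \<Longrightarrow> t \<le> b \<Longrightarrow> (hi t, t) \<in> K"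
  using closed_contains_Sup[OF slice_ne slice_bdd(2) compact_imp_closed[OF slice_compact], of t]
  unfolding hi_def by blast

lemma in_bounds: "(x, t) \<in> K \<Longrightarrow> lo t \<le> x \<and> x \<le> hi t"
  unfolding lo_def hi_def
  using cInf_lower[of x, OF _ slice_bdd(1)] cSup_upper[of x, OF _ slice_bdd(2)] by simp

lemma in_K_iff: "a \<le> t \<Longrightarrow> t \<le> b \<Longrightarrow> (x, t) \<in> K \<longleftrightarrow> lo t \<le> x \<and> x \<le> hi t"
proof (intro iffI)
  assume t: "a \<le> t" "t \<le> b" and x: "lo t \<le> x \<and> x \<le> hi t"
  show "(x, t) \<in> K"
  proof (cases "lo t = hi t")
    case True
    then have "x = lo t" using x by simp
    then show ?thesis using lo_in[OF t] by simp
  next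
    case False
    then have l: "lo t < hi t" using x by linarith
    define u where "u = (x - lo t) / (hi t - lo t)"
    have u: "0 \<le> u" "u \<le> 1" using x l by (auto simp: u_def)
    have "u * (hi t - lo t) = x - lo t" using l by (simp add: u_def)
    then have "x = (1 - u) * lo t + u * hi t" by (simp add: algebra_simps)
    moreover have "(1 - u) *\<^sub>R (lo t, t) + u *\<^sub>R (hi t, t) \<in> K"
      by (rule convexD[OF convex_K lo_in[OF t] hi_in[OF t]]) (use u in auto)
    moreover have "(1 - u) * t + u * t = t" by (simp add: algebra_simps)
    ultimately show ?thesis by simp
  qed
qed (use in_bounds in auto)

lemma comb_in_K:
  assumes "a \<le> s" "s \<le> b" "a \<le> t" "t \<le> b" "0 \<le> u" "u \<le> 1" "(x, s) \<in> K" "(y, t) \<in> K"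
  shows "((1 - u) * x + u * y, (1 - u) * s + u * t) \<in> K"
  using convexD[OF convex_K assms(7,8), of "1 - u" u] assms by simp

lemma convex_lo: "convex_on {a..b} lo"
proof (rule convex_onI)
  fix u x y :: real assume A: "0 < u" "u < 1" "x \<in> {a..b}" "y \<in> {a..b}"
  have "((1 - u) * lo x + u * lo y, (1 - u) * x + u * y) \<in> K"
    by (rule comb_in_K) (use A lo_in in auto)
  then show "lo ((1 - u) *\<^sub>R x + u *\<^sub>R y) \<le> (1 - u) * lo x + u * lo y" using in_bounds by auto
qed simp

lemma convex_hi: "convex_on {a..b} (\<lambda>t. - hi t)"
proof (rule convex_onI)
  fix u x y :: real assume A: "0 < u" "u < 1" "x \<in> {a..b}" "y \<in> {a..b}"
  have "((1 - u) * hi x + u * hi y, (1 - u) * x + u * y) \<in> K"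
    by (rule comb_in_K) (use A hi_in in auto)
  then show "- hi ((1 - u) *\<^sub>R x + u *\<^sub>R y) \<le> (1 - u) * - hi x + u * - hi y" using in_bounds by force
qed simp

lemma w_nonneg: "a \<le> t \<Longrightarrow> t \<le> b \<Longrightarrow> 0 \<le> w t"
  using in_bounds[OF lo_in, of t] unfolding w_def by simp

lemma w_concave:
  assumes "a \<le> x" "x \<le> b" "a \<le> y" "y \<le> b" "0 \<le> u" "u \<le> 1"
  shows "(1 - u) * w x + u * w y \<le> w ((1 - u) * x + u * y)"
proof -
  have "lo ((1 - u) * x + u * y) \<le> (1 - u) * lo x + u * lo y"
    using convex_onD[OF convex_lo, of u x y] assms by simp
  moreover have "- hi ((1 - u) * x + u * y) \<le> (1 - u) * - hi x + u * - hi y"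
    using convex_onD[OF convex_hi, of u x y] assms by simp
  ultimately show ?thesis unfolding w_def by (simp add: algebra_simps)
qed

lemma w_pos_ex: "\<exists>t. a < t \<and> t < b \<and> 0 < w t"
proof -
  obtain z where "z \<in> interior K" using interior_K by auto
  then obtain e where e: "0 < e" "cball z e \<subseteq> K" by (auto simp: mem_interior_cball)
  have k: "(fst z + r, snd z + s) \<in> K" if "\<bar>r\<bar> \<le> e / 2" "\<bar>s\<bar> \<le> e / 2" for r s
  proof -
    have "dist z (fst z + r, snd z + s) \<le> \<bar>r\<bar> + \<bar>s\<bar>"
      using sqrt_sum_squares_le_sum_abs[of r s] by (cases z) (simp add: dist_Pair_Pair dist_real_def)
    then show ?thesis using e that by (auto simp: subset_iff)
  qed
  show ?thesis
  proof (intro exI[of _ "snd z"] conjI)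
    show "a < snd z" using snd_bounds[OF k[of 0 "- e / 2"]] e by auto
    show "snd z < b" using snd_bounds[OF k[of 0 "e / 2"]] e by auto
    show "0 < w (snd z)" using in_bounds[OF k[of "- e / 2" 0]] in_bounds[OF k[of "e / 2" 0]] e
      unfolding w_def by auto
  qed
qed

lemma ab: "a < b" using w_pos_ex by auto

text \<open>\<open>t\<close> is a convex combination of a level \<open>s\<close> of positive width
  and the end \<open>e\<close> of the range on the side of \<open>t\<close>, with positive weight on
  \<open>s\<close>; concavity does the rest.\<close>

lemma w_pos:
  assumes t: "a < t" "t < b"
  shows "0 < w t"
proof -
  obtain s where s: "a < s" "s < b" "0 < w s" using w_pos_ex by blast
  define e where "e = (if t \<le> s then a else b)"
  define u where "u = (t - e) / (s - e)"
  have u: "0 < u" "u \<le> 1" using t s by (auto simp: u_def e_def field_simps)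
  have "s - e \<noteq> 0" using s by (auto simp: e_def)
  then have "u * (s - e) = t - e" by (simp add: u_def)
  then have te: "t = (1 - u) * e + u * s" by (simp add: algebra_simps)
  have ew: "0 \<le> w e" "a \<le> e" "e \<le> b" using ab by (auto simp: e_def intro: w_nonneg)
  have "(1 - u) * w e + u * w s \<le> w t"
    unfolding te by (rule w_concave) (use ew s u in auto)
  moreover have "0 < u * w s" "0 \<le> (1 - u) * w e" using u s ew by auto
  ultimately show ?thesis by linarith
qed

lemma frontier_sub: "frontier K \<subseteq> K"
  using compact_K by (simp add: compact_imp_closed frontier_subset_closed)

text \<open>A supporting functional at a point strictly inside its slice has no horizontal
  component, and since the level is strictly between \<open>a\<close> and \<open>b\<close> it has no
  vertical component either.\<close>

lemma frontier_cases:
  assumes "(x, t) \<in> frontier K" "a < t" "t < b"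
  shows "x = lo t \<or> x = hi t"
proof (rule ccontr)
  assume "\<not> ?thesis"
  moreover have xK: "(x, t) \<in> K" using assms frontier_sub by auto
  ultimately have x: "lo t < x" "x < hi t" using in_bounds[OF xK] by auto
  have "(x, t) \<notin> interior K" using assms(1) by (simp add: frontier_def)
  then obtain v where v: "v \<noteq> 0" "\<And>y. y \<in> K \<Longrightarrow> v \<bullet> y \<le> v \<bullet> (x, t)"
    using supporting_functional[OF convex_K interior_K xK] by blast
  obtain v1 v2 where vv: "v = (v1, v2)" by (cases v)
  have "v1 * lo t \<le> v1 * x" "v1 * hi t \<le> v1 * x"
    using v(2)[OF lo_in, of t] v(2)[OF hi_in, of t] assms by (auto simp: vv)
  then have v1: "v1 = 0" using x by (smt (verit) mult_less_cancel_left)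
  have "v2 * a \<le> v2 * t" "v2 * b \<le> v2 * t"
    using v(2)[OF lo_in, of a] v(2)[OF lo_in, of b] ab by (auto simp: vv v1)
  then have "v2 = 0" using assms by (smt (verit) mult_less_cancel_left)
  then show False using v(1) v1 vv by (simp add: zero_prod_def)
qed

abbreviation upper where "upper t \<equiv> {z::real \<times> real. t \<le> snd z}"

definition area where "area t = measure lborel (K \<inter> upper t)"

lemma upper_borel [measurable]: "upper t \<in> sets borel"
  by (intro borel_closed closed_Collect_le continuous_intros)

lemma K_borel [measurable]: "K \<in> sets borel" using compact_K by (rule borel_compact)

lemma emeasure_K_fin: "A \<subseteq> K \<Longrightarrow> emeasure lborel A < \<infinity>"
  using emeasure_bounded_finite bounded_subset compact_imp_bounded[OF compact_K] by metis

lemma fmeas: "A \<subseteq> K \<Longrightarrow> A \<in> sets borel \<Longrightarrow> A \<in> fmeasurable lborel"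
  using emeasure_K_fin by (auto simp: fmeasurable_def)

lemma area_mono: "s \<le> t \<Longrightarrow> area t \<le> area s"
  unfolding area_def by (intro measure_mono_fmeasurable fmeas) auto

text \<open>Fubini over horizontal slices. The slab is half open, \<open>s \<le> y < t\<close>,
  because \<open>upper t\<close> contains its bottom line.\<close>

lemma area_step:
  assumes st: "a \<le> s" "s \<le> t" "t \<le> b" and W: "\<And>x. s \<le> x \<Longrightarrow> x < t \<Longrightarrow> W \<le> w x" "0 \<le> W"
  shows "(t - s) * W \<le> area s - area t"
proof -
  have "{z::real \<times> real. s \<le> snd z \<and> snd z < t} = upper s - upper t" by auto
  then have bo[measurable]: "{z::real \<times> real. s \<le> snd z \<and> snd z < t} \<in> sets borel" by simp
  let ?S = "K \<inter> {z. s \<le> snd z \<and> snd z < t}"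
  have "area s - area t = measure lborel (K \<inter> upper s - K \<inter> upper t)"
    unfolding area_def by (rule measure_Diff[symmetric]) (use emeasure_K_fin[of "K \<inter> upper s"] st in auto)
  also have "K \<inter> upper s - K \<inter> upper t = ?S" by auto
  finally have eq: "area s - area t = measure lborel ?S" .
  have sl: "(\<lambda>x. (x, y)) -` ?S = (if s \<le> y \<and> y < t then {lo y..hi y} else {})" for y
    using in_K_iff[of y] st by auto
  have "emeasure lborel ?S = emeasure (lborel \<Otimes>\<^sub>M lborel) ?S" by (simp add: lborel_prod)
  also have "\<dots> = (\<integral>\<^sup>+y. emeasure lborel ((\<lambda>x. (x, y)) -` ?S) \<partial>lborel)"
    by (rule lborel_pair.emeasure_pair_measure_alt2) (simp only: lborel_prod sets_lborel, intro sets.Int K_borel bo)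
  also have "\<dots> \<ge> (\<integral>\<^sup>+y. ennreal W * indicator {s..<t} y \<partial>lborel)"
  proof (rule nn_integral_mono)
    fix y
    show "ennreal W * indicator {s..<t} y \<le> emeasure lborel ((\<lambda>x. (x, y)) -` ?S)"
      unfolding sl using W(1)[of y] W(2) st by (auto simp: indicator_def w_def ennreal_leI)
  qed
  also have "(\<integral>\<^sup>+y. ennreal W * indicator {s..<t} y \<partial>lborel) = ennreal ((t - s) * W)"
    using st W(2) by (subst nn_integral_cmult_indicator) (auto simp: mult.commute simp flip: ennreal_mult)
  finally have "ennreal ((t - s) * W) \<le> ennreal (measure lborel ?S)"
    using emeasure_K_fin[of ?S] by (subst emeasure_eq_ennreal_measure[symmetric]) auto
  then show ?thesis using eq by simp
qed

end

section \<open>Areas of trapezoids and lengths of convex graphs\<close>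

lemma emeasure_lborel_trapezoid_le:
  fixes d Y k :: real
  assumes d: "0 \<le> d" and Y: "0 \<le> Y" "k * d \<le> Y"
  shows "emeasure lborel {z. 0 \<le> fst z \<and> fst z \<le> d \<and> k * fst z \<le> snd z \<and> snd z \<le> Y} \<le> ennreal (d * (Y - k * d / 2))"
proof -
  let ?S = "{z::real \<times> real. 0 \<le> fst z \<and> fst z \<le> d \<and> k * fst z \<le> snd z \<and> snd z \<le> Y}"
  have cl: "closed ?S" by (intro closed_Collect_conj closed_Collect_le continuous_intros)
  have kY: "k * y \<le> Y" if "0 \<le> y" "y \<le> d" for y
  proof (cases "0 \<le> k")
    case True then show ?thesis using that Y mult_left_mono[of y d k] by linarith
  next
    case False then show ?thesis using that Y mult_nonneg_nonneg[of "-k" y] by auto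
  qed
  have "emeasure lborel ?S = emeasure (lborel \<Otimes>\<^sub>M lborel) ?S" by (simp add: lborel_prod)
  also have "\<dots> = (\<integral>\<^sup>+x. emeasure lborel (Pair x -` ?S) \<partial>lborel)"
    by (rule lborel.emeasure_pair_measure_alt) (simp only: lborel_prod sets_lborel borel_closed[OF cl])
  also have "\<dots> = (\<integral>\<^sup>+x. ennreal (Y - k * x) * indicator {0..d} x \<partial>lborel)"
  proof (rule nn_integral_cong)
    fix x
    have "Pair x -` ?S = (if x \<in> {0..d} then {k * x..Y} else {})" by auto
    then show "emeasure lborel (Pair x -` ?S) = ennreal (Y - k * x) * indicator {0..d} x"
      using kY[of x] by (simp add: indicator_def)
  qed
  also have "\<dots> = ennreal ((Y * d - k * d ^ 2 / 2) - (Y * 0 - k * 0 ^ 2 / 2))"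
    by (rule nn_integral_FTC_Icc[where F="\<lambda>x. Y * x - k * x ^ 2 / 2"])
      (use d kY in \<open>auto intro!: derivative_eq_intros simp: has_real_derivative_iff_has_vector_derivative[symmetric]\<close>)
  also have "(Y * d - k * d ^ 2 / 2) - (Y * 0 - k * 0 ^ 2 / 2) = d * (Y - k * d / 2)"
    by (simp add: algebra_simps power2_eq_square)
  finally show ?thesis by simp
qed

text \<open>\<open>J\<close> takes coordinates in the orthonormal frame \<open>n\<close>,
  \<open>e\<close> and preserves area, so the trapezoid may be assumed to have its parallel sides
  along an axis.\<close>

lemma measure_le_trapezoid:
  fixes e n P :: "real \<times> real"
  assumes orth: "e \<bullet> e = 1" "n \<bullet> n = 1" "e \<bullet> n = 0"
    and d: "0 \<le> d" and Y: "0 \<le> Y" "k * d \<le> Y"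
    and A: "A \<in> sets borel"
    and sub: "\<And>z. z \<in> A \<Longrightarrow> 0 \<le> n \<bullet> (z - P) \<and> n \<bullet> (z - P) \<le> d \<and> k * (n \<bullet> (z - P)) \<le> e \<bullet> (z - P) \<and> e \<bullet> (z - P) \<le> Y"
  shows "measure lborel A \<le> d * (Y - k * d / 2)"
proof -
  obtain e1 e2 n1 n2 where en: "e = (e1, e2)" "n = (n1, n2)" by (cases e, cases n) auto
  have o: "e1 * e1 + e2 * e2 = 1" "n1 * n1 + n2 * n2 = 1" "e1 * n1 + e2 * n2 = 0"
    using orth by (auto simp: en)
  define J where "J z = (n \<bullet> z, e \<bullet> z)" for z
  have lin: "linear J" unfolding J_def by (intro linearI) (auto simp: inner_add_right)
  have nrm: "norm (J z) = norm z" for z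
  proof -
    obtain x y where z: "z = (x, y)" by (cases z)
    \<comment> \<open>The rows of the matrix of \<open>J\<close> are orthonormal, hence so are its
      columns; this makes \<open>J\<close> norm preserving.\<close>
    have n12: "n1 * n1 + e1 * e1 = 1" using o by algebra
    have n13: "n2 * n2 + e2 * e2 = 1" using o by algebra
    have n14: "n1 * n2 + e1 * e2 = 0" using o by algebra
    have "(n1 * x + n2 * y)\<^sup>2 + (e1 * x + e2 * y)\<^sup>2 =
        (n1 * n1 + e1 * e1) * x\<^sup>2 + (n2 * n2 + e2 * e2) * y\<^sup>2 + 2 * (n1 * n2 + e1 * e2) * x * y"
      by (simp add: power2_eq_square algebra_simps)
    also have "\<dots> = x\<^sup>2 + y\<^sup>2" by (simp add: n12 n13 n14)
    finally show ?thesis by (simp add: J_def en z norm_Pair)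
  qed
  have inj: "inj J" using nrm lin by (metis linear_injective_0 norm_eq_zero)
  then have bij: "bij J" using lin linear_injective_imp_surjective by (auto simp: bij_def)
  let ?T = "{z::real \<times> real. 0 \<le> fst z \<and> fst z \<le> d \<and> k * fst z \<le> snd z \<and> snd z \<le> Y}"
  have clT: "closed ?T" by (intro closed_Collect_conj closed_Collect_le continuous_intros)
  have mJ[measurable]: "J \<in> borel_measurable borel"
    by (intro borel_measurable_continuous_onI linear_continuous_on linear_linear[THEN iffD2] lin)
  have [measurable]: "?T \<in> sets borel" by (rule borel_closed[OF clT])
  have "A \<subseteq> (\<lambda>z. z - P) -` (J -` ?T)" using sub by (auto simp: J_def)
  then have "emeasure lborel A \<le> emeasure lborel ((\<lambda>z. z - P) -` (J -` ?T))"
    using measurable_sets[of "\<lambda>z. J (z - P)" borel borel ?T] by (intro emeasure_mono) (auto simp: vimage_def)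
  also have "\<dots> = emeasure (distr lborel borel (\<lambda>z. z - P)) (J -` ?T)"
    using measurable_sets[of J borel borel ?T] by (subst emeasure_distr) auto
  also have "distr lborel borel (\<lambda>z. z - P) = (lborel :: (real \<times> real) measure)"
  proof -
    have "(\<lambda>z. z - P) = (+) (- P)" by auto
    then show ?thesis by (simp only: lborel_distr_plus)
  qed
  also have "emeasure lborel (J -` ?T) = emeasure (distr lborel borel J) ?T"
    by (subst emeasure_distr) auto
  also have "distr lborel borel J = lborel" by (rule lborel_distr_isometry[OF lin bij nrm refl])
  also have "emeasure lborel ?T \<le> ennreal (d * (Y - k * d / 2))"
    by (rule emeasure_lborel_trapezoid_le[OF d Y])
  finally have le: "emeasure lborel A \<le> ennreal (d * (Y - k * d / 2))" .
  have "k * d / 2 \<le> Y" using Y by linarith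
  then have "0 \<le> d * (Y - k * d / 2)" using d by simp
  then show ?thesis using le by (simp add: measure_def enn2real_leI)
qed

text \<open>The triangle inequality for the vectors \<open>(1, \<sigma>)\<close> and
  \<open>(0, M - \<sigma>)\<close>.\<close>

lemma sqrt_one_plus_le: "sqrt (1 + M\<^sup>2) \<le> sqrt (1 + \<sigma>\<^sup>2) + \<bar>M - \<sigma>\<bar>" for M \<sigma> :: real
  using norm_triangle_ineq[of "(1::real, \<sigma>)" "(0::real, M - \<sigma>)"] by (simp add: norm_Pair)

text \<open>All slopes on \<open>{s..t}\<close> are at most \<open>M\<close> in modulus, while the
  chord has a slope \<open>\<sigma>\<close> between \<open>D s\<close> and \<open>D t\<close>;
  passing from \<open>M\<close> to \<open>\<sigma>\<close> costs at most \<open>D t - D s\<close>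
  per unit of level. The excess over the chord is thus a product of two increments and disappears
  under subdivision.\<close>

lemma hausdorff_outer_1_graph_le:
  fixes f D :: "real \<Rightarrow> real"
  assumes st: "s < t" and D: "\<And>x y. x \<in> {s..t} \<Longrightarrow> y \<in> {s..t} \<Longrightarrow> f x + D x * (y - x) \<le> f y"
  shows "hausdorff_outer 1 ((\<lambda>x. (f x, x)) ` {s..t}) \<le> ennreal (dist (f s, s) (f t, t) + (t - s) * (D t - D s))"
proof -
  have mono: "D x \<le> D y" if "x \<in> {s..t}" "y \<in> {s..t}" "x \<le> y" for x y
  proof (cases "x = y")
    case False
    have "(D x - D y) * (y - x) \<le> 0" using D[of x y] D[of y x] that by (simp add: algebra_simps)
    then show ?thesis using False that by (smt (verit) mult_pos_pos)
  qed simp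
  define M where "M = max \<bar>D s\<bar> \<bar>D t\<bar>"
  have slope: "\<bar>f y - f x\<bar> \<le> M * \<bar>y - x\<bar>" if "x \<in> {s..t}" "y \<in> {s..t}" "x \<le> y" for x y
  proof -
    have "D s * (y - x) \<le> D x * (y - x)" "D y * (y - x) \<le> D t * (y - x)"
      using mono[of s x] mono[of y t] that by (auto intro!: mult_right_mono)
    then have "D s * (y - x) \<le> f y - f x" "f y - f x \<le> D t * (y - x)"
      using D[of x y] D[of y x] that by (auto simp: algebra_simps)
    moreover have "- M \<le> D s" "D t \<le> M" by (auto simp: M_def)
    then have "- M * (y - x) \<le> D s * (y - x)" "D t * (y - x) \<le> M * (y - x)"
      using mult_right_mono[of "- M" "D s" "y - x"] mult_right_mono[of "D t" M "y - x"] that by auto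
    ultimately show ?thesis using that by (auto simp: abs_if)
  qed
  have lip: "dist (f x, x) (f y, y) \<le> sqrt (1 + M\<^sup>2) * dist x y" if "x \<in> {s..t}" "y \<in> {s..t}" for x y
  proof -
    have "\<bar>f x - f y\<bar> \<le> M * \<bar>x - y\<bar>"
      using slope[of x y] slope[of y x] that by (cases "x \<le> y") (auto simp: abs_minus_commute)
    then have "(f x - f y)\<^sup>2 \<le> (M * \<bar>x - y\<bar>)\<^sup>2" by (metis abs_ge_zero abs_le_square_iff abs_of_nonneg order_trans)
    then have "sqrt ((f x - f y)\<^sup>2 + (x - y)\<^sup>2) \<le> sqrt ((1 + M\<^sup>2) * (x - y)\<^sup>2)"
      by (intro real_sqrt_le_mono) (simp add: power_mult_distrib algebra_simps)
    also have "\<dots> = sqrt (1 + M\<^sup>2) * \<bar>x - y\<bar>" by (simp add: real_sqrt_mult)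
    finally show ?thesis by (simp add: dist_Pair_Pair dist_real_def)
  qed
  define \<sigma> where "\<sigma> = (f t - f s) / (t - s)"
  have fs: "f t - f s = \<sigma> * (t - s)" using st by (simp add: \<sigma>_def)
  have "D s * (t - s) \<le> \<sigma> * (t - s)" "\<sigma> * (t - s) \<le> D t * (t - s)"
    using D[of s t] D[of t s] st fs by (auto simp: algebra_simps)
  then have \<sigma>: "D s \<le> \<sigma>" "\<sigma> \<le> D t" using st by auto
  have "sqrt (1 + M\<^sup>2) \<le> sqrt (1 + \<sigma>\<^sup>2) + \<bar>M - \<bar>\<sigma>\<bar>\<bar>" using sqrt_one_plus_le[of M "\<bar>\<sigma>\<bar>"] by simp
  also have "\<bar>M - \<bar>\<sigma>\<bar>\<bar> \<le> D t - D s" using \<sigma> by (auto simp: M_def max_def abs_if)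
  finally have sM: "sqrt (1 + M\<^sup>2) \<le> sqrt (1 + \<sigma>\<^sup>2) + (D t - D s)" by simp
  have "dist (f s, s) (f t, t) = sqrt ((1 + \<sigma>\<^sup>2) * (t - s)\<^sup>2)"
  proof -
    have "(f s - f t)\<^sup>2 = \<sigma>\<^sup>2 * (t - s)\<^sup>2" using fs by (metis power2_commute power_mult_distrib)
    then show ?thesis by (simp add: dist_Pair_Pair dist_real_def power2_commute[of s] distrib_right)
  qed
  also have "\<dots> = sqrt (1 + \<sigma>\<^sup>2) * (t - s)" using st by (simp add: real_sqrt_mult)
  finally have ds: "dist (f s, s) (f t, t) = sqrt (1 + \<sigma>\<^sup>2) * (t - s)" .
  have "hausdorff_outer 1 ((\<lambda>x. (f x, x)) ` {s..t}) \<le> ennreal (sqrt (1 + M\<^sup>2) * (t - s))"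
    by (rule hausdorff_outer_1_lipschitz_curve) (use st lip in \<open>auto intro: add_pos_nonneg\<close>)
  also have "\<dots> \<le> ennreal (dist (f s, s) (f t, t) + (t - s) * (D t - D s))"
    using mult_right_mono[OF sM, of "t - s"] st ds by (intro ennreal_leI) (simp add: algebra_simps)
  finally show ?thesis .
qed

text \<open>For an equal subdivision with step \<open>h\<close> the increments of \<open>D\<close>
  telescope, so the total error is \<open>C * h * (D T - D c)\<close>, which tends to
  \<open>0\<close> with \<open>h\<close>.\<close>

lemma telescoping_error_vanishes:
  fixes \<Phi> D :: "real \<Rightarrow> real"
  assumes cT: "c < T" and C: "0 \<le> C"
    and step: "\<And>s t. c \<le> s \<Longrightarrow> s < t \<Longrightarrow> t \<le> T \<Longrightarrow> \<Phi> s \<le> \<Phi> t + C * (t - s) * (D t - D s)"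
  shows "\<Phi> c \<le> \<Phi> T"
proof -
  have bnd: "\<Phi> c \<le> \<Phi> T + C * ((T - c) * (D T - D c)) * (1 / real (Suc n))" for n
  proof -
    define h where "h = (T - c) / real (Suc n)"
    have h: "h > 0" using cT by (simp add: h_def)
    have hT: "c + real (Suc n) * h = T" by (simp add: h_def)
    have "\<Phi> c \<le> \<Phi> (c + real m * h) + C * h * (D (c + real m * h) - D c)" if "m \<le> Suc n" for m
      using that
    proof (induction m)
      case (Suc m)
      have le: "c + real (Suc m) * h \<le> T"
      proof -
        have "real (Suc m) * h \<le> real (Suc n) * h" using Suc.prems h by (intro mult_right_mono) auto
        then show ?thesis using hT by linarith
      qed
      have "\<Phi> (c + real m * h) \<le> \<Phi> (c + real (Suc m) * h) + C * h * (D (c + real (Suc m) * h) - D (c + real m * h))"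
        using step[of "c + real m * h" "c + real (Suc m) * h"] le h by (simp add: algebra_simps)
      then show ?case using Suc by (simp add: right_diff_distrib del: of_nat_Suc)
    qed simp
    from this[of "Suc n"] show ?thesis unfolding hT by (simp add: h_def field_simps del: of_nat_Suc)
  qed
  have "(\<lambda>n. \<Phi> T + C * ((T - c) * (D T - D c)) * (1 / real (Suc n))) \<longlonglongrightarrow> \<Phi> T + C * ((T - c) * (D T - D c)) * 0"
    by (intro tendsto_intros LIMSEQ_Suc[OF lim_1_over_n])
  then show ?thesis using bnd by (intro LIMSEQ_le_const) auto
qed

declare One_nat_def [simp del]

lemma subgradient_interval:
  fixes f :: "real \<Rightarrow> real"
  assumes "convex_on {a..b} f"
  obtains D where "\<And>x y. a < x \<Longrightarrow> x < b \<Longrightarrow> a \<le> y \<Longrightarrow> y \<le> b \<Longrightarrow> f x + D x * (y - x) \<le> f y"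
  using convex_le_Inf_differential[OF assms] by (intro that) auto

section \<open>Arc length against area of a cap\<close>

locale planar_body_perimeter = planar_body +
  assumes additive: "hausdorff_additive 1 TYPE(real \<times> real)"
    and finite_perimeter: "hausdorff_outer 1 (frontier K) < \<infinity>"
begin

abbreviation Hm :: "(real \<times> real) measure" where "Hm \<equiv> hausdorff_measure 1"

definition arc where "arc t = measure Hm (frontier K \<inter> upper t)"

lemma Hm_eq: "A \<in> sets borel \<Longrightarrow> emeasure Hm A = hausdorff_outer 1 A"
  by (rule emeasure_hausdorff_measure[OF additive])

lemma frontier_borel [measurable]: "frontier K \<in> sets borel"
  by (intro borel_closed frontier_closed)

lemma Hm_fin: "A \<subseteq> frontier K \<Longrightarrow> A \<in> sets borel \<Longrightarrow> emeasure Hm A < \<infinity>"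
  using finite_perimeter hausdorff_outer_mono[of A "frontier K" 1] by (simp add: Hm_eq)

lemma Hm_segment: "emeasure Hm (closed_segment p q) = ennreal (dist p q)"
  using hausdorff_outer_1_segment[of p q] by (simp add: Hm_eq borel_closed)

text \<open>Permits deleting the vertices of a triangle, so that its sides become disjoint and their
  lengths add up.\<close>

lemma Hm_segment_diff:
  assumes "finite N"
  shows "emeasure Hm (closed_segment p q - N) = ennreal (dist p q)"
proof -
  have "N \<in> null_sets Hm" using assms
  proof (induction N)
    case (insert x N)
    have "{x} \<in> null_sets Hm"
      by (intro null_setsI) (simp_all add: Hm_eq hausdorff_outer_singleton)
    then have "{x} \<union> N \<in> null_sets Hm" using insert by (intro null_sets.Un) auto
    then show ?case by simp
  qed simp
  then show ?thesis
    using Hm_segment[of p q] by (subst emeasure_Diff_null_set) (auto simp: borel_closed)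
qed

lemma emeasure_arc: "emeasure Hm (frontier K \<inter> upper t) = ennreal (arc t)"
  unfolding arc_def by (rule emeasure_eq_ennreal_measure) (use Hm_fin[of "frontier K \<inter> upper t"] in auto)

lemma arc_nonneg: "0 \<le> arc t" by (simp add: arc_def)

text \<open>The triangle with base \<open>P\<close>, \<open>Q\<close> and apex \<open>X\<close> lies
  in the cap above \<open>t\<close>, so its perimeter is at most that of the cap. The boundary of
  the cap is covered by the arc and the chord, and the length of the chord cancels. Strictness of
  \<open>t < snd X\<close> keeps the triangle nondegenerate.\<close>

lemma arc_ge_aux:
  assumes t: "a < t" "t < b" and X: "X \<in> K" "t < snd X"
  shows "dist X (lo t, t) + dist X (hi t, t) \<le> arc t"
proof -
  define P where "P = (lo t, t)"
  define Q where "Q = (hi t, t)"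
  obtain x y where Xxy: "X = (x, y)" by (cases X)
  have y: "t < y" using X Xxy by simp
  have lh: "lo t < hi t" using w_pos[OF t] by (simp add: w_def)
  have PQK: "P \<in> K" "Q \<in> K" using lo_in[of t] hi_in[of t] t by (auto simp: P_def Q_def)
  define C where "C = convex hull {P, Q, X}"
  define Kt where "Kt = K \<inter> upper t"
  have cup: "closed (upper t)" by (intro closed_Collect_le continuous_intros)
  have convup: "convex (upper t)" using convex_halfspace_ge[of t "(0, 1) :: real \<times> real"] by (simp add: inner_prod_def)
  have Kt: "compact Kt" "convex Kt" unfolding Kt_def
    using compact_K cup convex_K convup by (auto intro: compact_Int_closed convex_Int)
  have CKt: "C \<subseteq> Kt" unfolding C_def using PQK X y
    by (intro hull_minimal Kt) (auto simp: Kt_def P_def Q_def Xxy)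
  have compC: "compact C" unfolding C_def by (intro finite_imp_compact_convex_hull) auto
  have m1: "hausdorff_outer 1 (frontier C) \<le> hausdorff_outer 1 (frontier Kt)"
    by (rule hausdorff_outer_frontier_mono) (use compC CKt Kt in \<open>auto simp: C_def compact_imp_closed\<close>)
  \<comment> \<open>A boundary point of the cap that is interior to \<open>K\<close> sits on the
    cutting line, hence on the chord.\<close>
  have fKt: "frontier Kt \<subseteq> (frontier K \<inter> upper t) \<union> closed_segment P Q"
  proof
    fix z assume z: "z \<in> frontier Kt"
    then have zKt: "z \<in> Kt" using Kt(1) frontier_subset_closed compact_imp_closed by blast
    show "z \<in> (frontier K \<inter> upper t) \<union> closed_segment P Q"
    proof (cases "z \<in> frontier K")
      case True then show ?thesis using zKt by (auto simp: Kt_def)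
    next
      case False
      then have zi: "z \<in> interior K" using zKt compact_K
        by (simp add: frontier_def Kt_def compact_imp_closed)
      have "snd z = t"
      proof (rule ccontr)
        assume "snd z \<noteq> t"
        then have "t < snd z" using zKt by (simp add: Kt_def)
        moreover have "open {z::real \<times> real. t < snd z}" by (intro open_Collect_less continuous_intros)
        moreover have "{z::real \<times> real. t < snd z} \<subseteq> upper t" by auto
        ultimately have "z \<in> interior (upper t)" using interior_maximal by blast
        then have "z \<in> interior Kt" using zi by (simp add: Kt_def)
        then show False using z by (simp add: frontier_def)
      qed
      then have "(fst z, t) \<in> K" using zKt by (auto simp: Kt_def)
      then have f: "lo t \<le> fst z" "fst z \<le> hi t" using in_bounds by auto
      define u where "u = (fst z - lo t) / (hi t - lo t)"
      have u: "0 \<le> u" "u \<le> 1" using f lh by (auto simp: u_def)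
      have "u * (hi t - lo t) = fst z - lo t" using lh by (simp add: u_def)
      then have "z = (1 - u) *\<^sub>R P + u *\<^sub>R Q"
        using \<open>snd z = t\<close> by (intro prod_eqI) (auto simp: P_def Q_def algebra_simps)
      then show ?thesis using u by (auto simp: in_segment)
    qed
  qed
  have "emeasure Hm (frontier Kt) \<le> emeasure Hm ((frontier K \<inter> upper t) \<union> closed_segment P Q)"
    using fKt by (intro emeasure_mono) (auto simp: borel_closed)
  also have "\<dots> \<le> emeasure Hm (frontier K \<inter> upper t) + emeasure Hm (closed_segment P Q)"
    by (rule emeasure_subadditive) (auto simp: borel_closed)
  also have "\<dots> = ennreal (arc t) + ennreal (dist P Q)" by (simp add: emeasure_arc Hm_segment)
  finally have m2: "emeasure Hm (frontier C) \<le> ennreal (arc t) + ennreal (dist P Q)"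
    using m1 by (simp add: Hm_eq borel_closed)
  \<comment> \<open>A segment of \<open>C\<close> on a supporting line contains no interior point of
    \<open>C\<close>.\<close>
  have edge: "closed_segment A B \<subseteq> frontier C"
    if AB: "A \<in> C" "B \<in> C" and v: "v \<noteq> 0" "v \<bullet> A = \<beta>" "v \<bullet> B = \<beta>" "v \<bullet> P \<le> \<beta>" "v \<bullet> Q \<le> \<beta>" "v \<bullet> X \<le> \<beta>" for A B v \<beta>
  proof
    fix z assume z: "z \<in> closed_segment A B"
    have "C \<subseteq> {y. v \<bullet> y \<le> \<beta>}"
      unfolding C_def using v by (intro hull_minimal convex_halfspace_le) auto
    moreover have "v \<bullet> z = \<beta>"
    proof -
      obtain u where "z = (1 - u) *\<^sub>R A + u *\<^sub>R B" using z by (auto simp: in_segment)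
      then have "v \<bullet> z = (1 - u) * \<beta> + u * \<beta>" using v by (simp add: inner_add_right)
      then show ?thesis by (simp add: algebra_simps)
    qed
    ultimately have "z \<notin> interior C" using v(1) by (intro not_interior_halfspace) auto
    moreover have "z \<in> C" using z AB closed_segment_subset[of A C B] by (auto simp: C_def)
    ultimately show "z \<in> frontier C" using compC by (simp add: frontier_def compact_imp_closed)
  qed
  have inC: "P \<in> C" "Q \<in> C" "X \<in> C" unfolding C_def by (auto intro: hull_inc)
  have pos: "0 < (y - t) * (hi t - lo t)" using y lh by simp
  \<comment> \<open>The functional is the direction of the side turned by a right angle, pointing
    away from the third vertex; likewise for the other two sides.\<close>
  have e1: "closed_segment P X \<subseteq> frontier C"
    by (rule edge[where v="(t - y, x - lo t)" and \<beta>="(t - y, x - lo t) \<bullet> P"])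
       (use inC y pos in \<open>auto simp: P_def Q_def Xxy zero_prod_def algebra_simps\<close>)
  have e2: "closed_segment X Q \<subseteq> frontier C"
    by (rule edge[where v="(y - t, hi t - x)" and \<beta>="(y - t, hi t - x) \<bullet> Q"])
       (use inC y pos in \<open>auto simp: P_def Q_def Xxy zero_prod_def algebra_simps\<close>)
  have e3: "closed_segment P Q \<subseteq> frontier C"
    by (rule edge[where v="(0, - 1)" and \<beta>="- t"])
       (use inC y in \<open>auto simp: P_def Q_def Xxy zero_prod_def\<close>)
  \<comment> \<open>Each vertex is kept in at most one side, which makes the three sides disjoint
    without changing their lengths.\<close>
  let ?S1 = "closed_segment P X - {}" and ?S2 = "closed_segment X Q - {X}" and ?S3 = "closed_segment P Q - {P, Q}"
  have d12: "?S1 \<inter> ?S2 = {}"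
  proof (rule ccontr)
    assume "?S1 \<inter> ?S2 \<noteq> {}"
    then obtain z where z: "z \<in> closed_segment P X" "z \<in> closed_segment X Q" "z \<noteq> X" by auto
    then obtain u v where u: "0 \<le> u" "u \<le> 1" "z = (1 - u) *\<^sub>R P + u *\<^sub>R X"
      and v: "0 \<le> v" "v \<le> 1" "z = (1 - v) *\<^sub>R X + v *\<^sub>R Q" by (auto simp: in_segment)
    have "(1 - u) * t + u * y = (1 - v) * y + v * t" using u(3) v(3) by (simp add: P_def Q_def Xxy)
    then have "(u + v - 1) * (y - t) = 0" by (simp add: algebra_simps)
    then have v': "v = 1 - u" using y by simp
    have "(1 - u) * lo t + u * x = (1 - v) * x + v * hi t" using u(3) v(3) by (simp add: P_def Q_def Xxy)
    then have "(1 - u) * (hi t - lo t) = 0" by (simp add: v' algebra_simps)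
    then have "u = 1" using lh by simp
    then show False using u(3) z(3) by simp
  qed
  have on_t: "snd z = t" if "z \<in> closed_segment P Q" for z
    using that by (auto simp: in_segment P_def Q_def algebra_simps)
  have d3: "(?S1 \<union> ?S2) \<inter> ?S3 = {}"
  proof (rule ccontr)
    assume "(?S1 \<union> ?S2) \<inter> ?S3 \<noteq> {}"
    then obtain z where z: "z \<in> closed_segment P X \<or> z \<in> closed_segment X Q" "z \<in> closed_segment P Q" "z \<noteq> P" "z \<noteq> Q" by auto
    have zt: "snd z = t" using on_t z by auto
    from z(1) show False
    proof
      assume "z \<in> closed_segment P X"
      then obtain u where u: "z = (1 - u) *\<^sub>R P + u *\<^sub>R X" by (auto simp: in_segment)
      then have "u * (y - t) = 0" using zt by (simp add: P_def Xxy algebra_simps)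
      then show False using y u z(3) by simp
    next
      assume "z \<in> closed_segment X Q"
      then obtain u where u: "z = (1 - u) *\<^sub>R X + u *\<^sub>R Q" by (auto simp: in_segment)
      then have "(1 - u) * (y - t) = 0" using zt by (simp add: Q_def Xxy algebra_simps)
      then show False using y u z(4) by simp
    qed
  qed
  have "ennreal (dist P X) + ennreal (dist X Q) + ennreal (dist P Q) = emeasure Hm ?S1 + emeasure Hm ?S2 + emeasure Hm ?S3"
    by (simp only: Hm_segment_diff finite.emptyI finite.insertI)
  also have "\<dots> = emeasure Hm (?S1 \<union> ?S2) + emeasure Hm ?S3"
    by (subst plus_emeasure) (use d12 in \<open>auto simp: borel_closed\<close>)
  also have "\<dots> = emeasure Hm (?S1 \<union> ?S2 \<union> ?S3)"
    by (subst plus_emeasure) (use d3 in \<open>auto simp: borel_closed\<close>)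
  also have "\<dots> \<le> emeasure Hm (frontier C)"
    using e1 e2 e3 by (intro emeasure_mono) (auto simp: borel_closed)
  finally have "ennreal (dist P X) + ennreal (dist X Q) + ennreal (dist P Q) \<le> emeasure Hm (frontier C)" .
  from order_trans[OF this m2] have "dist P X + dist X Q + dist P Q \<le> arc t + dist P Q"
    using arc_nonneg[of t] by (simp flip: ennreal_plus)
  then show ?thesis by (simp add: P_def Q_def dist_commute)
qed

text \<open>On the level \<open>t\<close> itself the triangle degenerates. Moving \<open>X\<close>
  by a fraction \<open>\<epsilon>\<close> towards a highest point \<open>Z\<close> brings it
  strictly above the level, and \<open>\<epsilon>\<close> tends to \<open>0\<close>.\<close>

lemma arc_ge:
  assumes t: "a < t" "t < b" and X: "X \<in> K" "t \<le> snd X"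
  shows "dist X (lo t, t) + dist X (hi t, t) \<le> arc t"
proof -
  define Z where "Z = (lo b, b)"
  have Z: "Z \<in> K" using lo_in[of b] ab by (simp add: Z_def)
  have step: "dist X (lo t, t) + dist X (hi t, t) \<le> arc t + 2 * dist X Z * (1 / real (Suc n))" for n
  proof -
    define \<epsilon> where "\<epsilon> = 1 / real (Suc n)"
    have e: "0 < \<epsilon>" "\<epsilon> \<le> 1" by (auto simp: \<epsilon>_def)
    define X' where "X' = (1 - \<epsilon>) *\<^sub>R X + \<epsilon> *\<^sub>R Z"
    have "X' \<in> K" unfolding X'_def using convexD[OF convex_K X(1) Z] e by simp
    moreover have "t < snd X'"
    proof -
      have "(1 - \<epsilon>) * t \<le> (1 - \<epsilon>) * snd X" "\<epsilon> * t < \<epsilon> * b" using e X t by (auto intro: mult_left_mono)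
      then show ?thesis by (simp add: X'_def Z_def algebra_simps)
    qed
    ultimately have "dist X' (lo t, t) + dist X' (hi t, t) \<le> arc t" by (rule arc_ge_aux[OF t])
    moreover have "dist X X' = \<epsilon> * dist X Z"
    proof -
      have "X - X' = \<epsilon> *\<^sub>R (X - Z)" by (simp add: X'_def algebra_simps)
      then show ?thesis using e by (simp add: dist_norm)
    qed
    ultimately show ?thesis
      using dist_triangle[of X "(lo t, t)" X'] dist_triangle[of X "(hi t, t)" X'] by (simp add: \<epsilon>_def)
  qed
  have "(\<lambda>n. arc t + 2 * dist X Z * (1 / real (Suc n))) \<longlonglongrightarrow> arc t + 2 * dist X Z * 0"
    by (intro tendsto_intros LIMSEQ_Suc[OF lim_1_over_n])
  then show ?thesis using step by (intro LIMSEQ_le_const) auto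
qed

text \<open>The cap above level \<open>t\<close> lies in the trapezoid cut off by the line through the two left
  endpoints, its parallel through the right endpoint, the chord, and the farthest perpendicular line
  that meets the cap.\<close>

lemma cap_area_le:
  fixes p q :: "real \<Rightarrow> real" and sg :: real
  assumes t: "a < t" "t < b" and st: "s < t" and sg: "sg * sg = 1"
    and pq: "(p t, t) \<in> K" "(q t, t) \<in> K" "{p t, q t} = {lo t, hi t}" and W: "W = sg * (q t - p t)"
    and m: "m = (p t - p s) / (t - s)"
    and left: "\<And>x \<tau>. (x, \<tau>) \<in> K \<Longrightarrow> t \<le> \<tau> \<Longrightarrow> 0 \<le> sg * (x - p t - m * (\<tau> - t))"
    and right: "\<And>x \<tau>. (x, \<tau>) \<in> K \<Longrightarrow> t \<le> \<tau> \<Longrightarrow> sg * (x - q t - m * (\<tau> - t)) \<le> 0"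
  shows "2 * dist (p s, s) (p t, t) * area t \<le> (t - s) * W * arc t"
proof -
  \<comment> \<open>\<open>\<rho>\<close> is the length of \<open>(m, 1)\<close>, \<open>e\<close>
    the unit vector along the line through the endpoints at levels \<open>s\<close> and
    \<open>t\<close>, and \<open>n\<close> its normal. The sign \<open>sg\<close> is
    \<open>1\<close> when \<open>p\<close> is the left side and \<open>- 1\<close> when it is the
    right side, so that \<open>n\<close> points towards the opposite side.\<close>
  define \<rho> where "\<rho> = sqrt (1 + m\<^sup>2)"
  have \<rho>: "\<rho> > 0" "\<rho> * \<rho> = 1 + m\<^sup>2" by (auto simp: \<rho>_def add_pos_nonneg)
  define P where "P = (p t, t)"
  define Q where "Q = (q t, t)"
  define e where "e = (m / \<rho>, 1 / \<rho>)"
  define n where "n = (sg / \<rho>, - sg * m / \<rho>)"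
  define Kt where "Kt = K \<inter> upper t"
  have cup: "closed (upper t)" by (intro closed_Collect_le continuous_intros)
  have Kt: "compact Kt" unfolding Kt_def using compact_K cup by (rule compact_Int_closed)
  have PQ: "P \<in> Kt" "Q \<in> Kt" using pq by (auto simp: P_def Q_def Kt_def)
  have "\<exists>X\<in>Kt. \<forall>z\<in>Kt. e \<bullet> (z - P) \<le> e \<bullet> (X - P)"
    by (rule continuous_attains_sup[OF Kt]) (use PQ in \<open>auto intro!: continuous_intros\<close>)
  then obtain X where X: "X \<in> Kt" "\<And>z. z \<in> Kt \<Longrightarrow> e \<bullet> (z - P) \<le> e \<bullet> (X - P)" by blast
  \<comment> \<open>In the frame \<open>n\<close>, \<open>e\<close> with origin \<open>P\<close> the
    chord is the line of slope \<open>k\<close> over \<open>{0..d}\<close>, and \<open>Y\<close> is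
    the height of the farthest point \<open>X\<close> of the cap.\<close>
  define Y where "Y = e \<bullet> (X - P)"
  define d where "d = W / \<rho>"
  define k where "k = sg * m"
  have m2: "m / \<rho> * (m / \<rho>) + 1 / \<rho> * (1 / \<rho>) = 1"
  proof -
    have "m / \<rho> * (m / \<rho>) + 1 / \<rho> * (1 / \<rho>) = (1 + m\<^sup>2) / (\<rho> * \<rho>)"
      by (simp add: add_divide_distrib power2_eq_square)
    then show ?thesis unfolding \<rho>(2)[symmetric] using \<rho>(1) by simp
  qed
  have orth: "e \<bullet> e = 1" "n \<bullet> n = 1" "e \<bullet> n = 0"
  proof -
    show "e \<bullet> e = 1" using m2 by (simp add: e_def)
    have "n \<bullet> n = (sg * sg) * (m / \<rho> * (m / \<rho>) + 1 / \<rho> * (1 / \<rho>))"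
      by (simp add: n_def algebra_simps)
    then show "n \<bullet> n = 1" by (simp only: m2 sg)  
    show "e \<bullet> n = 0" by (simp add: e_def n_def)
  qed
  have W0: "0 \<le> W" using right[of "p t" t] pq(1) by (simp add: W algebra_simps)
  have d0: "0 \<le> d" using W0 \<rho> by (simp add: d_def)
  have Y0: "0 \<le> Y" using X(2)[OF PQ(1)] by (simp add: Y_def)
  have kd: "k * d = e \<bullet> (Q - P)"
  proof -
    have "k * d = (sg * sg) * m * (q t - p t) / \<rho>" by (simp add: k_def d_def W)
    then show ?thesis by (simp add: sg e_def P_def Q_def)
  qed
  have kdY: "k * d \<le> Y" using X(2)[OF PQ(2)] kd by (simp add: Y_def)
  have ar: "area t \<le> d * (Y - k * d / 2)"
    unfolding area_def
  proof (rule measure_le_trapezoid[OF orth d0 Y0 kdY])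
    show "K \<inter> upper t \<in> sets borel" by simp
    fix z assume "z \<in> K \<inter> upper t"
    then obtain x \<tau> where z: "z = (x, \<tau>)" "(x, \<tau>) \<in> K" "t \<le> \<tau>" by (cases z) auto
    have nz: "n \<bullet> (z - P) = sg * (x - p t - m * (\<tau> - t)) / \<rho>"
      by (simp add: n_def P_def z algebra_simps diff_divide_distrib add_divide_distrib)
    have ez: "e \<bullet> (z - P) = (m * (x - p t) + (\<tau> - t)) / \<rho>"
      by (simp add: e_def P_def z algebra_simps diff_divide_distrib add_divide_distrib)
    \<comment> \<open>In the direction \<open>e\<close> a point of the cap is above the line of the
      chord: the difference of the two sides works out to
      \<open>(1 + m\<^sup>2) * (\<tau> - t) / \<rho>\<close>.\<close>
    have "k * (n \<bullet> (z - P)) = (sg * sg) * (m * (x - p t - m * (\<tau> - t))) / \<rho>"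
      unfolding nz k_def by (simp add: algebra_simps)
    also have "\<dots> = (m * (x - p t) - m\<^sup>2 * (\<tau> - t)) / \<rho>"
      by (simp add: sg algebra_simps power2_eq_square)
    also have "\<dots> \<le> e \<bullet> (z - P)"
    proof -
      have "0 \<le> m\<^sup>2 * (\<tau> - t)" using z(3) by simp
      then have "m * (x - p t) - m\<^sup>2 * (\<tau> - t) \<le> m * (x - p t) + (\<tau> - t)" using z(3) by linarith
      then show ?thesis unfolding ez using \<rho>(1) by (intro divide_right_mono) auto
    qed
    finally have 1: "k * (n \<bullet> (z - P)) \<le> e \<bullet> (z - P)" .
    have 2: "0 \<le> n \<bullet> (z - P)" unfolding nz using left[OF z(2,3)] \<rho> by simp
    have "sg * (x - p t - m * (\<tau> - t)) \<le> W"
      using right[OF z(2,3)] by (simp add: W algebra_simps)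
    then have 3: "n \<bullet> (z - P) \<le> d" unfolding nz d_def using \<rho> by (simp add: divide_right_mono)
    show "0 \<le> n \<bullet> (z - P) \<and> n \<bullet> (z - P) \<le> d \<and> k * (n \<bullet> (z - P)) \<le> e \<bullet> (z - P) \<and> e \<bullet> (z - P) \<le> Y"
      using 1 2 3 X(2)[of z] z by (auto simp: Y_def Kt_def)
  qed
  have ne: "norm e = 1" using orth(1) by (simp add: norm_eq_1)
  have "Y \<le> dist X P" using norm_cauchy_schwarz[of e "X - P"] ne by (simp add: Y_def dist_norm)
  moreover have "Y - k * d \<le> dist X Q"
    using norm_cauchy_schwarz[of e "X - Q"] ne by (simp add: Y_def kd dist_norm inner_diff_right)
  moreover have "dist X P + dist X Q \<le> arc t"
  proof -
    have "dist X P + dist X Q = dist X (lo t, t) + dist X (hi t, t)"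
      using pq(3) by (auto simp: doubleton_eq_iff P_def Q_def)
    then show ?thesis using arc_ge[OF t, of X] X(1) by (simp add: Kt_def)
  qed
  \<comment> \<open>\<open>Y\<close> and \<open>Y - k * d\<close> are the parallel sides of the
    trapezoid. They are bounded by the distances from \<open>X\<close> to the two ends of the chord,
    whose sum is at most the arc.\<close>
  ultimately have "Y + (Y - k * d) \<le> arc t" by linarith
  then have "2 * (Y - k * d / 2) \<le> arc t" by (simp add: algebra_simps)
  then have "d * (2 * (Y - k * d / 2)) \<le> d * arc t" using d0 by (rule mult_left_mono)
  then have A: "2 * area t \<le> d * arc t" using ar by linarith
  have pm: "p t - p s = m * (t - s)" using st m by simp
  have "dist (p s, s) (p t, t) = (t - s) * \<rho>"
  proof -
    have "(p s - p t)\<^sup>2 + (s - t)\<^sup>2 = (1 + m\<^sup>2) * (t - s)\<^sup>2"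
      using pm by (metis add.commute distrib_right mult_1 power2_commute power_mult_distrib)
    then have "dist (p s, s) (p t, t) = sqrt ((1 + m\<^sup>2) * (t - s)\<^sup>2)"
      by (simp add: dist_Pair_Pair dist_real_def)
    then show ?thesis using st by (simp add: real_sqrt_mult \<rho>_def)
  qed
  then have "2 * dist (p s, s) (p t, t) * area t = (t - s) * \<rho> * (2 * area t)" by simp
  also have "\<dots> \<le> (t - s) * \<rho> * (d * arc t)" using A st \<rho> by (intro mult_left_mono) auto
  also have "\<dots> = (t - s) * W * arc t" using \<rho> by (simp add: d_def)
  finally show ?thesis .
qed

end

lemma convex_on_secant_le:
  fixes f :: "real \<Rightarrow> real"
  assumes f: "convex_on {a..b} f" and le: "a \<le> s" "s < t" "t \<le> \<tau>" "\<tau> \<le> b"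
  shows "f t + (f t - f s) / (t - s) * (\<tau> - t) \<le> f \<tau>"
proof -
  define u where "u = (t - s) / (\<tau> - s)"
  have u: "0 \<le> u" "u \<le> 1" "u * (\<tau> - s) = t - s" using le by (auto simp: u_def)
  have "t = (1 - u) * s + u * \<tau>" using u(3) by (simp add: algebra_simps)
  then have "f t \<le> (1 - u) * f s + u * f \<tau>"
    using convex_onD[OF f u(1,2), of s \<tau>] le by simp
  then have "f t * (\<tau> - s) \<le> ((1 - u) * f s + u * f \<tau>) * (\<tau> - s)"
    using le by (intro mult_right_mono) auto
  also have "\<dots> = (\<tau> - s) * f s - (u * (\<tau> - s)) * f s + (u * (\<tau> - s)) * f \<tau>" by (simp add: algebra_simps)
  also have "\<dots> = (\<tau> - t) * f s + (t - s) * f \<tau>" unfolding u(3) by (simp add: algebra_simps)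
  finally have "f t * (t - s) + (f t - f s) * (\<tau> - t) \<le> f \<tau> * (t - s)" by (simp add: algebra_simps)
  then have "(f t * (t - s) + (f t - f s) * (\<tau> - t)) / (t - s) \<le> f \<tau>"
    using le by (simp add: pos_divide_le_eq)
  then show ?thesis using le by (simp add: add_divide_distrib)
qed

context planar_body
begin

text \<open>A widest slice is found as a maximum over the compact set of pairs of points of
  \<open>K\<close> at equal height, so that continuity of \<open>w\<close> at the extreme levels
  need not be discussed.\<close>

lemma w_max_ex: obtains tm where "a \<le> tm" "tm \<le> b" "\<And>t. a \<le> t \<Longrightarrow> t \<le> b \<Longrightarrow> w t \<le> w tm"
proof -
  let ?D = "(K \<times> K) \<inter> {p. snd (fst p) = snd (snd p)}"
  have "compact ?D"
    by (intro compact_Int_closed compact_Times compact_K closed_Collect_eq continuous_intros)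
  moreover obtain z where "z \<in> K" using K_ne by auto
  then have "?D \<noteq> {}" by (auto intro!: exI[of _ "fst z"] exI[of _ "snd z"])
  moreover have "continuous_on ?D (\<lambda>p. fst (snd p) - fst (fst p))" by (intro continuous_intros)
  ultimately have "\<exists>p\<in>?D. \<forall>q\<in>?D. fst (snd q) - fst (fst q) \<le> fst (snd p) - fst (fst p)"
    by (rule continuous_attains_sup)
  then obtain p where p: "p \<in> ?D" "\<And>q. q \<in> ?D \<Longrightarrow> fst (snd q) - fst (fst q) \<le> fst (snd p) - fst (fst p)"
    by blast
  obtain x y t where pe: "p = ((x, t), (y, t))" using p(1) by (cases p) auto
  have tK: "(x, t) \<in> K" "(y, t) \<in> K" using p(1) pe by auto
  have tb: "a \<le> t" "t \<le> b" using snd_bounds[OF tK(1)] by auto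
  have wt: "y - x \<le> w t" using in_bounds[OF tK(1)] in_bounds[OF tK(2)] by (simp add: w_def)
  show ?thesis
  proof (rule that[OF tb])
    fix s assume s: "a \<le> s" "s \<le> b"
    have "((lo s, s), (hi s, s)) \<in> ?D" using lo_in[OF s] hi_in[OF s] by auto
    from p(2)[OF this] show "w s \<le> w t" using wt by (simp add: pe w_def)
  qed
qed

lemma w_decreasing:
  assumes tm: "a \<le> tm" "\<And>t. a \<le> t \<Longrightarrow> t \<le> b \<Longrightarrow> w t \<le> w tm" and st: "tm \<le> s" "s \<le> t" "t \<le> b"
  shows "w t \<le> w s"
proof (cases "tm = t")
  case True then show ?thesis using st by auto
next
  case False
  define u where "u = (s - tm) / (t - tm)"
  have u: "0 \<le> u" "u \<le> 1" "u * (t - tm) = s - tm" using st False by (auto simp: u_def)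
  have "s = (1 - u) * tm + u * t" using u(3) by (simp add: algebra_simps)
  then have "(1 - u) * w tm + u * w t \<le> w s"
    using w_concave[of tm t u] tm st u by auto
  moreover have "(1 - u) * w t \<le> (1 - u) * w tm"
    using tm(2)[of t] tm(1) st u by (intro mult_left_mono) auto
  ultimately show ?thesis by (simp add: algebra_simps)
qed

end

context planar_body_perimeter
begin

text \<open>From level \<open>s\<close> up to below \<open>t\<close> the boundary consists of the
  graphs of \<open>lo\<close> and \<open>hi\<close> only. The graph estimate applies to the convex
  functions \<open>lo\<close> and \<open>- hi\<close>, and \<open>D\<close> is the sum of their
  subgradients.\<close>

lemma arc_step:
  obtains D where "\<And>s t. a < s \<Longrightarrow> s < t \<Longrightarrow> t < b \<Longrightarrow> D s \<le> D t"
    "\<And>s t. a < s \<Longrightarrow> s < t \<Longrightarrow> t < b \<Longrightarrow>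
    arc s \<le> arc t + (dist (lo s, s) (lo t, t) + dist (hi s, s) (hi t, t)) + (t - s) * (D t - D s)"
proof -
  obtain Dl where Dl: "\<And>x y. a < x \<Longrightarrow> x < b \<Longrightarrow> a \<le> y \<Longrightarrow> y \<le> b \<Longrightarrow> lo x + Dl x * (y - x) \<le> lo y"
    using subgradient_interval[OF convex_lo] by blast
  obtain Dh where Dh: "\<And>x y. a < x \<Longrightarrow> x < b \<Longrightarrow> a \<le> y \<Longrightarrow> y \<le> b \<Longrightarrow> - hi x + Dh x * (y - x) \<le> - hi y"
    using subgradient_interval[OF convex_hi] by blast
  show ?thesis
  proof (rule that[of "\<lambda>t. Dl t + Dh t"])
    fix s t assume st: "a < s" "s < t" "t < b"
    have mono: "D s \<le> D t" if "\<And>x y. a < x \<Longrightarrow> x < b \<Longrightarrow> a \<le> y \<Longrightarrow> y \<le> b \<Longrightarrow> f x + D x * (y - x) \<le> f y" for D f :: "real \<Rightarrow> real"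
    proof -
      have "(D s - D t) * (t - s) \<le> 0" using that[of s t] that[of t s] st by (simp add: algebra_simps)
      then show ?thesis using st by (smt (verit) mult_pos_pos)
    qed
    have Dm: "Dl s \<le> Dl t" "Dh s \<le> Dh t" using mono[of lo Dl] mono[of "\<lambda>x. - hi x" Dh] Dl Dh by auto
    then show "Dl s + Dh s \<le> Dl t + Dh t" by simp
    let ?G1 = "(\<lambda>x. (lo x, x)) ` {s..t}" and ?G2 = "(\<lambda>x. (hi x, x)) ` {s..t}"
    have g1: "hausdorff_outer 1 ?G1 \<le> ennreal (dist (lo s, s) (lo t, t) + (t - s) * (Dl t - Dl s))"
      by (rule hausdorff_outer_1_graph_le) (use st Dl in auto)
    have "hausdorff_outer 1 ((\<lambda>x. (- hi x, x)) ` {s..t}) \<le> ennreal (dist (- hi s, s) (- hi t, t) + (t - s) * (Dh t - Dh s))"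
      by (rule hausdorff_outer_1_graph_le[where f="\<lambda>x. - hi x"]) (use st Dh in auto)
    moreover have "dist (- hi s, s) (- hi t, t) = dist (hi s, s) (hi t, t)"
      by (simp add: dist_Pair_Pair dist_real_def abs_minus_commute)
    moreover have "hausdorff_outer 1 ((\<lambda>(x, y). (- x, y)) ` ?G2) = hausdorff_outer 1 ?G2"
      by (rule hausdorff_outer_isometry_image) (auto simp: dist_Pair_Pair dist_real_def abs_minus_commute)
    moreover have "(\<lambda>(x, y). (- x, y)) ` ?G2 = (\<lambda>x. (- hi x, x)) ` {s..t}" by (simp add: image_image)
    ultimately have g2: "hausdorff_outer 1 ?G2 \<le> ennreal (dist (hi s, s) (hi t, t) + (t - s) * (Dh t - Dh s))"
      by simp
    let ?S = "frontier K \<inter> upper s - frontier K \<inter> upper t"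
    have sub: "?S \<subseteq> ?G1 \<union> ?G2"
    proof
      fix z assume "z \<in> ?S"
      then obtain x \<tau> where z: "z = (x, \<tau>)" "(x, \<tau>) \<in> frontier K" "s \<le> \<tau>" "\<tau> < t" by (cases z) auto
      then have "x = lo \<tau> \<or> x = hi \<tau>" using frontier_cases st by auto
      then show "z \<in> ?G1 \<union> ?G2" using z by auto
    qed
    have cG: "compact ((\<lambda>x. (f x, x)) ` {s..t})" if "continuous_on {a<..<b} f" for f :: "real \<Rightarrow> real"
      using st by (intro compact_continuous_image continuous_intros continuous_on_subset[OF that]) auto
    have cl: "continuous_on {a<..<b} lo"
      by (rule convex_on_continuous) (use convex_lo in \<open>auto intro: convex_on_subset\<close>)
    have "continuous_on {a<..<b} (\<lambda>t. - hi t)"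
      by (rule convex_on_continuous) (use convex_hi in \<open>auto intro: convex_on_subset\<close>)
    from continuous_on_minus[OF this] have ch: "continuous_on {a<..<b} hi" by simp
    have b1: "?G1 \<in> sets borel" "?G2 \<in> sets borel"
      using cG[OF cl] cG[OF ch] by (auto intro: borel_compact)
    have "emeasure Hm ?S \<le> emeasure Hm (?G1 \<union> ?G2)" using sub b1 by (intro emeasure_mono) auto
    also have "\<dots> \<le> emeasure Hm ?G1 + emeasure Hm ?G2" using b1 by (intro emeasure_subadditive) auto
    also have "\<dots> \<le> ennreal (dist (lo s, s) (lo t, t) + (t - s) * (Dl t - Dl s)) + ennreal (dist (hi s, s) (hi t, t) + (t - s) * (Dh t - Dh s))"
      using g1 g2 b1 by (intro add_mono) (simp_all add: Hm_eq)
    also have "\<dots> = ennreal (dist (lo s, s) (lo t, t) + (t - s) * (Dl t - Dl s) + (dist (hi s, s) (hi t, t) + (t - s) * (Dh t - Dh s)))"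
      using Dm st by (simp flip: ennreal_plus)
    finally have S: "emeasure Hm ?S \<le> ennreal (dist (lo s, s) (lo t, t) + (t - s) * (Dl t - Dl s) + (dist (hi s, s) (hi t, t) + (t - s) * (Dh t - Dh s)))" .
    have "emeasure Hm (frontier K \<inter> upper s) \<le> emeasure Hm (frontier K \<inter> upper t \<union> ?S)"
      by (intro emeasure_mono) auto
    also have "\<dots> \<le> emeasure Hm (frontier K \<inter> upper t) + emeasure Hm ?S"
      by (intro emeasure_subadditive) auto
    also have "\<dots> \<le> ennreal (arc t) + ennreal (dist (lo s, s) (lo t, t) + (t - s) * (Dl t - Dl s) + (dist (hi s, s) (hi t, t) + (t - s) * (Dh t - Dh s)))"
      using S by (simp add: emeasure_arc add_left_mono)
    also have "\<dots> = ennreal (arc t + (dist (lo s, s) (lo t, t) + (t - s) * (Dl t - Dl s) + (dist (hi s, s) (hi t, t) + (t - s) * (Dh t - Dh s))))"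
      using Dm st arc_nonneg by (simp flip: ennreal_plus)
    finally have "arc s \<le> arc t + (dist (lo s, s) (lo t, t) + (t - s) * (Dl t - Dl s) + (dist (hi s, s) (hi t, t) + (t - s) * (Dh t - Dh s)))"
      unfolding emeasure_arc using Dm st arc_nonneg[of t] by (subst (asm) ennreal_le_iff) auto
    then show "arc s \<le> arc t + (dist (lo s, s) (lo t, t) + dist (hi s, s) (hi t, t)) + (t - s) * ((Dl t + Dh t) - (Dl s + Dh s))"
      by (simp add: algebra_simps)
  qed
qed

text \<open>The cap estimate is used for the left and for the right side and the results are
  averaged. Since the width does not grow from \<open>s\<close> to \<open>t\<close>, the secants do
  not diverge upwards; hence beyond \<open>t\<close> the body stays inside the parallel to one
  secant through the endpoint of the other.\<close>

lemma secants_area_le: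
  assumes st: "a \<le> s" "s < t" "a < t" "t < b" and w: "w t \<le> w s"
  shows "(dist (lo s, s) (lo t, t) + dist (hi s, s) (hi t, t)) * area t \<le> (t - s) * w t * arc t"
proof -
  define m where "m = (lo t - lo s) / (t - s)"
  define m' where "m' = (hi t - hi s) / (t - s)"
  have "m' - m = (w t - w s) / (t - s)" by (simp add: m_def m'_def w_def diff_divide_distrib)
  also have "\<dots> \<le> 0" using w st by (simp add: divide_nonpos_pos)
  finally have mm: "m' \<le> m" by simp
  have L: "lo t + m * (\<tau> - t) \<le> x" "x \<le> hi t + m' * (\<tau> - t)" "m' * (\<tau> - t) \<le> m * (\<tau> - t)" if "(x, \<tau>) \<in> K" "t \<le> \<tau>" for x \<tau>
  proof -
    have tb: "\<tau> \<le> b" using snd_bounds[OF that(1)] by simp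
    show "lo t + m * (\<tau> - t) \<le> x"
      using convex_on_secant_le[OF convex_lo st(1,2) that(2) tb] in_bounds[OF that(1)] by (simp add: m_def)
    have "- hi t + (- hi t - (- hi s)) / (t - s) * (\<tau> - t) \<le> - hi \<tau>"
      using convex_on_secant_le[OF convex_hi st(1,2) that(2) tb] by simp
    moreover have mm': "(- hi t - (- hi s)) / (t - s) = - m'" by (simp add: m'_def diff_divide_distrib)
    ultimately have "- hi t + - m' * (\<tau> - t) \<le> - hi \<tau>" by (simp only: mm')
    then show "x \<le> hi t + m' * (\<tau> - t)" using in_bounds[OF that(1)] by simp
    show "m' * (\<tau> - t) \<le> m * (\<tau> - t)" using mm that by (intro mult_right_mono) auto
  qed
  have K: "(lo t, t) \<in> K" "(hi t, t) \<in> K" using lo_in hi_in st by auto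
  have "2 * dist (lo s, s) (lo t, t) * area t \<le> (t - s) * w t * arc t"
    by (rule cap_area_le[of t s 1 lo hi _ m]) (use st K m_def L in \<open>force simp: w_def\<close>)+
  moreover have "2 * dist (hi s, s) (hi t, t) * area t \<le> (t - s) * w t * arc t"
    by (rule cap_area_le[of t s "-1" hi lo _ m']) (use st K m'_def L in \<open>force simp: w_def\<close>)+
  ultimately show ?thesis by (simp add: algebra_simps)
qed

lemma area_pos:
  assumes "a \<le> t" "t < b" "\<And>x y. c0 \<le> x \<Longrightarrow> x \<le> y \<Longrightarrow> y \<le> b \<Longrightarrow> w y \<le> w x" "c0 \<le> t"
  shows "0 < area t"
proof -
  define t' where "t' = (t + b) / 2"
  have t': "t < t'" "t' < b" using assms by (auto simp: t'_def)
  have "(t' - t) * w t' \<le> area t - area t'"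
    by (rule area_step) (use assms t' w_nonneg in auto)
  moreover have "0 < (t' - t) * w t'" using t' w_pos[of t'] assms by simp
  moreover have "0 \<le> area t'" by (simp add: area_def)
  ultimately show ?thesis by linarith
qed

text \<open>The growth of \<open>arc\<close> from \<open>t\<close> down to \<open>s\<close> is
  bounded by the secants, the secants by the width at \<open>t\<close>, and the width by the growth
  of \<open>area\<close>. Together these say that \<open>arc / area\<close> does not fall from
  \<open>s\<close> to \<open>t\<close>, up to an error that telescopes away.\<close>

lemma arc_area_ratio:
  assumes w: "\<And>x y. c0 \<le> x \<Longrightarrow> x \<le> y \<Longrightarrow> y \<le> b \<Longrightarrow> w y \<le> w x"
    and c: "c0 \<le> c" "a < c" "c < T" "T < b"
  shows "arc c * area T \<le> arc T * area c"
proof -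
  obtain D where Dmono: "\<And>s t. a < s \<Longrightarrow> s < t \<Longrightarrow> t < b \<Longrightarrow> D s \<le> D t"
    and D: "\<And>s t. a < s \<Longrightarrow> s < t \<Longrightarrow> t < b \<Longrightarrow>
    arc s \<le> arc t + (dist (lo s, s) (lo t, t) + dist (hi s, s) (hi t, t)) + (t - s) * (D t - D s)"
    using arc_step by blast
  have pos: "0 < area t" if "c \<le> t" "t < b" for t
    by (rule area_pos[of _ c0]) (use w c that in auto)
  have "arc c / area c \<le> arc T / area T"
  proof (rule telescoping_error_vanishes[where \<Phi>="\<lambda>t. arc t / area t" and c=c and T=T and D=D and C="1 / area T"])
    show "c < T" by fact
    show "0 \<le> 1 / area T" using pos[of T] c by simp
    fix s t assume st: "c \<le> s" "s < t" "t \<le> T"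
    let ?sec = "dist (lo s, s) (lo t, t) + dist (hi s, s) (hi t, t)"
    have p: "0 < area s" "0 < area t" "area T \<le> area s" using pos[of s] pos[of t] st c by (auto intro: area_mono)
    have "(t - s) * w t \<le> area s - area t"
      by (rule area_step) (use st c w w_nonneg in auto)
    then have "(t - s) * w t * arc t \<le> (area s - area t) * arc t" by (rule mult_right_mono[OF _ arc_nonneg])
    then have "?sec * area t \<le> (area s - area t) * arc t"
      using secants_area_le[of s t] st c w[of s t] by (auto intro: order_trans)
    moreover have "arc s * area t \<le> (arc t + ?sec + (t - s) * (D t - D s)) * area t"
      using D[of s t] st c p by (intro mult_right_mono) auto
    ultimately have "arc s * area t \<le> arc t * area s + (t - s) * (D t - D s) * area t"
      by (simp add: algebra_simps)
    then have "arc s * area t / (area s * area t) \<le> (arc t * area s + (t - s) * (D t - D s) * area t) / (area s * area t)"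
      using p by (intro divide_right_mono) auto
    then have "arc s / area s \<le> arc t / area t + (t - s) * (D t - D s) / area s"
      using p by (simp add: add_divide_distrib)
    \<comment> \<open>\<open>area\<close> decreases with the level, so \<open>area T\<close> yields
      one constant for all \<open>s\<close>.\<close>
    also have "(t - s) * (D t - D s) / area s \<le> (t - s) * (D t - D s) / area T"
      using p pos[of T] c st Dmono[of s t] by (intro divide_left_mono mult_nonneg_nonneg) auto
    finally show "arc s / area s \<le> arc t / area t + 1 / area T * (t - s) * (D t - D s)" by simp
  qed
  then show ?thesis using pos[of c] pos[of T] c by (simp add: field_simps)
qed

end

section \<open>Tail integrals and the single crossing\<close>

text \<open>Layer cake: \<open>ennreal (f x - c)\<close> is the length of \<open>{c..f x}\<close>,
  which is \<open>0\<close> for \<open>f x < c\<close>, and the integrals are exchanged.\<close>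

lemma nn_integral_upper_tail:
  fixes f :: "'b \<Rightarrow> real"
  assumes "sigma_finite_measure N" and f[measurable]: "f \<in> borel_measurable N"
  shows "(\<integral>\<^sup>+x. ennreal (f x - c) \<partial>N) = (\<integral>\<^sup>+t. emeasure N {x \<in> space N. t \<le> f x} * indicator {c..} t \<partial>lborel)"
proof -
  interpret N: sigma_finite_measure N by fact
  interpret pair_sigma_finite N lborel by unfold_locales
  have "(\<integral>\<^sup>+x. ennreal (f x - c) \<partial>N) = (\<integral>\<^sup>+x. (\<integral>\<^sup>+t. (if t \<le> f x then 1 else 0) * indicator {c..} t \<partial>lborel) \<partial>N)"
  proof (rule nn_integral_cong)
    fix x
    have "ennreal (f x - c) = emeasure lborel {c..f x}" by (cases "c \<le> f x") (auto simp: ennreal_neg)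
    also have "\<dots> = (\<integral>\<^sup>+t. indicator {c..f x} t \<partial>lborel)" by simp
    also have "\<dots> = (\<integral>\<^sup>+t. (if t \<le> f x then 1 else 0) * indicator {c..} t \<partial>lborel)"
      by (intro nn_integral_cong) (auto simp: indicator_def)
    finally show "ennreal (f x - c) = (\<integral>\<^sup>+t. (if t \<le> f x then 1 else 0) * indicator {c..} t \<partial>lborel)" .
  qed
  also have "\<dots> = (\<integral>\<^sup>+t. (\<integral>\<^sup>+x. (if t \<le> f x then 1 else 0) * indicator {c..} t \<partial>N) \<partial>lborel)"
    by (rule Fubini'[symmetric]) measurable
  also have "\<dots> = (\<integral>\<^sup>+t. emeasure N {x \<in> space N. t \<le> f x} * indicator {c..} t \<partial>lborel)"
  proof (rule nn_integral_cong)
    fix t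
    have "(\<integral>\<^sup>+x. (if t \<le> f x then 1 else 0) * indicator {c..} t \<partial>N) = (\<integral>\<^sup>+x. indicator {x \<in> space N. t \<le> f x} x * indicator {c..} t \<partial>N)"
      by (intro nn_integral_cong) (auto simp: indicator_def)
    also have "\<dots> = emeasure N {x \<in> space N. t \<le> f x} * indicator {c..} t"
      by (subst nn_integral_multc) auto
    finally show "(\<integral>\<^sup>+x. (if t \<le> f x then 1 else 0) * indicator {c..} t \<partial>N) = emeasure N {x \<in> space N. t \<le> f x} * indicator {c..} t" .
  qed
  finally show ?thesis .
qed

lemma integral_pos_part_eq:
  fixes f :: "'b \<Rightarrow> real"
  assumes [measurable]: "f \<in> borel_measurable N"
  shows "(\<integral>x. max 0 (f x) \<partial>N) = enn2real (\<integral>\<^sup>+x. ennreal (f x) \<partial>N)"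
  by (subst integral_eq_nn_integral) (auto simp: ennreal_max_0)

context planar_body_perimeter
begin

definition per where "per = measure Hm (frontier K)"
definition ar where "ar = measure lborel K"

lemma measure_Diff_upper:
  "measure Hm (frontier K - upper t) = per - arc t" "measure lborel (K - upper t) = ar - area t"
proof -
  have "frontier K - upper t = frontier K - frontier K \<inter> upper t" "K - upper t = K - K \<inter> upper t" by auto
  then show "measure Hm (frontier K - upper t) = per - arc t" "measure lborel (K - upper t) = ar - area t"
    unfolding per_def arc_def ar_def area_def using Hm_fin[of "frontier K"] emeasure_K_fin[of K]
    by (auto intro!: measure_Diff)
qed

lemma reflected: "planar_body_perimeter ((\<lambda>z. (fst z, - snd z)) ` K)" (is "planar_body_perimeter (?R ` K)")
proof -
  have lin: "linear ?R" by (intro linearI) auto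
  have inv: "?R (?R z) = z" for z by simp
  have inj: "inj ?R" by (intro injI) (metis inv)
  show ?thesis
  proof
    show "compact (?R ` K)" by (intro compact_continuous_image continuous_intros compact_K)
    show "convex (?R ` K)" by (rule convex_linear_image[OF lin convex_K])
    show "interior (?R ` K) \<noteq> {}"
      using interior_injective_linear_image[OF lin inj, of K] interior_K by simp
    show "hausdorff_additive 1 TYPE(real \<times> real)" by (rule additive)
    have "frontier (?R ` K) = ?R ` frontier K"
      unfolding frontier_def using interior_injective_linear_image[OF lin inj, of K] closure_injective_linear_image[OF lin inj, of K]
      by (simp add: image_set_diff[OF inj])
    then show "hausdorff_outer 1 (frontier (?R ` K)) < \<infinity>"
      using finite_perimeter hausdorff_outer_isometry_image[of "frontier K" ?R 1]
      by (simp add: dist_prod_def dist_real_def abs_minus_commute)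
  qed
qed

text \<open>A level strictly between \<open>a\<close> and \<open>b\<close> meets the boundary in at
  most two points and the body in a segment. Both are null, so the closed lower part has the measure
  of the complement of \<open>upper t\<close>.\<close>

lemma level_null:
  assumes "a < t" "t < b"
  shows "measure Hm (frontier K \<inter> {z. snd z \<le> t}) = per - arc t" "measure lborel (K \<inter> {z. snd z \<le> t}) = ar - area t"
proof -
  have cl: "closed {z::real \<times> real. snd z \<le> t}" by (intro closed_Collect_le continuous_intros)
  have "frontier K \<inter> {z. snd z \<le> t} \<subseteq> (frontier K - upper t) \<union> {(lo t, t), (hi t, t)}"
    using frontier_cases[OF _ assms] by force
  moreover have "{(lo t, t), (hi t, t)} \<in> null_sets Hm"
    using null_sets.Un[of "{(lo t, t)}" Hm "{(hi t, t)}"]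
    by (simp add: null_sets_def Hm_eq hausdorff_outer_singleton insert_commute)
  ultimately have "emeasure Hm (frontier K \<inter> {z. snd z \<le> t}) \<le> emeasure Hm (frontier K - upper t)"
    using emeasure_Un_null_set[of "frontier K - upper t" Hm] 
    by (metis (no_types, lifting) emeasure_mono frontier_borel null_setsD2 sets.Diff sets.Un sets_hausdorff_measure upper_borel)
  moreover have "emeasure Hm (frontier K - upper t) \<le> emeasure Hm (frontier K \<inter> {z. snd z \<le> t})"
    using cl by (intro emeasure_mono) (auto simp: borel_closed)
  ultimately have "emeasure Hm (frontier K \<inter> {z. snd z \<le> t}) = emeasure Hm (frontier K - upper t)" by simp
  then show "measure Hm (frontier K \<inter> {z. snd z \<le> t}) = per - arc t"
    using measure_Diff_upper(1)[of t] by (simp add: measure_def)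
  have "{z::real \<times> real. snd z = t} = {z. (0, 1) \<bullet> z = t}" by (auto simp: inner_prod_def)
  then have "negligible {z::real \<times> real. snd z = t}"
    using negligible_hyperplane[of "(0, 1) :: real \<times> real" t] by (simp add: zero_prod_def)
  moreover have cleq: "closed {z::real \<times> real. snd z = t}" by (intro closed_Collect_eq continuous_intros)
  ultimately have n: "{z::real \<times> real. snd z = t} \<in> null_sets lborel"
    by (simp add: negligible_iff_null_sets null_sets_completion_iff borel_closed)
  have "emeasure lborel (K \<inter> {z. snd z \<le> t}) \<le> emeasure lborel ((K - upper t) \<union> {z. snd z = t})"
    using cleq by (intro emeasure_mono) (auto simp: borel_closed)
  also have "\<dots> = emeasure lborel (K - upper t)" by (rule emeasure_Un_null_set) (use n in auto)
  finally have "emeasure lborel (K \<inter> {z. snd z \<le> t}) \<le> emeasure lborel (K - upper t)" .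
  moreover have "emeasure lborel (K - upper t) \<le> emeasure lborel (K \<inter> {z. snd z \<le> t})"
    using cl by (intro emeasure_mono) (auto simp: borel_closed)
  ultimately have "emeasure lborel (K \<inter> {z. snd z \<le> t}) = emeasure lborel (K - upper t)" by simp
  then show "measure lborel (K \<inter> {z. snd z \<le> t}) = ar - area t"
    using measure_Diff_upper(2)[of t] by (simp add: measure_def)
qed

text \<open>A reflection in a horizontal line turns the part below a level into a cap, to which the
  ratio estimate applies on the levels where \<open>w\<close> increases.\<close>

lemma lower_arc_area_ratio:
  assumes w: "\<And>x y. a \<le> x \<Longrightarrow> x \<le> y \<Longrightarrow> y \<le> c0 \<Longrightarrow> w x \<le> w y"
    and c: "a < c" "c < T" "T \<le> c0" "T < b" "c0 \<le> b"
  shows "(per - arc T) * (ar - area c) \<le> (per - arc c) * (ar - area T)" "0 < ar - area c"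
proof -
  let ?R = "\<lambda>z::real \<times> real. (fst z, - snd z)"
  interpret R: planar_body_perimeter "?R ` K" by (rule reflected)
  have lin: "linear ?R" by (intro linearI) auto
  have inj: "inj ?R" by (intro injI) (auto simp: prod_eq_iff)
  have mem: "(x, t) \<in> ?R ` K \<longleftrightarrow> (x, - t) \<in> K" for x t by force
  have loR: "R.lo t = lo (- t)" "R.hi t = hi (- t)" for t
    unfolding R.lo_def R.hi_def lo_def hi_def mem by auto
  have wR: "R.w t = w (- t)" for t by (simp add: R.w_def w_def loR)
  have "snd ` ?R ` K = uminus ` snd ` K" by force
  then have "{R.a..R.b} = {- b..- a}" unfolding R.snd_image snd_image by simp
  then have abR: "R.a = - b" "R.b = - a" using ab R.ab by (auto simp: Icc_eq_Icc)
  have fr: "frontier (?R ` K) = ?R ` frontier K"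
    unfolding frontier_def using interior_injective_linear_image[OF lin inj, of K] closure_injective_linear_image[OF lin inj, of K]
    by (simp add: image_set_diff[OF inj])
  have bij: "bij ?R" using inj lin linear_injective_imp_surjective by (auto simp: bij_def)
  have cl: "closed {z::real \<times> real. snd z \<le> t}" "closed {z::real \<times> real. t \<le> snd z}" for t
    by (intro closed_Collect_le continuous_intros)+
  have arcR: "R.arc (- t) = per - arc t" if "a < t" "t < b" for t
  proof -
    have "frontier (?R ` K) \<inter> R.upper (- t) = ?R ` (frontier K \<inter> {z. snd z \<le> t})" by (auto simp: fr)
    moreover have "hausdorff_outer 1 (?R ` (frontier K \<inter> {z. snd z \<le> t})) = hausdorff_outer 1 (frontier K \<inter> {z. snd z \<le> t})"
      by (rule hausdorff_outer_isometry_image) (simp add: dist_prod_def dist_real_def abs_minus_commute)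
    ultimately have "emeasure Hm (frontier (?R ` K) \<inter> R.upper (- t)) = emeasure Hm (frontier K \<inter> {z. snd z \<le> t})"
    proof (subst (1 2) Hm_eq)
      show "frontier (?R ` K) \<inter> R.upper (- t) \<in> sets borel" "frontier K \<inter> {z. snd z \<le> t} \<in> sets borel"
        using cl by (auto simp: borel_closed)
    qed simp
    then show ?thesis using level_null(1)[OF that] by (simp add: R.arc_def measure_def)
  qed
  have areaR: "R.area (- t) = ar - area t" if "a < t" "t < b" for t
  proof -
    have "distr lborel borel ?R = (lborel :: (real \<times> real) measure)"
      by (rule lborel_distr_isometry[OF lin bij]) (auto simp: norm_prod_def)
    then have "emeasure lborel (?R ` K \<inter> R.upper (- t)) = emeasure (distr lborel borel ?R) (?R ` K \<inter> R.upper (- t))" by simp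
    also have "\<dots> = emeasure lborel (?R -` (?R ` K \<inter> R.upper (- t)))"
      by (subst emeasure_distr) (auto intro!: borel_measurable_continuous_onI continuous_intros)
    also have "?R -` (?R ` K \<inter> R.upper (- t)) = K \<inter> {z. snd z \<le> t}" by force
    finally show ?thesis using level_null(2)[OF that] by (simp add: R.area_def measure_def)
  qed
  have wdec: "R.w y \<le> R.w x" if "- c0 \<le> x" "x \<le> y" "y \<le> R.b" for x y
    unfolding wR using w[of "- y" "- x"] that abR by auto
  show "(per - arc T) * (ar - area c) \<le> (per - arc c) * (ar - area T)"
    using R.arc_area_ratio[of "- c0" "- T" "- c"] wdec c abR arcR areaR by auto
  show "0 < ar - area c"
    using R.area_pos[of "- c" "- c0"] wdec c abR areaR[of c] by auto
qed

text \<open>The inequalities are \<open>area / ar \<le> arc / per\<close> with the denominators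
  cleared. Above the widest level \<open>tm\<close> the ratio of \<open>arc\<close> to
  \<open>area\<close> grows; below it the ratio of the complements falls; either preserves the
  inequality when the level rises. Levels on both sides of \<open>tm\<close> are joined through
  \<open>tm\<close>.\<close>

lemma crossing_upward:
  assumes ct: "a < c" "c < T" "T < b" and Z: "area c * per \<le> arc c * ar"
  shows "area T * per \<le> arc T * ar"
proof -
  obtain tm where tm: "a \<le> tm" "tm \<le> b" "\<And>t. a \<le> t \<Longrightarrow> t \<le> b \<Longrightarrow> w t \<le> w tm" using w_max_ex by blast
  have dec: "w y \<le> w x" if "tm \<le> x" "x \<le> y" "y \<le> b" for x y
    using w_decreasing[OF tm(1,3) that] by blast
  have inc: "w x \<le> w y" if "a \<le> x" "x \<le> y" "y \<le> tm" for x y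
  proof (cases "x = tm")
    case True then show ?thesis using that by auto
  next
    case False
    define u where "u = (tm - y) / (tm - x)"
    have u: "0 \<le> u" "u \<le> 1" "u * (tm - x) = tm - y" using that False by (auto simp: u_def)
    have "y = (1 - u) * tm + u * x" using u(3) by (simp add: algebra_simps)
    then have "(1 - u) * w tm + u * w x \<le> w y" using w_concave[of tm x u] tm that u by auto
    moreover have "(1 - u) * w x \<le> (1 - u) * w tm"
      using tm(3)[of x] tm(2) that u by (intro mult_left_mono) auto
    ultimately show ?thesis by (simp add: algebra_simps)
  qed
  have nn: "0 \<le> per" "0 \<le> ar" by (auto simp: per_def ar_def)
  have up: "area T * per \<le> arc T * ar" if "tm \<le> c" "a < c" "c < T" "T < b" "area c * per \<le> arc c * ar" for c T
  proof -
    have pos: "0 < area c" by (rule area_pos[of _ tm]) (use that dec in auto)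
    have "area T * per * area c \<le> area T * (arc c * ar)"
      using mult_left_mono[OF that(5), of "area T"] by (simp add: mult_ac area_def)
    also have "\<dots> = (arc c * area T) * ar" by simp
    also have "\<dots> \<le> (arc T * area c) * ar"
      using arc_area_ratio[of tm c T] dec that nn by (intro mult_right_mono) auto
    finally have "(area T * per) * area c \<le> (arc T * ar) * area c" by (simp add: mult_ac)
    then show ?thesis using pos by simp
  qed
  have low: "area T * per \<le> arc T * ar" if "a < c" "c < T" "T \<le> tm" "T < b" "area c * per \<le> arc c * ar" for c T
  proof -
    note r = lower_arc_area_ratio[of tm c T, OF inc that(1-4) tm(2)]
    have "(per - arc c) * ar \<le> (ar - area c) * per" using that(5) by (simp add: algebra_simps)
    moreover have "0 \<le> ar - area T" using measure_Diff_upper(2)[of T] by (metis measure_nonneg)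
    ultimately have "(ar - area T) * ((per - arc c) * ar) \<le> (ar - area T) * ((ar - area c) * per)"
      by (rule mult_left_mono)
    moreover have "(per - arc T) * (ar - area c) * ar \<le> (per - arc c) * (ar - area T) * ar"
      using r(1) nn by (intro mult_right_mono) auto
    ultimately have "((per - arc T) * ar) * (ar - area c) \<le> ((ar - area T) * per) * (ar - area c)"
      by (simp add: mult_ac)
    then have "(per - arc T) * ar \<le> (ar - area T) * per" using r(2) by simp
    then show ?thesis by (simp add: algebra_simps)
  qed
  show ?thesis
  proof (cases "tm \<le> c")
    case True then show ?thesis using up ct Z by blast
  next
    case c: False
    show ?thesis
    proof (cases "T \<le> tm")
      case True then show ?thesis using low ct Z by blast
    next
      case False
      then have "area tm * per \<le> arc tm * ar" using low[of c tm] ct Z c by auto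
      then show ?thesis using up[of tm T] False c ct by auto
    qed
  qed
qed

lemma per_pos: "0 < per" "0 < ar"
proof -
  obtain t where t: "a < t" "t < b" "0 < w t" using w_pos_ex by blast
  have "w t = dist (lo t, t) (hi t, t)" using t by (simp add: w_def dist_Pair_Pair dist_real_def)
  also have "\<dots> \<le> arc t" using arc_ge[OF t(1,2), of "(lo t, t)"] lo_in[of t] t by simp
  also have "arc t \<le> per" unfolding arc_def per_def using Hm_fin[of "frontier K"]
    by (intro measure_mono_fmeasurable) (auto simp: fmeasurable_def)
  finally show "0 < per" using t by simp
  obtain z where "z \<in> interior K" using interior_K by auto
  then obtain e where "0 < e" "cball z e \<subseteq> K" by (auto simp: mem_interior_cball)
  then have "0 < measure lborel (ball z e)" "ball z e \<subseteq> K" using ball_subset_cball by auto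
  moreover have "measure lborel (ball z e) \<le> ar"
    unfolding ar_def by (rule measure_mono_fmeasurable[OF calculation(2)]) (auto intro: fmeas)
  ultimately show "0 < ar" by linarith
qed

lemma emeasure_uniform_upper:
  "emeasure (uniform_measure Hm (frontier K)) (upper t) = ennreal (arc t / per)"
  "emeasure (uniform_measure lborel K) (upper t) = ennreal (area t / ar)"
  "emeasure (uniform_measure Hm (frontier K)) (- upper t) = ennreal ((per - arc t) / per)"
  "emeasure (uniform_measure lborel K) (- upper t) = ennreal ((ar - area t) / ar)"
proof -
  have e: "emeasure Hm (frontier K) = ennreal per" "emeasure lborel K = ennreal ar"
    using Hm_fin[of "frontier K"] emeasure_K_fin[of K]
    by (auto simp: per_def ar_def emeasure_eq_ennreal_measure)
  have "emeasure Hm (frontier K \<inter> - upper t) = ennreal (per - arc t)"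
    using Hm_fin[of "frontier K - upper t"] measure_Diff_upper(1)[of t]
    by (simp add: emeasure_eq_ennreal_measure Diff_eq[symmetric])
  moreover have "emeasure lborel (K \<inter> - upper t) = ennreal (ar - area t)"
    using emeasure_K_fin[of "K - upper t"] measure_Diff_upper(2)[of t]
    by (simp add: emeasure_eq_ennreal_measure Diff_eq[symmetric])
  moreover have "emeasure lborel (K \<inter> upper t) = ennreal (area t)"
    using emeasure_K_fin[of "K \<inter> upper t"] by (simp add: emeasure_eq_ennreal_measure area_def)
  moreover have "0 \<le> per - arc t" "0 \<le> ar - area t" using measure_Diff_upper[of t] by (metis measure_nonneg)+
  moreover have "- upper t \<in> sets borel" by (simp add: borel_comp)
  ultimately show
    "emeasure (uniform_measure Hm (frontier K)) (upper t) = ennreal (arc t / per)"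
    "emeasure (uniform_measure lborel K) (upper t) = ennreal (area t / ar)"
    "emeasure (uniform_measure Hm (frontier K)) (- upper t) = ennreal ((per - arc t) / per)"
    "emeasure (uniform_measure lborel K) (- upper t) = ennreal ((ar - area t) / ar)"
    using per_pos by (simp_all add: emeasure_arc e divide_ennreal arc_nonneg area_def)
qed

end

lemma integrable_continuous_compact_support:
  fixes f :: "'a::euclidean_space \<Rightarrow> 'b::euclidean_space"
  assumes "finite_measure N" and s: "sets N = sets borel" and ae: "AE x in N. x \<in> K"
    and K: "compact K" and f: "continuous_on UNIV f"
  shows "integrable N f"
proof -
  interpret finite_measure N by fact
  have "bounded (f ` K)"
    using K f by (intro compact_imp_bounded compact_continuous_image continuous_on_subset[OF f]) auto
  then obtain B where B: "\<And>x. x \<in> K \<Longrightarrow> norm (f x) \<le> B" by (auto simp: bounded_iff)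
  have "f \<in> borel_measurable N"
    using borel_measurable_continuous_onI[OF f] s by (simp cong: measurable_cong_sets)
  moreover have "AE x in N. norm (f x) \<le> B" using ae by eventually_elim (rule B)
  ultimately show ?thesis by (rule integrable_const_bound[rotated])
qed

lemma distr_uniform_measure:
  assumes f[measurable]: "f \<in> M \<rightarrow>\<^sub>M L" and d: "distr M L f = N" and A: "A \<in> sets L"
  shows "distr (uniform_measure M (f -` A \<inter> space M)) L f = uniform_measure N A"
proof (rule measure_eqI)
  show "sets (distr (uniform_measure M (f -` A \<inter> space M)) L f) = sets (uniform_measure N A)"
    by (simp add: d[symmetric])
  fix B assume "B \<in> sets (distr (uniform_measure M (f -` A \<inter> space M)) L f)"
  then have B: "B \<in> sets L" by simp
  have sN: "sets N = sets L" by (simp add: d[symmetric])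
  have e: "emeasure N X = emeasure M (f -` X \<inter> space M)" if "X \<in> sets L" for X
    using that by (subst d[symmetric]) (simp add: emeasure_distr)
  have "(f -` A \<inter> space M) \<inter> (f -` B \<inter> space M) = f -` (A \<inter> B) \<inter> space M" by auto
  then show "emeasure (distr (uniform_measure M (f -` A \<inter> space M)) L f) B = emeasure (uniform_measure N A) B"
    using measurable_sets[OF f A] measurable_sets[OF f B] A B
    by (simp add: emeasure_distr e sN)
qed

context planar_body_perimeter
begin

abbreviation \<nu> where "\<nu> \<equiv> uniform_measure Hm (frontier K)"
abbreviation \<mu> where "\<mu> \<equiv> uniform_measure lborel K"

lemma emeasure_per: "emeasure Hm (frontier K) = ennreal per" "emeasure lborel K = ennreal ar"
  using Hm_fin[of "frontier K"] emeasure_K_fin[of K]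
  by (auto simp: per_def ar_def emeasure_eq_ennreal_measure)

lemma prob_spaces: "prob_space \<nu>" "prob_space \<mu>"
  using per_pos by (auto intro!: prob_space_uniform_measure simp: emeasure_per)

lemma AE_in_K: "AE x in \<nu>. x \<in> K" "AE x in \<mu>. x \<in> K"
  using frontier_sub by (auto intro!: AE_uniform_measureI)

text \<open>If the boundary has the larger share above \<open>c\<close>, it has it above every
  higher level, and the tails can be integrated. Otherwise, by contraposition, it has the larger
  share below every level up to \<open>c\<close>; this compares the excess below \<open>c\<close>,
  and equality of the means converts it into the excess above \<open>c\<close>.\<close>

lemma snd_excess:
  assumes mean: "(\<integral>x. snd x \<partial>\<mu>) = (\<integral>x. snd x \<partial>\<nu>)"
  shows "(\<integral>x. max 0 (snd x - c) \<partial>\<mu>) \<le> (\<integral>x. max 0 (snd x - c) \<partial>\<nu>)"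
proof -
  interpret N: prob_space \<nu> by (rule prob_spaces)
  interpret M: prob_space \<mu> by (rule prob_spaces)
  have int: "integrable \<nu> f" "integrable \<mu> f" if "continuous_on UNIV f" for f :: "real \<times> real \<Rightarrow> real"
    using integrable_continuous_compact_support[OF N.finite_measure_axioms _ AE_in_K(1) compact_K that]
      integrable_continuous_compact_support[OF M.finite_measure_axioms _ AE_in_K(2) compact_K that] by auto
  have csnd: "continuous_on UNIV (snd :: real \<times> real \<Rightarrow> real)" by (intro continuous_intros)
  have mean': "(\<integral>x. snd x - c \<partial>\<mu>) = (\<integral>x. snd x - c \<partial>\<nu>)"
    using mean int[OF csnd] M.prob_space N.prob_space by simp
  have snd_m: "(snd :: real \<times> real \<Rightarrow> real) \<in> borel_measurable \<mu>" "(snd :: real \<times> real \<Rightarrow> real) \<in> borel_measurable \<nu>"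
    using borel_measurable_continuous_onI[OF csnd] by (simp_all cong: measurable_cong_sets)
  consider "c \<le> a" | "b \<le> c" | "a < c" "c < b" by linarith
  then show ?thesis
  proof cases
    case 1
    have eq: "AE x in \<mu>. max 0 (snd x - c) = snd x - c" "AE x in \<nu>. max 0 (snd x - c) = snd x - c"
      using AE_in_K(2) by (eventually_elim, use 1 snd_bounds in force)
        (use AE_in_K(1) in eventually_elim, use 1 snd_bounds in force)
    have "(\<integral>x. max 0 (snd x - c) \<partial>\<mu>) = (\<integral>x. snd x - c \<partial>\<mu>)"
      by (rule integral_cong_AE[OF _ _ eq(1)]) (use snd_m in auto)
    moreover have "(\<integral>x. max 0 (snd x - c) \<partial>\<nu>) = (\<integral>x. snd x - c \<partial>\<nu>)"
      by (rule integral_cong_AE[OF _ _ eq(2)]) (use snd_m in auto)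
    ultimately show ?thesis using mean' by simp
  next
    case 2
    have eq: "AE x in \<mu>. max 0 (snd x - c) = 0"
      using AE_in_K(2) by eventually_elim (use 2 snd_bounds in force)
    have "(\<integral>x. max 0 (snd x - c) \<partial>\<mu>) = (\<integral>x. 0 \<partial>\<mu>)"
      by (rule integral_cong_AE[OF _ _ eq]) (use snd_m in auto)
    then show ?thesis by simp
  next
    case 3
    have fin: "(\<integral>\<^sup>+x. ennreal (f x) \<partial>\<nu>) < \<infinity>" if "continuous_on UNIV f" for f :: "real \<times> real \<Rightarrow> real"
    proof -
      have "(\<integral>\<^sup>+x. ennreal (f x) \<partial>\<nu>) \<le> (\<integral>\<^sup>+x. ennreal (norm (f x)) \<partial>\<nu>)"
        by (intro nn_integral_mono ennreal_leI) auto
      also have "\<dots> < \<infinity>" using int(1)[OF that] by (simp add: integrable_iff_bounded)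
      finally show ?thesis .
    qed
    show ?thesis
    proof (cases "area c * per \<le> arc c * ar")
      case True
      \<comment> \<open>The level \<open>b\<close> is left out because the crossing lemma stops
        short of it; one level is null for the tail integral.\<close>
      have le: "emeasure \<mu> (upper t) \<le> emeasure \<nu> (upper t)" if t: "c \<le> t" "t \<noteq> b" for t
      proof (cases "t < b")
        case tb: True
        have "area t * per \<le> arc t * ar"
          using crossing_upward[OF 3(1) _ tb True] True t by (cases "t = c") auto
        then have "area t / ar \<le> arc t / per" using per_pos by (simp add: field_simps)
        then show ?thesis by (simp add: emeasure_uniform_upper ennreal_leI del: emeasure_uniform_measure)
      next
        case False
        then have "K \<inter> upper t = {}" using t snd_bounds by force
        then have "area t = 0" by (simp add: area_def)
        then show ?thesis by (simp add: emeasure_uniform_upper del: emeasure_uniform_measure)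
      qed
      have "(\<integral>\<^sup>+x. ennreal (snd x - c) \<partial>\<mu>) \<le> (\<integral>\<^sup>+x. ennreal (snd x - c) \<partial>\<nu>)"
        unfolding nn_integral_upper_tail[OF N.sigma_finite_measure_axioms snd_m(2)] nn_integral_upper_tail[OF M.sigma_finite_measure_axioms snd_m(1)]
      proof (rule nn_integral_mono_AE)
        show "AE t in lborel. emeasure \<mu> {x \<in> space \<mu>. t \<le> snd x} * indicator {c..} t \<le> emeasure \<nu> {x \<in> space \<nu>. t \<le> snd x} * indicator {c..} t"
          using AE_lborel_singleton[of b]
          by eventually_elim (use le in \<open>auto simp: indicator_def simp del: emeasure_uniform_measure\<close>)
      qed
      then show ?thesis
        using snd_m fin[of "\<lambda>x. snd x - c", OF continuous_on_diff[OF csnd continuous_on_const]]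
        by (subst (1 2) integral_pos_part_eq) (auto intro!: enn2real_mono continuous_intros)
    next
      case False
      let ?L = "\<lambda>t. {z::real \<times> real. snd z \<le> t}"
      have clL: "?L t \<in> sets borel" for t by (intro borel_closed closed_Collect_le continuous_intros)
      have le: "emeasure \<mu> (?L t) \<le> emeasure \<nu> (?L t)" if t: "t \<le> c" "t \<noteq> a" for t
      proof (cases "a < t")
        case ta: True
        have tb: "t < b" using t 3 by simp
        have "\<not> area t * per \<le> arc t * ar"
          using crossing_upward[OF ta _ 3(2)] False t by (cases "t = c") auto
        then have "(ar - area t) * per \<le> (per - arc t) * ar" by (simp add: algebra_simps)
        then have le: "(ar - area t) / ar \<le> (per - arc t) / per" using per_pos by (simp add: field_simps)
        have "emeasure Hm (frontier K \<inter> ?L t) = ennreal (per - arc t)"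
          using Hm_fin[of "frontier K \<inter> ?L t"] clL level_null(1)[OF ta tb] by (simp add: emeasure_eq_ennreal_measure)
        moreover have "emeasure lborel (K \<inter> ?L t) = ennreal (ar - area t)"
          using emeasure_K_fin[of "K \<inter> ?L t"] level_null(2)[OF ta tb] by (simp add: emeasure_eq_ennreal_measure)
        moreover have "0 \<le> per - arc t" "0 \<le> ar - area t"
          using level_null[OF ta tb] by (metis measure_nonneg)+
        ultimately show ?thesis
          using le per_pos clL[of t] by (simp add: emeasure_per divide_ennreal ennreal_leI)
      next
        case False
        then have "K \<inter> ?L t = {}" using t snd_bounds by force
        then show ?thesis using clL[of t] by simp
      qed
      have m': "(\<lambda>x. - snd x) \<in> borel_measurable \<mu>" "(\<lambda>x. - snd x) \<in> borel_measurable \<nu>" using snd_m by auto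
      have le': "emeasure \<mu> {x. t \<le> - snd x} * indicator {- c..} t \<le> emeasure \<nu> {x. t \<le> - snd x} * indicator {- c..} t" if "t \<noteq> - a" for t
      proof -
        have "{x::real \<times> real. t \<le> - snd x} = ?L (- t)" by auto
        then show ?thesis using le[of "- t"] that by (auto simp: indicator_def simp del: emeasure_uniform_measure)
      qed
      have "(\<integral>\<^sup>+x. ennreal (- snd x - - c) \<partial>\<mu>) \<le> (\<integral>\<^sup>+x. ennreal (- snd x - - c) \<partial>\<nu>)"
        unfolding nn_integral_upper_tail[OF N.sigma_finite_measure_axioms m'(2)] nn_integral_upper_tail[OF M.sigma_finite_measure_axioms m'(1)]
      proof (rule nn_integral_mono_AE)
        show "AE t in lborel. emeasure \<mu> {x \<in> space \<mu>. t \<le> - snd x} * indicator {- c..} t \<le> emeasure \<nu> {x \<in> space \<nu>. t \<le> - snd x} * indicator {- c..} t"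
          using AE_lborel_singleton[of "- a"]
          by eventually_elim (use le' in \<open>auto simp del: emeasure_uniform_measure\<close>)
      qed
      then have low: "(\<integral>x. max 0 (- snd x - - c) \<partial>\<mu>) \<le> (\<integral>x. max 0 (- snd x - - c) \<partial>\<nu>)"
        using m' fin[of "\<lambda>x. - snd x - - c", OF continuous_on_diff[OF continuous_on_minus[OF csnd] continuous_on_const]]
        by (subst (1 2) integral_pos_part_eq) (auto intro!: enn2real_mono continuous_intros)
      have eq: "max 0 (snd x - c) = max 0 (- snd x - - c) + (snd x - c)" for x :: "real \<times> real" by auto
      have c1: "continuous_on UNIV (\<lambda>x::real \<times> real. max 0 (- snd x - - c))" "continuous_on UNIV (\<lambda>x::real \<times> real. snd x - c)"
        by (intro continuous_intros)+
      have "(\<integral>x. max 0 (snd x - c) \<partial>\<mu>) = (\<integral>x. max 0 (- snd x - - c) \<partial>\<mu>) + (\<integral>x. snd x - c \<partial>\<mu>)"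
        unfolding eq by (rule Bochner_Integration.integral_add[OF int(2)[OF c1(1)] int(2)[OF c1(2)]])
      moreover have "(\<integral>x. max 0 (snd x - c) \<partial>\<nu>) = (\<integral>x. max 0 (- snd x - - c) \<partial>\<nu>) + (\<integral>x. snd x - c \<partial>\<nu>)"
        unfolding eq by (rule Bochner_Integration.integral_add[OF int(1)[OF c1(1)] int(1)[OF c1(2)]])
      ultimately show ?thesis using low mean' by linarith
    qed
  qed
qed

end

text \<open>The rotation \<open>J\<close> turns the direction of \<open>u\<close> into the second
  coordinate, and the positive factor \<open>r\<close> is pulled out of the fold.\<close>

lemma planar_halfspace_excess:
  fixes K :: "(real \<times> real) set"
  assumes K: "compact K" "convex K" "interior K \<noteq> {}"
    and ha: "hausdorff_additive 1 TYPE(real \<times> real)" and fin: "hausdorff_outer 1 (frontier K) < \<infinity>"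
    and mean: "(\<integral>x. x \<partial>uniform_measure lborel K) = (\<integral>x. x \<partial>uniform_measure (hausdorff_measure 1) (frontier K))"
  shows "(\<integral>x. max 0 (u \<bullet> x + c) \<partial>uniform_measure lborel K)
    \<le> (\<integral>x. max 0 (u \<bullet> x + c) \<partial>uniform_measure (hausdorff_measure 1) (frontier K))"
proof -
  interpret P: planar_body_perimeter K by standard (use K ha fin in auto)
  interpret N: prob_space P.\<nu> by (rule P.prob_spaces)
  interpret M: prob_space P.\<mu> by (rule P.prob_spaces)
  show ?thesis
  proof (cases "u = 0")
    case True
    then show ?thesis using M.prob_space N.prob_space by simp
  next
    case False
    define r where "r = norm u"
    have r: "r > 0" using False by (simp add: r_def)
    obtain u1 u2 where u: "u = (u1, u2)" by (cases u)
    define v1 v2 where "v1 = u1 / r" and "v2 = u2 / r"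
    have v: "v1\<^sup>2 + v2\<^sup>2 = 1"
    proof -
      have "r\<^sup>2 = u1\<^sup>2 + u2\<^sup>2" by (simp add: r_def u norm_Pair)
      moreover have "v1\<^sup>2 + v2\<^sup>2 = (u1\<^sup>2 + u2\<^sup>2) / r\<^sup>2"
        by (simp add: v1_def v2_def power_divide add_divide_distrib)
      moreover have "r\<^sup>2 \<noteq> 0" using r by simp
      ultimately show ?thesis by (metis divide_self)
    qed
    define J where "J z = (v2 * fst z - v1 * snd z, v1 * fst z + v2 * snd z)" for z :: "real \<times> real"
    have lin: "linear J" unfolding J_def by (intro linearI) (auto simp: algebra_simps)
    have nrm: "norm (J z) = norm z" for z
    proof -
      have "(v2 * fst z - v1 * snd z)\<^sup>2 + (v1 * fst z + v2 * snd z)\<^sup>2 = (v1\<^sup>2 + v2\<^sup>2) * ((fst z)\<^sup>2 + (snd z)\<^sup>2)"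
        by (simp add: power2_eq_square algebra_simps)
      then show ?thesis by (simp add: J_def norm_prod_def v)
    qed
    have iso: "dist (J x) (J y) = dist x y" for x y
      using nrm[of "x - y"] by (simp add: dist_norm linear_diff[OF lin])
    have inj: "inj J" using iso by (metis dist_eq_0_iff injI)
    then have bij: "bij J" using lin linear_injective_imp_surjective by (auto simp: bij_def)
    have cJ: "continuous_on UNIV J" by (intro linear_continuous_on linear_linear[THEN iffD2] lin)
    have mJ[measurable]: "J \<in> borel_measurable borel" by (rule borel_measurable_continuous_onI[OF cJ])
    have fr: "frontier (J ` K) = J ` frontier K"
      unfolding frontier_def using interior_injective_linear_image[OF lin inj, of K] closure_injective_linear_image[OF lin inj, of K]
      by (simp add: image_set_diff[OF inj])
    interpret R: planar_body_perimeter "J ` K"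
    proof
      show "compact (J ` K)" using K cJ by (intro compact_continuous_image) (auto intro: continuous_on_subset)
      show "convex (J ` K)" by (rule convex_linear_image[OF lin K(2)])
      show "interior (J ` K) \<noteq> {}"
        using interior_injective_linear_image[OF lin inj, of K] K(3) by simp
      show "hausdorff_outer 1 (frontier (J ` K)) < \<infinity>"
        unfolding fr using fin hausdorff_outer_isometry_image[of "frontier K" J 1] iso by simp
    qed (rule ha)
    have dl: "distr lborel borel J = lborel" by (rule lborel_distr_isometry[OF lin bij nrm refl])
    have dh: "distr (hausdorff_measure 1) borel J = hausdorff_measure 1"
      by (rule distr_hausdorff_measure_isometry[OF ha iso]) (use bij in \<open>simp add: bij_def\<close>)
    have vi: "J -` J ` A = A" for A using inj by (rule inj_vimage_image_eq)
    have d1: "distr P.\<mu> borel J = R.\<mu>"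
      using distr_uniform_measure[OF _ dl, of "J ` K"] vi[of K] R.K_borel by simp
    have d2: "distr P.\<nu> borel J = R.\<nu>"
      using distr_uniform_measure[OF _ dh, of "J ` frontier K"] vi[of "frontier K"] R.frontier_borel
      by (simp add: fr)
    have ci: "continuous_on UNIV (\<lambda>x::real \<times> real. x)" by (rule continuous_on_id)
    have ids: "integrable P.\<mu> (\<lambda>x. x)" "integrable P.\<nu> (\<lambda>x. x)"
      using integrable_continuous_compact_support[OF N.finite_measure_axioms _ P.AE_in_K(1) K(1) ci]
        integrable_continuous_compact_support[OF M.finite_measure_axioms _ P.AE_in_K(2) K(1) ci] by auto
    have sJ: "snd (J x) = (v1, v2) \<bullet> x" for x by (simp add: J_def inner_prod_def)
    have mJ': "J \<in> measurable P.\<mu> borel" "J \<in> measurable P.\<nu> borel" using mJ by (simp_all cong: measurable_cong_sets)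
    have msnd: "(snd :: real \<times> real \<Rightarrow> real) \<in> borel_measurable borel"
      by (intro borel_measurable_continuous_onI continuous_intros)
    have "(\<integral>x. snd x \<partial>R.\<mu>) = (\<integral>x. snd x \<partial>R.\<nu>)"
      unfolding d1[symmetric] d2[symmetric] integral_distr[OF mJ'(1) msnd] integral_distr[OF mJ'(2) msnd] sJ
      using mean ids by (simp add: integral_inner_right)
    from R.snd_excess[OF this, of "- c / r"]
    have "(\<integral>x. max 0 (snd (J x) + c / r) \<partial>P.\<mu>) \<le> (\<integral>x. max 0 (snd (J x) + c / r) \<partial>P.\<nu>)"
      unfolding d1[symmetric] d2[symmetric] using msnd
      by (subst (asm) (1 2) integral_distr) (auto simp: mJ')
    moreover have "max 0 (u \<bullet> x + c) = r * max 0 (snd (J x) + c / r)" for x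
    proof -
      have "u \<bullet> x + c = r * (snd (J x) + c / r)"
        using r by (simp add: sJ v1_def v2_def u inner_prod_def field_simps)
      then show ?thesis using r by (simp add: max_mult_distrib_left)
    qed
    ultimately show ?thesis using r by (simp only: integral_mult_right_zero mult_left_mono)
  qed
qed

declare One_nat_def [simp]

section \<open>Envelopes of convex functions on polygons\<close>

text \<open>Affine summands come with either sign, folds only with nonnegative coefficients, which
  are absorbed in \<open>w\<close> and \<open>c\<close>. Such sums are convex, and an inequality
  between integrals that holds for affine functions and folds passes to them by additivity.\<close>

inductive crease :: "('a::real_inner \<Rightarrow> real) \<Rightarrow> bool" where
  affine: "crease (\<lambda>x. w \<bullet> x + c)"
| fold: "crease (\<lambda>x. max 0 (w \<bullet> x + c))"
| add: "crease F \<Longrightarrow> crease G \<Longrightarrow> crease (\<lambda>x. F x + G x)"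

lemma convex_on_affine_form: "convex_on UNIV (\<lambda>x::'a::real_inner. w \<bullet> x + c)"
proof (rule convex_onI)
  fix t :: real and x y :: 'a
  have "c = (1 - t) * c + t * c" by (simp add: algebra_simps)
  then show "w \<bullet> ((1 - t) *\<^sub>R x + t *\<^sub>R y) + c \<le> (1 - t) * (w \<bullet> x + c) + t * (w \<bullet> y + c)"
    by (simp add: inner_add_right algebra_simps)
qed simp

lemma convex_on_crease: "crease F \<Longrightarrow> convex_on UNIV F"
proof (induction rule: crease.induct)
  case (affine w c) show ?case by (rule convex_on_affine_form)
next
  case (fold w c)
  show ?case
  proof (rule convex_onI)
    fix t :: real and x y :: 'a assume t: "0 < t" "t < 1"
    have "w \<bullet> ((1 - t) *\<^sub>R x + t *\<^sub>R y) + c \<le> (1 - t) * (w \<bullet> x + c) + t * (w \<bullet> y + c)"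
      using convex_onD[OF convex_on_affine_form, of t x y w c] t by simp
    also have "\<dots> \<le> (1 - t) * max 0 (w \<bullet> x + c) + t * max 0 (w \<bullet> y + c)"
      using t by (intro add_mono mult_left_mono) auto
    finally show "max 0 (w \<bullet> ((1 - t) *\<^sub>R x + t *\<^sub>R y) + c) \<le> (1 - t) * max 0 (w \<bullet> x + c) + t * max 0 (w \<bullet> y + c)"
      using t by auto
  qed simp
qed (simp add: convex_on_add)

lemma continuous_on_crease: "crease F \<Longrightarrow> continuous_on UNIV F"
  by (induction rule: crease.induct) (auto intro!: continuous_intros)

text \<open>Trades a fold whose affine function is nonnegative on a chord for that affine function
  and a fold that vanishes on the chord.\<close>

lemma crease_uminus_fold: "max 0 (w \<bullet> x + c) = (w \<bullet> x + c) + max 0 ((- w) \<bullet> x + (- c))" for x w :: "'a::real_inner"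
  by auto

text \<open>The part of \<open>P\<close> where \<open>w \<bullet> x + c\<close> is positive is
  convex and misses the chord, so it lies on one side of the chord. If the fold vanishes beyond the
  chord it is kept; otherwise it vanishes on the near side and is replaced by
  \<open>0\<close>.\<close>

lemma crease_glue_fold:
  fixes w wl :: "'a::real_inner"
  assumes P: "convex P" "p \<in> P" "q \<in> P" "x0 \<in> P"
    and chord: "\<And>x. x \<in> P \<Longrightarrow> wl \<bullet> x + cl = 0 \<Longrightarrow> x \<in> closed_segment p q"
    and x0: "wl \<bullet> x0 + cl > 0" and m: "m = (1 / 2) *\<^sub>R (p + q)"
    and pq: "w \<bullet> p + c \<le> 0" "w \<bullet> q + c \<le> 0" and mx: "w \<bullet> m + c < 0 \<or> w \<bullet> x0 + c \<le> 0"
  shows "\<exists>G. crease G \<and> (\<forall>x\<in>P. 0 \<le> wl \<bullet> x + cl \<longrightarrow> G x = max 0 (w \<bullet> x + c)) \<and>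
    (\<forall>x\<in>P. wl \<bullet> x + cl \<le> 0 \<longrightarrow> G x = 0) \<and>
    (\<exists>\<delta>>0. \<forall>t. 0 \<le> t \<longrightarrow> t \<le> \<delta> \<longrightarrow> max 0 (w \<bullet> (m + t *\<^sub>R (x0 - m)) + c) = 0)"
proof -
  have "w \<bullet> m + c = ((w \<bullet> p + c) + (w \<bullet> q + c)) / 2" by (simp add: m inner_add_right field_simps)
  also have "\<dots> \<le> 0" using add_nonpos_nonpos[OF pq] by simp
  finally have mle: "w \<bullet> m + c \<le> 0" .
  \<comment> \<open>Either the affine function is nonpositive at both \<open>m\<close> and
    \<open>x0\<close>, or it starts negative at \<open>m\<close> and reaches its zero at the
    positive parameter \<open>?d\<close>.\<close>
  have ray: "\<exists>\<delta>>0. \<forall>t. 0 \<le> t \<longrightarrow> t \<le> \<delta> \<longrightarrow> max 0 (w \<bullet> (m + t *\<^sub>R (x0 - m)) + c) = 0"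
  proof (cases "w \<bullet> x0 + c \<le> 0")
    case True
    show ?thesis
    proof (intro exI[of _ 1] conjI allI impI)
      fix t :: real assume t: "0 \<le> t" "t \<le> 1"
      have "w \<bullet> (m + t *\<^sub>R (x0 - m)) + c = (1 - t) * (w \<bullet> m + c) + t * (w \<bullet> x0 + c)"
        by (simp add: inner_add_right inner_diff_right algebra_simps)
      also have "\<dots> \<le> 0" using t mle True by (intro add_nonpos_nonpos[OF mult_nonneg_nonpos mult_nonneg_nonpos]) auto
      finally show "max 0 (w \<bullet> (m + t *\<^sub>R (x0 - m)) + c) = 0" by simp
    qed simp
  next
    case False
    then have ml: "w \<bullet> m + c < 0" "0 < w \<bullet> x0 + c" using mx by auto
    let ?d = "- (w \<bullet> m + c) / ((w \<bullet> x0 + c) - (w \<bullet> m + c))"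
    show ?thesis
    proof (intro exI[of _ ?d] conjI allI impI)
      show "0 < ?d" using ml by (intro divide_pos_pos) auto
      fix t :: real assume t: "0 \<le> t" "t \<le> ?d"
      have "t * ((w \<bullet> x0 + c) - (w \<bullet> m + c)) \<le> - (w \<bullet> m + c)"
        using t(2) ml by (simp add: pos_le_divide_eq)
      moreover have "w \<bullet> (m + t *\<^sub>R (x0 - m)) + c = (w \<bullet> m + c) + t * ((w \<bullet> x0 + c) - (w \<bullet> m + c))"
        by (simp add: inner_add_right inner_diff_right algebra_simps)
      ultimately show "max 0 (w \<bullet> (m + t *\<^sub>R (x0 - m)) + c) = 0" by simp
    qed
  qed
  have onchord: "w \<bullet> z + c \<le> 0" if z: "z \<in> closed_segment p q" for z
  proof -
    obtain u where u: "0 \<le> u" "u \<le> 1" "z = (1 - u) *\<^sub>R p + u *\<^sub>R q" using z by (auto simp: in_segment)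
    have "w \<bullet> z + c = (1 - u) * (w \<bullet> p + c) + u * (w \<bullet> q + c)"
      by (simp add: u inner_add_right algebra_simps)
    also have "\<dots> \<le> 0" using u pq by (intro add_nonpos_nonpos[OF mult_nonneg_nonpos mult_nonneg_nonpos]) auto
    finally show ?thesis .
  qed
  show ?thesis
  proof (cases "\<forall>x\<in>P. wl \<bullet> x + cl \<le> 0 \<longrightarrow> w \<bullet> x + c \<le> 0")
    case True
    then show ?thesis using ray by (intro exI[of _ "\<lambda>x. max 0 (w \<bullet> x + c)"]) (auto intro: crease.fold)
  next
    case False
    then obtain y where y: "y \<in> P" "wl \<bullet> y + cl \<le> 0" "0 < w \<bullet> y + c" by force
    have "w \<bullet> x + c \<le> 0" if x: "x \<in> P" "0 \<le> wl \<bullet> x + cl" for x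
    proof (rule ccontr)
      assume n: "\<not> w \<bullet> x + c \<le> 0"
      define u where "u = (if wl \<bullet> x + cl = 0 then 0 else (wl \<bullet> x + cl) / ((wl \<bullet> x + cl) - (wl \<bullet> y + cl)))"
      have u: "0 \<le> u" "u \<le> 1" using x(2) y(2) by (auto simp: u_def field_simps)
      have ueq: "(1 - u) * (wl \<bullet> x + cl) + u * (wl \<bullet> y + cl) = 0"
      proof (cases "wl \<bullet> x + cl = 0")
        case False
        then have "u * ((wl \<bullet> x + cl) - (wl \<bullet> y + cl)) = wl \<bullet> x + cl" using x(2) y(2) by (simp add: u_def)
        then show ?thesis by (simp add: algebra_simps)
      qed (simp add: u_def)
      define z where "z = (1 - u) *\<^sub>R x + u *\<^sub>R y"
      have "z \<in> P" unfolding z_def using convexD[OF P(1) x(1) y(1)] u by simp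
      moreover have "wl \<bullet> z + cl = 0" using ueq by (simp add: z_def inner_add_right algebra_simps)
      ultimately have "w \<bullet> z + c \<le> 0" using chord onchord by blast
      moreover have "w \<bullet> z + c = (1 - u) * (w \<bullet> x + c) + u * (w \<bullet> y + c)"
        by (simp add: z_def inner_add_right algebra_simps)
      moreover have "0 < (1 - u) * (w \<bullet> x + c) + u * (w \<bullet> y + c)"
      proof (cases "u = 0")
        case True then show ?thesis using n by simp
      next
        case False
        then have "0 < u * (w \<bullet> y + c)" using u y by simp
        moreover have "0 \<le> (1 - u) * (w \<bullet> x + c)" using u n by simp
        ultimately show ?thesis by linarith
      qed
      ultimately show False by linarith
    qed
    then show ?thesis using ray crease.affine[of 0 0] by (intro exI[of _ "\<lambda>x. 0"]) auto
  qed
qed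

text \<open>All summands are convex, so equality at the midpoint for the sum forces equality for
  each. A fold therefore does not change sign along the chord and can be continued one at a time.
  The clause on the ray identifies the affine continuation: it agrees with \<open>F\<close> just
  inside the positive side.\<close>

lemma crease_glue:
  fixes wl :: "'a::real_inner"
  assumes F: "crease F"
    and P: "convex P" "p \<in> P" "q \<in> P" "x0 \<in> P"
    and chord: "\<And>x. x \<in> P \<Longrightarrow> wl \<bullet> x + cl = 0 \<Longrightarrow> x \<in> closed_segment p q"
    and x0: "wl \<bullet> x0 + cl > 0" and m: "m = (1 / 2) *\<^sub>R (p + q)"
    and Fm: "F m = (F p + F q) / 2"
  shows "\<exists>G u c. crease G \<and> (\<forall>x\<in>P. 0 \<le> wl \<bullet> x + cl \<longrightarrow> G x = F x) \<and>
    (\<forall>x\<in>P. wl \<bullet> x + cl \<le> 0 \<longrightarrow> G x = u \<bullet> x + c) \<and>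
    (\<exists>\<delta>>0. \<forall>t. 0 \<le> t \<longrightarrow> t \<le> \<delta> \<longrightarrow> F (m + t *\<^sub>R (x0 - m)) = u \<bullet> (m + t *\<^sub>R (x0 - m)) + c)"
  using F Fm
proof (induction rule: crease.induct)
  case (affine w c)
  show ?case
    by (rule exI[of _ "\<lambda>x. w \<bullet> x + c"], rule exI[of _ w], rule exI[of _ c]) (auto intro: crease.affine exI[of _ 1])
next
  case (fold w c)
  let ?e = "\<lambda>x. w \<bullet> x + c"
  have em: "?e m = (?e p + ?e q) / 2" by (simp add: m inner_add_right field_simps)
  show ?case
  \<comment> \<open>If the affine function vanishes at both ends of the chord, its sign at
    \<open>x0\<close> decides whether the fold or its trade is continued.\<close>
  proof (cases "?e p \<le> 0 \<and> ?e q \<le> 0 \<and> (?e m < 0 \<or> ?e x0 \<le> 0)")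
    case True
    then obtain G \<delta> where G: "crease G" "\<forall>x\<in>P. 0 \<le> wl \<bullet> x + cl \<longrightarrow> G x = max 0 (?e x)"
      "\<forall>x\<in>P. wl \<bullet> x + cl \<le> 0 \<longrightarrow> G x = 0" "\<delta> > 0"
      "\<forall>t. 0 \<le> t \<longrightarrow> t \<le> \<delta> \<longrightarrow> max 0 (?e (m + t *\<^sub>R (x0 - m))) = 0"
      using crease_glue_fold[OF P chord x0 m, of w c] by blast
    then have ray: "\<exists>\<delta>>0. \<forall>t. 0 \<le> t \<longrightarrow> t \<le> \<delta> \<longrightarrow> max 0 (?e (m + t *\<^sub>R (x0 - m))) = 0 \<bullet> (m + t *\<^sub>R (x0 - m)) + 0" by auto
    show ?thesis
      by (rule exI[of _ G], rule exI[of _ 0], rule exI[of _ 0]) (use G ray in auto)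
  next
    case False
    have neg: "- ?e p \<le> 0" "- ?e q \<le> 0" "- ?e m < 0 \<or> - ?e x0 \<le> 0"
    proof -
      have A: "- ?e p \<le> 0 \<and> - ?e q \<le> 0 \<and> (- ?e m < 0 \<or> - ?e x0 \<le> 0)"
      proof (cases "?e p \<le> 0 \<and> ?e q \<le> 0")
        case True
        then have "?e m = 0" "?e x0 > 0" using False em by auto
        then show ?thesis using True em by auto
      next
        case n: False
        show ?thesis using fold n em by (auto simp: max_def split: if_splits)
      qed
      then show "- ?e p \<le> 0" "- ?e q \<le> 0" "- ?e m < 0 \<or> - ?e x0 \<le> 0" by auto
    qed
    obtain G \<delta> where G: "crease G" "\<forall>x\<in>P. 0 \<le> wl \<bullet> x + cl \<longrightarrow> G x = max 0 ((- w) \<bullet> x + (- c))"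
      "\<forall>x\<in>P. wl \<bullet> x + cl \<le> 0 \<longrightarrow> G x = 0" "\<delta> > 0"
      "\<forall>t. 0 \<le> t \<longrightarrow> t \<le> \<delta> \<longrightarrow> max 0 ((- w) \<bullet> (m + t *\<^sub>R (x0 - m)) + (- c)) = 0"
      using crease_glue_fold[OF P chord x0 m, of "- w" "- c"] neg by auto
    have g: "crease (\<lambda>x. (w \<bullet> x + c) + G x)" by (rule crease.add[OF crease.affine G(1)])
    have eq: "\<forall>x\<in>P. 0 \<le> wl \<bullet> x + cl \<longrightarrow> (w \<bullet> x + c) + G x = max 0 (?e x)"
      using G(2) crease_uminus_fold[of w _ c] by simp
    have "max 0 (?e (m + t *\<^sub>R (x0 - m))) = ?e (m + t *\<^sub>R (x0 - m))" if "0 \<le> t" "t \<le> \<delta>" for t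
      using G(5) that crease_uminus_fold[of w "m + t *\<^sub>R (x0 - m)" c] by simp
    then have ray: "\<exists>\<delta>>0. \<forall>t. 0 \<le> t \<longrightarrow> t \<le> \<delta> \<longrightarrow> max 0 (?e (m + t *\<^sub>R (x0 - m))) = ?e (m + t *\<^sub>R (x0 - m))"
      using G(4) by blast
    show ?thesis
      by (rule exI[of _ "\<lambda>x. (w \<bullet> x + c) + G x"], rule exI[of _ w], rule exI[of _ c]) (use G(3) g eq ray in auto)
  qed
next
  case (add F1 F2)
  have le: "F m \<le> (F p + F q) / 2" if "crease F" for F :: "'a \<Rightarrow> real"
    using convex_onD[OF convex_on_crease[OF that], of "1/2" p q] by (simp add: m scaleR_add_right)
  have "F1 m = (F1 p + F1 q) / 2" "F2 m = (F2 p + F2 q) / 2"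
    using le[OF add(1)] le[OF add(2)] add.prems by (auto simp: field_simps)
  then obtain G1 u1 c1 \<delta>1 G2 u2 c2 \<delta>2 where
    G1: "crease G1" "\<forall>x\<in>P. 0 \<le> wl \<bullet> x + cl \<longrightarrow> G1 x = F1 x" "\<forall>x\<in>P. wl \<bullet> x + cl \<le> 0 \<longrightarrow> G1 x = u1 \<bullet> x + c1"
      "\<delta>1 > 0" "\<forall>t. 0 \<le> t \<longrightarrow> t \<le> \<delta>1 \<longrightarrow> F1 (m + t *\<^sub>R (x0 - m)) = u1 \<bullet> (m + t *\<^sub>R (x0 - m)) + c1" and
    G2: "crease G2" "\<forall>x\<in>P. 0 \<le> wl \<bullet> x + cl \<longrightarrow> G2 x = F2 x" "\<forall>x\<in>P. wl \<bullet> x + cl \<le> 0 \<longrightarrow> G2 x = u2 \<bullet> x + c2"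
      "\<delta>2 > 0" "\<forall>t. 0 \<le> t \<longrightarrow> t \<le> \<delta>2 \<longrightarrow> F2 (m + t *\<^sub>R (x0 - m)) = u2 \<bullet> (m + t *\<^sub>R (x0 - m)) + c2"
    using add.IH by blast
  have "\<forall>t. 0 \<le> t \<longrightarrow> t \<le> min \<delta>1 \<delta>2 \<longrightarrow>
      F1 (m + t *\<^sub>R (x0 - m)) + F2 (m + t *\<^sub>R (x0 - m)) = (u1 + u2) \<bullet> (m + t *\<^sub>R (x0 - m)) + (c1 + c2)"
    using G1(5) G2(5) by (simp add: inner_add_left)
  moreover have "0 < min \<delta>1 \<delta>2" using G1(4) G2(4) by simp
  ultimately have ray: "\<exists>\<delta>>0. \<forall>t. 0 \<le> t \<longrightarrow> t \<le> \<delta> \<longrightarrow>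
      F1 (m + t *\<^sub>R (x0 - m)) + F2 (m + t *\<^sub>R (x0 - m)) = (u1 + u2) \<bullet> (m + t *\<^sub>R (x0 - m)) + (c1 + c2)" by blast
  show ?case
    by (rule exI[of _ "\<lambda>x. G1 x + G2 x"], rule exI[of _ "u1 + u2"], rule exI[of _ "c1 + c2"])
      (use G1 G2 ray in \<open>auto intro: crease.add simp: inner_add_left\<close>)
qed

section \<open>Affine minorants and chords of polygons\<close>

text \<open>Take an affine minorant of the data with maximal value at \<open>x\<close>. If
  \<open>x\<close> were outside the hull of the contact points, a functional separating them could
  be used to tilt the minorant and raise its value at \<open>x\<close>.\<close>

lemma affine_minorant_touching:
  fixes x :: "'a::euclidean_space" and f :: "'a \<Rightarrow> real"
  assumes S: "finite S" and x: "x \<in> interior (convex hull S)"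
  shows "\<exists>u c. (\<forall>s\<in>S. u \<bullet> s + c \<le> f s) \<and> x \<in> convex hull {s \<in> S. u \<bullet> s + c = f s}"
proof -
  obtain \<rho> where \<rho>: "\<rho> > 0" "cball x \<rho> \<subseteq> convex hull S" using x by (auto simp: mem_interior_cball)
  have ne: "S \<noteq> {}" using x by auto
  define M where "M = Max (f ` S)"
  define m0 where "m0 = Min (f ` S)"
  have fb: "m0 \<le> f s" "f s \<le> M" if "s \<in> S" for s using that S by (auto simp: M_def m0_def)
  \<comment> \<open>The pairs of gradient and constant of admissible minorants. The last condition
    discards those that are worse at \<open>x\<close> than the constant \<open>m0\<close>, which
    makes the set bounded.\<close>
  define A where "A = (\<Inter>s\<in>S. {p :: 'a \<times> real. fst p \<bullet> s + snd p \<le> f s}) \<inter> {p. m0 \<le> fst p \<bullet> x + snd p}"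
  have clA: "closed A" unfolding A_def
    by (intro closed_Int closed_INT ballI closed_Collect_le continuous_intros)
  have bd: "norm (fst p) \<le> (M - m0) / \<rho> \<and> \<bar>snd p\<bar> \<le> \<bar>M\<bar> + \<bar>m0\<bar> + (M - m0) / \<rho> * norm x" if p: "p \<in> A" for p
  proof -
    obtain u c where uc: "p = (u, c)" by (cases p)
    have "S \<subseteq> {y. u \<bullet> y \<le> M - c}" using p fb by (force simp: A_def uc)
    then have hull: "convex hull S \<subseteq> {y. u \<bullet> y \<le> M - c}" by (intro hull_minimal convex_halfspace_le)
    have m: "m0 \<le> u \<bullet> x + c" using p by (simp add: A_def uc)
    \<comment> \<open>A step of length \<open>\<rho>\<close> along the gradient stays in the hull,
      where the minorant is at most \<open>M\<close>, while at \<open>x\<close> it is at least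
      \<open>m0\<close>.\<close>
    have nu: "norm u \<le> (M - m0) / \<rho>"
    proof (cases "u = 0")
      case True
      have "x \<in> convex hull S" using x interior_subset by blast
      then have "u \<bullet> x \<le> M - c" using hull by blast
      then have "m0 \<le> M" using m True by simp
      then show ?thesis using True \<rho> by simp
    next
      case False
      have "x + (\<rho> / norm u) *\<^sub>R u \<in> cball x \<rho>" using False \<rho> by (simp add: dist_norm)
      then have "u \<bullet> (x + (\<rho> / norm u) *\<^sub>R u) \<le> M - c" using \<rho> hull by blast
      then have "u \<bullet> x + \<rho> * norm u \<le> M - c" using False by (simp add: inner_add_right power2_norm_eq_inner[symmetric] power2_eq_square)
      then have "norm u * \<rho> \<le> M - m0" using m by (simp add: mult.commute)
      then show ?thesis using \<rho> by (simp add: pos_le_divide_eq)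
    qed
    have "\<bar>u \<bullet> x\<bar> \<le> norm u * norm x" by (rule Cauchy_Schwarz_ineq2)
    also have "\<dots> \<le> (M - m0) / \<rho> * norm x" using nu by (intro mult_right_mono) auto
    finally have ux: "\<bar>u \<bullet> x\<bar> \<le> (M - m0) / \<rho> * norm x" .
    have "u \<bullet> x \<le> M - c" using hull x interior_subset by blast
    then show ?thesis using nu ux m by (auto simp: uc)
  qed
  have "bounded A"
  proof (rule boundedI)
    fix p assume "p \<in> A"
    have "norm p \<le> norm (fst p) + norm (snd p)" by (metis norm_Pair_le prod.collapse)
    then show "norm p \<le> (M - m0) / \<rho> + (\<bar>M\<bar> + \<bar>m0\<bar> + (M - m0) / \<rho> * norm x)"
      using bd[OF \<open>p \<in> A\<close>] by auto
  qed
  then have "compact A" using clA by (simp add: compact_eq_bounded_closed)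
  moreover have inA: "(0, m0) \<in> A" using fb by (auto simp: A_def)
  then have "A \<noteq> {}" by blast
  moreover have "continuous_on A (\<lambda>p. fst p \<bullet> x + snd p)" by (intro continuous_intros)
  ultimately have "\<exists>p\<in>A. \<forall>r\<in>A. fst r \<bullet> x + snd r \<le> fst p \<bullet> x + snd p" by (rule continuous_attains_sup)
  then obtain u c where uc: "(u, c) \<in> A" and opt: "\<And>r. r \<in> A \<Longrightarrow> fst r \<bullet> x + snd r \<le> u \<bullet> x + c" by force
  define T where "T = {s \<in> S. u \<bullet> s + c = f s}"
  have low: "u \<bullet> s + c \<le> f s" if "s \<in> S" for s using uc that by (auto simp: A_def)
  have "x \<in> convex hull T"
  proof (rule ccontr)
    assume "x \<notin> convex hull T"
    moreover have "closed (convex hull T)"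
      using S by (intro compact_imp_closed finite_imp_compact_convex_hull) (simp add: T_def)
    ultimately obtain w \<beta> where w: "w \<bullet> x < \<beta>" "\<And>y. y \<in> convex hull T \<Longrightarrow> \<beta> < w \<bullet> y"
      using separating_hyperplane_closed_point[of "convex hull T" x] by auto
    \<comment> \<open>A tilt of size \<open>g s\<close> is tolerated at the non-contact point
      \<open>s\<close>. The summand \<open>1\<close> keeps the denominator positive; the
      \<open>1\<close> inserted into the minimum keeps its set nonempty.\<close>
    define g where "g s = (f s - (u \<bullet> s + c)) / (1 + \<bar>\<beta> - w \<bullet> s\<bar>)" for s
    define \<epsilon> where "\<epsilon> = Min (insert 1 (g ` (S - T)))"
    have gpos: "0 < g s" if "s \<in> S - T" for s
      using low[of s] that unfolding g_def by (intro divide_pos_pos) (auto simp: T_def)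
    have \<epsilon>: "0 < \<epsilon>" unfolding \<epsilon>_def using S gpos by (subst Min_gr_iff) auto
    have "(u - \<epsilon> *\<^sub>R w) \<bullet> s + (c + \<epsilon> * \<beta>) \<le> f s" if s: "s \<in> S" for s
    proof (cases "s \<in> T")
      case True
      have "\<beta> < w \<bullet> s" using w(2) True hull_inc by metis
      then have "\<epsilon> * \<beta> \<le> \<epsilon> * (w \<bullet> s)" using \<epsilon> by simp
      then show ?thesis using low[OF s] by (simp add: inner_diff_left)
    next
      case False
      have "\<epsilon> \<le> g s" unfolding \<epsilon>_def using S s False by (intro Min_le) auto
      then have "\<epsilon> * (1 + \<bar>\<beta> - w \<bullet> s\<bar>) \<le> f s - (u \<bullet> s + c)"
        unfolding g_def by (simp add: pos_le_divide_eq add_pos_nonneg)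
      moreover have "\<epsilon> * (\<beta> - w \<bullet> s) \<le> \<epsilon> * (1 + \<bar>\<beta> - w \<bullet> s\<bar>)" using \<epsilon> by (intro mult_left_mono) auto
      ultimately show ?thesis by (simp add: inner_diff_left algebra_simps)
    qed
    moreover have inc: "0 < \<epsilon> * (\<beta> - w \<bullet> x)" using \<epsilon> w(1) by simp
    ultimately have "(u - \<epsilon> *\<^sub>R w, c + \<epsilon> * \<beta>) \<in> A"
      using uc by (auto simp: A_def inner_diff_left algebra_simps)
    from opt[OF this] show False using inc by (simp add: inner_diff_left algebra_simps)
  qed
  then show ?thesis using low unfolding T_def by blast
qed

text \<open>Write \<open>x\<close> as a combination of \<open>y\<close> from the hull on the
  nonnegative side and \<open>z\<close> from the hull on the other side. The segment from
  \<open>y\<close> to \<open>z\<close> crosses the chord from \<open>p\<close> to \<open>q\<close>,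
  which belongs to the first hull, and \<open>x\<close> is not beyond the crossing.\<close>

lemma convex_hull_halfspace_part:
  fixes wl :: "'a::euclidean_space"
  assumes p: "p \<in> S" "wl \<bullet> p + cl = 0" and q: "q \<in> S" "wl \<bullet> q + cl = 0"
    and chord: "\<And>x. x \<in> convex hull S \<Longrightarrow> wl \<bullet> x + cl = 0 \<Longrightarrow> x \<in> closed_segment p q"
    and x: "x \<in> convex hull S" "0 \<le> wl \<bullet> x + cl"
  shows "x \<in> convex hull {s \<in> S. 0 \<le> wl \<bullet> s + cl}"
proof -
  let ?A = "{s \<in> S. 0 \<le> wl \<bullet> s + cl}" and ?B = "{s \<in> S. wl \<bullet> s + cl \<le> 0}"
  have pqA: "p \<in> ?A" "q \<in> ?A" "p \<in> ?B" using p q by auto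
  have "S \<subseteq> convex hull ?A \<union> convex hull ?B"
  proof
    fix s assume "s \<in> S"
    then have "s \<in> ?A \<or> s \<in> ?B" by auto
    then show "s \<in> convex hull ?A \<union> convex hull ?B" by (auto intro: hull_inc)
  qed
  then have "convex hull S \<subseteq> convex hull (convex hull ?A \<union> convex hull ?B)" by (rule hull_mono)
  also have "convex hull ?A \<noteq> {}" "convex hull ?B \<noteq> {}" using pqA by (auto intro: hull_inc)
  then have "convex hull (convex hull ?A \<union> convex hull ?B) =
      {u *\<^sub>R s + v *\<^sub>R t |u v s t. u \<ge> 0 \<and> v \<ge> 0 \<and> u + v = 1 \<and> s \<in> convex hull ?A \<and> t \<in> convex hull ?B}"
    by (intro convex_hull_union_two convex_convex_hull)
  finally have "x \<in> {u *\<^sub>R s + v *\<^sub>R t |u v s t. u \<ge> 0 \<and> v \<ge> 0 \<and> u + v = 1 \<and> s \<in> convex hull ?A \<and> t \<in> convex hull ?B}"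
    using x(1) by blast
  then obtain u v y z where y: "y \<in> convex hull ?A" and z: "z \<in> convex hull ?B"
    and uv: "0 \<le> u" "0 \<le> v" "u + v = 1" "x = u *\<^sub>R y + v *\<^sub>R z" by blast
  have segA: "closed_segment p q \<subseteq> convex hull ?A"
    using pqA by (intro closed_segment_subset hull_inc convex_convex_hull)
  have sub: "convex hull ?A \<subseteq> convex hull S" "convex hull ?B \<subseteq> convex hull S" by (intro hull_mono; auto)+
  have "?A \<subseteq> {a. wl \<bullet> a \<ge> - cl}" by auto
  then have "convex hull ?A \<subseteq> {a. wl \<bullet> a \<ge> - cl}" by (intro hull_minimal convex_halfspace_ge)
  then have ly: "0 \<le> wl \<bullet> y + cl" using y by force
  have "?B \<subseteq> {a. wl \<bullet> a \<le> - cl}" by auto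
  then have "convex hull ?B \<subseteq> {a. wl \<bullet> a \<le> - cl}" by (intro hull_minimal convex_halfspace_le)
  then have lz: "wl \<bullet> z + cl \<le> 0" using z by force
  have u: "u = 1 - v" using uv by simp
  have lx: "wl \<bullet> x + cl = (1 - v) * (wl \<bullet> y + cl) + v * (wl \<bullet> z + cl)"
    unfolding uv(4) u by (simp add: inner_add_right algebra_simps)
  show ?thesis
  proof (cases "v = 0 \<or> wl \<bullet> z + cl = 0")
    case True
    then have "v = 0 \<or> z \<in> convex hull ?A" using chord[of z] z sub segA by blast
    then show ?thesis
    proof
      assume "v = 0" then show ?thesis using uv y by simp
    next
      assume "z \<in> convex hull ?A"
      then show ?thesis using convexD[OF convex_convex_hull y] uv by simp
    qed
  next
    case False
    then have v: "0 < v" and lz': "wl \<bullet> z + cl < 0" using uv lz by auto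
    \<comment> \<open>The parameter at which the segment from \<open>y\<close> to \<open>z\<close>
      meets the chord.\<close>
    define v' where "v' = (wl \<bullet> y + cl) / ((wl \<bullet> y + cl) - (wl \<bullet> z + cl))"
    have den: "0 < (wl \<bullet> y + cl) - (wl \<bullet> z + cl)" using ly lz' by simp
    have v': "v' * ((wl \<bullet> y + cl) - (wl \<bullet> z + cl)) = wl \<bullet> y + cl" using den by (simp add: v'_def)
    have "v * ((wl \<bullet> y + cl) - (wl \<bullet> z + cl)) \<le> wl \<bullet> y + cl"
      using lx x(2) by (simp add: algebra_simps)
    then have vv: "v \<le> v'" unfolding v'_def using den by (simp add: pos_le_divide_eq)
    have v'1: "0 \<le> v'" "v' \<le> 1" using ly lz' den by (auto simp: v'_def)
    define y' where "y' = (1 - v') *\<^sub>R y + v' *\<^sub>R z"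
    have "y' \<in> convex hull S" unfolding y'_def
      by (rule convexD[OF convex_convex_hull]) (use v'1 y z sub in auto)
    moreover have "wl \<bullet> y' + cl = (1 - v') * (wl \<bullet> y + cl) + v' * (wl \<bullet> z + cl)"
      unfolding y'_def by (simp add: inner_add_right algebra_simps)
    then have "wl \<bullet> y' + cl = 0" using v' by (simp add: algebra_simps)
    ultimately have y'A: "y' \<in> convex hull ?A" using chord segA by blast
    have r: "v / v' * v' = v" using v vv by simp
    have "(1 - v / v') *\<^sub>R y + (v / v') *\<^sub>R y' = (1 - v / v' * v') *\<^sub>R y + (v / v' * v') *\<^sub>R z"
      unfolding y'_def by (simp add: algebra_simps)
    also have "\<dots> = x" unfolding r uv(4) u ..
    finally have "x = (1 - v / v') *\<^sub>R y + (v / v') *\<^sub>R y'" by simp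
    then show ?thesis using convexD[OF convex_convex_hull y y'A, of "1 - v / v'" "v / v'"] v vv by simp
  qed
qed

text \<open>Rotation by a right angle. \<open>perp (q - p) \<bullet> (x - p)\<close> is the
  determinant of \<open>q - p\<close> and \<open>x - p\<close>, twice the signed area of the
  triangle \<open>p\<close>, \<open>q\<close>, \<open>x\<close>; its sign tells the side of the line
  through \<open>p\<close> and \<open>q\<close>.\<close>

definition perp :: "real \<times> real \<Rightarrow> real \<times> real" where "perp d = (- snd d, fst d)"

lemma perp_parallel:
  assumes "d \<noteq> 0" "v \<bullet> d = 0"
  shows "\<exists>\<gamma>. v = \<gamma> *\<^sub>R perp d"
proof -
  obtain d1 d2 v1 v2 where dv: "d = (d1, d2)" "v = (v1, v2)" by (cases d, cases v) auto
  have o: "v1 * d1 + v2 * d2 = 0" using assms by (simp add: dv)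
  have n: "d1 * d1 + d2 * d2 \<noteq> 0" using assms by (auto simp: dv zero_prod_def sum_squares_eq_zero_iff)
  define \<gamma> where "\<gamma> = (v2 * d1 - v1 * d2) / (d1 * d1 + d2 * d2)"
  have g: "\<gamma> * (d1 * d1 + d2 * d2) = v2 * d1 - v1 * d2" using n by (simp add: \<gamma>_def)
  have "(v1 + \<gamma> * d2) * (d1 * d1 + d2 * d2) = 0" "(v2 - \<gamma> * d1) * (d1 * d1 + d2 * d2) = 0"
    using g o by algebra+
  then have "v1 = - (\<gamma> * d2)" "v2 = \<gamma> * d1" using n by auto
  then show ?thesis by (auto simp: dv perp_def)
qed

lemma perp_inner_self [simp]: "perp d \<bullet> d = 0"
  by (cases d) (simp add: perp_def)

text \<open>With points of \<open>P\<close> on both sides, the line through \<open>p\<close> and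
  \<open>q\<close> contains an interior point \<open>o'\<close>. A point of \<open>P\<close> on the
  line beyond \<open>p\<close> or \<open>q\<close> would put that boundary point between it and
  \<open>o'\<close>, hence into the interior.\<close>

lemma chord_eq_segment:
  fixes P :: "(real \<times> real) set"
  assumes P: "convex P" "interior P \<noteq> {}" and pq: "p \<in> P" "q \<in> P" "p \<noteq> q" "p \<notin> interior P" "q \<notin> interior P"
    and s: "s1 \<in> P" "0 < perp (q - p) \<bullet> (s1 - p)" "s2 \<in> P" "perp (q - p) \<bullet> (s2 - p) < 0"
    and x: "x \<in> P" "perp (q - p) \<bullet> (x - p) = 0"
  shows "x \<in> closed_segment p q"
proof -
  let ?l = "\<lambda>x. perp (q - p) \<bullet> (x - p)"
  have shrink: "y \<in> interior P" if "z \<in> P" "o' \<in> interior P" "0 < e" "e \<le> 1" "y = z - e *\<^sub>R (z - o')" for y z o' e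
    using mem_interior_convex_shrink[OF P(1) that(2,1,3,4)] that(5) by simp
  obtain i0 where i0: "i0 \<in> interior P" using P by auto
  \<comment> \<open>From an interior point \<open>i0\<close> off the line one moves towards a point
    of \<open>P\<close> on the other side; where the line is met the point is still
    interior.\<close>
  have "\<exists>o'\<in>interior P. ?l o' = 0"
  proof (cases "?l i0 = 0")
    case False
    obtain z where z: "z \<in> P" "?l z * ?l i0 < 0"
      using s False by (cases "0 < ?l i0") (auto simp: mult_neg_pos mult_pos_neg intro: that)
    define e where "e = ?l z / (?l z - ?l i0)"
    have ne: "?l z - ?l i0 \<noteq> 0" using z(2) by (auto simp: mult_less_0_iff)
    have e: "0 < e" "e \<le> 1" using z(2) by (auto simp: e_def mult_less_0_iff field_simps zero_less_divide_iff)
    have ee: "e * (?l z - ?l i0) = ?l z" using ne by (simp add: e_def)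
    have "?l (z - e *\<^sub>R (z - i0)) = ?l z - e * (?l z - ?l i0)"
      by (simp add: inner_diff_right algebra_simps)
    then have "?l (z - e *\<^sub>R (z - i0)) = 0" using ee by simp
    then show ?thesis using shrink[OF z(1) i0 e refl] by blast
  qed (use i0 in auto)
  then obtain o' where o': "o' \<in> interior P" "?l o' = 0" by blast
  have oP: "o' \<in> P" using o'(1) interior_subset by blast
  have dn: "perp (q - p) \<noteq> 0" using pq(3) by (auto simp: perp_def zero_prod_def prod_eq_iff)
  have param: "\<exists>\<tau>. y = p + \<tau> *\<^sub>R (q - p)" if "?l y = 0" for y
  proof -
    have "(y - p) \<bullet> perp (q - p) = 0" using that by (simp add: inner_commute)
    from perp_parallel[OF dn this] obtain g where "y - p = g *\<^sub>R perp (perp (q - p))" by blast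
    then have "y = p + (- g) *\<^sub>R (q - p)" by (simp add: perp_def prod_eq_iff algebra_simps)
    then show ?thesis by blast
  qed
  obtain t where t: "x = p + t *\<^sub>R (q - p)" using param x by blast
  obtain r where r: "o' = p + r *\<^sub>R (q - p)" using param o' by blast
  \<comment> \<open>If \<open>o'\<close> were at or beyond \<open>p\<close>, then \<open>p\<close>
    would be interior as a point between \<open>o'\<close> and \<open>q\<close>. The same argument
    gives the bounds \<open>r < 1\<close>, \<open>t \<le> 1\<close> and
    \<open>0 \<le> t\<close>.\<close>
  have r0: "0 < r"
  proof (rule ccontr)
    assume n: "\<not> 0 < r"
    have "p = q - (1 / (1 - r)) *\<^sub>R (q - o')"
    proof -
      have "q - o' = (1 - r) *\<^sub>R (q - p)" by (simp add: r algebra_simps)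
      then show ?thesis using n by simp
    qed
    then have "p \<in> interior P" by (rule shrink[OF pq(2) o'(1), rotated 2]) (use n in auto)
    then show False using pq by simp
  qed
  have r1: "r < 1"
  proof (rule ccontr)
    assume n: "\<not> r < 1"
    have "q = p - (1 / r) *\<^sub>R (p - o')"
    proof -
      have "p - o' = (- r) *\<^sub>R (q - p)" by (simp add: r algebra_simps)
      then show ?thesis using n by simp
    qed
    then have "q \<in> interior P" by (rule shrink[OF pq(1) o'(1), rotated 2]) (use n in auto)
    then show False using pq by simp
  qed
  have xo: "x - o' = (t - r) *\<^sub>R (q - p)" by (simp add: r t algebra_simps)
  have t1: "t \<le> 1"
  proof (rule ccontr)
    assume n: "\<not> t \<le> 1"
    have "q = x - ((t - 1) / (t - r)) *\<^sub>R (x - o')"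
    proof -
      have "((t - 1) / (t - r)) * (t - r) = t - 1" using n r1 by simp
      then have "((t - 1) / (t - r)) *\<^sub>R (x - o') = (t - 1) *\<^sub>R (q - p)" unfolding xo scaleR_scaleR by simp
      then show ?thesis by (simp add: t algebra_simps)
    qed
    then have "q \<in> interior P" by (rule shrink[OF x(1) o'(1), rotated 2]) (use n r1 in auto)
    then show False using pq by simp
  qed
  have t0: "0 \<le> t"
  proof (rule ccontr)
    assume n: "\<not> 0 \<le> t"
    have "p = x - (t / (t - r)) *\<^sub>R (x - o')"
      using n r0 unfolding xo by (simp add: t)
    then have "p \<in> interior P"
      by (rule shrink[OF x(1) o'(1), rotated 2]) (use n r0 in \<open>auto simp: zero_less_divide_iff divide_le_eq_1\<close>)
    then show False using pq by simp
  qed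
  have "x = (1 - t) *\<^sub>R p + t *\<^sub>R q" by (simp add: t algebra_simps)
  then show ?thesis using t0 t1 by (auto simp: in_segment)
qed

text \<open>The affine continuation agrees with the minorant given by \<open>ua\<close> and
  \<open>ca\<close> at \<open>p\<close> and \<open>q\<close>, so the two differ by a multiple of
  \<open>n \<bullet> (x - p)\<close>. Near the midpoint, on the positive side, the continuation
  equals \<open>F\<close> and is thus not below the minorant; this gives the sign of
  \<open>\<gamma>\<close>.\<close>

lemma crease_glue_affine:
  fixes n :: "real \<times> real"
  assumes F: "crease F"
    and P: "convex P" "p \<in> P" "q \<in> P" "z \<in> P" and pq: "p \<noteq> q"
    and n: "n \<bullet> (q - p) = 0"
    and chord: "\<And>x. x \<in> P \<Longrightarrow> n \<bullet> (x - p) = 0 \<Longrightarrow> x \<in> closed_segment p q"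
    and z: "0 < n \<bullet> (z - p)" and m: "m = (1 / 2) *\<^sub>R (p + q)"
    and eq: "F p = ua \<bullet> p + ca" "F q = ua \<bullet> q + ca" "F m = ua \<bullet> m + ca"
    and A: "convex A" "m \<in> A" "z \<in> A" "\<And>x. x \<in> A \<Longrightarrow> ua \<bullet> x + ca \<le> F x"
  shows "\<exists>G \<gamma>. crease G \<and> 0 \<le> \<gamma> \<and> (\<forall>x\<in>P. 0 \<le> n \<bullet> (x - p) \<longrightarrow> G x = F x) \<and>
    (\<forall>x\<in>P. n \<bullet> (x - p) \<le> 0 \<longrightarrow> G x = ua \<bullet> x + ca + \<gamma> * (n \<bullet> (x - p)))"
proof -
  have l: "n \<bullet> x + - (n \<bullet> p) = n \<bullet> (x - p)" for x by (simp add: inner_diff_right)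
  have Fm: "F m = (F p + F q) / 2" unfolding eq by (simp add: m inner_add_right field_simps)
  have "\<exists>G u c. crease G \<and> (\<forall>x\<in>P. 0 \<le> n \<bullet> x + - (n \<bullet> p) \<longrightarrow> G x = F x) \<and>
    (\<forall>x\<in>P. n \<bullet> x + - (n \<bullet> p) \<le> 0 \<longrightarrow> G x = u \<bullet> x + c) \<and>
    (\<exists>\<delta>>0. \<forall>t. 0 \<le> t \<longrightarrow> t \<le> \<delta> \<longrightarrow> F (m + t *\<^sub>R (z - m)) = u \<bullet> (m + t *\<^sub>R (z - m)) + c)"
  proof (rule crease_glue[OF F P _ _ m Fm])
    fix x assume "x \<in> P" "n \<bullet> x + - (n \<bullet> p) = 0"
    then show "x \<in> closed_segment p q" unfolding l by (rule chord)
  qed (simp only: l z)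
  then obtain G u c \<delta> where G: "crease G" "\<And>x. x \<in> P \<Longrightarrow> 0 \<le> n \<bullet> (x - p) \<Longrightarrow> G x = F x"
    "\<And>x. x \<in> P \<Longrightarrow> n \<bullet> (x - p) \<le> 0 \<Longrightarrow> G x = u \<bullet> x + c"
    and \<delta>: "0 < \<delta>" "\<And>t. 0 \<le> t \<Longrightarrow> t \<le> \<delta> \<Longrightarrow> F (m + t *\<^sub>R (z - m)) = u \<bullet> (m + t *\<^sub>R (z - m)) + c"
    unfolding l by blast
  have "G p = ua \<bullet> p + ca" "G p = u \<bullet> p + c" using G(2)[OF P(2)] G(3)[OF P(2)] eq by auto
  moreover have "G q = ua \<bullet> q + ca" "G q = u \<bullet> q + c" using G(2)[OF P(3)] G(3)[OF P(3)] eq n by auto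
  ultimately have up: "(u - ua) \<bullet> p + (c - ca) = 0" and uq: "(u - ua) \<bullet> (q - p) = 0"
    by (auto simp: inner_diff_left inner_diff_right)
  obtain g1 where g1: "u - ua = g1 *\<^sub>R perp (q - p)" using perp_parallel[OF _ uq] pq by auto
  obtain g2 where g2: "n = g2 *\<^sub>R perp (q - p)" using perp_parallel[OF _ n] pq by auto
  have g20: "g2 \<noteq> 0" using z g2 by auto
  define \<gamma> where "\<gamma> = g1 / g2"
  have un: "u - ua = \<gamma> *\<^sub>R n" using g1 g2 g20 by (simp add: \<gamma>_def)
  have lin: "u \<bullet> x + c = ua \<bullet> x + ca + \<gamma> * (n \<bullet> (x - p))" for x
  proof -
    have "(u - ua) \<bullet> (x - p) = \<gamma> * (n \<bullet> (x - p))" unfolding un by simp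
    then show ?thesis using up by (simp add: inner_diff_left inner_diff_right)
  qed
  define t where "t = min \<delta> 1"
  have t: "0 < t" "t \<le> \<delta>" "t \<le> 1" using \<delta>(1) by (auto simp: t_def)
  define xt where "xt = m + t *\<^sub>R (z - m)"
  have "xt = (1 - t) *\<^sub>R m + t *\<^sub>R z" by (simp add: xt_def algebra_simps)
  then have "xt \<in> A" using convexD[OF A(1-3), of "1 - t" t] t by simp
  then have "0 \<le> \<gamma> * (n \<bullet> (xt - p))" using A(4)[of xt] \<delta>(2)[of t] t lin[of xt] by (simp add: xt_def)
  moreover have "n \<bullet> (m - p) = 0"
  proof -
    have "m - p = (1 / 2) *\<^sub>R (q - p)" by (simp add: m prod_eq_iff)
    then show ?thesis using n by simp
  qed
  then have "n \<bullet> (xt - p) = t * (n \<bullet> (z - p))"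
    by (simp add: xt_def inner_add_right inner_diff_right algebra_simps)
  then have "0 < n \<bullet> (xt - p)" using t z by simp
  ultimately have "0 \<le> \<gamma>" by (simp add: zero_le_mult_iff)
  then show ?thesis using G lin by (intro exI[of _ G] exI[of _ \<gamma>]) auto
qed

text \<open>A convex function on a polygon is dominated by the lower convex envelope of its values at
  boundary points. The envelope is piecewise affine along non-crossing chords, hence a sum of an affine
  function and of positive parts of affine functions. The induction splits the polygon along a chord on
  which the envelope is affine.\<close>

theorem crease_envelope:
  fixes S :: "(real \<times> real) set"
  assumes f: "convex_on UNIV f"
    and S: "finite S" "S \<inter> interior (convex hull S) = {}" "interior (convex hull S) \<noteq> {}"
  shows "\<exists>F. crease F \<and> (\<forall>s\<in>S. F s \<le> f s) \<and>
    (\<forall>h. convex_on UNIV h \<longrightarrow> (\<forall>s\<in>S. h s \<le> f s) \<longrightarrow> (\<forall>x\<in>convex hull S. h x \<le> F x))"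
  using S
proof (induction S rule: finite_psubset_induct)
  case (psubset S)
  let ?P = "convex hull S"
  have bd: "s \<notin> interior ?P" if "s \<in> S" for s using psubset.prems that by auto
  have SP: "S \<subseteq> ?P" by (rule hull_subset)
  obtain x where x: "x \<in> interior ?P" using psubset.prems by auto
  obtain ua ca where low: "\<And>s. s \<in> S \<Longrightarrow> ua \<bullet> s + ca \<le> f s"
    and xT: "x \<in> convex hull {s \<in> S. ua \<bullet> s + ca = f s}"
    using affine_minorant_touching[OF psubset.hyps(1) x, of f] by blast
  define T where "T = {s \<in> S. ua \<bullet> s + ca = f s}"
  show ?case
  \<comment> \<open>Either two contact points span a chord with points of \<open>S\<close> strictly
    on both sides, and the polygon is split there, or every line through two contact points supports
    the polygon.\<close>
  proof (cases "\<exists>p\<in>T. \<exists>q\<in>T. p \<noteq> q \<and> (\<exists>s1\<in>S. \<exists>s2\<in>S. 0 < perp (q - p) \<bullet> (s1 - p) \<and> perp (q - p) \<bullet> (s2 - p) < 0)")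
    case True
    then obtain p q s1 s2 where pq: "p \<in> T" "q \<in> T" "p \<noteq> q" and s: "s1 \<in> S" "s2 \<in> S"
      "0 < perp (q - p) \<bullet> (s1 - p)" "perp (q - p) \<bullet> (s2 - p) < 0" by blast
    define n where "n = perp (q - p)"
    have pqS: "p \<in> S" "q \<in> S" "ua \<bullet> p + ca = f p" "ua \<bullet> q + ca = f q" using pq by (auto simp: T_def)
    define m where "m = (1 / 2) *\<^sub>R (p + q)"
    have chord: "y \<in> closed_segment p q" if "y \<in> ?P" "n \<bullet> (y - p) = 0" for y
      by (rule chord_eq_segment[of ?P p q s1 s2])
        (use that SP pqS pq s bd psubset.prems in \<open>auto simp: n_def\<close>)
    have mseg: "m \<in> closed_segment p q"
      unfolding m_def in_segment by (intro exI[of _ "1/2"]) (auto simp: scaleR_add_right)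
    \<comment> \<open>What the induction gives on the side where \<open>v\<close> is nonnegative:
      the envelope \<open>F\<close> there, and a crease \<open>G\<close> that continues it affinely
      across the chord and differs from the minorant by the slope \<open>\<gamma>\<close>.\<close>
    define good where "good v F G \<gamma> \<longleftrightarrow> (\<forall>s\<in>S. 0 \<le> v \<bullet> (s - p) \<longrightarrow> F s \<le> f s) \<and>
        (\<forall>h. convex_on UNIV h \<longrightarrow> (\<forall>s\<in>S. h s \<le> f s) \<longrightarrow> (\<forall>y\<in>?P. 0 \<le> v \<bullet> (y - p) \<longrightarrow> h y \<le> F y)) \<and>
        crease G \<and> 0 \<le> \<gamma> \<and> (\<forall>x\<in>?P. 0 \<le> v \<bullet> (x - p) \<longrightarrow> G x = F x) \<and>
        (\<forall>x\<in>?P. v \<bullet> (x - p) \<le> 0 \<longrightarrow> G x = ua \<bullet> x + ca + \<gamma> * (v \<bullet> (x - p)))" for v F G \<gamma>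
    have side: "\<exists>F G \<gamma>. good v F G \<gamma>"
      if v: "v = n \<or> v = - n" and z: "z1 \<in> S" "z2 \<in> S" "0 < v \<bullet> (z1 - p)" "v \<bullet> (z2 - p) < 0" for v z1 z2
    proof -
      define S1 where "S1 = {s \<in> S. 0 \<le> v \<bullet> (s - p)}"
      have vq: "v \<bullet> (q - p) = 0" using v by (auto simp: n_def)
      have mem: "p \<in> S1" "q \<in> S1" "z1 \<in> S1" "z2 \<notin> S1" using pqS vq z by (auto simp: S1_def)
      have "S1 \<subseteq> S" by (auto simp: S1_def)
      then have S1S: "S1 \<subset> S" using mem z by blast
      have hS1: "convex hull S1 \<subseteq> ?P" using S1S by (intro hull_mono) auto
      have vchord: "y \<in> closed_segment p q" if "y \<in> ?P" "v \<bullet> (y - p) = 0" for y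
        using chord[OF that(1)] that(2) v by auto
      \<comment> \<open>A line containing the whole part would contain \<open>p\<close>,
        \<open>q\<close> and \<open>z1\<close>, but \<open>z1\<close> is strictly to one side of the
        chord.\<close>
      have int1: "interior (convex hull S1) \<noteq> {}"
      proof
        assume "interior (convex hull S1) = {}"
        then obtain a b where a: "a \<noteq> 0" "convex hull S1 \<subseteq> {y. a \<bullet> y = b}"
          using empty_interior_subset_hyperplane[OF convex_convex_hull] by blast
        have "a \<bullet> y = b" if "y \<in> S1" for y using subsetD[OF a(2) hull_inc[OF that]] by simp
        then have "a \<bullet> (q - p) = 0" "a \<bullet> (z1 - p) = 0" using mem by (auto simp: inner_diff_right)
        then obtain g where "a = g *\<^sub>R n" "g * (n \<bullet> (z1 - p)) = 0"
          using perp_parallel[of "q - p" a] pq unfolding n_def by force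
        moreover have "g \<noteq> 0" using a(1) calculation by auto
        ultimately have "n \<bullet> (z1 - p) = 0" by simp
        then show False using z(3) v by auto
      qed
      have "S1 \<inter> interior (convex hull S1) = {}"
        using bd S1S interior_mono[OF hS1] by blast
      from psubset.IH[OF S1S this int1] obtain F where F: "crease F" "\<And>s. s \<in> S1 \<Longrightarrow> F s \<le> f s"
        and dom: "\<And>h. convex_on UNIV h \<Longrightarrow> (\<forall>s\<in>S1. h s \<le> f s) \<Longrightarrow> (\<forall>x\<in>convex hull S1. h x \<le> F x)" by blast
      \<comment> \<open>The touching affine function is itself a convex minorant of the data, so the
        envelope dominates it. At \<open>p\<close> and \<open>q\<close> the two meet, and convexity
        of \<open>F\<close> forces equality at \<open>m\<close>.\<close>
      have ge: "ua \<bullet> y + ca \<le> F y" if "y \<in> convex hull S1" for y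
        using dom[OF convex_on_affine_form[of ua ca]] low S1S that by blast
      have h1: "p \<in> convex hull S1" "q \<in> convex hull S1" "z1 \<in> convex hull S1" using mem by (auto intro: hull_inc)
      have seg1: "closed_segment p q \<subseteq> convex hull S1" using h1 by (intro closed_segment_subset) auto
      have Fp: "F p = ua \<bullet> p + ca" using ge[OF h1(1)] F(2)[OF mem(1)] pqS by simp
      have Fq: "F q = ua \<bullet> q + ca" using ge[OF h1(2)] F(2)[OF mem(2)] pqS by simp
      have "F m \<le> (F p + F q) / 2"
        using convex_onD[OF convex_on_crease[OF F(1)], of "1/2" p q] by (simp add: m_def scaleR_add_right)
      also have "\<dots> = ua \<bullet> m + ca" by (simp add: Fp Fq m_def inner_add_right field_simps)
      finally have Fm: "F m = ua \<bullet> m + ca" using ge[of m] seg1 mseg by auto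
      have "\<exists>G \<gamma>. crease G \<and> 0 \<le> \<gamma> \<and> (\<forall>x\<in>?P. 0 \<le> v \<bullet> (x - p) \<longrightarrow> G x = F x) \<and>
          (\<forall>x\<in>?P. v \<bullet> (x - p) \<le> 0 \<longrightarrow> G x = ua \<bullet> x + ca + \<gamma> * (v \<bullet> (x - p)))"
        by (rule crease_glue_affine[OF F(1) convex_convex_hull, where q=q and z=z1 and m=m and A="convex hull S1"])
          (use SP pqS pq z vq vchord m_def Fp Fq Fm seg1 mseg h1 ge in auto)
      then obtain G \<gamma> where G: "crease G" "0 \<le> \<gamma>" "\<forall>x\<in>?P. 0 \<le> v \<bullet> (x - p) \<longrightarrow> G x = F x"
        "\<forall>x\<in>?P. v \<bullet> (x - p) \<le> 0 \<longrightarrow> G x = ua \<bullet> x + ca + \<gamma> * (v \<bullet> (x - p))" by blast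
      have hF: "h y \<le> F y" if h: "convex_on UNIV h" "\<forall>s\<in>S. h s \<le> f s" and y: "y \<in> ?P" "0 \<le> v \<bullet> (y - p)" for h y
      proof -
        have "y \<in> convex hull {s \<in> S. 0 \<le> v \<bullet> s + - (v \<bullet> p)}"
          by (rule convex_hull_halfspace_part[of p S v _ q])
            (use pqS vq vchord y in \<open>auto simp: inner_diff_right\<close>)
        also have "{s \<in> S. 0 \<le> v \<bullet> s + - (v \<bullet> p)} = S1" by (auto simp: S1_def inner_diff_right)
        finally show ?thesis using dom[OF h(1)] h(2) S1S by blast
      qed
      have "good v F G \<gamma>"
        unfolding good_def using F(2) hF G by (auto simp: S1_def)
      then show ?thesis by blast
    qed
    obtain F1 G1 \<gamma>1 where g1: "good n F1 G1 \<gamma>1"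
      using side[OF disjI1[OF refl] s(1,2)] s(3,4) unfolding n_def by blast
    have "0 < (- n) \<bullet> (s2 - p)" "(- n) \<bullet> (s1 - p) < 0" using s(3,4) by (simp_all add: n_def)
    from side[OF disjI2[OF refl] s(2,1) this] obtain F2 G2 \<gamma>2 where g2: "good (- n) F2 G2 \<gamma>2" by blast
    have F1: "F1 s \<le> f s" if "s \<in> S" "0 \<le> n \<bullet> (s - p)" for s using g1 that unfolding good_def by blast
    have F2: "F2 s \<le> f s" if "s \<in> S" "n \<bullet> (s - p) \<le> 0" for s using g2 that unfolding good_def by simp
    have h1: "h y \<le> F1 y" if "convex_on UNIV h" "\<forall>s\<in>S. h s \<le> f s" "y \<in> ?P" "0 \<le> n \<bullet> (y - p)" for h y
      using g1 that unfolding good_def by blast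
    have h2: "h y \<le> F2 y" if "convex_on UNIV h" "\<forall>s\<in>S. h s \<le> f s" "y \<in> ?P" "n \<bullet> (y - p) \<le> 0" for h y
      using g2 that unfolding good_def by simp
    have G1: "crease G1" "0 \<le> \<gamma>1" "\<And>x. x \<in> ?P \<Longrightarrow> 0 \<le> n \<bullet> (x - p) \<Longrightarrow> G1 x = F1 x"
      "\<And>x. x \<in> ?P \<Longrightarrow> n \<bullet> (x - p) \<le> 0 \<Longrightarrow> G1 x = ua \<bullet> x + ca + \<gamma>1 * (n \<bullet> (x - p))"
      using g1 unfolding good_def by simp_all
    have G2: "crease G2" "0 \<le> \<gamma>2" "\<And>x. x \<in> ?P \<Longrightarrow> n \<bullet> (x - p) \<le> 0 \<Longrightarrow> G2 x = F2 x"
      "\<And>x. x \<in> ?P \<Longrightarrow> 0 \<le> n \<bullet> (x - p) \<Longrightarrow> G2 x = ua \<bullet> x + ca - \<gamma>2 * (n \<bullet> (x - p))"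
      using g2 unfolding good_def by simp_all
    \<comment> \<open>Adding the two continuations counts the minorant twice and leaves slopes
      \<open>\<gamma>1\<close> and \<open>\<gamma>2\<close> across the chord. The affine correction
      and the two folds remove them, leaving \<open>F1\<close> on one side and \<open>F2\<close> on
      the other; since \<open>\<gamma>1\<close> and \<open>\<gamma>2\<close> are nonnegative, each
      fold is inactive on the opposite side.\<close>
    define w where "w = (\<gamma>2 - \<gamma>1) *\<^sub>R n - ua"
    define c where "c = - ca - (\<gamma>2 - \<gamma>1) * (n \<bullet> p)"
    define F where "F = (\<lambda>x. ((G1 x + G2 x) + (w \<bullet> x + c)) + (max 0 ((\<gamma>1 *\<^sub>R n) \<bullet> x + - (\<gamma>1 * (n \<bullet> p))) + max 0 ((- \<gamma>2 *\<^sub>R n) \<bullet> x + \<gamma>2 * (n \<bullet> p))))"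
    have cF: "crease F" unfolding F_def by (intro crease.intros G1 G2)
    have Feq: "F x = ((G1 x + G2 x) - (ua \<bullet> x + ca) + (\<gamma>2 - \<gamma>1) * (n \<bullet> (x - p))) + (max 0 (\<gamma>1 * (n \<bullet> (x - p))) + max 0 (- (\<gamma>2 * (n \<bullet> (x - p)))))" for x
      by (simp add: F_def w_def c_def inner_diff_right inner_diff_left algebra_simps)
    have Fpos: "F x = F1 x" if "x \<in> ?P" "0 \<le> n \<bullet> (x - p)" for x
    proof -
      have "0 \<le> \<gamma>1 * (n \<bullet> (x - p))" "0 \<le> \<gamma>2 * (n \<bullet> (x - p))" using G1(2) G2(2) that(2) by auto
      then show ?thesis unfolding Feq G1(3)[OF that] G2(4)[OF that] left_diff_distrib by linarith
    qed
    have Fneg: "F x = F2 x" if "x \<in> ?P" "n \<bullet> (x - p) \<le> 0" for x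
    proof -
      have "\<gamma>1 * (n \<bullet> (x - p)) \<le> 0" "\<gamma>2 * (n \<bullet> (x - p)) \<le> 0"
        using G1(2) G2(2) that(2) by (auto simp: mult_nonneg_nonpos)
      then show ?thesis unfolding Feq G1(4)[OF that] G2(3)[OF that] left_diff_distrib by linarith
    qed
    show ?thesis
    proof (intro exI[of _ F] conjI cF ballI allI impI)
      fix s assume "s \<in> S"
      then show "F s \<le> f s" using Fpos[of s] Fneg[of s] F1[of s] F2[of s] SP
        by (cases "0 \<le> n \<bullet> (s - p)") auto
    next
      fix h y assume "convex_on UNIV h" "\<forall>s\<in>S. h s \<le> f s" "y \<in> ?P"
      then show "h y \<le> F y" using Fpos[of y] Fneg[of y] h1[of h y] h2[of h y]
        by (cases "0 \<le> n \<bullet> (y - p)") auto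
    qed
  next
    case False
    then have one: "(\<forall>s\<in>S. 0 \<le> perp (q - p) \<bullet> (s - p)) \<or> (\<forall>s\<in>S. perp (q - p) \<bullet> (s - p) \<le> 0)"
      if "p \<in> T" "q \<in> T" "p \<noteq> q" for p q using that by (meson not_le)
    have TS: "T \<subseteq> S" by (auto simp: T_def)
    have xT': "x \<in> convex hull T" using xT by (simp add: T_def)
    then have "T \<noteq> {}" by auto
    then obtain p where p: "p \<in> T" by blast
    have "\<exists>q\<in>T. q \<noteq> p"
    proof (rule ccontr)
      assume "\<not> ?thesis"
      then have "T = {p}" using p by blast
      then have "x = p" using xT' by simp
      then show False using bd[of p] x p TS by blast
    qed
    then obtain q where q: "q \<in> T" "q \<noteq> p" by blast
    \<comment> \<open>If all contact points were on the line through \<open>p\<close> and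
      \<open>q\<close>, then \<open>x\<close>, a convex combination of them, would lie on a
      supporting line of the polygon, although it is interior.\<close>
    have "\<exists>r\<in>T. perp (q - p) \<bullet> (r - p) \<noteq> 0"
    proof (rule ccontr)
      assume "\<not> ?thesis"
      then have "T \<subseteq> {y. perp (q - p) \<bullet> y = perp (q - p) \<bullet> p}" by (auto simp: inner_diff_right)
      then have "convex hull T \<subseteq> {y. perp (q - p) \<bullet> y = perp (q - p) \<bullet> p}"
        by (intro hull_minimal convex_hyperplane)
      then have xe: "perp (q - p) \<bullet> x = perp (q - p) \<bullet> p" using xT' by auto
      have nz: "perp (q - p) \<noteq> 0" using q(2) by (auto simp: perp_def zero_prod_def prod_eq_iff)
      from one[OF p q(1) q(2)[symmetric]] show False
      proof
        assume "\<forall>s\<in>S. perp (q - p) \<bullet> (s - p) \<le> 0" 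
        then have "S \<subseteq> {y. perp (q - p) \<bullet> y \<le> perp (q - p) \<bullet> p}" by (auto simp: inner_diff_right)
        then have "?P \<subseteq> {y. perp (q - p) \<bullet> y \<le> perp (q - p) \<bullet> p}" by (intro hull_minimal convex_halfspace_le)
        from interior_mono[OF this] show False using x nz xe by auto
      next
        assume "\<forall>s\<in>S. 0 \<le> perp (q - p) \<bullet> (s - p)"
        then have "S \<subseteq> {y. perp (q - p) \<bullet> y \<ge> perp (q - p) \<bullet> p}" by (auto simp: inner_diff_right)
        then have "?P \<subseteq> {y. perp (q - p) \<bullet> y \<ge> perp (q - p) \<bullet> p}" by (intro hull_minimal convex_halfspace_ge)
        from interior_mono[OF this] show False using x nz xe by auto
      qed
    qed
    then obtain r where r: "r \<in> T" "perp (q - p) \<bullet> (r - p) \<noteq> 0" by blast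
    have qr: "q \<noteq> r" "p \<noteq> r" using r(2) by auto
    define D where "D = perp (q - p) \<bullet> (r - p)"
    have cyc: "perp (r - q) \<bullet> (p - q) = D" "perp (p - r) \<bullet> (q - r) = D"
      by (auto simp: D_def perp_def inner_prod_def algebra_simps)
    have D0: "D \<noteq> 0" using r(2) by (simp add: D_def)
    have sign: "0 \<le> (perp (v - u) \<bullet> (s - u)) / D" if uv: "u \<in> T" "v \<in> T" "u \<noteq> v" "w \<in> S" "perp (v - u) \<bullet> (w - u) = D" and s: "s \<in> S" for u v w s
      using one[OF uv(1,2,3)]
    proof
      assume "\<forall>s\<in>S. 0 \<le> perp (v - u) \<bullet> (s - u)"
      then have "0 \<le> D" "0 \<le> perp (v - u) \<bullet> (s - u)" using uv s by auto
      then show ?thesis by simp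
    next
      assume "\<forall>s\<in>S. perp (v - u) \<bullet> (s - u) \<le> 0"
      then have "D \<le> 0" "perp (v - u) \<bullet> (s - u) \<le> 0" using uv s by auto
      then show ?thesis by (simp add: divide_nonpos_nonpos)
    qed
    \<comment> \<open>The three signed areas divided by \<open>D\<close> are the barycentric
      coordinates of \<open>s\<close> in the triangle \<open>p\<close>, \<open>q\<close>,
      \<open>r\<close>. They are nonnegative because the sides of the triangle support the polygon,
      and convexity of \<open>f\<close> bounds \<open>f s\<close> by the affine value.\<close>
    have fa: "f s = ua \<bullet> s + ca" if s: "s \<in> S" for s
    proof -
      define l1 l2 l3 where "l1 = perp (r - q) \<bullet> (s - q) / D" and "l2 = perp (p - r) \<bullet> (s - r) / D" and "l3 = perp (q - p) \<bullet> (s - p) / D"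
      have nn: "0 \<le> l1" "0 \<le> l2" "0 \<le> l3"
        unfolding l1_def l2_def l3_def
        using sign[OF q(1) r(1) qr(1) _ cyc(1) s] sign[OF r(1) p qr(2)[symmetric] _ cyc(2) s]
          sign[OF p q(1) q(2)[symmetric] _ D_def[symmetric] s] p q(1) r(1) TS by blast+
      have "perp (r - q) \<bullet> (s - q) + perp (p - r) \<bullet> (s - r) + perp (q - p) \<bullet> (s - p) = D"
        by (simp add: D_def perp_def inner_prod_def algebra_simps)
      then have sum: "l1 + l2 + l3 = 1" using D0 unfolding l1_def l2_def l3_def by (simp flip: add_divide_distrib)
      have "D *\<^sub>R s = (perp (r - q) \<bullet> (s - q)) *\<^sub>R p + (perp (p - r) \<bullet> (s - r)) *\<^sub>R q + (perp (q - p) \<bullet> (s - p)) *\<^sub>R r"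
        by (simp add: D_def perp_def inner_prod_def prod_eq_iff algebra_simps)
      then have "(1 / D) *\<^sub>R (D *\<^sub>R s) = l1 *\<^sub>R p + l2 *\<^sub>R q + l3 *\<^sub>R r"
        unfolding l1_def l2_def l3_def by (simp add: scaleR_add_right)
      then have se: "s = l1 *\<^sub>R p + l2 *\<^sub>R q + l3 *\<^sub>R r" using D0 by simp
      have "f s \<le> l1 * f p + l2 * f q + l3 * f r"
      proof -
        have "f (\<Sum>i\<in>{0::nat,1,2}. (if i = 0 then l1 else if i = 1 then l2 else l3) *\<^sub>R (if i = 0 then p else if i = 1 then q else r))
           \<le> (\<Sum>i\<in>{0::nat,1,2}. (if i = 0 then l1 else if i = 1 then l2 else l3) * f (if i = 0 then p else if i = 1 then q else r))"
          by (rule convex_on_sum[OF _ _ f]) (use nn sum in auto)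
        then show ?thesis by (simp add: se add.assoc)
      qed
      also have "\<dots> = l1 * (ua \<bullet> p + ca) + l2 * (ua \<bullet> q + ca) + l3 * (ua \<bullet> r + ca)"
        using p q r by (simp add: T_def)
      also have "\<dots> = ua \<bullet> s + (l1 + l2 + l3) * ca" by (simp add: se inner_add_right algebra_simps)
      finally show ?thesis using low[OF s] sum by simp
    qed
    show ?thesis
    proof (intro exI[of _ "\<lambda>x. ua \<bullet> x + ca"] conjI crease.affine ballI allI impI)
      fix h y assume h: "convex_on UNIV h" "\<forall>s\<in>S. h s \<le> f s" and y: "y \<in> ?P"
      have "convex_on UNIV (\<lambda>x. h x + ((- ua) \<bullet> x + (- ca)))" by (intro convex_on_add h convex_on_affine_form)
      then have "convex_on ?P (\<lambda>x. h x + ((- ua) \<bullet> x + (- ca)))" by (rule convex_on_subset) auto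
      moreover have "\<forall>s\<in>S. h s + ((- ua) \<bullet> s + (- ca)) \<le> 0" using h(2) fa by auto
      ultimately have "\<forall>y\<in>?P. h y + ((- ua) \<bullet> y + (- ca)) \<le> 0" by (rule convex_on_convex_hull_bound)
      then show "h y \<le> ua \<bullet> y + ca" using y by force
    qed (simp add: fa)
  qed
qed

declare One_nat_def [simp del]

section \<open>From folds to convex functions in the plane\<close>

lemma convex_order_crease:
  fixes K :: "(real \<times> real) set"
  assumes K: "compact K" "convex K" "interior K \<noteq> {}"
    and ha: "hausdorff_additive 1 TYPE(real \<times> real)" and fin: "hausdorff_outer 1 (frontier K) < \<infinity>"
    and mean: "(\<integral>x. x \<partial>uniform_measure lborel K) = (\<integral>x. x \<partial>uniform_measure (hausdorff_measure 1) (frontier K))"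
    and F: "crease F"
  shows "(\<integral>x. F x \<partial>uniform_measure lborel K) \<le> (\<integral>x. F x \<partial>uniform_measure (hausdorff_measure 1) (frontier K))"
proof -
  interpret P: planar_body_perimeter K by standard (use K ha fin in auto)
  interpret N: prob_space P.\<nu> by (rule P.prob_spaces)
  interpret M: prob_space P.\<mu> by (rule P.prob_spaces)
  have int: "integrable P.\<nu> f" "integrable P.\<mu> f" if "continuous_on UNIV f" for f :: "real \<times> real \<Rightarrow> 'x::euclidean_space"
    using integrable_continuous_compact_support[OF N.finite_measure_axioms _ P.AE_in_K(1) K(1) that]
      integrable_continuous_compact_support[OF M.finite_measure_axioms _ P.AE_in_K(2) K(1) that] by auto
  note ids = int[OF continuous_on_id]
  show ?thesis using F
  proof (induction rule: crease.induct)
    case (affine w c)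
    have "(\<integral>x. w \<bullet> x + c \<partial>P.\<mu>) = w \<bullet> (\<integral>x. x \<partial>P.\<mu>) + c"
      using ids M.prob_space by (simp add: integral_inner_right)
    moreover have "(\<integral>x. w \<bullet> x + c \<partial>P.\<nu>) = w \<bullet> (\<integral>x. x \<partial>P.\<nu>) + c"
      using ids N.prob_space by (simp add: integral_inner_right)
    ultimately show ?case using mean by simp
  next
    case (fold w c)
    show ?case by (rule planar_halfspace_excess[OF K ha fin mean])
  next
    case (add F G)
    then show ?case
      using int[OF continuous_on_crease[OF add(1)]] int[OF continuous_on_crease[OF add(2)]] by simp
  qed
qed

text \<open>The net is taken on the boundary of a slightly enlarged body, so that its convex hull contains
  \<open>K\<close> and every boundary point of \<open>K\<close> is a convex combination of a net point, with weight close to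
  \<open>1\<close>, and a point near the centre.\<close>

lemma crease_sandwich:
  fixes K :: "(real \<times> real) set"
  assumes K: "compact K" "convex K" and z: "cball z \<rho> \<subseteq> K" "0 < \<rho>"
    and f: "convex_on UNIV f" and \<epsilon>: "0 < \<epsilon>" "\<epsilon> \<le> 1" "\<epsilon> \<le> \<rho>"
    and R: "\<And>x. x \<in> K \<Longrightarrow> dist z x \<le> R" and M: "\<And>x. dist z x \<le> 2 * R \<Longrightarrow> \<bar>f x\<bar> \<le> M"
  shows "\<exists>F. crease F \<and> (\<forall>x\<in>K. f x \<le> F x) \<and>
    (\<forall>B\<in>frontier K. \<exists>s. dist z s \<le> 2 * R \<and> dist s B \<le> \<epsilon> * (R + 1) \<and> F B \<le> f s + 2 * \<epsilon> * M)"
proof -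
  define D where "D x = z + (1 + \<epsilon>) *\<^sub>R (x - z)" for x
  have zK: "z \<in> K" using z by auto
  have R0: "0 \<le> R" using R[OF zK] by simp
  have frK: "frontier K \<subseteq> K" using K by (simp add: compact_imp_closed frontier_subset_closed)
  have "compact (frontier K)" using K(1) by (rule compact_frontier)
  \<comment> \<open>The spacing is of second order in \<open>\<epsilon>\<close>: the dilation at
    most doubles it, and the resulting \<open>\<epsilon>\<^sup>2\<close> is absorbed by the
    enlargement, which moves every supporting line outwards by at least
    \<open>\<epsilon> * \<rho>\<close>.\<close>
  then obtain N where N: "finite N" "N \<subseteq> frontier K" "frontier K \<subseteq> (\<Union>x\<in>N. ball x (\<epsilon>\<^sup>2 / 2))"
    using compactE_image[of "frontier K" "frontier K" "\<lambda>x. ball x (\<epsilon>\<^sup>2 / 2)"] \<epsilon> by force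
  define S where "S = D ` N"
  have Deq: "D = (\<lambda>x. (- \<epsilon> *\<^sub>R z) + (1 + \<epsilon>) *\<^sub>R x)" unfolding D_def by (auto simp: algebra_simps)
  have Dimg: "D ` A = (+) (- \<epsilon> *\<^sub>R z) ` ((*\<^sub>R) (1 + \<epsilon>) ` A)" for A by (auto simp: Deq image_image)
  have DK: "convex (D ` K)" unfolding Dimg using K(2) by (intro convex_translation convex_scaling)
  have intD: "interior (D ` K) = D ` interior K"
    unfolding Dimg interior_translation using \<epsilon> interior_injective_linear_image[of "(*\<^sub>R) (1 + \<epsilon>)" K]
    by (simp add: inj_on_def)
  have injD: "inj D" using \<epsilon> by (auto simp: inj_on_def D_def)
  have NK: "N \<subseteq> K" using N frK by auto
  have hull: "convex hull S \<subseteq> D ` K" unfolding S_def using NK DK by (intro hull_minimal) auto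
  have S1: "S \<inter> interior (convex hull S) = {}"
  proof (rule ccontr)
    assume "S \<inter> interior (convex hull S) \<noteq> {}"
    then obtain y where "y \<in> S" "y \<in> interior (convex hull S)" by blast
    moreover then obtain x where x: "x \<in> N" "y = D x" unfolding S_def by blast
    ultimately have "x \<in> N" "D x \<in> interior (D ` K)" using interior_mono[OF hull] by blast+
    then have "x \<in> interior K" "x \<in> frontier K" using intD injD N by (auto simp: inj_image_mem_iff)
    then show False by (simp add: frontier_def)
  qed
  have Dd: "dist (D x) x \<le> \<epsilon> * R" if "x \<in> K" for x
  proof -
    have "D x - x = \<epsilon> *\<^sub>R (x - z)" by (simp add: D_def algebra_simps)
    then show ?thesis using R[OF that] \<epsilon> by (simp add: dist_norm norm_minus_commute mult_left_mono)
  qed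
  have Dz: "dist z (D x) \<le> 2 * R" if "x \<in> K" for x
  proof -
    have "dist z (D x) = (1 + \<epsilon>) * dist z x" using \<epsilon> by (simp add: D_def dist_norm norm_minus_commute)
    also have "\<dots> \<le> 2 * R" using \<epsilon> R[OF that] by (intro mult_mono) auto
    finally show ?thesis .
  qed
  have net: "\<exists>n\<in>N. dist n B < \<epsilon>\<^sup>2 / 2" if B: "B \<in> frontier K" for B
  proof -
    obtain n where "n \<in> N" "B \<in> ball n (\<epsilon>\<^sup>2 / 2)" using N(3) B by blast
    then show ?thesis by (intro bexI[of _ n]) auto
  qed
  have KS: "K \<subseteq> convex hull S"
  proof (rule ccontr)
    assume "\<not> ?thesis"
    then obtain x where x: "x \<in> K" "x \<notin> convex hull S" by auto
    have "closed (convex hull S)" unfolding S_def using N(1) by (intro compact_imp_closed finite_imp_compact_convex_hull) auto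
    then obtain w \<beta> where w: "w \<bullet> x < \<beta>" "\<And>y. y \<in> convex hull S \<Longrightarrow> \<beta> < w \<bullet> y"
      using separating_hyperplane_closed_point[of "convex hull S" x] x by auto
    \<comment> \<open>The separating functional is minimized over \<open>K\<close>. Its minimum is
      at a boundary point \<open>B\<close>, and a net point near \<open>B\<close> is carried by
      \<open>D\<close> to a value not above that of \<open>x\<close>, contrary to the
      separation.\<close>
    have "\<exists>B\<in>K. \<forall>y\<in>K. w \<bullet> B \<le> w \<bullet> y"
      by (rule continuous_attains_inf) (use K x in \<open>auto intro!: continuous_intros\<close>)
    then obtain B where B: "B \<in> K" "\<And>y. y \<in> K \<Longrightarrow> w \<bullet> B \<le> w \<bullet> y" by blast
    show False
    proof (cases "w = 0")
      case True
      have "frontier K \<noteq> {}" using K zK frontier_eq_empty[of K] compact_imp_bounded not_bounded_UNIV by auto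
      then obtain n where "n \<in> N" using net by blast
      then have "D n \<in> convex hull S" by (auto simp: S_def intro: hull_inc)
      from w(2)[OF this] show False using w(1) True by simp
    next
      case False
      have "B \<notin> interior K"
        by (rule not_interior_halfspace[of "- w" K "- (w \<bullet> B)"]) (use False B in auto)
      then have "B \<in> frontier K" using B K by (simp add: frontier_def compact_imp_closed)
      then obtain n where n: "n \<in> N" "dist n B < \<epsilon>\<^sup>2 / 2" using net by blast
      have "z - (\<rho> / norm w) *\<^sub>R w \<in> cball z \<rho>" using False z by (simp add: dist_norm)
      then have "w \<bullet> B \<le> w \<bullet> (z - (\<rho> / norm w) *\<^sub>R w)" using B z by blast
      then have wB: "w \<bullet> (B - z) \<le> - (\<rho> * norm w)"
        using False by (simp add: inner_diff_right power2_norm_eq_inner[symmetric] power2_eq_square)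
      have "norm (D n - D B) = (1 + \<epsilon>) * norm (n - B)"
      proof -
        have "D n - D B = (1 + \<epsilon>) *\<^sub>R (n - B)" by (simp add: D_def algebra_simps)
        then show ?thesis using \<epsilon> by simp
      qed
      also have "\<dots> \<le> 2 * (\<epsilon>\<^sup>2 / 2)" using \<epsilon> n(2) by (intro mult_mono) (auto simp: dist_norm)
      finally have "norm w * norm (D n - D B) \<le> norm w * \<epsilon>\<^sup>2" by (intro mult_left_mono) auto
      then have "w \<bullet> (D n - D B) \<le> norm w * \<epsilon>\<^sup>2" using norm_cauchy_schwarz[of w "D n - D B"] by linarith
      then have "w \<bullet> D n \<le> w \<bullet> D B + norm w * \<epsilon>\<^sup>2" by (simp only: inner_diff_right)
      also have "w \<bullet> D B = w \<bullet> B + \<epsilon> * (w \<bullet> (B - z))"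
        by (simp add: D_def inner_add_right inner_diff_right algebra_simps)
      also have "\<epsilon> * (w \<bullet> (B - z)) \<le> \<epsilon> * - (\<rho> * norm w)" using \<epsilon> wB by (intro mult_left_mono) auto
      finally have "w \<bullet> D n \<le> w \<bullet> B + norm w * (\<epsilon> * (\<epsilon> - \<rho>))" by (simp add: algebra_simps power2_eq_square)
      also have "norm w * (\<epsilon> * (\<epsilon> - \<rho>)) \<le> 0" using \<epsilon> by (intro mult_nonneg_nonpos) auto
      finally have "w \<bullet> D n \<le> w \<bullet> x" using B(2)[OF x(1)] by linarith
      moreover have "\<beta> < w \<bullet> D n" using n(1) by (intro w(2) hull_inc) (auto simp: S_def)
      ultimately show False using w(1) by linarith
    qed
  qed
  have "z \<in> interior K" using z by (auto simp: mem_interior_cball)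
  then have S2: "interior (convex hull S) \<noteq> {}" using interior_mono[OF KS] by auto
  have finS: "finite S" using N(1) by (simp add: S_def)
  obtain F where F: "crease F" "\<And>s. s \<in> S \<Longrightarrow> F s \<le> f s"
    and dom: "\<And>h. convex_on UNIV h \<Longrightarrow> (\<forall>s\<in>S. h s \<le> f s) \<Longrightarrow> (\<forall>x\<in>convex hull S. h x \<le> F x)"
    using crease_envelope[OF f finS S1 S2] by blast
  have fF: "f x \<le> F x" if "x \<in> K" for x using dom[OF f] KS that by auto
  have FM: "F s \<le> M" if "s \<in> S" for s
    using F(2)[OF that] M[OF Dz] that NK by (force simp: S_def)
  have "convex_on (convex hull S) F" by (rule convex_on_subset[OF convex_on_crease[OF F(1)]]) auto
  then have FMh: "F y \<le> M" if "y \<in> convex hull S" for y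
    using convex_on_convex_hull_bound[of S F M] FM that by blast
  have "\<exists>s. dist z s \<le> 2 * R \<and> dist s B \<le> \<epsilon> * (R + 1) \<and> F B \<le> f s + 2 * \<epsilon> * M" if B: "B \<in> frontier K" for B
  proof -
    obtain n where n: "n \<in> N" "dist n B < \<epsilon>\<^sup>2 / 2" using net B by blast
    have nK: "n \<in> K" using n NK by auto
    \<comment> \<open>This choice gives \<open>(1 - l) * (1 + \<epsilon>) = 1\<close>, so the weight
      \<open>1 - l\<close> undoes the dilation. The difference \<open>B - n\<close> is left to
      \<open>y\<close>, which is within \<open>\<epsilon> \<le> \<rho>\<close> of
      \<open>z\<close>.\<close>
    define l where "l = \<epsilon> / (1 + \<epsilon>)"
    have l: "0 < l" "l \<le> 1" "l \<le> \<epsilon>" "l * (1 + \<epsilon>) = \<epsilon>" using \<epsilon> by (auto simp: l_def field_simps)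
    define y where "y = z + (1 / l) *\<^sub>R (B - n)"
    have "dist z y = dist n B / l" using l by (simp add: y_def dist_norm norm_minus_commute)
    also have "\<dots> \<le> (\<epsilon>\<^sup>2 / 2) / l" using n(2) l by (intro divide_right_mono) auto
    also have "\<dots> = \<epsilon> * (1 + \<epsilon>) / 2" using \<epsilon> by (simp add: l_def field_simps power2_eq_square)
    also have "\<dots> \<le> \<epsilon>" using \<epsilon> mult_left_mono[of "1 + \<epsilon>" 2 \<epsilon>] by simp
    finally have "y \<in> cball z \<rho>" using \<epsilon> by simp
    then have yS: "y \<in> convex hull S" using z KS by blast
    have "(1 - l) *\<^sub>R D n = n - l *\<^sub>R z"
    proof -
      have c: "(1 - l) * (1 + \<epsilon>) = 1" using l(4) by (simp add: algebra_simps)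
      have "(1 - l) *\<^sub>R D n = (1 - l) *\<^sub>R z + ((1 - l) * (1 + \<epsilon>)) *\<^sub>R (n - z)"
        by (simp add: D_def scaleR_add_right)
      then show ?thesis unfolding c by (simp add: algebra_simps)
    qed
    moreover have "l *\<^sub>R y = l *\<^sub>R z + (B - n)" using l by (simp add: y_def scaleR_add_right)
    ultimately have Beq: "B = (1 - l) *\<^sub>R D n + l *\<^sub>R y" by simp
    have "F B \<le> (1 - l) * F (D n) + l * F y"
      unfolding Beq using convex_onD[OF convex_on_crease[OF F(1)], of l] l by simp
    also have "\<dots> \<le> (1 - l) * f (D n) + l * M"
      using l F(2)[of "D n"] FMh[OF yS] n by (intro add_mono mult_left_mono) (auto simp: S_def)
    also have "\<dots> = f (D n) + l * (M - f (D n))" by (simp add: algebra_simps)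
    also have "l * (M - f (D n)) \<le> \<epsilon> * (2 * M)"
      using l \<epsilon> M[OF Dz[OF nK]] by (intro mult_mono) auto
    finally have FB: "F B \<le> f (D n) + 2 * \<epsilon> * M" by simp
    have "dist (D n) B \<le> dist (D n) n + dist n B" by (rule dist_triangle)
    also have "\<dots> \<le> \<epsilon> * R + \<epsilon> * 1"
    proof -
      have "\<epsilon>\<^sup>2 / 2 \<le> \<epsilon> * 1" using \<epsilon> mult_left_mono[of \<epsilon> 1 \<epsilon>] by (simp add: power2_eq_square)
      then show ?thesis using Dd[OF nK] n(2) by linarith
    qed
    finally have "dist (D n) B \<le> \<epsilon> * (R + 1)" by (simp add: algebra_simps)
    then show ?thesis using FB Dz[OF nK] by blast
  qed
  then show ?thesis using F(1) fF by blast
qed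

text \<open>A crease \<open>F\<close> with \<open>f \<le> F\<close> on \<open>K\<close> and
  \<open>F \<le> f + \<eta>\<close> on the boundary transfers the inequality. The error is
  controlled by uniform continuity of \<open>f\<close> on the ball of radius \<open>2 * R\<close>,
  which contains the comparison points of the sandwich.\<close>

theorem planar_convex_order_prod:
  fixes K :: "(real \<times> real) set" and f :: "real \<times> real \<Rightarrow> real"
  assumes K: "compact K" "convex K" "interior K \<noteq> {}"
    and ha: "hausdorff_additive 1 TYPE(real \<times> real)" and fin: "hausdorff_outer 1 (frontier K) < \<infinity>"
    and mean: "(\<integral>x. x \<partial>uniform_measure lborel K) = (\<integral>x. x \<partial>uniform_measure (hausdorff_measure 1) (frontier K))"
    and f: "convex_on UNIV f"
  shows "(\<integral>x. f x \<partial>uniform_measure lborel K) \<le> (\<integral>x. f x \<partial>uniform_measure (hausdorff_measure 1) (frontier K))"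
proof -
  interpret P: planar_body_perimeter K by standard (use K ha fin in auto)
  interpret N: prob_space P.\<nu> by (rule P.prob_spaces)
  interpret M: prob_space P.\<mu> by (rule P.prob_spaces)
  have int: "integrable P.\<nu> f" "integrable P.\<mu> f" if "continuous_on UNIV f" for f :: "real \<times> real \<Rightarrow> real"
    using integrable_continuous_compact_support[OF N.finite_measure_axioms _ P.AE_in_K(1) K(1) that]
      integrable_continuous_compact_support[OF M.finite_measure_axioms _ P.AE_in_K(2) K(1) that] by auto
  have cf: "continuous_on UNIV f" by (rule convex_on_continuous[OF open_UNIV f])
  have AEfr: "AE x in P.\<nu>. x \<in> frontier K" by (auto intro!: AE_uniform_measureI)
  obtain z where "z \<in> interior K" using K by auto
  then obtain \<rho> where z: "cball z \<rho> \<subseteq> K" "0 < \<rho>" by (auto simp: mem_interior_cball)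
  obtain R where R: "\<And>x. x \<in> K \<Longrightarrow> dist z x \<le> R"
    using compact_imp_bounded[OF K(1)] bounded_any_center[of K z] by (auto simp: dist_commute)
  have comp: "compact (cball z (2 * R))" by (rule compact_cball)
  have "bounded (f ` cball z (2 * R))"
    using comp cf by (intro compact_imp_bounded compact_continuous_image) (auto intro: continuous_on_subset)
  then obtain M where "\<forall>y\<in>f ` cball z (2 * R). norm y \<le> M" unfolding bounded_iff by blast
  then have M: "\<bar>f x\<bar> \<le> M" if "dist z x \<le> 2 * R" for x using that by simp
  have "z \<in> K" using z centre_in_cball[of z \<rho>] by auto
  then have R0: "0 \<le> R" using R[of z] by simp
  have M0: "0 \<le> M" using M[of z] R0 by auto
  have "uniformly_continuous_on (cball z (2 * R)) f"
    using comp cf by (intro compact_uniformly_continuous) (auto intro: continuous_on_subset)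
  note uc = this[unfolded uniformly_continuous_on_def]
  show ?thesis
  proof (rule field_le_epsilon)
    fix \<eta> :: real assume \<eta>: "0 < \<eta>"
    obtain \<delta> where \<delta>: "0 < \<delta>" "\<And>x y. x \<in> cball z (2 * R) \<Longrightarrow> y \<in> cball z (2 * R) \<Longrightarrow> dist x y < \<delta> \<Longrightarrow> dist (f x) (f y) < \<eta> / 2"
      using uc \<eta> by (metis half_gt_zero)
    \<comment> \<open>\<open>1\<close> and \<open>\<rho>\<close> meet the conditions of the
      sandwich; the other terms make the displacement \<open>\<epsilon> * (R + 1)\<close> less than
      \<open>\<delta>\<close> and the error \<open>2 * \<epsilon> * M\<close> at most
      \<open>\<eta> / 2\<close>. The added \<open>1\<close> avoids division by zero.\<close>
    define \<epsilon> where "\<epsilon> = min (min 1 \<rho>) (min (\<delta> / (2 * (R + 1))) (\<eta> / (4 * (M + 1))))"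
    have \<epsilon>: "0 < \<epsilon>" "\<epsilon> \<le> 1" "\<epsilon> \<le> \<rho>" using z \<delta>(1) \<eta> R0 M0 by (auto simp: \<epsilon>_def)
    have "\<epsilon> \<le> \<delta> / (2 * (R + 1))" "\<epsilon> \<le> \<eta> / (4 * (M + 1))" by (auto simp: \<epsilon>_def)
    then have "\<epsilon> * (2 * (R + 1)) \<le> \<delta>" "\<epsilon> * (4 * (M + 1)) \<le> \<eta>" using R0 M0 by (auto simp: pos_le_divide_eq)
    moreover have "0 < \<epsilon> * (R + 1)" using \<epsilon> R0 by simp
    ultimately have e1: "\<epsilon> * (R + 1) < \<delta>" and e2: "2 * \<epsilon> * M \<le> \<eta> / 2" using \<epsilon> by (auto simp: algebra_simps)
    obtain F where F: "crease F" "\<And>x. x \<in> K \<Longrightarrow> f x \<le> F x"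
      and FB: "\<And>B. B \<in> frontier K \<Longrightarrow> \<exists>s. dist z s \<le> 2 * R \<and> dist s B \<le> \<epsilon> * (R + 1) \<and> F B \<le> f s + 2 * \<epsilon> * M"
      using crease_sandwich[OF K(1,2) z f \<epsilon> R M] by blast
    have cF: "continuous_on UNIV F" by (rule continuous_on_crease[OF F(1)])
    have "(\<integral>x. f x \<partial>P.\<mu>) \<le> (\<integral>x. F x \<partial>P.\<mu>)"
    proof (rule integral_mono_AE[OF int(2)[OF cf] int(2)[OF cF]])
      show "AE x in P.\<mu>. f x \<le> F x" using P.AE_in_K(2) by eventually_elim (rule F(2))
    qed
    also have "\<dots> \<le> (\<integral>x. F x \<partial>P.\<nu>)" by (rule convex_order_crease[OF K ha fin mean F(1)])
    also have "\<dots> \<le> (\<integral>x. f x + \<eta> \<partial>P.\<nu>)"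
    proof (rule integral_mono_AE[OF int(1)[OF cF]])
      show "integrable P.\<nu> (\<lambda>x. f x + \<eta>)" using int(1)[OF cf] by simp
      show "AE x in P.\<nu>. F x \<le> f x + \<eta>" using AEfr
      proof eventually_elim
        fix B assume B: "B \<in> frontier K"
        then obtain s where s: "dist z s \<le> 2 * R" "dist s B \<le> \<epsilon> * (R + 1)" "F B \<le> f s + 2 * \<epsilon> * M" using FB by blast
        have "dist z B \<le> 2 * R" using R[of B] B P.frontier_sub R0 by force
        then have "dist (f s) (f B) < \<eta> / 2" using s e1 by (intro \<delta>(2)) auto
        then have "f s \<le> f B + \<eta> / 2" unfolding dist_real_def by linarith
        then show "F B \<le> f B + \<eta>" using s(3) e2 by linarith
      qed
    qed
    also have "\<dots> = (\<integral>x. f x \<partial>P.\<nu>) + \<eta>" using int(1)[OF cf] N.prob_space by simp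
    finally show "(\<integral>x. f x \<partial>P.\<mu>) \<le> (\<integral>x. f x \<partial>P.\<nu>) + \<eta>" .
  qed
qed

text \<open>Spaces of equal dimension are linearly isometric, and the isometry carries the body,
  both laws and their means to \<open>real \<times> real\<close>.\<close>

theorem planar_convex_order:
  fixes K :: "'a::euclidean_space set" and f :: "'a \<Rightarrow> real"
  assumes dim: "DIM('a) = 2"
    and K: "compact K" "convex K" "interior K \<noteq> {}"
    and ha: "hausdorff_additive 1 TYPE('a)" and fin: "hausdorff_outer 1 (frontier K) < \<infinity>"
    and mean: "(\<integral>x. x \<partial>uniform_measure lborel K) = (\<integral>x. x \<partial>uniform_measure (hausdorff_measure 1) (frontier K))"
    and intg: "integrable (uniform_measure lborel K) (\<lambda>x. x)" "integrable (uniform_measure (hausdorff_measure 1) (frontier K)) (\<lambda>x. x)"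
    and f: "convex_on UNIV f"
  shows "(\<integral>x. f x \<partial>uniform_measure lborel K) \<le> (\<integral>x. f x \<partial>uniform_measure (hausdorff_measure 1) (frontier K))"
proof -
  have dim': "DIM('a) = DIM(real \<times> real)" using dim by simp
  obtain J :: "'a \<Rightarrow> real \<times> real" and L where lin: "linear J" "linear L"
    and nrm: "\<And>x. norm (J x) = norm x" and LJ: "\<And>x. L (J x) = x" and JL: "\<And>y. J (L y) = y"
    by (rule isomorphisms_UNIV_UNIV[OF dim']) blast
  have iso: "dist (J x) (J y) = dist x y" for x y
    using nrm[of "x - y"] by (simp add: dist_norm linear_diff[OF lin(1)])
  have inj: "inj J" using LJ by (metis injI)
  have sur: "surj J" using JL by (metis surjI)
  have bij: "bij J" using inj sur by (simp add: bij_def)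
  have cJ: "continuous_on UNIV J" by (intro linear_continuous_on linear_linear[THEN iffD2] lin)
  have mJ[measurable]: "J \<in> borel_measurable borel" by (rule borel_measurable_continuous_onI[OF cJ])
  have inter: "interior (J ` K) = J ` interior K"
  proof
    have op: "open (J ` U)" if "open U" for U
    proof -
      have "J ` U = L -` U" using LJ JL by (auto simp: image_iff) (metis)
      moreover have "continuous_on UNIV L" by (intro linear_continuous_on linear_linear[THEN iffD2] lin)
      ultimately show ?thesis using that by (simp add: open_vimage)
    qed
    show "J ` interior K \<subseteq> interior (J ` K)"
      by (rule interior_maximal) (use interior_subset op in auto)
    have "open (J -` interior (J ` K))" using cJ by (simp add: open_vimage)
    moreover have "J -` interior (J ` K) \<subseteq> J -` J ` K" using interior_subset by blast
    then have "J -` interior (J ` K) \<subseteq> K" using inj by (simp add: inj_vimage_image_eq)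
    ultimately have "J -` interior (J ` K) \<subseteq> interior K" by (rule interior_maximal[rotated])
    then have "J ` (J -` interior (J ` K)) \<subseteq> J ` interior K" by (rule image_mono)
    then show "interior (J ` K) \<subseteq> J ` interior K" using sur by (simp add: surj_image_vimage_eq)
  qed
  have cJK: "compact (J ` K)" using K cJ by (intro compact_continuous_image) (auto intro: continuous_on_subset)
  have fr: "frontier (J ` K) = J ` frontier K"
    unfolding frontier_def using inter cJK K(1) by (simp add: compact_imp_closed image_set_diff[OF inj])
  have dl: "distr lborel borel J = lborel" by (rule lborel_distr_isometry[OF lin(1) bij nrm]) (use dim in simp)
  have dh: "distr (hausdorff_measure 1) borel J = hausdorff_measure 1"
    by (rule distr_hausdorff_measure_isometry[OF ha iso sur])
  have vi: "J -` J ` A = A" for A using inj by (rule inj_vimage_image_eq)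
  let ?m = "uniform_measure lborel K" and ?n = "uniform_measure (hausdorff_measure 1) (frontier K)"
  have d1: "distr ?m borel J = uniform_measure lborel (J ` K)"
    using distr_uniform_measure[OF _ dl, of "J ` K"] vi[of K] borel_compact[OF cJK] by simp
  have d2: "distr ?n borel J = uniform_measure (hausdorff_measure 1) (frontier (J ` K))"
    using distr_uniform_measure[OF _ dh, of "frontier (J ` K)"] vi[of "frontier K"]
    by (simp add: fr[symmetric] borel_closed)
  have mJ': "J \<in> measurable ?m borel" "J \<in> measurable ?n borel" using mJ by (simp_all cong: measurable_cong_sets)
  have bl: "bounded_linear J" using lin(1) by (simp add: linear_conv_bounded_linear)
  have mean': "(\<integral>x. x \<partial>uniform_measure lborel (J ` K)) = (\<integral>x. x \<partial>uniform_measure (hausdorff_measure 1) (frontier (J ` K)))"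
    unfolding d1[symmetric] d2[symmetric]
    using mean integral_bounded_linear[OF bl intg(1)] integral_bounded_linear[OF bl intg(2)]
    by (subst (1 2) integral_distr) (auto simp: mJ')
  have cg: "convex_on UNIV (f \<circ> L)"
  proof (rule convex_onI)
    fix t :: real and x y assume "0 < t" "t < 1"
    then show "(f \<circ> L) ((1 - t) *\<^sub>R x + t *\<^sub>R y) \<le> (1 - t) * (f \<circ> L) x + t * (f \<circ> L) y"
      using convex_onD[OF f, of t "L x" "L y"] by (simp add: linear_add[OF lin(2)] linear_scale[OF lin(2)])
  qed simp
  have "(\<integral>x. (f \<circ> L) x \<partial>uniform_measure lborel (J ` K)) \<le> (\<integral>x. (f \<circ> L) x \<partial>uniform_measure (hausdorff_measure 1) (frontier (J ` K)))"
  proof (rule planar_convex_order_prod)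
    show "hausdorff_outer 1 (frontier (J ` K)) < \<infinity>"
      unfolding fr using fin hausdorff_outer_isometry_image[of "frontier K" J 1] iso by simp
    show "hausdorff_additive 1 TYPE(real \<times> real)" by (rule hausdorff_additive_isometry[OF ha iso sur])
    show "convex_on UNIV (f \<circ> L)" by (rule cg)
  qed (use cJK convex_linear_image[OF lin(1) K(2)] inter K mean' in auto)
  moreover have "(f \<circ> L) \<in> borel_measurable borel"
    by (intro borel_measurable_continuous_onI convex_on_continuous[OF open_UNIV cg])
  ultimately show ?thesis
    unfolding d1[symmetric] d2[symmetric] by (subst (asm) (1 2) integral_distr) (auto simp: mJ' LJ)
qed

declare One_nat_def [simp]

section \<open>Cones over facets\<close>

text \<open>Let \<open>c t\<close> be the factor by which the shear \<open>\<phi> t\<close> scales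
  volumes. The reflection \<open>R\<close> conjugates \<open>\<phi> t\<close> to
  \<open>\<phi> (- t)\<close>, so \<open>c (- t) = c t\<close>; the two shears are inverse to each
  other, so \<open>c t * c (- t) = 1\<close>. Hence \<open>c t = 1\<close>.\<close>

lemma lborel_distr_shear:
  fixes n :: "'a::euclidean_space"
  assumes n: "norm n = 1" and v: "n \<bullet> v = 0"
  shows "distr lborel borel (\<lambda>x. x + ((n \<bullet> x) / r) *\<^sub>R v) = lborel"
proof -
  define \<phi> where "\<phi> t x = x + (t * (n \<bullet> x)) *\<^sub>R v" for t x
  have nn: "n \<bullet> n = 1" using n by (simp add: norm_eq_1)
  have comp: "\<phi> t (\<phi> u x) = \<phi> (t + u) x" for t u x using v by (simp add: \<phi>_def inner_add_right algebra_simps)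
  have lin: "linear (\<phi> t)" for t by (intro linearI) (simp_all add: \<phi>_def inner_add_right algebra_simps)
  have inv: "\<phi> (- t) (\<phi> t x) = x" "\<phi> t (\<phi> (- t) x) = x" for t x by (simp_all add: comp) (simp_all add: \<phi>_def)
  have bij: "bij (\<phi> t)" for t by (rule bijI') (metis inv(1), metis inv(2))
  have m: "\<phi> t \<in> borel_measurable borel" for t
    by (intro borel_measurable_continuous_onI linear_continuous_on linear_linear[THEN iffD2] lin)
  have vb: "\<phi> t -` A \<in> sets borel" if "A \<in> sets borel" for t A using measurable_sets[OF m that] by simp
  obtain c where c: "\<And>t. 0 \<le> c t" "\<And>t A. A \<in> sets borel \<Longrightarrow> emeasure lborel (\<phi> t -` A) = ennreal (c t) * emeasure lborel A"
  proof -
    have "\<exists>c. 0 \<le> c \<and> (\<forall>A. A \<in> sets borel \<longrightarrow> emeasure lborel (\<phi> t -` A) = ennreal c * emeasure lborel A)" for t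
      by (rule emeasure_lborel_linear_vimage[OF lin[of t] bij[of t]]) blast
    then have "\<exists>c. \<forall>t. 0 \<le> c t \<and> (\<forall>A. A \<in> sets borel \<longrightarrow> emeasure lborel (\<phi> t -` A) = ennreal (c t) * emeasure lborel A)"
      by (intro choice) simp
    then show ?thesis using that by blast
  qed
  define R where "R x = x - (2 * (n \<bullet> x)) *\<^sub>R n" for x
  have RR: "R (R x) = x" for x using nn by (simp add: R_def inner_diff_right algebra_simps)
  have linR: "linear R" by (intro linearI) (simp_all add: R_def inner_add_right algebra_simps)
  have bijR: "bij R" by (rule bijI') (metis RR, metis RR)
  have nR: "norm (R x) = norm x" for x
    unfolding norm_eq using nn by (simp add: R_def inner_diff_left inner_diff_right inner_commute algebra_simps)
  have mR: "R \<in> borel_measurable borel"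
    by (intro borel_measurable_continuous_onI linear_continuous_on linear_linear[THEN iffD2] linR)
  have eR: "emeasure lborel (R -` A) = emeasure lborel A" if "A \<in> sets borel" for A
    using lborel_distr_isometry[OF linR bijR nR refl] emeasure_distr[of R lborel borel A] that mR by simp
  let ?B = "ball (0::'a) 1"
  have B: "emeasure lborel ?B = ennreal (measure lborel ?B)" "0 < measure lborel ?B"
    using content_ball_gt_0_iff[of "0::'a" 1] by (auto simp: emeasure_eq_ennreal_measure emeasure_ball)
  have cancel: "x = y" if "ennreal x * emeasure lborel ?B = ennreal y * emeasure lborel ?B" "0 \<le> x" "0 \<le> y" for x y
    using that B by (simp add: ennreal_mult'[symmetric])
  have conj: "\<phi> (- t) x = R (\<phi> t (R x))" for t x using nn v by (simp add: \<phi>_def R_def inner_commute inner_diff_right inner_add_right algebra_simps)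
  have "c (- t) = c t" for t
  proof (rule cancel)
    have "\<phi> (- t) -` ?B = R -` (\<phi> t -` (R -` ?B))" by (auto simp: conj)
    then have "emeasure lborel (\<phi> (- t) -` ?B) = ennreal (c t) * emeasure lborel ?B"
      using vb[of "R -` ?B" t] measurable_sets[OF mR, of ?B] by (simp add: eR c(2))
    then show "ennreal (c (- t)) * emeasure lborel ?B = ennreal (c t) * emeasure lborel ?B" by (simp add: c(2))
  qed (auto simp: c(1))
  moreover have "c t * c (- t) = 1" for t
  proof (rule cancel)
    have "?B = \<phi> t -` (\<phi> (- t) -` ?B)" by (auto simp: inv)
    then have "emeasure lborel ?B = ennreal (c t) * (ennreal (c (- t)) * emeasure lborel ?B)"
      using c(2)[OF vb, of ?B t "- t"] c(2)[of ?B "- t"] by simp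
    then show "ennreal (c t * c (- t)) * emeasure lborel ?B = ennreal 1 * emeasure lborel ?B"
      using c(1) by (simp add: ennreal_mult' mult.assoc)
  qed (auto simp: c(1))
  ultimately have "c t * c t = 1" for t by metis
  then have "c t = 1" for t using c(1)[of t] by (metis abs_of_nonneg abs_square_eq_1 power2_eq_square)
  then have "distr lborel borel (\<phi> (1 / r)) = lborel"
    using m by (intro measure_eqI) (auto simp: emeasure_distr c(2))
  then show ?thesis by (simp add: \<phi>_def[abs_def])
qed

section \<open>Hausdorff measure on a hyperplane and cones above it\<close>

definition flat_measure :: "nat \<Rightarrow> 'a::euclidean_space \<Rightarrow> 'a measure" where
  "flat_measure s n = density (hausdorff_measure s) (indicator {v. n \<bullet> v = 0})"

text \<open>The coefficient of the projected point when \<open>x\<close> is written as a convex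
  combination of the apex and its projection to height \<open>r\<close>.\<close>

definition cone_weight :: "'a::euclidean_space \<Rightarrow> real \<Rightarrow> 'a \<Rightarrow> real" where
  "cone_weight n r x = (if 0 < n \<bullet> x \<and> n \<bullet> x \<le> r then (n \<bullet> x) / r else 0)"

text \<open>Weighted Lebesgue measure on a slab, seen through the central projection onto the
  hyperplane at height \<open>r\<close>. The shift by \<open>r *\<^sub>R n\<close> puts it on the
  hyperplane of \<open>flat_measure\<close>. The weight is built in because convexity along the
  segments from the apex produces it.\<close>

definition cone_measure :: "'a::euclidean_space \<Rightarrow> real \<Rightarrow> 'a measure" where
  "cone_measure n r = distr (density lborel (\<lambda>x. ennreal (cone_weight n r x))) borel (\<lambda>x. (r / (n \<bullet> x)) *\<^sub>R x - r *\<^sub>R n)"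

lemma cone_weight_measurable [measurable]: "cone_weight n r \<in> borel_measurable borel"
  unfolding cone_weight_def[abs_def] by measurable

lemma cone_proj_measurable [measurable]: "(\<lambda>x. (r / (n \<bullet> x)) *\<^sub>R x - r *\<^sub>R n) \<in> borel_measurable borel"
  for n :: "'a::euclidean_space"
  by measurable

lemma sets_flat_measure [simp, measurable_cong]: "sets (flat_measure s n) = sets borel"
  by (simp add: flat_measure_def)

lemma sets_cone_measure [simp, measurable_cong]: "sets (cone_measure n r) = sets borel"
  by (simp add: cone_measure_def)

lemma hyperplane_borel [measurable]: "{v. n \<bullet> v = c} \<in> sets borel" for n :: "'a::euclidean_space"
  by (intro borel_closed closed_hyperplane)

lemma emeasure_flat_measure:
  fixes n :: "'a::euclidean_space"
  assumes "hausdorff_additive s TYPE('a)" and E: "E \<in> sets borel"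
  shows "emeasure (flat_measure s n) E = hausdorff_outer s (E \<inter> {v. n \<bullet> v = 0})"
proof -
  have "emeasure (flat_measure s n) E = (\<integral>\<^sup>+x. indicator {v. n \<bullet> v = 0} x * indicator E x \<partial>hausdorff_measure s)"
    unfolding flat_measure_def using E by (subst emeasure_density) auto
  also have "\<dots> = (\<integral>\<^sup>+x. indicator (E \<inter> {v. n \<bullet> v = 0}) x \<partial>hausdorff_measure s)"
    by (intro nn_integral_cong) (auto simp: indicator_def)
  also have "\<dots> = hausdorff_outer s (E \<inter> {v. n \<bullet> v = 0})"
    using E by (simp add: emeasure_hausdorff_measure[OF assms(1)])
  finally show ?thesis .
qed

lemma emeasure_cone_measure:
  assumes E: "E \<in> sets borel"
  shows "emeasure (cone_measure n r) E = (\<integral>\<^sup>+x. ennreal (cone_weight n r x) * indicator E ((r / (n \<bullet> x)) *\<^sub>R x - r *\<^sub>R n) \<partial>lborel)"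
proof -
  let ?g = "\<lambda>x. (r / (n \<bullet> x)) *\<^sub>R x - r *\<^sub>R n"
  have v: "?g -` E \<in> sets borel" using measurable_sets[OF cone_proj_measurable E] by simp
  have "emeasure (cone_measure n r) E = emeasure (density lborel (\<lambda>x. ennreal (cone_weight n r x))) (?g -` E)"
    unfolding cone_measure_def using E by (subst emeasure_distr) auto
  also have "\<dots> = (\<integral>\<^sup>+x. ennreal (cone_weight n r x) * indicator (?g -` E) x \<partial>lborel)"
    using v by (subst emeasure_density) auto
  finally show ?thesis by (simp add: indicator_def vimage_def)
qed

lemma hausdorff_outer_translation: "hausdorff_outer s ((\<lambda>x. x + v) ` A) = hausdorff_outer s A" for v :: "'a::real_normed_vector"
  by (rule hausdorff_outer_isometry_image) (simp add: dist_norm)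

text \<open>The orthogonal projection along \<open>n\<close> is a contraction, and each line in
  direction \<open>n\<close> through a point of the disc around \<open>z\<close> meets the boundary
  of \<open>K\<close>. Finite measure of the boundary thus passes to discs in every
  hyperplane.\<close>

lemma hausdorff_outer_disc_le:
  fixes n z :: "'a::euclidean_space"
  assumes n: "norm n = 1" and K: "compact K" "cball z \<rho> \<subseteq> K"
  shows "hausdorff_outer s (cball 0 \<rho> \<inter> {v. n \<bullet> v = 0}) \<le> hausdorff_outer s (frontier K)"
proof -
  have nn: "n \<bullet> n = 1" using n by (simp add: norm_eq_1)
  have n0: "n \<noteq> 0" using n by auto
  define \<pi> where "\<pi> x = (x - z) - (n \<bullet> (x - z)) *\<^sub>R n" for x
  have lip: "dist (\<pi> x) (\<pi> y) \<le> 1 * dist x y" for x y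
  proof -
    let ?d = "x - y"
    have "\<pi> x - \<pi> y = ?d - (n \<bullet> ?d) *\<^sub>R n" by (simp add: \<pi>_def inner_diff_right algebra_simps)
    moreover have "(norm (?d - (n \<bullet> ?d) *\<^sub>R n))\<^sup>2 = (norm ?d)\<^sup>2 - (n \<bullet> ?d)\<^sup>2"
    proof -
      have c: "x \<bullet> n = n \<bullet> x" "y \<bullet> n = n \<bullet> y" "x \<bullet> y = y \<bullet> x" by (simp_all add: inner_commute)
      show ?thesis unfolding power2_norm_eq_inner
        by (simp add: inner_diff_left inner_diff_right nn c power2_eq_square algebra_simps)
    qed
    then have "(norm (?d - (n \<bullet> ?d) *\<^sub>R n))\<^sup>2 \<le> (norm ?d)\<^sup>2" by simp
    then have "norm (?d - (n \<bullet> ?d) *\<^sub>R n) \<le> norm ?d" by (rule power2_le_imp_le) simp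
    ultimately show ?thesis by (simp add: dist_norm)
  qed
  have "cball 0 \<rho> \<inter> {v. n \<bullet> v = 0} \<subseteq> \<pi> ` frontier K"
  proof
    fix v assume v: "v \<in> cball 0 \<rho> \<inter> {v. n \<bullet> v = 0}"
    then have zv: "z + v \<in> K" using K(2) by (auto simp: dist_norm)
    have "\<exists>t. z + v + t *\<^sub>R n \<in> frontier K"
    proof (cases "z + v \<in> interior K")
      case True
      then obtain t where "z + v + t *\<^sub>R n \<in> frontier K"
        using ray_to_frontier[OF compact_imp_bounded[OF K(1)] True n0] by auto
      then show ?thesis by blast
    next
      case False
      then have "z + v + 0 *\<^sub>R n \<in> frontier K" using zv K(1) by (simp add: frontier_def compact_imp_closed)
      then show ?thesis by blast
    qed
    then obtain t where t: "z + v + t *\<^sub>R n \<in> frontier K" by blast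
    have "\<pi> (z + v + t *\<^sub>R n) = v" using v nn by (simp add: \<pi>_def inner_add_right)
    then show "v \<in> \<pi> ` frontier K" using t by (metis image_eqI)
  qed
  then have "hausdorff_outer s (cball 0 \<rho> \<inter> {v. n \<bullet> v = 0}) \<le> hausdorff_outer s (\<pi> ` frontier K)"
    by (rule hausdorff_outer_mono)
  also have "\<dots> \<le> ennreal (1 ^ s) * hausdorff_outer s (frontier K)"
    by (rule hausdorff_outer_lipschitz_image) (use lip in auto)
  finally show ?thesis by simp
qed

lemma hausdorff_outer_big_disc_finite:
  fixes n :: "'a::euclidean_space"
  assumes \<rho>: "0 < \<rho>" and fin: "hausdorff_outer s (cball 0 \<rho> \<inter> {v. n \<bullet> v = 0}) < \<infinity>"
  shows "hausdorff_outer s (cball 0 k \<inter> {v. n \<bullet> v = 0}) < \<infinity>"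
proof -
  define L where "L = max 1 (k / \<rho>)"
  have L: "0 < L" by (simp add: L_def)
  have kL: "k \<le> L * \<rho>" using \<rho> by (simp add: L_def pos_divide_le_eq[symmetric])
  have "cball 0 k \<inter> {v. n \<bullet> v = 0} \<subseteq> (\<lambda>x. L *\<^sub>R x) ` (cball 0 \<rho> \<inter> {v. n \<bullet> v = 0})"
  proof
    fix v assume v: "v \<in> cball 0 k \<inter> {v. n \<bullet> v = 0}"
    then have "norm v \<le> L * \<rho>" using kL by auto
    then have "norm v / L \<le> \<rho>" using L by (simp add: pos_divide_le_eq mult.commute)
    then show "v \<in> (\<lambda>x. L *\<^sub>R x) ` (cball 0 \<rho> \<inter> {v. n \<bullet> v = 0})"
      using v L by (intro image_eqI[of _ _ "(1 / L) *\<^sub>R v"]) auto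
  qed
  then have "hausdorff_outer s (cball 0 k \<inter> {v. n \<bullet> v = 0}) \<le> hausdorff_outer s ((\<lambda>x. L *\<^sub>R x) ` (cball 0 \<rho> \<inter> {v. n \<bullet> v = 0}))"
    by (rule hausdorff_outer_mono)
  also have "\<dots> \<le> ennreal (L ^ s) * hausdorff_outer s (cball 0 \<rho> \<inter> {v. n \<bullet> v = 0})"
    by (rule hausdorff_outer_lipschitz_image[OF L]) (use L in \<open>simp add: dist_norm flip: scaleR_diff_right\<close>)
  also have "\<dots> < \<infinity>" using fin by (simp add: ennreal_mult_less_top)
  finally show ?thesis .
qed

lemma sigma_finite_measure_ballsI:
  fixes N :: "'a::euclidean_space measure"
  assumes "sets N = sets borel" "\<And>k::nat. emeasure N (ball 0 (real k)) < \<infinity>"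
  shows "sigma_finite_measure N"
proof
  have sp: "space N = UNIV" using sets_eq_imp_space_eq[OF assms(1)] by simp
  show "\<exists>A. countable A \<and> A \<subseteq> sets N \<and> \<Union> A = space N \<and> (\<forall>a\<in>A. emeasure N a \<noteq> \<infinity>)"
  proof (intro exI[of _ "range (\<lambda>n::nat. ball 0 (real n))"] conjI ballI)
    show "\<Union> (range (\<lambda>n::nat. ball (0::'a) (real n))) = space N"
      using reals_Archimedean2 by (auto simp: sp)
    show "range (\<lambda>n::nat. ball (0::'a) (real n)) \<subseteq> sets N" by (auto simp: assms(1))
    fix a assume "a \<in> range (\<lambda>n::nat. ball (0::'a) (real n))"
    then show "emeasure N a \<noteq> \<infinity>" using assms(2) by (auto simp: less_top)
  qed simp
qed

text \<open>Projection to height \<open>r\<close> multiplies the distance from the apex by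
  \<open>r / (n \<bullet> x) \<ge> 1\<close>, so only a bounded part of the slab is projected into
  the ball, and the weight is at most \<open>1\<close>.\<close>

lemma cone_measure_ball_finite:
  fixes n :: "'a::euclidean_space"
  assumes n: "norm n = 1" and r: "0 < r"
  shows "emeasure (cone_measure n r) (ball 0 k) < \<infinity>"
proof -
  have "emeasure (cone_measure n r) (ball 0 k) \<le> (\<integral>\<^sup>+x. indicator (cball (0::'a) (\<bar>k\<bar> + r)) x \<partial>lborel)"
    unfolding emeasure_cone_measure[OF borel_open[OF open_ball]]
  proof (rule nn_integral_mono)
    fix x :: 'a
    let ?g = "(r / (n \<bullet> x)) *\<^sub>R x - r *\<^sub>R n"
    show "ennreal (cone_weight n r x) * indicator (ball 0 k) ?g \<le> indicator (cball 0 (\<bar>k\<bar> + r)) x"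
    proof (cases "0 < n \<bullet> x \<and> n \<bullet> x \<le> r \<and> norm ?g < k")
      case True
      have "norm ((r / (n \<bullet> x)) *\<^sub>R x) \<le> norm ?g + norm (r *\<^sub>R n)" by (metis add_diff_cancel_left' diff_add_cancel norm_triangle_ineq)
      moreover have "norm ((r / (n \<bullet> x)) *\<^sub>R x) = (r / (n \<bullet> x)) * norm x" "norm (r *\<^sub>R n) = r"
        using True r n by simp_all
      ultimately have "(r / (n \<bullet> x)) * norm x \<le> \<bar>k\<bar> + r" using True by linarith
      moreover have "1 * norm x \<le> (r / (n \<bullet> x)) * norm x" using True r by (intro mult_right_mono) auto
      ultimately have "norm x \<le> \<bar>k\<bar> + r" by simp
      moreover have "cone_weight n r x \<le> 1" using True r by (simp add: cone_weight_def)
      ultimately show ?thesis using True by (simp add: ennreal_le_1)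
    qed (auto simp: cone_weight_def indicator_def)
  qed
  also have "\<dots> < \<infinity>" using emeasure_bounded_finite[OF bounded_cball, of "0::'a" "\<bar>k\<bar> + r"] by simp
  finally show ?thesis .
qed

lemma cone_measure_ball_pos:
  fixes n :: "'a::euclidean_space"
  assumes n: "norm n = 1" and r: "0 < r"
  shows "0 < emeasure (cone_measure n r) (ball 0 1)"
proof -
  have nn: "n \<bullet> n = 1" using n by (simp add: norm_eq_1)
  \<comment> \<open>Within \<open>\<delta>\<close> of the middle of the slab the height is at least
    \<open>r / 4\<close>, so the weight is at least \<open>1 / 4\<close> and the projected point has
    norm at most \<open>8 * \<delta> < 1\<close>.\<close>
  define \<delta> where "\<delta> = min (r / 4) (1 / 9)"
  have \<delta>: "0 < \<delta>" "\<delta> \<le> r / 4" "\<delta> \<le> 1 / 9" using r by (auto simp: \<delta>_def)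
  let ?x0 = "(r / 2) *\<^sub>R n"
  have "0 < ennreal (1 / 4) * emeasure lborel (ball ?x0 \<delta>)"
    using \<delta> unit_ball_vol_pos[of "real DIM('a)"] by (simp add: emeasure_ball ennreal_zero_less_mult_iff)
  also have "\<dots> = (\<integral>\<^sup>+x. ennreal (1 / 4) * indicator (ball ?x0 \<delta>) x \<partial>lborel)"
    by (simp add: nn_integral_cmult_indicator)
  also have "\<dots> \<le> emeasure (cone_measure n r) (ball 0 1)"
    unfolding emeasure_cone_measure[OF borel_open[OF open_ball]]
  proof (rule nn_integral_mono)
    fix x :: 'a
    let ?g = "(r / (n \<bullet> x)) *\<^sub>R x - r *\<^sub>R n"
    show "ennreal (1 / 4) * indicator (ball ?x0 \<delta>) x \<le> ennreal (cone_weight n r x) * indicator (ball 0 1) ?g"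
    proof (cases "x \<in> ball ?x0 \<delta>")
      case True
      then have d: "norm (x - ?x0) < \<delta>" by (simp add: dist_norm norm_minus_commute)
      have nx: "n \<bullet> (x - ?x0) = n \<bullet> x - r / 2" using nn by (simp add: inner_diff_right)
      have "\<bar>n \<bullet> (x - ?x0)\<bar> \<le> norm (x - ?x0)" using Cauchy_Schwarz_ineq2[of n "x - ?x0"] n by simp
      then have b: "\<bar>n \<bullet> x - r / 2\<bar> \<le> \<delta>" using d nx by simp
      have lo: "r / 4 \<le> n \<bullet> x" using b \<delta> by linarith
      have hi: "n \<bullet> x \<le> r" using b \<delta> r by linarith
      have pos: "0 < n \<bullet> x" using lo r by linarith
      have w: "1 / 4 \<le> cone_weight n r x" using lo hi pos r by (simp add: cone_weight_def pos_le_divide_eq)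
      have "?g = (r / (n \<bullet> x)) *\<^sub>R (x - (n \<bullet> x) *\<^sub>R n)" using pos by (simp add: scaleR_diff_right)
      also have "x - (n \<bullet> x) *\<^sub>R n = (x - ?x0) - (n \<bullet> (x - ?x0)) *\<^sub>R n" using nn by (simp add: nx algebra_simps)
      finally have "norm ?g = (r / (n \<bullet> x)) * norm ((x - ?x0) - (n \<bullet> (x - ?x0)) *\<^sub>R n)" using pos r by simp
      also have "\<dots> \<le> 4 * (2 * \<delta>)"
      proof (intro mult_mono)
        show "r / (n \<bullet> x) \<le> 4" using lo pos by (simp add: pos_divide_le_eq)
        have "norm ((x - ?x0) - (n \<bullet> (x - ?x0)) *\<^sub>R n) \<le> norm (x - ?x0) + norm ((n \<bullet> (x - ?x0)) *\<^sub>R n)" by (rule norm_triangle_ineq4)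
        also have "\<dots> \<le> 2 * \<delta>" using d b nx n by simp
        finally show "norm ((x - ?x0) - (n \<bullet> (x - ?x0)) *\<^sub>R n) \<le> 2 * \<delta>" .
      qed auto
      also have "\<dots> < 1" using \<delta> by simp
      finally have "norm ?g < 1" .
      then show ?thesis using w True by (simp add: ennreal_leI)
    qed simp
  qed
  finally show ?thesis .
qed

lemma distr_flat_measure_translation:
  fixes n :: "'a::euclidean_space"
  assumes ha: "hausdorff_additive s TYPE('a)" and v: "n \<bullet> v = 0"
  shows "distr (flat_measure s n) borel (\<lambda>x. x - v) = flat_measure s n"
proof (rule measure_eqI)
  fix E assume "E \<in> sets (distr (flat_measure s n) borel (\<lambda>x. x - v))"
  then have E: "E \<in> sets borel" by simp
  have vE: "(\<lambda>x. x - v) -` E \<in> sets borel" using measurable_sets[of "\<lambda>x. x - v" borel borel E] E by simp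
  have sp: "space (flat_measure s n) = UNIV" by (simp add: flat_measure_def)
  have "((\<lambda>x. x - v) -` E) \<inter> {x. n \<bullet> x = 0} = (\<lambda>x. x + v) ` (E \<inter> {x. n \<bullet> x = 0})"
  proof (intro set_eqI iffI)
    fix x assume "x \<in> ((\<lambda>x. x - v) -` E) \<inter> {x. n \<bullet> x = 0}"
    then show "x \<in> (\<lambda>x. x + v) ` (E \<inter> {x. n \<bullet> x = 0})"
      using v by (intro image_eqI[of _ _ "x - v"]) (auto simp: inner_diff_right)
  qed (use v in \<open>auto simp: inner_add_right\<close>)
  then show "emeasure (distr (flat_measure s n) borel (\<lambda>x. x - v)) E = emeasure (flat_measure s n) E"
    using E vE by (simp add: emeasure_distr emeasure_flat_measure[OF ha] hausdorff_outer_translation sp)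
qed simp

text \<open>The shear by \<open>v\<close> with parameter \<open>1 / r\<close> preserves Lebesgue
  measure and the height \<open>n \<bullet> x\<close>, hence the weight, and it moves the projected
  point by exactly \<open>v\<close>.\<close>

lemma distr_cone_measure_translation:
  fixes n :: "'a::euclidean_space"
  assumes n: "norm n = 1" and r: "0 < r" and v: "n \<bullet> v = 0"
  shows "distr (cone_measure n r) borel (\<lambda>x. x + v) = cone_measure n r"
proof (rule measure_eqI)
  fix E assume "E \<in> sets (distr (cone_measure n r) borel (\<lambda>x. x + v))"
  then have E[measurable]: "E \<in> sets borel" by simp
  have vE: "(\<lambda>x. x + v) -` E \<in> sets borel" using measurable_sets[of "\<lambda>x. x + v" borel borel E] E by simp
  have sp: "space (cone_measure n r) = UNIV" by (simp add: cone_measure_def)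
  let ?g = "\<lambda>x. (r / (n \<bullet> x)) *\<^sub>R x - r *\<^sub>R n" and ?\<phi> = "\<lambda>x. x + ((n \<bullet> x) / r) *\<^sub>R v"
  have n\<phi>: "n \<bullet> ?\<phi> x = n \<bullet> x" for x using v by (simp add: inner_add_right)
  have w\<phi>: "cone_weight n r (?\<phi> x) = cone_weight n r x" for x unfolding cone_weight_def n\<phi> ..
  have g\<phi>: "?g (?\<phi> x) = ?g x + v" if "0 < n \<bullet> x" for x
    unfolding n\<phi> using that r by (simp add: scaleR_add_right)
  have "emeasure (distr (cone_measure n r) borel (\<lambda>x. x + v)) E = emeasure (cone_measure n r) ((\<lambda>x. x + v) -` E)"
    using E by (simp add: emeasure_distr sp)
  also have "\<dots> = (\<integral>\<^sup>+x. ennreal (cone_weight n r x) * indicator E (?g x + v) \<partial>lborel)"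
    unfolding emeasure_cone_measure[OF vE] by (simp add: indicator_def)
  also have "\<dots> = (\<integral>\<^sup>+x. ennreal (cone_weight n r (?\<phi> x)) * indicator E (?g (?\<phi> x)) \<partial>lborel)"
  proof (rule nn_integral_cong)
    fix x
    show "ennreal (cone_weight n r x) * indicator E (?g x + v) = ennreal (cone_weight n r (?\<phi> x)) * indicator E (?g (?\<phi> x))"
    proof (cases "0 < n \<bullet> x")
      case True then show ?thesis by (simp only: w\<phi> g\<phi>)
    next
      case False then show ?thesis unfolding w\<phi> by (simp add: cone_weight_def)
    qed
  qed
  also have "\<dots> = (\<integral>\<^sup>+x. ennreal (cone_weight n r x) * indicator E (?g x) \<partial>distr lborel borel ?\<phi>)"
    by (rule nn_integral_distr[symmetric]) measurable
  also have "distr lborel borel ?\<phi> = lborel" by (rule lborel_distr_shear[OF n v])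
  finally show "emeasure (distr (cone_measure n r) borel (\<lambda>x. x + v)) E = emeasure (cone_measure n r) E"
    unfolding emeasure_cone_measure[OF E] .
qed simp

text \<open>Uniqueness of invariant measures on the hyperplane, normalized on the unit ball.
  Uniqueness yields a reflected set; comparing \<open>cone_measure\<close> with itself removes the
  reflection.\<close>

lemma flat_cone_measure_proportional:
  fixes n :: "'a::euclidean_space"
  assumes ha: "hausdorff_additive s TYPE('a)" and n: "norm n = 1" and r: "0 < r"
    and fin: "\<And>k. hausdorff_outer s (cball 0 k \<inter> {v. n \<bullet> v = 0}) < \<infinity>"
    and A: "A \<in> sets borel"
  shows "emeasure (flat_measure s n) A * emeasure (cone_measure n r) (ball 0 1) =
    emeasure (flat_measure s n) (ball 0 1) * emeasure (cone_measure n r) A"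
proof -
  let ?N1 = "flat_measure s n" and ?N4 = "cone_measure n r"
  have sf1: "sigma_finite_measure ?N1"
  proof (rule sigma_finite_measure_ballsI)
    fix k :: nat
    have "emeasure ?N1 (ball 0 (real k)) \<le> hausdorff_outer s (cball 0 (real k) \<inter> {v. n \<bullet> v = 0})"
      by (subst emeasure_flat_measure[OF ha]) (auto intro!: hausdorff_outer_mono)
    also have "\<dots> < \<infinity>" by (rule fin)
    finally show "emeasure ?N1 (ball 0 (real k)) < \<infinity>" .
  qed simp
  have sf4: "sigma_finite_measure ?N4"
    by (rule sigma_finite_measure_ballsI) (simp, rule cone_measure_ball_finite[OF n r])
  have ae1: "AE x in ?N1. x \<in> {v. n \<bullet> v = 0}"
    unfolding flat_measure_def by (subst AE_density) (auto simp: indicator_def)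
  have nn: "n \<bullet> n = 1" using n by (simp add: norm_eq_1)
  have ae4: "AE x in ?N4. x \<in> {v. n \<bullet> v = 0}"
  proof -
    have b: "{v. n \<bullet> v \<noteq> 0} \<in> sets borel" by (simp add: Collect_neg_eq borel_comp)
    have eq: "ennreal (cone_weight n r x) * indicator {v. n \<bullet> v \<noteq> 0} ((r / (n \<bullet> x)) *\<^sub>R x - r *\<^sub>R n) = 0" for x
      by (auto simp: cone_weight_def indicator_def inner_diff_right nn)
    have "emeasure ?N4 {v. n \<bullet> v \<noteq> 0} = 0" unfolding emeasure_cone_measure[OF b] eq by simp
    with b show ?thesis by (intro AE_I[of _ _ "{v. n \<bullet> v \<noteq> 0}"]) auto
  qed
  have t4: "distr ?N4 borel (\<lambda>x. x - v) = ?N4" if "v \<in> {v. n \<bullet> v = 0}" for v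
    using distr_cone_measure_translation[OF n r, of "- v"] that by simp
  have u: "emeasure N A * emeasure ?N4 B = emeasure N B * emeasure ?N4 (uminus -` A)"
    if "N = ?N1 \<or> N = ?N4" "A \<in> sets borel" "B \<in> sets borel" for N A B
  proof (rule translation_invariant_unique[where V="{v. n \<bullet> v = 0}"])
    show "sigma_finite_measure N" "AE x in N. x \<in> {v. n \<bullet> v = 0}" using that(1) sf1 sf4 ae1 ae4 by auto
    show "distr N borel (\<lambda>x. x - v) = N" if "v \<in> {v. n \<bullet> v = 0}" for v
      using that \<open>N = ?N1 \<or> N = ?N4\<close> t4[of v] distr_flat_measure_translation[OF ha, of n v] by auto
    show "distr ?N4 borel (\<lambda>x. x + v) = ?N4" if "v \<in> {v. n \<bullet> v = 0}" for v
      using that distr_cone_measure_translation[OF n r] by auto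
  qed (use that sf4 ae4 in auto)
  let ?B = "ball (0::'a) 1"
  have b4: "0 < emeasure ?N4 ?B" "emeasure ?N4 ?B < \<infinity>"
    using cone_measure_ball_pos[OF n r] cone_measure_ball_finite[OF n r] by auto
  have "emeasure ?N4 A * emeasure ?N4 ?B = emeasure ?N4 (uminus -` A) * emeasure ?N4 ?B"
    using u[of ?N4 A ?B] A by (simp add: mult.commute)
  then have "emeasure ?N4 A * emeasure ?N4 ?B / emeasure ?N4 ?B = emeasure ?N4 (uminus -` A) * emeasure ?N4 ?B / emeasure ?N4 ?B"
    by simp
  then have "emeasure ?N4 (uminus -` A) = emeasure ?N4 A"
    using b4 by (subst (asm) (1 2) mult_divide_eq_ennreal) auto
  then show ?thesis using u[of ?N1 A ?B] A by simp
qed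

text \<open>A rotation from \<open>n\<close> to \<open>n'\<close> carries weight and projection
  along and preserves the unit ball. With the ball as reference set, the proportionality factor does
  not depend on the normal.\<close>

lemma rotation_ball_measures:
  fixes n n' :: "'a::euclidean_space"
  assumes ha: "hausdorff_additive s TYPE('a)" and R: "orthogonal_transformation R" "R n = n'"
  shows "emeasure (flat_measure s n') (ball 0 1) = emeasure (flat_measure s n) (ball 0 1)"
    and "emeasure (cone_measure n' r) (ball 0 1) = emeasure (cone_measure n r) (ball 0 1)"
proof -
  have lin: "linear R" and ip: "\<And>x y. R x \<bullet> R y = x \<bullet> y" using R(1) by (auto simp: orthogonal_transformation_def)
  have bij: "bij R" using R(1) by (rule orthogonal_transformation_bij)
  have nrm: "norm (R x) = norm x" for x by (simp add: norm_eq_sqrt_inner ip)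
  have iso: "dist (R x) (R y) = dist x y" for x y using nrm[of "x - y"] by (simp add: dist_norm linear_diff[OF lin])
  have nR: "n' \<bullet> R x = n \<bullet> x" for x by (simp add: R(2)[symmetric] ip)
  have "ball 0 1 \<inter> {v. n' \<bullet> v = 0} = R ` (ball 0 1 \<inter> {v. n \<bullet> v = 0})"
  proof (intro set_eqI iffI)
    fix y assume y: "y \<in> ball 0 1 \<inter> {v. n' \<bullet> v = 0}"
    obtain x where "y = R x" using bij by (metis bij_pointE)
    then show "y \<in> R ` (ball 0 1 \<inter> {v. n \<bullet> v = 0})" using y nR nrm by auto
  qed (auto simp: nrm nR)
  then show "emeasure (flat_measure s n') (ball 0 1) = emeasure (flat_measure s n) (ball 0 1)"
    using hausdorff_outer_isometry_image[of "ball 0 1 \<inter> {v. n \<bullet> v = 0}" R s] iso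
    by (simp add: emeasure_flat_measure[OF ha])
  have mR[measurable]: "R \<in> borel_measurable borel"
    by (intro borel_measurable_continuous_onI linear_continuous_on linear_linear[THEN iffD2] lin)
  have dl: "distr lborel borel R = lborel" by (rule lborel_distr_isometry[OF lin bij nrm refl])
  let ?g = "\<lambda>n x. (r / (n \<bullet> x)) *\<^sub>R x - r *\<^sub>R n"
  have msb: "(\<lambda>x. ennreal (cone_weight n' r x) * indicator (ball 0 1) (?g n' x)) \<in> borel_measurable borel"
    by (intro borel_measurable_times_ennreal measurable_compose[OF cone_proj_measurable] borel_measurable_indicator) auto
  have "emeasure (cone_measure n' r) (ball 0 1) = (\<integral>\<^sup>+x. ennreal (cone_weight n' r x) * indicator (ball 0 1) (?g n' x) \<partial>distr lborel borel R)"
    unfolding dl by (rule emeasure_cone_measure) simp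
  also have "(\<integral>\<^sup>+x. ennreal (cone_weight n' r x) * indicator (ball 0 1) (?g n' x) \<partial>distr lborel borel R) = (\<integral>\<^sup>+x. ennreal (cone_weight n' r (R x)) * indicator (ball 0 1) (?g n' (R x)) \<partial>lborel)"
    by (rule nn_integral_distr) (use msb in simp_all)
  also have "\<dots> = (\<integral>\<^sup>+x. ennreal (cone_weight n r x) * indicator (ball 0 1) (?g n x) \<partial>lborel)"
  proof (rule nn_integral_cong)
    fix x
    have "?g n' (R x) = R (?g n x)" by (simp add: nR linear_diff[OF lin] linear_scale[OF lin] R(2))
    then show "ennreal (cone_weight n' r (R x)) * indicator (ball 0 1) (?g n' (R x)) = ennreal (cone_weight n r x) * indicator (ball 0 1) (?g n x)"
      using nrm[of "?g n x"] by (simp add: cone_weight_def nR indicator_def)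
  qed
  also have "\<dots> = emeasure (cone_measure n r) (ball 0 1)" by (rule emeasure_cone_measure[symmetric]) simp
  finally show "emeasure (cone_measure n' r) (ball 0 1) = emeasure (cone_measure n r) (ball 0 1)" .
qed

text \<open>The proportionality constant depends on \<open>s\<close> and \<open>r\<close> only. This is why the
  value of the normalization constant of the Hausdorff measure is irrelevant.\<close>

lemma cone_measure_constant:
  assumes ha: "hausdorff_additive s TYPE(real ^ 'd)" and r: "0 < r"
    and K: "compact K" "cball z \<rho> \<subseteq> K" "0 < \<rho>" and fin: "hausdorff_outer s (frontier (K :: (real ^ 'd) set)) < \<infinity>"
  obtains b1 b4 :: real where "0 \<le> b1" "0 < b4"
    "\<And>(n :: real ^ 'd) A. norm n = 1 \<Longrightarrow> A \<in> sets borel \<Longrightarrow>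
      ennreal b4 * hausdorff_outer s (A \<inter> {v. n \<bullet> v = 0}) = ennreal b1 * emeasure (cone_measure n r) A"
proof -
  \<comment> \<open>The boundary of the single body \<open>K\<close> gives finiteness for every
    normal \<open>n\<close>.\<close>
  have dfin: "hausdorff_outer s (cball 0 k \<inter> {v. n \<bullet> v = 0}) < \<infinity>" if "norm n = 1" for n :: "real ^ 'd" and k
    by (rule hausdorff_outer_big_disc_finite[OF K(3)])
      (rule le_less_trans[OF hausdorff_outer_disc_le[OF that K(1,2)] fin])
  obtain n0 :: "real ^ 'd" where n0: "norm n0 = 1" using vector_choose_size[of 1] by auto
  let ?b1 = "enn2real (emeasure (flat_measure s n0) (ball 0 1))" and ?b4 = "enn2real (emeasure (cone_measure n0 r) (ball 0 1))"
  have "emeasure (flat_measure s n0) (ball 0 1) \<le> hausdorff_outer s (cball 0 1 \<inter> {v. n0 \<bullet> v = 0})"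
    by (subst emeasure_flat_measure[OF ha]) (auto intro!: hausdorff_outer_mono)
  then have b1: "emeasure (flat_measure s n0) (ball 0 1) = ennreal ?b1"
    using dfin[OF n0, of 1] by (auto simp: less_top)
  have b4: "emeasure (cone_measure n0 r) (ball 0 1) = ennreal ?b4" "0 < ?b4"
    using cone_measure_ball_pos[OF n0 r] cone_measure_ball_finite[OF n0 r, of 1] by (auto simp: enn2real_positive_iff less_top)
  show ?thesis
  proof (rule that[of ?b1 ?b4])
    fix n :: "real ^ 'd" and A :: "(real ^ 'd) set" assume n: "norm n = 1" and A: "A \<in> sets borel"
    obtain R where R: "orthogonal_transformation R" "R n0 = n"
      using orthogonal_transformation_exists[of n0 n] n n0 by auto
    show "ennreal ?b4 * hausdorff_outer s (A \<inter> {v. n \<bullet> v = 0}) = ennreal ?b1 * emeasure (cone_measure n r) A"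
      using flat_cone_measure_proportional[OF ha n r dfin[OF n] A] rotation_ball_measures[OF ha R] b1 b4(1)
      by (simp add: emeasure_flat_measure[OF ha A] mult.commute)
  qed (use b4 in auto)
qed

section \<open>Facets tangent to the inscribed sphere\<close>

text \<open>A supporting functional of the epigraph at \<open>(c, f c)\<close>. Its vertical
  component is nonzero because the epigraph has points above every \<open>x\<close>, so it can be
  normalized.\<close>

lemma convex_on_subgradient:
  fixes f :: "'a::euclidean_space \<Rightarrow> real"
  assumes f: "convex_on UNIV f"
  obtains u where "\<And>x. f c + u \<bullet> (x - c) \<le> f x"
proof -
  define E where "E = {p :: 'a \<times> real. f (fst p) \<le> snd p}"
  have cf: "continuous_on UNIV f" by (rule convex_on_continuous[OF open_UNIV f])
  have "E = epigraph UNIV f" by (auto simp: E_def epigraph_def)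
  then have cE: "convex E" using f by (simp add: convex_epigraphI)
  have "open {p :: 'a \<times> real. f (fst p) < snd p}"
    by (intro open_Collect_less continuous_intros continuous_on_compose2[OF cf]) auto
  moreover have "{p :: 'a \<times> real. f (fst p) < snd p} \<subseteq> E" by (auto simp: E_def)
  ultimately have "{p :: 'a \<times> real. f (fst p) < snd p} \<subseteq> interior E" by (rule interior_maximal[rotated])
  moreover have "(c, f c + 1) \<in> {p :: 'a \<times> real. f (fst p) < snd p}" by simp
  ultimately have iE: "interior E \<noteq> {}" by blast
  have inE: "(c, f c) \<in> E" by (simp add: E_def)
  have "(c, f c) \<notin> interior E"
  proof
    assume "(c, f c) \<in> interior E"
    then obtain e where e: "0 < e" "cball (c, f c) e \<subseteq> E" by (auto simp: mem_interior_cball)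
    have "(c, f c - e) \<in> cball (c, f c) e" using e by (simp add: dist_Pair_Pair dist_real_def)
    then show False using e by (auto simp: E_def)
  qed
  then obtain w where w: "w \<noteq> 0" "\<And>y. y \<in> E \<Longrightarrow> w \<bullet> y \<le> w \<bullet> (c, f c)"
    using supporting_functional[OF cE iE inE] by blast
  obtain w1 w2 where ww: "w = (w1, w2)" by (cases w)
  have le: "w1 \<bullet> x + w2 * t \<le> w1 \<bullet> c + w2 * f c" if "f x \<le> t" for x t
    using w(2)[of "(x, t)"] that by (simp add: E_def ww)
  have "w2 \<le> 0" using le[of c "f c + 1"] by (simp add: algebra_simps)
  moreover have "w2 \<noteq> 0"
  proof
    assume w2: "w2 = 0"
    have "w1 \<bullet> (c + w1) \<le> w1 \<bullet> c" using le[of "c + w1" "f (c + w1)"] w2 by simp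
    then have "w1 \<bullet> w1 \<le> 0" by (simp add: inner_add_right)
    then have "w1 = 0" by (metis inner_eq_zero_iff inner_ge_zero order_antisym)
    then show False using w(1) ww w2 by (simp add: zero_prod_def)
  qed
  ultimately have neg: "w2 < 0" by simp
  show ?thesis
  proof (rule that[of "(1 / - w2) *\<^sub>R w1"])
    fix x
    have "w1 \<bullet> (x - c) \<le> (f x - f c) * - w2" using le[of x "f x"] by (simp add: inner_diff_right algebra_simps)
    then have "w1 \<bullet> (x - c) / - w2 \<le> f x - f c" using neg by (subst pos_divide_le_eq) auto
    then show "f c + ((1 / - w2) *\<^sub>R w1) \<bullet> (x - c) \<le> f x" by simp
  qed
qed

text \<open>The affine hull of a facet is a whole hyperplane, and the tangency point
  \<open>p\<close> on it has distance \<open>r\<close> from \<open>c\<close>. Since the sphere lies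
  in \<open>K\<close>, the hyperplane is not closer to \<open>c\<close> than \<open>r\<close>, so
  Cauchy-Schwarz gives distance exactly \<open>r\<close>.\<close>

lemma inscribed_facet_normal:
  fixes K :: "'a::euclidean_space set"
  assumes P: "polyhedron K" and int: "interior K \<noteq> {}" and F: "F facet_of K"
    and ins: "inscribed_sphere K c r"
  obtains n where "norm n = 1" "K \<subseteq> {x. n \<bullet> (x - c) \<le> r}" "F = K \<inter> {x. n \<bullet> (x - c) = r}"
proof -
  obtain a b where ab: "a \<noteq> 0" "K \<subseteq> {x. a \<bullet> x \<le> b}" "F = K \<inter> {x. a \<bullet> x = b}"
    using facet_of_polyhedron[OF P F] by blast
  have r: "0 < r" and sph: "sphere c r \<subseteq> K" using ins by (auto simp: inscribed_sphere_def)
  obtain p where p: "p \<in> F" "sphere c r \<inter> affine hull F = {p}"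
    using ins F unfolding inscribed_sphere_def by blast
  have "aff_dim F = DIM('a) - 1" using F aff_dim_nonempty_interior[OF int] by (simp add: facet_of_def)
  moreover have "affine hull F \<subseteq> {x. a \<bullet> x = b}" using ab(3) by (intro hull_minimal affine_hyperplane) auto
  moreover have "affine hull F \<noteq> {}" using p by (auto intro: hull_inc)
  ultimately have "affine hull F = {x. a \<bullet> x = b}"
    using ab(1) by (intro affine_dim_equal affine_affine_hull affine_hyperplane) auto
  then have pin: "a \<bullet> p = b" "dist c p = r" using p by auto
  define n where "n = (1 / norm a) *\<^sub>R a"
  have n: "norm n = 1" using ab by (simp add: n_def)
  have an: "a \<bullet> x = norm a * (n \<bullet> x)" for x using ab by (simp add: n_def)
  have "c + r *\<^sub>R n \<in> sphere c r" using n r by (simp add: dist_norm)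
  then have "a \<bullet> (c + r *\<^sub>R n) \<le> b" using sph ab by blast
  then have "norm a * (n \<bullet> (c + r *\<^sub>R n)) \<le> norm a * (n \<bullet> p)" using pin an by simp
  then have "n \<bullet> (c + r *\<^sub>R n) \<le> n \<bullet> p" using ab by simp
  then have ge: "r \<le> n \<bullet> (p - c)" using n by (simp add: inner_add_right inner_diff_right norm_eq_1)
  have "n \<bullet> (p - c) \<le> norm n * norm (p - c)" by (rule norm_cauchy_schwarz)
  then have "n \<bullet> (p - c) = r" using ge pin n by (simp add: dist_norm norm_minus_commute)
  then have b: "b = norm a * (n \<bullet> c + r)" using pin an[of p] by (simp add: inner_diff_right algebra_simps)
  show ?thesis
  proof (rule that[OF n])
    show "K \<subseteq> {x. n \<bullet> (x - c) \<le> r}" using ab(1,2) by (auto simp: an b inner_diff_right)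
    show "F = K \<inter> {x. n \<bullet> (x - c) = r}" unfolding ab(3) using ab(1) by (auto simp: an b inner_diff_right)
  qed
qed

lemma integral_uniform_measure:
  fixes f :: "'b \<Rightarrow> real"
  assumes S: "S \<in> sets M" and m: "emeasure M S = ennreal m" "0 < m" and f: "f \<in> borel_measurable M"
  shows "(\<integral>x. f x \<partial>uniform_measure M S) = (\<integral>x. indicator S x * f x \<partial>M) / m"
proof -
  have "uniform_measure M S = density M (\<lambda>x. ennreal (indicator S x / m))"
    unfolding uniform_measure_def m(1) using m(2)
    by (intro arg_cong[where f="density M"] ext) (auto simp: indicator_def divide_ennreal simp flip: ennreal_1)
  then have "(\<integral>x. f x \<partial>uniform_measure M S) = (\<integral>x. (indicator S x / m) *\<^sub>R f x \<partial>M)"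
    using S f m(2) by (simp only:) (subst integral_density, auto)
  then show ?thesis by simp
qed

definition cone_proj :: "'a::euclidean_space \<Rightarrow> real \<Rightarrow> 'a \<Rightarrow> 'a \<Rightarrow> 'a" where
  "cone_proj n r c x = c + (r / (n \<bullet> (x - c))) *\<^sub>R (x - c)"

lemma borel_measurable_cone_proj [measurable]: "cone_proj n r c \<in> borel_measurable borel" for n c :: "'a::euclidean_space"
  unfolding cone_proj_def[abs_def] by measurable

text \<open>The proportionality for sets is read as an equality of two weighted measures on
  \<open>F\<close>, and therefore holds for integrals of \<open>g\<close>. Translation by
  \<open>c + r *\<^sub>R n\<close> moves the hyperplane through the origin to that of
  \<open>F\<close>.\<close>

lemma cone_integral:
  fixes n :: "real ^ 'd" and g :: "real ^ 'd \<Rightarrow> real"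
  assumes ha: "hausdorff_additive s TYPE(real ^ 'd)"
    and b: "0 < b1" "0 < b4" and pr: "\<And>A. A \<in> sets borel \<Longrightarrow>
      ennreal b4 * hausdorff_outer s (A \<inter> {v. n \<bullet> v = 0}) = ennreal b1 * emeasure (cone_measure n r) A"
    and n: "norm n = 1" and F: "F \<in> sets borel" "F \<subseteq> {x. n \<bullet> (x - c) = r}" and g: "g \<in> borel_measurable borel"
  shows "(\<integral>x. cone_weight n r (x - c) * (indicator F (cone_proj n r c x) * g (cone_proj n r c x)) \<partial>lborel)
     = (b4 / b1) * (\<integral>x. indicator F x * g x \<partial>hausdorff_measure s)"
proof -
  let ?p = "cone_proj n r c" and ?W = "\<lambda>x. cone_weight n r (x - c)"
  have nn: "n \<bullet> n = 1" using n by (simp add: norm_eq_1)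
  have mW[measurable]: "?W \<in> borel_measurable borel" by measurable
  have tr: "distr lborel borel (\<lambda>x. x - c) = (lborel :: (real ^ 'd) measure)"
  proof -
    have "(\<lambda>x. x - c) = (+) (- c)" by auto
    then show ?thesis by (simp only: lborel_distr_plus)
  qed
  have key: "(\<integral>\<^sup>+x. ennreal (?W x) * indicator E (?p x) \<partial>lborel) = ennreal (b4 / b1) * hausdorff_outer s E"
    if E: "E \<in> sets borel" "E \<subseteq> F" for E
  proof -
    define A where "A = (\<lambda>y. y + (c + r *\<^sub>R n)) -` E"
    have A: "A \<in> sets borel" unfolding A_def using measurable_sets[of "\<lambda>y. y + (c + r *\<^sub>R n)" borel borel E] E by simp
    have "A \<subseteq> {v. n \<bullet> v = 0}"
    proof
      fix y assume "y \<in> A"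
      then have "n \<bullet> (y + (c + r *\<^sub>R n) - c) = r" using E F by (auto simp: A_def)
      then show "y \<in> {v. n \<bullet> v = 0}" using nn by (simp add: inner_add_right)
    qed
    then have "A \<inter> {v. n \<bullet> v = 0} = A" by blast
    moreover have "E = (\<lambda>y. y + (c + r *\<^sub>R n)) ` A"
    proof (intro set_eqI iffI)
      fix x assume "x \<in> E"
      then show "x \<in> (\<lambda>y. y + (c + r *\<^sub>R n)) ` A" by (intro image_eqI[of _ _ "x - (c + r *\<^sub>R n)"]) (auto simp: A_def)
    qed (auto simp: A_def)
    then have "hausdorff_outer s A = hausdorff_outer s E" using hausdorff_outer_translation[of s "c + r *\<^sub>R n" A] by simp
    ultimately have p: "ennreal b4 * hausdorff_outer s E = ennreal b1 * emeasure (cone_measure n r) A"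
      using pr[OF A] by simp
    have m: "(\<lambda>x. ennreal (cone_weight n r x) * indicator A ((r / (n \<bullet> x)) *\<^sub>R x - r *\<^sub>R n)) \<in> borel_measurable borel"
      using A by (intro borel_measurable_times_ennreal measurable_compose[OF cone_proj_measurable] borel_measurable_indicator) auto
    have "emeasure (cone_measure n r) A = (\<integral>\<^sup>+x. ennreal (cone_weight n r x) * indicator A ((r / (n \<bullet> x)) *\<^sub>R x - r *\<^sub>R n) \<partial>distr lborel borel (\<lambda>x. x - c))"
      unfolding tr by (rule emeasure_cone_measure[OF A])
    also have "\<dots> = (\<integral>\<^sup>+x. ennreal (?W x) * indicator A ((r / (n \<bullet> (x - c))) *\<^sub>R (x - c) - r *\<^sub>R n) \<partial>lborel)"
      by (rule nn_integral_distr) (use m in simp_all)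
    also have "\<dots> = (\<integral>\<^sup>+x. ennreal (?W x) * indicator E (?p x) \<partial>lborel)"
      by (intro nn_integral_cong) (simp add: A_def indicator_def cone_proj_def add.commute)
    finally have e: "emeasure (cone_measure n r) A = (\<integral>\<^sup>+x. ennreal (?W x) * indicator E (?p x) \<partial>lborel)" .
    have "ennreal (b4 / b1) * hausdorff_outer s E = (ennreal b4 * hausdorff_outer s E) / ennreal b1"
      using b by (simp add: divide_ennreal[symmetric] ennreal_divide_times ennreal_times_divide)
    also have "\<dots> = (emeasure (cone_measure n r) A * ennreal b1) / ennreal b1" unfolding p by (simp add: mult.commute)
    also have "\<dots> = emeasure (cone_measure n r) A" using b by (intro mult_divide_eq_ennreal) auto
    finally show ?thesis using e by simp
  qed
  let ?D = "distr (density lborel (\<lambda>x. ennreal (?W x))) borel ?p"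
  have eq: "density ?D (\<lambda>x. ennreal (indicator F x)) = density (hausdorff_measure s) (\<lambda>x. ennreal (b4 / b1 * indicator F x))"
  proof (rule measure_eqI)
    fix E assume "E \<in> sets (density ?D (\<lambda>x. ennreal (indicator F x)))"
    then have E[measurable]: "E \<in> sets borel" by simp
    note F(1)[measurable]
    have EF: "E \<inter> F \<in> sets borel" by simp
    have "emeasure (density ?D (\<lambda>x. ennreal (indicator F x))) E = (\<integral>\<^sup>+x. indicator (E \<inter> F) x \<partial>?D)"
      by (subst emeasure_density, simp, simp, rule nn_integral_cong) (auto simp: indicator_def)
    also have "\<dots> = (\<integral>\<^sup>+x. indicator (E \<inter> F) (?p x) \<partial>density lborel (\<lambda>x. ennreal (?W x)))"
      by (rule nn_integral_distr) measurable
    also have "\<dots> = (\<integral>\<^sup>+x. ennreal (?W x) * indicator (E \<inter> F) (?p x) \<partial>lborel)"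
      by (rule nn_integral_density) measurable
    also have "\<dots> = ennreal (b4 / b1) * hausdorff_outer s (E \<inter> F)" by (rule key[OF EF]) simp
    also have "\<dots> = ennreal (b4 / b1) * emeasure (hausdorff_measure s) (E \<inter> F)" by (simp add: emeasure_hausdorff_measure[OF ha EF])
    also have "\<dots> = (\<integral>\<^sup>+x. ennreal (b4 / b1) * indicator (E \<inter> F) x \<partial>hausdorff_measure s)"
      by (simp add: nn_integral_cmult_indicator)
    also have "\<dots> = emeasure (density (hausdorff_measure s) (\<lambda>x. ennreal (b4 / b1 * indicator F x))) E"
      by (subst emeasure_density, simp, simp, rule nn_integral_cong) (auto simp: indicator_def)
    finally show "emeasure (density ?D (\<lambda>x. ennreal (indicator F x))) E = emeasure (density (hausdorff_measure s) (\<lambda>x. ennreal (b4 / b1 * indicator F x))) E" .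
  qed simp
  note F(1)[measurable] g[measurable]
  have W0: "0 \<le> cone_weight n r x" for x using b
    by (simp add: cone_weight_def)
  have "(\<integral>x. g x \<partial>density ?D (\<lambda>x. ennreal (indicator F x))) = (\<integral>x. indicator F x *\<^sub>R g x \<partial>?D)"
    by (rule integral_density) (auto simp: g)
  also have "\<dots> = (\<integral>x. indicator F (?p x) *\<^sub>R g (?p x) \<partial>density lborel (\<lambda>x. ennreal (?W x)))"
    by (rule integral_distr) measurable
  also have "\<dots> = (\<integral>x. ?W x *\<^sub>R (indicator F (?p x) *\<^sub>R g (?p x)) \<partial>lborel)"
    by (rule integral_density) (measurable, simp add: W0)
  finally have l: "(\<integral>x. g x \<partial>density ?D (\<lambda>x. ennreal (indicator F x))) = (\<integral>x. ?W x * (indicator F (?p x) * g (?p x)) \<partial>lborel)" by simp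
  have "(\<integral>x. g x \<partial>density (hausdorff_measure s) (\<lambda>x. ennreal (b4 / b1 * indicator F x))) = (\<integral>x. (b4 / b1 * indicator F x) *\<^sub>R g x \<partial>hausdorff_measure s)"
    using b g by (intro integral_density) auto
  then show ?thesis using l eq by (simp add: mult.assoc)
qed

lemma cball_subset_convex_sphere:
  fixes c :: "'a::euclidean_space"
  assumes "convex K" "sphere c r \<subseteq> K" "0 < r"
  shows "cball c r \<subseteq> K"
proof
  fix x assume x: "x \<in> cball c r"
  obtain u t where u: "norm u = 1" "x = c + t *\<^sub>R u" "\<bar>t\<bar> \<le> r"
  proof (cases "x = c")
    case True
    show ?thesis
      by (rule that[of "SOME b. b \<in> Basis" 0]) (use True assms in \<open>auto simp: SOME_Basis\<close>)
  next
    case False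
    show ?thesis
      by (rule that[of "(1 / norm (x - c)) *\<^sub>R (x - c)" "norm (x - c)"])
         (use False x in \<open>auto simp: dist_norm norm_minus_commute\<close>)
  qed
  have "c + r *\<^sub>R u \<in> K" "c - r *\<^sub>R u \<in> K" using assms u by (auto simp: dist_norm intro!: subsetD[OF assms(2)])
  \<comment> \<open>\<open>x\<close> divides a diameter of the sphere;
    \<open>\<bar>t\<bar> \<le> r\<close> makes both coefficients nonnegative.\<close>
  then have "(1/2 + t / (2 * r)) *\<^sub>R (c + r *\<^sub>R u) + (1/2 - t / (2 * r)) *\<^sub>R (c - r *\<^sub>R u) \<in> K"
    using u assms(3) by (intro convexD[OF assms(1)]) (auto simp: field_simps abs_le_iff)
  moreover have "(1/2 + t / (2 * r)) *\<^sub>R (c + r *\<^sub>R u) + (1/2 - t / (2 * r)) *\<^sub>R (c - r *\<^sub>R u)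
      = ((1/2 + t / (2 * r)) + (1/2 - t / (2 * r))) *\<^sub>R c + ((1/2 + t / (2 * r)) * r - (1/2 - t / (2 * r)) * r) *\<^sub>R u"
    by (simp only: scaleR_add_right scaleR_diff_right scaleR_add_left scaleR_diff_left scaleR_scaleR) (simp add: algebra_simps)
  moreover have "\<dots> = x" using u assms(3) by (simp add: field_simps)
  ultimately show "x \<in> K" by simp
qed

lemma null_sets_hyperplane_lborel:
  fixes a :: "'a::euclidean_space"
  assumes "a \<noteq> 0" shows "{x. a \<bullet> (x - c) = 0} \<in> null_sets lborel"
proof -
  have "{x. a \<bullet> (x - c) = 0} = {x. a \<bullet> x = a \<bullet> c}" by (auto simp: inner_diff_right)
  moreover have "{x. a \<bullet> x = a \<bullet> c} \<in> null_sets lebesgue"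
    using negligible_hyperplane[of a "a \<bullet> c"] assms by (simp add: negligible_iff_null_sets)
  then have "{x. a \<bullet> x = a \<bullet> c} \<in> null_sets lborel"
    by (subst (asm) null_sets_completion_iff) (simp_all add: hyperplane_borel)
  ultimately show ?thesis by simp
qed

section \<open>Decomposition of a circumscribed polytope into cones\<close>

locale inscribed_ball_cones =
  fixes K :: "(real ^ 'd) set" and c :: "real ^ 'd" and r :: real and Fs :: "(real ^ 'd) set set" and n :: "(real ^ 'd) set \<Rightarrow> real ^ 'd"
  assumes K: "compact K" "convex K" and r: "0 < r" and c: "c \<in> interior K"
    and fin: "finite Fs" and fr: "frontier K = \<Union>Fs"
    and n1: "F \<in> Fs \<Longrightarrow> norm (n F) = 1"
    and nK: "F \<in> Fs \<Longrightarrow> x \<in> K \<Longrightarrow> n F \<bullet> (x - c) \<le> r"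
    and nF: "F \<in> Fs \<Longrightarrow> F = K \<inter> {x. n F \<bullet> (x - c) = r}"
begin

text \<open>Strict positivity excludes the apex \<open>c\<close>, at which the central projection
  has no meaning.\<close>

definition facet_cone where "facet_cone F = {x. 0 < n F \<bullet> (x - c) \<and> n F \<bullet> (x - c) \<le> r \<and> cone_proj (n F) r c x \<in> F}"

lemma facet_borel: "F \<in> Fs \<Longrightarrow> F \<in> sets borel"
proof -
  assume F: "F \<in> Fs"
  have "K \<inter> {x. n F \<bullet> (x - c) = r} \<in> sets borel" by (rule sets.Int[OF borel_compact[OF K(1)]]) measurable
  then show ?thesis using nF[OF F] by simp
qed

lemma inj_n: "F \<in> Fs \<Longrightarrow> G \<in> Fs \<Longrightarrow> F \<noteq> G \<Longrightarrow> n F - n G \<noteq> 0"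
  using nF[of F] nF[of G] by auto

lemma cone_point:
  assumes "x \<in> facet_cone F"
  shows "x = (1 - cone_weight (n F) r (x - c)) *\<^sub>R c + cone_weight (n F) r (x - c) *\<^sub>R cone_proj (n F) r c x"
    "0 \<le> cone_weight (n F) r (x - c)" "cone_weight (n F) r (x - c) \<le> 1"
proof -
  have p: "0 < n F \<bullet> (x - c)" "n F \<bullet> (x - c) \<le> r" using assms by (auto simp: facet_cone_def)
  then have w: "cone_weight (n F) r (x - c) = n F \<bullet> (x - c) / r" by (simp add: cone_weight_def)
  have "(n F \<bullet> (x - c) / r) *\<^sub>R (r / (n F \<bullet> (x - c))) *\<^sub>R (x - c) = x - c" using p r by simp
  then show "x = (1 - cone_weight (n F) r (x - c)) *\<^sub>R c + cone_weight (n F) r (x - c) *\<^sub>R cone_proj (n F) r c x"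
    unfolding w cone_proj_def scaleR_add_right scaleR_diff_left by simp
  show "0 \<le> cone_weight (n F) r (x - c)" "cone_weight (n F) r (x - c) \<le> 1" using p r w by auto
qed

lemma cone_subset: "F \<in> Fs \<Longrightarrow> facet_cone F \<subseteq> K"
proof
  fix x assume F: "F \<in> Fs" and x: "x \<in> facet_cone F"
  have "cone_proj (n F) r c x \<in> K" using x nF[OF F] by (auto simp: facet_cone_def)
  moreover have "c \<in> K" using c interior_subset by blast
  ultimately have "(1 - cone_weight (n F) r (x - c)) *\<^sub>R c + cone_weight (n F) r (x - c) *\<^sub>R cone_proj (n F) r c x \<in> K"
    using cone_point[OF x] by (intro convexD[OF K(2)]) auto
  then show "x \<in> K" using cone_point(1)[OF x] by simp
qed

lemma cone_cover:
  assumes "x \<in> K" "x \<noteq> c" obtains F where "F \<in> Fs" "x \<in> facet_cone F"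
proof -
  obtain d where d: "0 < d" "c + d *\<^sub>R (x - c) \<in> frontier K"
    by (rule ray_to_frontier[OF compact_imp_bounded[OF K(1)] c, of "x - c"]) (use assms in auto)
  then obtain F where F: "F \<in> Fs" "c + d *\<^sub>R (x - c) \<in> F" using fr by auto
  have "n F \<bullet> (c + d *\<^sub>R (x - c) - c) = r" using F(2) nF[OF F(1)] by blast
  then have "d * (n F \<bullet> (x - c)) = r" by simp
  then have e: "n F \<bullet> (x - c) = r / d" "r / (n F \<bullet> (x - c)) = d" using d r by (auto simp: field_simps)
  have "x \<in> facet_cone F" unfolding facet_cone_def cone_proj_def using nK[OF F(1) assms(1)] F(2) e d r by auto
  then show ?thesis using that F by blast
qed

lemma inner_cone_proj: "m \<bullet> (cone_proj v r c x - c) = r / (v \<bullet> (x - c)) * (m \<bullet> (x - c))"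
  by (simp add: cone_proj_def)

text \<open>Rescaling to height \<open>r\<close> shows that on the cone over \<open>F\<close> no
  other normal gives a larger height than \<open>n F\<close>. A point of two cones thus has equal
  heights for both normals, and these points form a null set.\<close>

lemma cone_proj_swap:
  assumes "n F \<bullet> (x - c) > 0" "n G \<bullet> (cone_proj (n F) r c x - c) \<le> r"
  shows "n G \<bullet> (x - c) \<le> n F \<bullet> (x - c)"
proof -
  have "r * (n G \<bullet> (x - c)) \<le> r * (n F \<bullet> (x - c))"
    using assms by (simp add: inner_cone_proj pos_divide_le_eq)
  then show ?thesis using r by simp
qed

lemma AE_cone_disjoint:
  "AE x in lborel. \<forall>F\<in>Fs. \<forall>G\<in>Fs. F \<noteq> G \<longrightarrow> (n F - n G) \<bullet> (x - c) \<noteq> 0"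
proof -
  have "AE x in lborel. F \<noteq> G \<longrightarrow> (n F - n G) \<bullet> (x - c) \<noteq> 0" if "F \<in> Fs" "G \<in> Fs" for F G
  proof (cases "F = G")
    case False
    then show ?thesis using AE_not_in[OF null_sets_hyperplane_lborel[OF inj_n[OF that False], of c]] by simp
  qed simp
  then show ?thesis using fin by (intro AE_finite_allI) auto
qed

lemma AE_indicator_cones:
  "AE x in lborel. indicator K x = (\<Sum>F\<in>Fs. indicator (facet_cone F) x :: real)"
proof -
  have "AE x in lborel. x \<noteq> c" by (rule AE_lborel_singleton)
  then show ?thesis using AE_cone_disjoint
  proof eventually_elim
    case (elim x)
    show ?case
    proof (cases "x \<in> K")
      case True
      obtain F where F: "F \<in> Fs" "x \<in> facet_cone F" using cone_cover[OF True elim(1)] .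
      have "x \<notin> facet_cone G" if G: "G \<in> Fs" "G \<noteq> F" for G
      proof
        assume x: "x \<in> facet_cone G"
        have "n G \<bullet> (x - c) \<le> n F \<bullet> (x - c)" using F x nK[OF G(1)] nF[OF F(1)] by (intro cone_proj_swap) (auto simp: facet_cone_def)
        moreover have "n F \<bullet> (x - c) \<le> n G \<bullet> (x - c)" using F x nK[OF F(1)] nF[OF G(1)] by (intro cone_proj_swap) (auto simp: facet_cone_def)
        ultimately show False using elim(2) F G by (auto simp: inner_diff_left)
      qed
      then have "(\<Sum>G\<in>Fs. indicator (facet_cone G) x :: real) = (\<Sum>G\<in>Fs. if G = F then 1 else 0)"
        using F by (intro sum.cong) (auto simp: indicator_def)
      then show ?thesis using True F fin by simp
    next
      case False
      then have "(\<Sum>G\<in>Fs. indicator (facet_cone G) x :: real) = 0" using cone_subset by (intro sum.neutral) (auto simp: indicator_def)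
      then show ?thesis using False by simp
    qed
  qed
qed

lemma facet_subset: "F \<in> Fs \<Longrightarrow> F \<subseteq> frontier K" using fr by auto

lemma frontier_borel: "frontier K \<in> sets borel" by (intro borel_closed) simp

context
  fixes s :: nat and b1 b4 :: real
  assumes ha: "hausdorff_additive s TYPE(real ^ 'd)" and b: "0 < b1" "0 < b4"
    and pr: "\<And>v A. norm (v :: real ^ 'd) = 1 \<Longrightarrow> A \<in> sets borel \<Longrightarrow>
      ennreal b4 * hausdorff_outer s (A \<inter> {x. v \<bullet> x = 0}) = ennreal b1 * emeasure (cone_measure v r) A"
    and Hfin: "emeasure (hausdorff_measure s) (frontier K) < \<infinity>"
begin

lemma facet_integral:
  assumes F: "F \<in> Fs" and A: "A \<in> sets borel" "A \<subseteq> F" and g: "g \<in> borel_measurable borel"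
  shows "(\<integral>x. cone_weight (n F) r (x - c) * (indicator A (cone_proj (n F) r c x) * g (cone_proj (n F) r c x)) \<partial>lborel)
     = (b4 / b1) * (\<integral>x. indicator A x * g x \<partial>hausdorff_measure s)"
proof -
  have "A \<subseteq> {x. n F \<bullet> (x - c) = r}" using A nF[OF F] by auto
  from cone_integral[OF ha b pr[OF n1[OF F]] n1[OF F] A(1) this g] show ?thesis .
qed

lemma facet_finite: "A \<in> sets borel \<Longrightarrow> F \<in> Fs \<Longrightarrow> A \<subseteq> F \<Longrightarrow> emeasure (hausdorff_measure s) A < \<infinity>"
  by (rule le_less_trans[OF emeasure_mono Hfin]) (use facet_subset frontier_borel in auto)

text \<open>The cone over \<open>F \<inter> G\<close> lies in a hyperplane, on which both normals
  give the same height. It is Lebesgue null, and the integral identity for cones transfers this to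
  the Hausdorff measure of \<open>F \<inter> G\<close>.\<close>

lemma facet_overlap_null:
  assumes F: "F \<in> Fs" and G: "G \<in> Fs" and ne: "F \<noteq> G"
  shows "F \<inter> G \<in> null_sets (hausdorff_measure s)"
proof -
  have FG: "F \<inter> G \<in> sets borel" using facet_borel F G by auto
  have ae: "AE x in lborel. cone_weight (n F) r (x - c) * (indicator (F \<inter> G) (cone_proj (n F) r c x) * 1) = (0::real)"
    using AE_cone_disjoint
  proof eventually_elim
    case (elim x)
    show ?case
    proof (rule ccontr)
      assume "\<not> ?thesis"
      then have w: "cone_weight (n F) r (x - c) \<noteq> 0" and p: "cone_proj (n F) r c x \<in> F \<inter> G" by (auto simp: indicator_def)
      from w have l: "0 < n F \<bullet> (x - c)" by (auto simp: cone_weight_def split: if_splits)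
      have "n G \<bullet> (cone_proj (n F) r c x - c) = r" using p nF[OF G] by auto
      then have "r * (n G \<bullet> (x - c)) = r * (n F \<bullet> (x - c))"
        using l by (simp add: inner_cone_proj nonzero_divide_eq_eq)
      then have "n G \<bullet> (x - c) = n F \<bullet> (x - c)" using r by simp
      then show False using elim F G ne by (auto simp: inner_diff_left)
    qed
  qed
  have "(b4 / b1) * (\<integral>x. indicator (F \<inter> G) x * 1 \<partial>hausdorff_measure s) = (\<integral>x. 0 \<partial>(lborel :: (real ^ 'd) measure))"
  proof (rule trans[OF facet_integral[OF F FG Int_lower1, symmetric] integral_cong_AE[OF _ _ ae]])
    note FG[measurable]
    show "(\<lambda>x. cone_weight (n F) r (x - c) * (indicator (F \<inter> G) (cone_proj (n F) r c x) * 1)) \<in> borel_measurable lborel"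
      by measurable
  qed auto
  then have "measure (hausdorff_measure s) (F \<inter> G) = 0" using b FG by simp
  then have "emeasure (hausdorff_measure s) (F \<inter> G) = 0"
    using facet_finite[OF FG F] by (simp add: emeasure_eq_ennreal_measure)
  then show ?thesis using FG by (intro null_setsI) auto
qed

lemma AE_indicator_facets:
  "AE x in hausdorff_measure s. indicator (frontier K) x = (\<Sum>F\<in>Fs. indicator F x :: real)"
proof -
  have "AE x in hausdorff_measure s. F \<noteq> G \<longrightarrow> x \<notin> F \<inter> G" if "F \<in> Fs" "G \<in> Fs" for F G
    using AE_not_in[OF facet_overlap_null[OF that]] by (cases "F = G") auto
  then have "AE x in hausdorff_measure s. \<forall>F\<in>Fs. \<forall>G\<in>Fs. F \<noteq> G \<longrightarrow> x \<notin> F \<inter> G"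
    using fin by (intro AE_finite_allI) auto
  then show ?thesis
  proof eventually_elim
    case (elim x)
    show ?case
    proof (cases "x \<in> frontier K")
      case True
      then obtain F where F: "F \<in> Fs" "x \<in> F" using fr by auto
      then have "(\<Sum>G\<in>Fs. indicator G x :: real) = (\<Sum>G\<in>Fs. if G = F then 1 else 0)"
        using elim by (intro sum.cong) (auto simp: indicator_def)
      then show ?thesis using True F fin by simp
    next
      case False
      then have "(\<Sum>G\<in>Fs. indicator G x :: real) = 0" using fr by (intro sum.neutral) (auto simp: indicator_def)
      then show ?thesis using False by simp
    qed
  qed
qed

lemma cones_integral:
  fixes g :: "real ^ 'd \<Rightarrow> real"
  assumes g: "g \<in> borel_measurable borel" and bd: "\<And>x. x \<in> K \<Longrightarrow> \<bar>g x\<bar> \<le> B"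
  shows "integrable lborel (\<lambda>x. \<Sum>F\<in>Fs. cone_weight (n F) r (x - c) * (indicator F (cone_proj (n F) r c x) * g (cone_proj (n F) r c x)))" (is ?I)
    and "(\<integral>x. (\<Sum>F\<in>Fs. cone_weight (n F) r (x - c) * (indicator F (cone_proj (n F) r c x) * g (cone_proj (n F) r c x))) \<partial>lborel)
      = (b4 / b1) * (\<integral>x. indicator (frontier K) x * g x \<partial>hausdorff_measure s)" (is ?E)
proof -
  note g[measurable]
  have i1: "integrable lborel (\<lambda>x. cone_weight (n F) r (x - c) * (indicator F (cone_proj (n F) r c x) * g (cone_proj (n F) r c x)))"
    if F: "F \<in> Fs" for F
  proof (rule Bochner_Integration.integrable_bound)
    show "integrable lborel (\<lambda>x. indicator K x *\<^sub>R B)"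
      using K(1) emeasure_compact_finite[OF K(1)] by (intro integrable_scaleR_left integrable_real_indicator) (auto intro: borel_compact)
    note facet_borel[OF F, measurable]
    show "(\<lambda>x. cone_weight (n F) r (x - c) * (indicator F (cone_proj (n F) r c x) * g (cone_proj (n F) r c x))) \<in> borel_measurable lborel"
      by measurable
    have "\<bar>cone_weight (n F) r (x - c) * (indicator F (cone_proj (n F) r c x) * g (cone_proj (n F) r c x))\<bar> \<le> \<bar>indicator K x * B\<bar>" for x
    proof (cases "x \<in> facet_cone F")
      case True
      have "cone_proj (n F) r c x \<in> K" using True nF[OF F] by (auto simp: facet_cone_def)
      then have "\<bar>g (cone_proj (n F) r c x)\<bar> \<le> \<bar>B\<bar>" using bd by fastforce
      then have "cone_weight (n F) r (x - c) * \<bar>g (cone_proj (n F) r c x)\<bar> \<le> 1 * \<bar>B\<bar>"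
        using cone_point[OF True] by (intro mult_mono) auto
      moreover have "x \<in> K" "cone_proj (n F) r c x \<in> F" using cone_subset[OF F] True by (auto simp: facet_cone_def)
      ultimately show ?thesis using cone_point(2)[OF True] by (simp add: abs_mult)
    next
      case False
      then have "cone_weight (n F) r (x - c) * indicator F (cone_proj (n F) r c x) = 0"
        by (auto simp: facet_cone_def cone_weight_def indicator_def)
      then show ?thesis by auto
    qed
    then show "AE x in lborel. norm (cone_weight (n F) r (x - c) * (indicator F (cone_proj (n F) r c x) * g (cone_proj (n F) r c x))) \<le> norm (indicator K x *\<^sub>R B)"
      by simp
  qed
  then show ?I by (intro Bochner_Integration.integrable_sum)
  have i2: "integrable (hausdorff_measure s) (\<lambda>x. indicator F x * g x)" if F: "F \<in> Fs" for F
  proof (rule Bochner_Integration.integrable_bound)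
    show "integrable (hausdorff_measure s) (\<lambda>x. indicator (frontier K) x *\<^sub>R B)"
      using frontier_borel Hfin by (intro integrable_scaleR_left integrable_real_indicator) auto
    show "(\<lambda>x. indicator F x * g x) \<in> borel_measurable (hausdorff_measure s)" using facet_borel[OF F] g by simp
    have "F \<subseteq> K" using nF[OF F] by blast
    then show "AE x in hausdorff_measure s. norm (indicator F x * g x) \<le> norm (indicator (frontier K) x *\<^sub>R B)"
      using facet_subset[OF F] bd by (intro AE_I2) (fastforce simp: indicator_def)
  qed
  have "(\<integral>x. (\<Sum>F\<in>Fs. cone_weight (n F) r (x - c) * (indicator F (cone_proj (n F) r c x) * g (cone_proj (n F) r c x))) \<partial>lborel)
      = (\<Sum>F\<in>Fs. \<integral>x. cone_weight (n F) r (x - c) * (indicator F (cone_proj (n F) r c x) * g (cone_proj (n F) r c x)) \<partial>lborel)"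
    by (rule Bochner_Integration.integral_sum) (rule i1)
  also have "\<dots> = (\<Sum>F\<in>Fs. (b4 / b1) * (\<integral>x. indicator F x * g x \<partial>hausdorff_measure s))"
    by (intro sum.cong refl facet_integral facet_borel g) auto
  also have "\<dots> = (b4 / b1) * (\<integral>x. (\<Sum>F\<in>Fs. indicator F x * g x) \<partial>hausdorff_measure s)"
    by (subst Bochner_Integration.integral_sum) (auto simp: i2 sum_distrib_left)
  also have "(\<integral>x. (\<Sum>F\<in>Fs. indicator F x * g x) \<partial>hausdorff_measure s) = (\<integral>x. indicator (frontier K) x * g x \<partial>hausdorff_measure s)"
  proof (rule integral_cong_AE)
    show "AE x in hausdorff_measure s. (\<Sum>F\<in>Fs. indicator F x * g x) = indicator (frontier K) x * g x"
      using AE_indicator_facets by eventually_elim (simp add: sum_distrib_right)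
    show "(\<lambda>x. \<Sum>F\<in>Fs. indicator F x * g x) \<in> borel_measurable (hausdorff_measure s)"
      by (intro borel_measurable_sum borel_measurable_integrable i2)
    show "(\<lambda>x. indicator (frontier K) x * g x) \<in> borel_measurable (hausdorff_measure s)"
    proof -
      note frontier_borel[measurable] g[measurable]
      show ?thesis by measurable
    qed
  qed
  finally show ?E .
qed

text \<open>With \<open>p\<close> the projection of \<open>x\<close> and \<open>w\<close> its
  weight, convexity on the segment from \<open>c\<close> to \<open>p\<close> gives
  \<open>f x - f c \<le> w * (f p - f c)\<close>. Summed over the cones, the right side integrates
  exactly to a multiple of a boundary integral.\<close>

lemma convex_integral_le:
  assumes f: "convex_on UNIV f"
  shows "(\<integral>x. indicator K x * f x \<partial>lborel) \<le> f c * measure lborel K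
     + (b4 / b1) * (\<integral>x. indicator (frontier K) x * (f x - f c) \<partial>hausdorff_measure s)"
proof -
  have cf: "continuous_on UNIV f" using f convex_on_continuous[OF open_UNIV] by blast
  then have mf[measurable]: "f \<in> borel_measurable borel" by (rule borel_measurable_continuous_onI)
  have "bounded ((\<lambda>x. f x - f c) ` K)"
    by (intro compact_imp_bounded compact_continuous_image continuous_intros continuous_on_subset[OF cf] K) auto
  then obtain B where B: "\<And>x. x \<in> K \<Longrightarrow> \<bar>f x - f c\<bar> \<le> B" unfolding bounded_iff by auto
  have "(\<lambda>x. f x - f c) \<in> borel_measurable borel" by simp
  note ci = cones_integral[OF this B]
  have Kb: "K \<in> sets borel" "emeasure lborel K < \<infinity>" using K(1) emeasure_compact_finite[OF K(1)] by (auto intro: borel_compact)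
  let ?S = "\<lambda>x. \<Sum>F\<in>Fs. cone_weight (n F) r (x - c) * (indicator F (cone_proj (n F) r c x) * (f (cone_proj (n F) r c x) - f c))"
  have iK: "integrable lborel (\<lambda>x. f c * indicator K x)"
    using Kb by (intro integrable_mult_right integrable_real_indicator) auto
  have "(\<integral>x. indicator K x * f x \<partial>lborel) \<le> (\<integral>x. f c * indicator K x + ?S x \<partial>lborel)"
  proof (rule integral_mono_AE)
    have "integrable lborel (\<lambda>x. indicator K x *\<^sub>R f x)"
      using borel_integrable_compact[OF K(1) continuous_on_subset[OF cf]] by (auto simp: indicator_def if_distrib cong: if_cong)
    then show "integrable lborel (\<lambda>x. indicator K x * f x)" by simp
    show "integrable lborel (\<lambda>x. f c * indicator K x + ?S x)" by (intro Bochner_Integration.integrable_add iK ci(1))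
    show "AE x in lborel. indicator K x * f x \<le> f c * indicator K x + ?S x"
      using AE_indicator_cones
    proof eventually_elim
      case (elim x)
      have "indicator (facet_cone F) x * (f x - f c)
          \<le> cone_weight (n F) r (x - c) * (indicator F (cone_proj (n F) r c x) * (f (cone_proj (n F) r c x) - f c))" for F
      proof (cases "x \<in> facet_cone F")
        case True
        let ?w = "cone_weight (n F) r (x - c)" and ?p = "cone_proj (n F) r c x"
        have "f ((1 - ?w) *\<^sub>R c + ?w *\<^sub>R ?p) \<le> (1 - ?w) * f c + ?w * f ?p"
          using cone_point[OF True] by (intro convex_onD[OF f]) auto
        then have "f x \<le> (1 - ?w) * f c + ?w * f ?p" using cone_point(1)[OF True] by simp
        moreover have "?p \<in> F" using True by (simp add: facet_cone_def)
        ultimately show ?thesis using True by (simp add: algebra_simps)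
      next
        case False
        then have "cone_weight (n F) r (x - c) * indicator F (cone_proj (n F) r c x) = 0"
          by (auto simp: facet_cone_def cone_weight_def indicator_def)
        then show ?thesis using False by auto
      qed
      then have "(\<Sum>F\<in>Fs. indicator (facet_cone F) x * (f x - f c)) \<le> ?S x" by (rule sum_mono)
      then show ?case unfolding elim sum_distrib_right[symmetric] by (simp add: algebra_simps)
    qed
  qed
  also have "\<dots> = f c * measure lborel K + (b4 / b1) * (\<integral>x. indicator (frontier K) x * (f x - f c) \<partial>hausdorff_measure s)"
    by (rule trans[OF Bochner_Integration.integral_add[OF iK ci(1)] arg_cong2[where f="(+)", OF _ ci(2)]]) (simp only: Bochner_Integration.integral_mult_right_zero Bochner_Integration.integral_indicator, use Kb in simp)
  finally show ?thesis .
qed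

text \<open>The same identity for the constant function \<open>1\<close>, with weights at most
  \<open>1\<close>. It shows that the coefficient of the boundary mean is at most \<open>1\<close>
  after normalization.\<close>

lemma boundary_constant_le: "(b4 / b1) * measure (hausdorff_measure s) (frontier K) \<le> measure lborel K"
proof -
  have Kb: "K \<in> sets borel" "emeasure lborel K < \<infinity>" using K(1) emeasure_compact_finite[OF K(1)] by (auto intro: borel_compact)
  have "(\<lambda>x. 1 :: real) \<in> borel_measurable borel" "\<And>x. x \<in> K \<Longrightarrow> \<bar>1 :: real\<bar> \<le> 1" by auto
  note ci = cones_integral[OF this]
  have "(b4 / b1) * (\<integral>x. indicator (frontier K) x * 1 \<partial>hausdorff_measure s) =
    (\<integral>x. (\<Sum>F\<in>Fs. cone_weight (n F) r (x - c) * (indicator F (cone_proj (n F) r c x) * 1)) \<partial>lborel)"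
    by (rule ci(2)[symmetric])
  also have "\<dots> \<le> (\<integral>x. indicator K x \<partial>lborel)"
  proof (rule integral_mono_AE[OF ci(1)])
    show "integrable lborel (indicator K :: _ \<Rightarrow> real)" using Kb by (intro integrable_real_indicator) auto
    show "AE x in lborel. (\<Sum>F\<in>Fs. cone_weight (n F) r (x - c) * (indicator F (cone_proj (n F) r c x) * 1)) \<le> (indicator K x :: real)"
      using AE_indicator_cones
    proof eventually_elim
      case (elim x)
      have "cone_weight (n F) r (x - c) * (indicator F (cone_proj (n F) r c x) * 1) \<le> (indicator (facet_cone F) x :: real)" for F
        using cone_point[of x F] by (cases "x \<in> facet_cone F") (auto simp: facet_cone_def cone_weight_def indicator_def)
      then show ?case unfolding elim by (rule sum_mono)
    qed
  qed
  finally show ?thesis using Kb by simp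
qed

end

end


lemma circumscribed_convex_order:
  fixes K :: "(real ^ 'd) set"
  assumes P: "polytope K" and int: "interior K \<noteq> {}" and ins: "inscribed_sphere K c r"
    and ha: "hausdorff_additive s TYPE(real ^ 'd)"
    and H: "hausdorff_outer s (frontier K) \<noteq> 0" "hausdorff_outer s (frontier K) < \<infinity>"
    and mean: "c = (\<integral>x. x \<partial>uniform_measure (hausdorff_measure s) (frontier K))"
    and f: "convex_on UNIV f"
  shows "(\<integral>x. f x \<partial>uniform_measure lborel K) \<le> (\<integral>x. f x \<partial>uniform_measure (hausdorff_measure s) (frontier K))"
proof -
  have K: "compact K" "convex K" using P by (auto intro: polytope_imp_compact polytope_imp_convex)
  have ph: "polyhedron K" using P by (rule polytope_imp_polyhedron)
  have r: "0 < r" using ins by (simp add: inscribed_sphere_def)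
  have cb: "cball c r \<subseteq> K" using cball_subset_convex_sphere[OF K(2)] ins by (simp add: inscribed_sphere_def)
  then have c: "c \<in> interior K" using r unfolding mem_interior_cball by blast
  let ?Fs = "{F. F facet_of K}"
  have "\<exists>n. \<forall>F\<in>?Fs. norm (n F) = 1 \<and> K \<subseteq> {x. n F \<bullet> (x - c) \<le> r} \<and> F = K \<inter> {x. n F \<bullet> (x - c) = r}"
  proof (intro bchoice ballI)
    fix F assume "F \<in> ?Fs"
    then obtain v where "norm v = 1" "K \<subseteq> {x. v \<bullet> (x - c) \<le> r}" "F = K \<inter> {x. v \<bullet> (x - c) = r}"
      by (elim CollectE inscribed_facet_normal[OF ph int _ ins])
    then show "\<exists>v. norm v = 1 \<and> K \<subseteq> {x. v \<bullet> (x - c) \<le> r} \<and> F = K \<inter> {x. v \<bullet> (x - c) = r}" by (intro exI[of _ v] conjI)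
  qed
  then obtain n where n: "\<forall>F\<in>?Fs. norm (n F) = 1 \<and> K \<subseteq> {x. n F \<bullet> (x - c) \<le> r} \<and> F = K \<inter> {x. n F \<bullet> (x - c) = r}" ..
  interpret inscribed_ball_cones K c r ?Fs n
  proof
    show "frontier K = \<Union>?Fs"
      using rel_frontier_of_polyhedron[OF ph] rel_frontier_frontier[OF affine_hull_nonempty_interior[OF int]] by simp
    show "finite ?Fs" using P by (rule finite_polytope_facets)
  qed (use K r c n in \<open>blast+\<close>)
  obtain b1 b4 where b: "0 \<le> b1" "0 < b4" and pr: "\<And>(v :: real ^ 'd) A. norm v = 1 \<Longrightarrow> A \<in> sets borel \<Longrightarrow>
      ennreal b4 * hausdorff_outer s (A \<inter> {x. v \<bullet> x = 0}) = ennreal b1 * emeasure (cone_measure v r) A"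
  proof (rule cone_measure_constant[OF ha r K(1) cb r H(2)])
    fix b1 b4 :: real
    assume a: "0 \<le> b1" "0 < b4" "\<And>(v :: real ^ 'd) A. norm v = 1 \<Longrightarrow> A \<in> sets borel \<Longrightarrow>
      ennreal b4 * hausdorff_outer s (A \<inter> {x. v \<bullet> x = 0}) = ennreal b1 * emeasure (cone_measure v r) A"
    show thesis by (rule that[OF a])
  qed
  have eH: "emeasure (hausdorff_measure s) (frontier K) = hausdorff_outer s (frontier K)"
    by (rule emeasure_hausdorff_measure[OF ha frontier_borel])
  \<comment> \<open>If \<open>b1\<close> vanished, every hyperplane would be a Hausdorff null set,
    and so would the boundary as a finite union of facets.\<close>
  have "b1 \<noteq> 0"
  proof
    assume b1: "b1 = 0"
    have "F \<in> null_sets (hausdorff_measure s)" if F: "F \<in> ?Fs" for F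
    proof (intro null_setsI)
      have "ennreal b4 * hausdorff_outer s (UNIV \<inter> {x. n F \<bullet> x = 0}) = 0" using pr[OF n1[OF F], of UNIV] b1 by simp
      then have "hausdorff_outer s {x. n F \<bullet> x = 0} = 0" using b(2) by simp
      then have z: "hausdorff_outer s ((\<lambda>x. x + (c + r *\<^sub>R n F)) ` {x. n F \<bullet> x = 0}) = 0" by (simp only: hausdorff_outer_translation)
      have nn: "n F \<bullet> n F = 1" using n1[OF F] by (simp add: norm_eq_1)
      have "F \<subseteq> (\<lambda>x. x + (c + r *\<^sub>R n F)) ` {x. n F \<bullet> x = 0}"
      proof
        fix x assume "x \<in> F"
        then have "n F \<bullet> (x - c) = r" using nF[OF F] by blast
        then have "n F \<bullet> (x - (c + r *\<^sub>R n F)) = 0" using nn by (simp add: inner_diff_right inner_add_right)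
        then show "x \<in> (\<lambda>x. x + (c + r *\<^sub>R n F)) ` {x. n F \<bullet> x = 0}"
          by (intro image_eqI[of _ _ "x - (c + r *\<^sub>R n F)"]) simp_all
      qed
      from hausdorff_outer_mono[OF this, of s] z have "hausdorff_outer s F = 0" by simp
      then show "emeasure (hausdorff_measure s) F = 0" by (simp only: emeasure_hausdorff_measure[OF ha facet_borel[OF F]])
      show "F \<in> sets (hausdorff_measure s)" using facet_borel[OF F] by simp
    qed
    then have "\<Union>?Fs \<in> null_sets (hausdorff_measure s)" using fin by (intro null_sets.finite_Union) auto
    then show False using H(1) eH fr by auto
  qed
  with b have b1: "0 < b1" by simp
  have Hfin: "emeasure (hausdorff_measure s) (frontier K) < \<infinity>" using eH H(2) by simp
  define hK where "hK = measure (hausdorff_measure s) (frontier K)"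
  define lK where "lK = measure lborel K"
  have ehK: "emeasure (hausdorff_measure s) (frontier K) = ennreal hK"
    unfolding hK_def using Hfin by (intro emeasure_eq_ennreal_measure) auto
  then have hK: "0 < hK" using H(1) eH by (cases "0 < hK") (auto simp: ennreal_neg)
  have elK: "emeasure lborel K = ennreal lK"
    unfolding lK_def using emeasure_compact_finite[OF K(1)] by (intro emeasure_eq_ennreal_measure) auto
  have "emeasure lborel (cball c r) = ennreal (measure lborel (cball c r))"
    by (rule emeasure_eq_ennreal_measure) (use emeasure_compact_finite[OF compact_cball[of c r]] in auto)
  then have "ennreal 0 < emeasure lborel (cball c r)" using content_cball_pos[OF r, of c] by simp
  also have "\<dots> \<le> emeasure lborel K" using cb K(1) by (intro emeasure_mono) (auto intro: borel_compact)
  finally have lK: "0 < lK" unfolding elK by simp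
  have Kb: "K \<in> sets lborel" using K(1) by (auto intro: borel_compact)
  let ?H = "hausdorff_measure s :: (real ^ 'd) measure" and ?N = "uniform_measure (hausdorff_measure s) (frontier K)"
  have cf: "continuous_on UNIV f" using f convex_on_continuous[OF open_UNIV] by blast
  then have mf[measurable]: "f \<in> borel_measurable borel" by (rule borel_measurable_continuous_onI)
  interpret N: prob_space ?N by (rule prob_space_uniform_measure) (use ehK hK in auto)
  have pu: "N.prob UNIV = 1" using N.prob_space by simp
  have frK: "compact (frontier K)" using K(1) by (rule compact_frontier)
  have aeN: "AE x in ?N. x \<in> frontier K" by (rule AE_uniform_measureI) (use frontier_borel in auto)
  have iN: "integrable ?N g" if "continuous_on UNIV g" for g :: "real ^ 'd \<Rightarrow> 'b::euclidean_space"
    by (rule integrable_continuous_compact_support[OF N.finite_measure_axioms _ aeN frK that]) simp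
  obtain u where u: "\<And>x. f c + u \<bullet> (x - c) \<le> f x"
  proof (rule convex_on_subgradient[OF f, of c])
    fix u assume a: "\<And>x. f c + u \<bullet> (x - c) \<le> f x"
    show thesis by (rule that[OF a])
  qed
  have ix: "integrable ?N (\<lambda>x. x)" by (intro iN continuous_intros)
  \<comment> \<open>Jensen for the boundary law: the affine minorant at \<open>c\<close> has mean
    \<open>f c\<close> because \<open>c\<close> is the mean of the law.\<close>
  have "f c = f c + u \<bullet> ((\<integral>x. x \<partial>?N) - c)" using mean by simp
  also have "\<dots> = (\<integral>x. f c + u \<bullet> (x - c) \<partial>?N)"
    using ix by (simp add: inner_diff_right pu)
  also have "\<dots> \<le> (\<integral>x. f x \<partial>?N)" by (intro integral_mono iN cf continuous_intros u)
  finally have J: "f c \<le> (\<integral>x. f x \<partial>?N)" .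
  have "(\<integral>x. f x - f c \<partial>?N) = (\<integral>x. indicator (frontier K) x * (f x - f c) \<partial>?H) / hK"
    by (rule integral_uniform_measure[OF _ ehK hK]) (use frontier_borel in simp, simp)
  moreover have "(\<integral>x. f x - f c \<partial>?N) = (\<integral>x. f x \<partial>?N) - f c" using iN[OF cf] by (simp add: pu)
  ultimately have e: "(\<integral>x. indicator (frontier K) x * (f x - f c) \<partial>?H) = hK * ((\<integral>x. f x \<partial>?N) - f c)" using hK by (simp add: field_simps)
  have "(\<integral>x. f x \<partial>uniform_measure lborel K) = (\<integral>x. indicator K x * f x \<partial>lborel) / lK"
    by (rule integral_uniform_measure[OF Kb elK lK]) (simp add: mf)
  moreover have "(\<integral>x. indicator K x * f x \<partial>lborel) \<le> f c * lK + (b4 / b1) * (hK * ((\<integral>x. f x \<partial>?N) - f c))"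
    unfolding e[symmetric] lK_def by (rule convex_integral_le[OF ha b1 b(2) _ Hfin f]) (rule pr)
  \<comment> \<open>The boundary mean is at least \<open>f c\<close>, so raising the coefficient to
    \<open>lK\<close> only increases the bound.\<close>
  moreover have "(b4 / b1 * hK) * ((\<integral>x. f x \<partial>?N) - f c) \<le> lK * ((\<integral>x. f x \<partial>?N) - f c)"
  proof (rule mult_right_mono)
    show "b4 / b1 * hK \<le> lK"
      unfolding hK_def lK_def by (rule boundary_constant_le[OF ha b1 b(2) _ Hfin]) (rule pr)
  qed (use J in simp)
  ultimately have "(\<integral>x. f x \<partial>uniform_measure lborel K) * lK \<le> f c * lK + lK * ((\<integral>x. f x \<partial>?N) - f c)"
    using lK by (simp add: mult.assoc)
  then have "(\<integral>x. f x \<partial>uniform_measure lborel K) * lK \<le> (\<integral>x. f x \<partial>?N) * lK" by (simp add: right_diff_distrib mult.commute)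
  then show ?thesis using lK by simp
qed

section \<open>Separately convex functions\<close>

definition vec_upd :: "'a ^ 'k \<Rightarrow> 'k \<Rightarrow> 'a \<Rightarrow> 'a ^ 'k" where
  "vec_upd x j y = (\<chi> i. if i = j then y else x $ i)"

lemma vec_upd_nth [simp]: "vec_upd x j y $ i = (if i = j then y else x $ i)"
  by (simp add: vec_upd_def)

lemma vec_upd_same [simp]: "vec_upd x j (x $ j) = x"
  by (simp add: vec_eq_iff)

lemma separately_convexD:
  "convex_in_each_arg \<phi> \<Longrightarrow> convex_on UNIV (\<lambda>y. \<phi> (vec_upd x j y))"
  by (simp add: convex_in_each_arg_def vec_upd_def)

text \<open>A convex function on a box is bounded by its values at the vertices. Coordinates are
  released one at a time from the finite vertex set \<open>S\<close> to the ball.\<close>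

lemma separately_convex_bounded_above:
  fixes \<phi> :: "('a::euclidean_space) ^ 'k::finite \<Rightarrow> real"
  assumes \<phi>: "convex_in_each_arg \<phi>"
  obtains B where "\<And>x. (\<And>i. norm (x $ i) \<le> R) \<Longrightarrow> \<phi> x \<le> B"
proof -
  obtain a :: 'a where a: "cball 0 R \<subseteq> cbox (- a) a"
    using bounded_subset_cbox_symmetric[OF bounded_cball] by blast
  obtain S where S: "finite S" "cbox (- a) a = convex hull S"
    using polytope_interval[of "- a" a] unfolding polytope_def by blast
  have "\<exists>B. \<forall>x. (\<forall>i\<in>J. norm (x $ i) \<le> R) \<and> (\<forall>i. i \<notin> J \<longrightarrow> x $ i \<in> S) \<longrightarrow> \<phi> x \<le> B" if "finite J" for J
    using that
  proof induction
    case empty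
    let ?X = "{x :: 'a ^ 'k. \<forall>i. x $ i \<in> S}"
    have "?X \<subseteq> vec_lambda ` (PiE UNIV (\<lambda>_. S))"
    proof
      fix x assume "x \<in> ?X"
      then show "x \<in> vec_lambda ` (PiE UNIV (\<lambda>_. S))" by (intro image_eqI[of _ _ "vec_nth x"]) auto
    qed
    then have "finite ?X" by (rule finite_subset) (intro finite_imageI finite_PiE, auto simp: S)
    then have "\<forall>x\<in>?X. \<phi> x \<le> Max (\<phi> ` ?X)" by auto
    then show ?case by (intro exI[of _ "Max (\<phi> ` ?X)"]) auto
  next
    case (insert j J)
    then obtain B where B: "\<And>x. (\<forall>i\<in>J. norm (x $ i) \<le> R) \<Longrightarrow> (\<forall>i. i \<notin> J \<longrightarrow> x $ i \<in> S) \<Longrightarrow> \<phi> x \<le> B" by auto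
    have "\<phi> x \<le> B" if x: "\<forall>i\<in>insert j J. norm (x $ i) \<le> R" "\<forall>i. i \<notin> insert j J \<longrightarrow> x $ i \<in> S" for x
    proof -
      have "\<forall>y\<in>S. \<phi> (vec_upd x j y) \<le> B" using x insert by (intro ballI B) auto
      then have "\<forall>y\<in>convex hull S. \<phi> (vec_upd x j y) \<le> B"
        by (intro convex_on_convex_hull_bound convex_on_subset[OF separately_convexD[OF \<phi>]]) auto
      moreover have "x $ j \<in> convex hull S" using x(1) a S(2) by auto
      ultimately have "\<phi> (vec_upd x j (x $ j)) \<le> B" by blast
      then show ?thesis by simp
    qed
    then show ?case by blast
  qed
  from this[OF finite_class.finite_UNIV] show ?thesis using that by auto
qed

text \<open>For the lower bound, \<open>0\<close> is the midpoint of \<open>x $ j\<close> and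
  \<open>- (x $ j)\<close>: the upper bound \<open>U\<close> at one end and the lower bound
  \<open>B\<close> at the midpoint give \<open>2 * B - U\<close> at the other end. Coordinates are
  released from \<open>0\<close> one at a time. For negative \<open>R\<close> the condition on
  \<open>x\<close> cannot be met.\<close>

lemma separately_convex_bounded:
  fixes \<phi> :: "('a::euclidean_space) ^ 'k::finite \<Rightarrow> real"
  assumes \<phi>: "convex_in_each_arg \<phi>"
  obtains B where "\<And>x. (\<And>i. norm (x $ i) \<le> R) \<Longrightarrow> \<bar>\<phi> x\<bar> \<le> B"
proof (cases "0 \<le> R")
  case R: True
  obtain U where U: "\<And>x. (\<And>i. norm (x $ i) \<le> R) \<Longrightarrow> \<phi> x \<le> U"
    by (rule separately_convex_bounded_above[OF \<phi>, of R]) blast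
  have "\<exists>B. \<forall>x. (\<forall>i\<in>J. norm (x $ i) \<le> R) \<and> (\<forall>i. i \<notin> J \<longrightarrow> x $ i = 0) \<longrightarrow> B \<le> \<phi> x" if "finite J" for J
    using that
  proof induction
    case empty
    have "x = 0" if "\<forall>i. x $ i = 0" for x :: "'a ^ 'k" using that by (simp add: vec_eq_iff)
    then show ?case by (intro exI[of _ "\<phi> 0"]) auto
  next
    case (insert j J)
    then obtain B where B: "\<And>x. (\<forall>i\<in>J. norm (x $ i) \<le> R) \<Longrightarrow> (\<forall>i. i \<notin> J \<longrightarrow> x $ i = 0) \<Longrightarrow> B \<le> \<phi> x" by auto
    have "2 * B - U \<le> \<phi> x" if x: "\<forall>i\<in>insert j J. norm (x $ i) \<le> R" "\<forall>i. i \<notin> insert j J \<longrightarrow> x $ i = 0" for x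
    proof -
      have "\<phi> (vec_upd x j ((1/2) *\<^sub>R (x $ j) + (1/2) *\<^sub>R (- (x $ j)))) \<le> (1/2) * \<phi> (vec_upd x j (x $ j)) + (1/2) * \<phi> (vec_upd x j (- (x $ j)))"
        using convex_onD[OF separately_convexD[OF \<phi>, of x j], of "1/2" "x $ j" "- (x $ j)"] by simp
      moreover have "B \<le> \<phi> (vec_upd x j 0)" using x insert by (intro B) auto
      moreover have "norm (x $ i) \<le> R" for i using x R by (cases "i \<in> insert j J") auto
      then have "\<phi> (vec_upd x j (- (x $ j))) \<le> U" by (intro U) simp
      ultimately show ?thesis by simp
    qed
    then show ?case by blast
  qed
  from this[OF finite_class.finite_UNIV] obtain L where L: "\<And>x. (\<And>i. norm (x $ i) \<le> R) \<Longrightarrow> L \<le> \<phi> x" by auto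
  show ?thesis
  proof (rule that)
    fix x :: "'a ^ 'k" assume "\<And>i. norm (x $ i) \<le> R"
    then have "L \<le> \<phi> x" "\<phi> x \<le> U" using L U by auto
    then show "\<bar>\<phi> x\<bar> \<le> max U (- L)" by auto
  qed
next
  case False
  show ?thesis
  proof (rule that)
    fix x :: "'a ^ 'k" assume "\<And>i. norm (x $ i) \<le> R"
    then have "norm (x $ undefined) \<le> R" .
    then show "\<bar>\<phi> x\<bar> \<le> 0" using False norm_ge_zero[of "x $ undefined"] by linarith
  qed
qed

text \<open>Prolong the segment from \<open>x\<close> to \<open>y\<close> by unit length to a point
  \<open>z\<close>, which is still in the ball of radius \<open>R + 1\<close>. Convexity at
  \<open>y\<close> bounds \<open>f y - f x\<close> by the share \<open>t / (1 + t)\<close> of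
  \<open>f z - f x\<close>, where \<open>t\<close> is the distance of \<open>x\<close> and
  \<open>y\<close>.\<close>

lemma convex_on_bounded_lipschitz:
  fixes f :: "'a::real_normed_vector \<Rightarrow> real"
  assumes f: "convex_on UNIV f" and B: "\<And>x. norm x \<le> R + 1 \<Longrightarrow> \<bar>f x\<bar> \<le> B"
    and x: "norm x \<le> R" and y: "norm y \<le> R"
  shows "\<bar>f y - f x\<bar> \<le> 2 * B * norm (y - x)"
proof -
  have *: "f y - f x \<le> 2 * B * norm (y - x)" if x: "norm x \<le> R" and y: "norm y \<le> R" for x y
  proof (cases "x = y")
    case False
    define t where "t = norm (y - x)"
    have t: "0 < t" using False by (simp add: t_def)
    define z where "z = y + (1 / t) *\<^sub>R (y - x)"
    have "norm z \<le> norm y + norm ((1 / t) *\<^sub>R (y - x))" unfolding z_def by (rule norm_triangle_ineq)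
    then have z: "norm z \<le> R + 1" using y t by (simp add: t_def)
    have "(1 + t) *\<^sub>R y = x + t *\<^sub>R z" using t by (simp add: z_def algebra_simps)
    then have "(1 + t) *\<^sub>R y = (1 + t) *\<^sub>R ((1 - t / (1 + t)) *\<^sub>R x + (t / (1 + t)) *\<^sub>R z)"
      using t by (simp only: scaleR_add_right scaleR_scaleR right_diff_distrib) simp
    then have yy: "y = (1 - t / (1 + t)) *\<^sub>R x + (t / (1 + t)) *\<^sub>R z"
      using t by (simp only: scaleR_cancel_left) simp
    have "f y \<le> (1 - t / (1 + t)) * f x + (t / (1 + t)) * f z"
      by (subst yy, rule convex_onD[OF f]) (use t in auto)
    then have "f y - f x \<le> (t / (1 + t)) * (f z - f x)" by (simp only: left_diff_distrib right_diff_distrib)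
    also have "\<dots> \<le> (t / (1 + t)) * (2 * B)" using B[OF z] B[of x] x t by (intro mult_left_mono) auto
    also have "\<dots> \<le> t * (2 * B)"
    proof (rule mult_right_mono)
      show "t / (1 + t) \<le> t" using t by (simp add: field_simps)
    qed (use B[OF z] in linarith)
    finally show ?thesis by (simp add: t_def mult.commute)
  qed simp
  show ?thesis using *[OF x y] *[OF y x] by (auto simp: abs_le_iff norm_minus_commute)
qed

text \<open>Pass from \<open>x\<close> to \<open>y\<close> by changing one coordinate at a time; the
  Lipschitz constant \<open>2 * B\<close> is the same for each change. Continuity is what makes
  \<open>\<phi>\<close> measurable.\<close>

lemma separately_convex_continuous:
  fixes \<phi> :: "('a::euclidean_space) ^ 'k::finite \<Rightarrow> real"
  assumes \<phi>: "convex_in_each_arg \<phi>"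
  shows "continuous_on UNIV \<phi>"
proof (rule continuous_at_imp_continuous_on, rule ballI)
  fix x :: "'a ^ 'k"
  define R where "R = norm x + 1"
  obtain B where B: "\<And>y. (\<And>i. norm (y $ i) \<le> R + 1) \<Longrightarrow> \<bar>\<phi> y\<bar> \<le> B"
    by (rule separately_convex_bounded[OF \<phi>, of "R + 1"]) blast
  have bd: "\<bar>\<phi> y - \<phi> x\<bar> \<le> (\<Sum>i\<in>UNIV. 2 * B * norm (y $ i - x $ i))" if y: "norm y \<le> R" for y
  proof -
    have yi: "norm (y $ i) \<le> R" "norm (x $ i) \<le> R" for i
      using Finite_Cartesian_Product.norm_nth_le[of y i] Finite_Cartesian_Product.norm_nth_le[of x i] y by (auto simp: R_def)
    have "\<bar>\<phi> (\<chi> i. if i \<in> J then y $ i else x $ i) - \<phi> x\<bar> \<le> (\<Sum>i\<in>J. 2 * B * norm (y $ i - x $ i))" if "finite J" for J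
      using that
    proof induction
      case empty
      show ?case by simp
    next
      case (insert j J)
      let ?v = "\<lambda>J. (\<chi> i. if i \<in> J then y $ i else x $ i)"
      have e: "?v (insert j J) = vec_upd (?v J) j (y $ j)" "?v J = vec_upd (?v J) j (x $ j)"
        using insert by (auto simp: vec_eq_iff)
      have "\<bar>\<phi> (vec_upd (?v J) j (y $ j)) - \<phi> (vec_upd (?v J) j (x $ j))\<bar> \<le> 2 * B * norm (y $ j - x $ j)"
      proof (rule convex_on_bounded_lipschitz[OF separately_convexD[OF \<phi>] _ yi(2) yi(1)])
        fix z :: 'a assume "norm z \<le> R + 1"
        moreover have "norm (y $ i) \<le> R + 1" "norm (x $ i) \<le> R + 1" for i using yi[of i] by auto
        ultimately show "\<bar>\<phi> (vec_upd (?v J) j z)\<bar> \<le> B" by (intro B) simp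
      qed
      then have "\<bar>\<phi> (?v (insert j J)) - \<phi> (?v J)\<bar> \<le> 2 * B * norm (y $ j - x $ j)" using e by simp
      then show ?case using insert by simp
    qed
    from this[OF finite_class.finite_UNIV] show ?thesis by simp
  qed
  have "((\<lambda>y. \<Sum>i\<in>UNIV. 2 * B * norm (y $ i - x $ i)) \<longlongrightarrow> (\<Sum>i\<in>UNIV. 2 * B * norm (x $ i - x $ i))) (at x)"
    by (intro tendsto_intros)
  then have l: "((\<lambda>y. \<Sum>i\<in>UNIV. 2 * B * norm (y $ i - x $ i)) \<longlongrightarrow> 0) (at x)" by simp
  have "eventually (\<lambda>y. norm y < R) (at x)"
    by (rule order_tendstoD(2)[of norm "norm x"]) (auto intro: tendsto_intros simp: R_def)
  then have "eventually (\<lambda>y. norm (\<phi> y - \<phi> x) \<le> (\<Sum>i\<in>UNIV. 2 * B * norm (y $ i - x $ i))) (at x)"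
    by eventually_elim (use bd in simp)
  from Lim_null_comparison[OF this l] show "isCont \<phi> x" unfolding isCont_def by (simp add: LIM_zero_iff)
qed

lemma measurable_vec_lambda_PiM:
  fixes N :: "'k::finite \<Rightarrow> 'a::euclidean_space measure"
  assumes "\<And>i. sets (N i) = sets borel"
  shows "vec_lambda \<in> borel_measurable (PiM UNIV N)"
proof (subst borel_measurable_euclidean_space, intro ballI)
  fix b :: "'a ^ 'k" assume "b \<in> Basis"
  then obtain i u where b: "b = axis i u" by (auto simp: Basis_vec_def)
  have "(\<lambda>x. x i) \<in> measurable (PiM UNIV N) (N i)" by simp
  then have "(\<lambda>x. x i) \<in> borel_measurable (PiM UNIV N)" by (simp add: measurable_def assms sets_eq_imp_space_eq[OF assms])
  then show "(\<lambda>x. vec_lambda x \<bullet> b) \<in> borel_measurable (PiM UNIV N)"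
    unfolding b by (simp add: inner_axis borel_measurable_inner)
qed

section \<open>Replacement of one factor at a time\<close>

locale convex_order_supported =
  fixes \<mu> \<nu> :: "'a::euclidean_space measure" and K :: "'a set"
  assumes K: "compact K" and prob: "prob_space \<mu>" "prob_space \<nu>"
    and sets: "sets \<mu> = sets borel" "sets \<nu> = sets borel"
    and supp: "AE x in \<mu>. x \<in> K" "AE x in \<nu>. x \<in> K"
    and order: "\<And>f. convex_on UNIV f \<Longrightarrow> (\<integral>x. f x \<partial>\<mu>) \<le> (\<integral>x. f x \<partial>\<nu>)"
begin

definition "mixed J i = (if i \<in> J then \<nu> else \<mu>)"

lemma mixed: "prob_space (mixed J i)" "sets (mixed J i) = sets borel" "AE x in mixed J i. x \<in> K"
proof -
  have "mixed J i = \<mu> \<or> mixed J i = \<nu>" by (simp add: mixed_def)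
  then show "prob_space (mixed J i)" "sets (mixed J i) = sets borel" "AE x in mixed J i. x \<in> K"
    using prob sets supp by (elim disjE; simp only:)+
qed

text \<open>Fubini isolates the coordinate \<open>j\<close>. With the others fixed the integrand is
  convex in the remaining argument, so \<open>order\<close> compares the inner integrals.\<close>

lemma mixed_step:
  fixes \<phi> :: "'a ^ 'k::finite \<Rightarrow> real"
  assumes \<phi>: "convex_in_each_arg \<phi>" and j: "j \<notin> J"
  shows "(\<integral>x. \<phi> (vec_lambda x) \<partial>PiM UNIV (mixed J)) \<le> (\<integral>x. \<phi> (vec_lambda x) \<partial>PiM UNIV (mixed (insert j J)))"
proof -
  obtain R where R: "\<And>x. x \<in> K \<Longrightarrow> norm x \<le> R" using compact_imp_bounded[OF K] unfolding bounded_iff by blast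
  obtain C where C: "\<And>x. (\<And>i. norm (x $ i) \<le> R) \<Longrightarrow> \<bar>\<phi> x\<bar> \<le> C"
    by (rule separately_convex_bounded[OF \<phi>, of R]) blast
  \<comment> \<open>The integral of a non-integrable function is \<open>0\<close> by convention; a
    nonnegative bound covers this case of the inner integral as well.\<close>
  define B where "B = max C 0"
  have B: "\<bar>\<phi> (vec_lambda x)\<bar> \<le> B" if "\<And>i. x i \<in> K" for x using C[of "vec_lambda x"] R that by (auto simp: B_def)
  have m\<phi>: "\<phi> \<in> borel_measurable borel"
    by (rule borel_measurable_continuous_onI[OF separately_convex_continuous[OF \<phi>]])
  let ?P = "PiM (UNIV - {j}) (mixed J)"
  have P: "?P = PiM (UNIV - {j}) (mixed (insert j J))" by (rule PiM_cong) (auto simp: mixed_def)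
  have un: "insert j (UNIV - {j}) = (UNIV :: 'k set)" by blast
  interpret P: prob_space ?P by (intro prob_space_PiM mixed)
  have aeP: "AE x in ?P. \<forall>i\<in>UNIV - {j}. x i \<in> K"
    by (intro AE_finite_allI AE_PiM_component mixed) auto
  have main: "(\<integral>x. \<phi> (vec_lambda x) \<partial>PiM UNIV (mixed L)) = (\<integral>x. (\<integral>y. \<phi> (vec_lambda (x(j := y))) \<partial>mixed L j) \<partial>?P)"
      (is "?l = ?r") and int: "integrable ?P (\<lambda>x. \<integral>y. \<phi> (vec_lambda (x(j := y))) \<partial>mixed L j)"
    if L: "PiM (UNIV - {j}) (mixed L) = ?P" for L
  proof -
    interpret L: product_sigma_finite "mixed L :: 'k \<Rightarrow> _"
      by (rule product_sigma_finite.intro) (intro prob_space_imp_sigma_finite mixed)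
    interpret U: prob_space "PiM UNIV (mixed L :: 'k \<Rightarrow> _)" by (intro prob_space_PiM mixed)
    interpret Nj: prob_space "mixed L j" by (rule mixed)
    have mv: "(\<lambda>x. \<phi> (vec_lambda x)) \<in> borel_measurable (PiM UNIV (mixed L))"
      by (rule measurable_compose[OF measurable_vec_lambda_PiM[OF mixed(2)] m\<phi>])
    have "AE x in PiM UNIV (mixed L). \<forall>i\<in>UNIV :: 'k set. x i \<in> K"
      by (intro AE_finite_allI AE_PiM_component mixed) auto
    then have "AE x in PiM UNIV (mixed L). norm (\<phi> (vec_lambda x)) \<le> B" by eventually_elim (use B in auto)
    then have i: "integrable (PiM (insert j (UNIV - {j})) (mixed L)) (\<lambda>x. \<phi> (vec_lambda x))"
      unfolding un by (rule U.integrable_const_bound[OF _ mv])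
    from L.product_integral_insert[OF _ _ this] show "?l = ?r" unfolding un L by simp
    have "(\<lambda>z. \<phi> (vec_lambda (case z of (x, y) \<Rightarrow> x(j := y)))) \<in> borel_measurable (?P \<Otimes>\<^sub>M mixed L j)"
      by (rule measurable_compose[OF measurable_add_dim[of j "UNIV - {j}" "mixed L", unfolded un L] mv])
    then have "(\<lambda>(x, y). \<phi> (vec_lambda (x(j := y)))) \<in> borel_measurable (?P \<Otimes>\<^sub>M mixed L j)"
      by (simp add: case_prod_beta)
    then have mm: "(\<lambda>x. \<integral>y. \<phi> (vec_lambda (x(j := y))) \<partial>mixed L j) \<in> borel_measurable ?P"
      by (rule sigma_finite_measure.borel_measurable_lebesgue_integral[OF prob_space_imp_sigma_finite[OF mixed(1)]])
    have "AE x in ?P. norm (\<integral>y. \<phi> (vec_lambda (x(j := y))) \<partial>mixed L j) \<le> B"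
      using aeP
    proof eventually_elim
      case (elim x)
      have "AE y in mixed L j. norm (\<phi> (vec_lambda (x(j := y)))) \<le> B"
        using mixed(3)[of L j] by eventually_elim (use elim B in auto)
      then have "(\<integral>y. norm (\<phi> (vec_lambda (x(j := y)))) \<partial>mixed L j) \<le> B"
        using prob_space.integral_le_const[OF mixed(1)[of L j], of "\<lambda>y. norm (\<phi> (vec_lambda (x(j := y))))" B]
        by (cases "integrable (mixed L j) (\<lambda>y. norm (\<phi> (vec_lambda (x(j := y)))))")
           (auto simp: not_integrable_integral_eq B_def)
      then show ?case by (rule order_trans[OF integral_norm_bound])
    qed
    then show "integrable ?P (\<lambda>x. \<integral>y. \<phi> (vec_lambda (x(j := y))) \<partial>mixed L j)"
      by (rule P.integrable_const_bound[OF _ mm])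
  qed
  show ?thesis unfolding main[OF refl] main[OF P[symmetric]]
  proof (rule integral_mono[OF int[OF refl] int[OF P[symmetric]]])
    fix x
    have "(\<lambda>y. \<phi> (vec_lambda (x(j := y)))) = (\<lambda>y. \<phi> (vec_upd (vec_lambda x) j y))"
      by (intro ext arg_cong[where f=\<phi>]) (simp add: vec_eq_iff)
    then have "convex_on UNIV (\<lambda>y. \<phi> (vec_lambda (x(j := y))))" using separately_convexD[OF \<phi>] by simp
    from order[OF this] show "(\<integral>y. \<phi> (vec_lambda (x(j := y))) \<partial>mixed J j) \<le> (\<integral>y. \<phi> (vec_lambda (x(j := y))) \<partial>mixed (insert j J) j)"
      using j by (simp add: mixed_def)
  qed
qed

lemma product_convex_order:
  fixes \<phi> :: "'a ^ 'k::finite \<Rightarrow> real"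
  assumes \<phi>: "convex_in_each_arg \<phi>"
  shows "(\<integral>x. \<phi> (vec_lambda x) \<partial>PiM UNIV (\<lambda>_. \<mu>)) \<le> (\<integral>x. \<phi> (vec_lambda x) \<partial>PiM UNIV (\<lambda>_. \<nu>))"
proof -
  have "(\<integral>x. \<phi> (vec_lambda x) \<partial>PiM UNIV (mixed {})) \<le> (\<integral>x. \<phi> (vec_lambda x) \<partial>PiM UNIV (mixed J))" if "finite J" for J :: "'k set"
    using that by induction (auto intro: order_trans mixed_step[OF \<phi>])
  from this[OF finite_class.finite_UNIV] show ?thesis by (simp add: mixed_def[abs_def])
qed

end

section \<open>Expectations of independent points as product integrals\<close>

lemma (in prob_space) integral_indep_vars:
  fixes X :: "'k::finite \<Rightarrow> 'a \<Rightarrow> 'b::euclidean_space" and \<phi> :: "'b ^ 'k \<Rightarrow> real"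
  assumes ind: "indep_vars (\<lambda>_. borel) X UNIV" and X: "\<And>j. X j \<in> borel_measurable M" "\<And>j. distr M borel (X j) = \<mu>"
    and \<phi>: "\<phi> \<in> borel_measurable borel"
  shows "(\<integral>\<omega>. \<phi> (\<chi> j. X j \<omega>) \<partial>M) = (\<integral>x. \<phi> (vec_lambda x) \<partial>PiM UNIV (\<lambda>_. \<mu>))"
proof -
  have d: "distr M (\<Pi>\<^sub>M i\<in>UNIV. borel) (\<lambda>x. \<lambda>i\<in>UNIV. X i x) = (\<Pi>\<^sub>M i\<in>UNIV. distr M borel (X i))"
    using ind X(1) by (subst (asm) indep_vars_iff_distr_eq_PiM') auto
  have m: "(\<lambda>x. \<lambda>i\<in>UNIV. X i x) \<in> measurable M (\<Pi>\<^sub>M i\<in>UNIV. borel)" using X(1) by (intro measurable_restrict)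
  have m2: "(\<lambda>x. \<phi> (vec_lambda x)) \<in> borel_measurable (\<Pi>\<^sub>M i\<in>UNIV. borel)"
    by (rule measurable_compose[OF measurable_vec_lambda_PiM \<phi>]) simp
  have "(\<integral>\<omega>. \<phi> (\<chi> j. X j \<omega>) \<partial>M) = (\<integral>\<omega>. \<phi> (vec_lambda (\<lambda>i\<in>UNIV. X i \<omega>)) \<partial>M)" by (simp add: restrict_def)
  also have "\<dots> = (\<integral>x. \<phi> (vec_lambda x) \<partial>distr M (\<Pi>\<^sub>M i\<in>UNIV. borel) (\<lambda>x. \<lambda>i\<in>UNIV. X i x))"
    by (rule integral_distr[OF m m2, symmetric])
  finally show ?thesis unfolding d X(2) .
qed

theorem theorem1:
  fixes K :: "(real ^ 'd) set"
    and M :: "'m measure"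
    and I\<^sub>0 B\<^sub>0 :: "'m \<Rightarrow> real ^ 'd"
    and I B :: "'k::finite \<Rightarrow> 'm \<Rightarrow> real ^ 'd"
    and \<phi> :: "(real ^ 'd) ^ 'k \<Rightarrow> real"
  assumes "convex_body K"
    and "prob_space M"
    and "uniform_in M I\<^sub>0 K"
    and "uniform_on_boundary M B\<^sub>0 K"
    and "(CARD('d) = 2 \<and> (\<integral>\<omega>. I\<^sub>0 \<omega> \<partial>M) = (\<integral>\<omega>. B\<^sub>0 \<omega> \<partial>M)) \<or>
         (polytope K \<and>
          (\<exists>c r. inscribed_sphere K c r \<and>
                 c = (\<integral>\<omega>. I\<^sub>0 \<omega> \<partial>M) \<and> c = (\<integral>\<omega>. B\<^sub>0 \<omega> \<partial>M)))"
    and "convex_in_each_arg \<phi>"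
    and "prob_space.indep_vars M (\<lambda>_. borel) I UNIV"
    and "\<And>j. uniform_in M (I j) K"
    and "prob_space.indep_vars M (\<lambda>_. borel) B UNIV"
    and "\<And>j. uniform_on_boundary M (B j) K"
  shows "(\<integral>\<omega>. \<phi> (\<chi> j. I j \<omega>) \<partial>M) \<le> (\<integral>\<omega>. \<phi> (\<chi> j. B j \<omega>) \<partial>M)"
proof -
  interpret prob_space M by fact
  define s where "s = DIM(real ^ 'd) - 1"
  let ?H = "hausdorff_measure s :: (real ^ 'd) measure"
  define \<mu> where "\<mu> = uniform_measure lborel K"
  define \<nu> where "\<nu> = uniform_measure ?H (frontier K)"
  have K: "compact K" "convex K" "interior K \<noteq> {}" using assms(1) by (auto simp: convex_body_def)
  have I0: "I\<^sub>0 \<in> borel_measurable M" "distr M borel I\<^sub>0 = \<mu>" and I: "I j \<in> borel_measurable M" "distr M borel (I j) = \<mu>" for j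
    using assms(3) assms(8)[of j] by (auto simp: uniform_in_def \<mu>_def)
  have B0: "B\<^sub>0 \<in> borel_measurable M" "distr M borel B\<^sub>0 = \<nu>" and B: "B j \<in> borel_measurable M" "distr M borel (B j) = \<nu>" for j
    using assms(4) assms(10)[of j] by (auto simp: uniform_on_boundary_def \<nu>_def s_def)
  have p\<mu>: "prob_space \<mu>" and p\<nu>: "prob_space \<nu>" using prob_space_distr[OF I0(1)] prob_space_distr[OF B0(1)] I0(2) B0(2) by simp_all
  have fr: "frontier K \<in> sets borel" "frontier K \<subseteq> K"
    using frontier_subset_closed[OF compact_imp_closed[OF K(1)]] by (simp_all add: borel_closed)
  \<comment> \<open>As the law of \<open>B\<^sub>0\<close>, the measure \<open>\<nu>\<close> has
    total mass \<open>1\<close>; as a uniform measure its mass is the quotient of the boundary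
    measure by itself. In \<open>ennreal\<close> this quotient is \<open>0\<close> at
    \<open>0\<close> and at \<open>\<infinity>\<close>, so the boundary has positive finite
    measure.\<close>
  have "emeasure \<nu> UNIV = emeasure ?H (frontier K \<inter> UNIV) / emeasure ?H (frontier K)"
    unfolding \<nu>_def by (rule emeasure_uniform_measure) (use fr(1) in \<open>simp_all only: sets_hausdorff_measure space_borel[symmetric] sets.top\<close>)
  moreover have "space \<nu> = UNIV" by (simp add: \<nu>_def)
  ultimately have "emeasure ?H (frontier K) / emeasure ?H (frontier K) = 1"
    using prob_space.emeasure_space_1[OF p\<nu>] by (simp only: Int_UNIV_right)
  then have h: "emeasure ?H (frontier K) \<noteq> 0" "emeasure ?H (frontier K) \<noteq> \<infinity>"
    unfolding divide_ennreal_def by (metis mult_zero_left zero_neq_one, metis ennreal_inverse_top infinity_ennreal_def mult_zero_right zero_neq_one)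
  have ha: "hausdorff_additive s TYPE(real ^ 'd)" by (rule hausdorff_additiveI[OF h(1)])
  have H: "hausdorff_outer s (frontier K) \<noteq> 0" "hausdorff_outer s (frontier K) < \<infinity>"
    using h emeasure_hausdorff_measure[OF ha fr(1)] by (auto simp: less_top)
  have sets: "sets \<mu> = sets borel" "sets \<nu> = sets borel" by (simp_all add: \<mu>_def \<nu>_def)
  have ae: "AE x in \<mu>. x \<in> K" unfolding \<mu>_def
    by (rule AE_uniform_measureI) (use K(1) in \<open>auto intro: borel_compact\<close>)
  have "AE x in \<nu>. x \<in> frontier K" unfolding \<nu>_def by (rule AE_uniform_measureI) (use fr(1) in auto)
  then have ae': "AE x in \<nu>. x \<in> K" by eventually_elim (use fr(2) in blast)
  have e: "(\<integral>\<omega>. I\<^sub>0 \<omega> \<partial>M) = (\<integral>x. x \<partial>\<mu>)" "(\<integral>\<omega>. B\<^sub>0 \<omega> \<partial>M) = (\<integral>x. x \<partial>\<nu>)"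
    using integral_distr[OF I0(1), of "\<lambda>x. x"] integral_distr[OF B0(1), of "\<lambda>x. x"] I0(2) B0(2) by simp_all
  have i: "integrable \<mu> (\<lambda>x. x)" "integrable \<nu> (\<lambda>x. x)"
    using integrable_continuous_compact_support[OF prob_space.finite_measure[OF p\<mu>] sets(1) ae K(1) continuous_on_id]
      integrable_continuous_compact_support[OF prob_space.finite_measure[OF p\<nu>] sets(2) ae' K(1) continuous_on_id] by simp_all
  have order: "(\<integral>x. f x \<partial>\<mu>) \<le> (\<integral>x. f x \<partial>\<nu>)" if f: "convex_on UNIV f" for f
    using assms(5)
  proof (elim disjE conjE exE)
    assume d: "CARD('d) = 2" and m: "(\<integral>\<omega>. I\<^sub>0 \<omega> \<partial>M) = (\<integral>\<omega>. B\<^sub>0 \<omega> \<partial>M)"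
    have s: "s = 1" using d by (simp add: s_def)
    show ?thesis unfolding \<mu>_def \<nu>_def s
    proof (rule planar_convex_order[OF _ K _ _ _ _ _ f])
      show "DIM(real ^ 'd) = 2" using d by simp
    qed (use ha H(2) i m e in \<open>simp_all only: \<mu>_def \<nu>_def s\<close>)
  next
    fix c r
    assume P: "polytope K" "inscribed_sphere K c r" and c: "c = (\<integral>\<omega>. B\<^sub>0 \<omega> \<partial>M)"
    from c e(2) have "c = (\<integral>x. x \<partial>\<nu>)" by simp
    then show ?thesis unfolding \<mu>_def \<nu>_def by (rule circumscribed_convex_order[OF P(1) K(3) P(2) ha H _ f])
  qed
  interpret convex_order_supported \<mu> \<nu> K
    by (rule convex_order_supported.intro) (fact K(1) p\<mu> p\<nu> sets ae ae' order)+
  have m\<phi>: "\<phi> \<in> borel_measurable borel"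
    by (rule borel_measurable_continuous_onI[OF separately_convex_continuous[OF assms(6)]])
  show ?thesis
    unfolding integral_indep_vars[OF assms(7) I m\<phi>] integral_indep_vars[OF assms(9) B m\<phi>]
    by (rule product_convex_order[OF assms(6)])
qed

end
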